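(* Let $f\in\operatorname{Hom}(V,W)_X$ and let $[f]_X:X\to\mathbb{P}(W)$ be the projection induced by $f$. Then: 1. There is a canonical isomorphism $$[f]_X^*(\det(T_{\mathbb{P}(W)}))=[\lambda_{V,X}^\vee]^{\otimes n}\otimes\det(W),$$ namely the one obtained from the identification $\det(T_{\mathbb{P}(W)})=[\lambda_W^\vee]^{\otimes n}\otimes\det(W)$ and from $(r_f^\vee)^{\otimes n}\otimes\mathrm{id}$. 2. The isomorphism class of the line bundle $[f]_X^*(\det(T_{\mathbb{P}(W)}))$ on $X$ is independent of $f\in\operatorname{Hom}(V,W)_X$. 3. $[f]_X:X\to\mathbb{P}(W)$ is relatively orientable if and only if $w_1(X)=n\,w_1(\lambda_V)|_X$ in $H^1(X,\mathbb{Z}_2)$. 4. The data of an isomorphism $\nu:[f]_X^*(\det(T_{\mathbb{P}(W)}))\to\det(T_X)$ is equivalent to the data of a line bundle isomorphism $\mu:X\times\det(W)\to\det(Y_X)$, hence to the data of a global trivialization of $\det(Y_X)$ with fibre $\det(W)$; the correspondence $\mu\mapsto\nu$ is given by $\nu=(r_f^\vee)^{\otimes n}\otimes\mu$ via the canonical identifications of $[f]_X^*\det(T_{\mathbb{P}(W)})$ with $[f]_X^*(\lambda_W^\vee)^{\otimes n}\otimes\det(W)$ and of $\det(T_X)$ with $(\lambda_{V,X}^\vee)^{\otimes n}\otimes\det(Y_X)$.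
   Context: $V$ is a real vector space of finite dimension $N$, $\mathbb{P}(V)$ is the projective space of lines in $V$, $X\subset\mathbb{P}(V)$ is a compact smooth (not necessarily algebraic) submanifold of dimension $m<N-1$, $n:=m+1$, and $W$ is a real vector space of dimension $n$. $\lambda_V,\lambda_W$ are the tautological line bundles of $\mathbb{P}(V),\mathbb{P}(W)$, and $\lambda_{V,X}:=\lambda_V|_X\subset X\times V$. $Y_X\subset X\times V$ is the rank $n$ subbundle containing $\lambda_{V,X}$ such that, under $T_l\mathbb{P}(V)=\operatorname{Hom}(l,V/l)$, one has $T_lX=\operatorname{Hom}(l,Y_l/l)$ for all $l\in X$. $\operatorname{Hom}(V,W)_X:=\{f\in\operatorname{Hom}(V,W)\mid X\cap\mathbb{P}(\ker f)=\emptyset\}$; for such $f$, $[f]_X:X\to\mathbb{P}(W)$ is $l\mapsto f(l)$, and $r_f:\lambda_{V,X}\to[f]_X^*\lambda_W$ is the line bundle isomorphism $v\mapsto f(v)$. Canonical identifications: $\det(T_{\mathbb{P}(W)})=[\lambda_W^\vee]^{\otimes n}\otimes\det(W)$ and $\det(T_X)=[\lambda_{V,X}^\vee]^{\otimes n}\otimes\det(Y_X)$, coming from $T_{\mathbb{P}(W)}=\operatorname{Hom}(\lambda_W,\underline W/\lambda_W)$, $T_X=\operatorname{Hom}(\lambda_{V,X},Y_X/\lambda_{V,X})$ and $\det(B)=A\otimes\det(B/A)$, $a\otimes[b]\mapsto a\wedge b$, for a line subbundle $A\subset B$. A continuous map $g:M\to N$ of manifolds is relatively orientable if there is an isomorphism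 of orientation sheaves $g^*o_N\to o_M$ (equivalently, an isomorphism of line bundles $g^*\det(T_N)\cong\det(T_M)$). $w_1(X)$ denotes $w_1(T_X)$. *)

theory Defs
  imports "HOL-Analysis.Analysis" "HOL-Homology.Homology" "HOL-Library.Z2"
begin

section \<open>Real vector spaces with explicit carrier\<close>

text \<open>Fibres such as \<open>Hom(l, V/l)\<close> depend on a point, so they cannot be types. They are
  recorded with explicit operations. Maps between them are \<open>extensional\<close>, so that a
  linear map is determined by its values on the carrier.\<close>

record 'e rvs =
  vcarrier :: "'e set"
  vadd :: "'e \<Rightarrow> 'e \<Rightarrow> 'e"
  vzero :: 'e
  vscale :: "real \<Rightarrow> 'e \<Rightarrow> 'e"

definition real_vs :: "'e rvs \<Rightarrow> bool" where
  "real_vs F \<longleftrightarrow>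
     vzero F \<in> vcarrier F \<and>
     (\<forall>x\<in>vcarrier F. \<forall>y\<in>vcarrier F. vadd F x y \<in> vcarrier F \<and> vadd F x y = vadd F y x) \<and>
     (\<forall>x\<in>vcarrier F. \<forall>y\<in>vcarrier F. \<forall>z\<in>vcarrier F.
        vadd F (vadd F x y) z = vadd F x (vadd F y z)) \<and>
     (\<forall>x\<in>vcarrier F. vadd F (vzero F) x = x \<and> (\<exists>y\<in>vcarrier F. vadd F x y = vzero F)) \<and>
     (\<forall>a. \<forall>x\<in>vcarrier F. vscale F a x \<in> vcarrier F) \<and>
     (\<forall>a. \<forall>x\<in>vcarrier F. \<forall>y\<in>vcarrier F.
        vscale F a (vadd F x y) = vadd F (vscale F a x) (vscale F a y)) \<and>
     (\<forall>a b. \<forall>x\<in>vcarrier F.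
        vscale F (a + b) x = vadd F (vscale F a x) (vscale F b x) \<and>
        vscale F (a * b) x = vscale F a (vscale F b x)) \<and>
     (\<forall>x\<in>vcarrier F. vscale F 1 x = x)"

primrec lincomb :: "'e rvs \<Rightarrow> nat \<Rightarrow> (nat \<Rightarrow> real) \<Rightarrow> (nat \<Rightarrow> 'e) \<Rightarrow> 'e" where
  "lincomb F 0 c b = vzero F"
| "lincomb F (Suc k) c b = vadd F (lincomb F k c b) (vscale F (c k) (b k))"

definition vs_basis :: "'e rvs \<Rightarrow> nat \<Rightarrow> (nat \<Rightarrow> 'e) \<Rightarrow> bool" where
  "vs_basis F k b \<longleftrightarrow>
     (\<forall>i<k. b i \<in> vcarrier F) \<and>
     (\<forall>x\<in>vcarrier F. \<exists>!c. c \<in> {..<k} \<rightarrow>\<^sub>E UNIV \<and> x = lincomb F k c b)"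

definition vs_dim :: "'e rvs \<Rightarrow> nat" where
  "vs_dim F = (LEAST k. \<exists>b. vs_basis F k b)"

definition vs_of :: "'e::real_vector set \<Rightarrow> 'e rvs" where
  "vs_of S = \<lparr>vcarrier = S, vadd = (+), vzero = 0, vscale = (*\<^sub>R)\<rparr>"

abbreviation real_line :: "real rvs" where
  "real_line \<equiv> vs_of UNIV"

definition vs_coset :: "'e::real_vector set \<Rightarrow> 'e \<Rightarrow> 'e set" where
  "vs_coset A b = {b + a | a. a \<in> A}"

text \<open>The quotient \<open>B/A\<close> for linear subspaces \<open>A \<subseteq> B\<close>. Its operations do not mention \<open>B\<close>, so
  \<open>B/A\<close> is literally a subspace of \<open>B'/A\<close> when \<open>B \<subseteq> B'\<close>. The \<open>a\<close> in the scalar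
  multiplication makes \<open>0 \<cdot> P = A\<close>.\<close>

definition vs_quot :: "'e::real_vector set \<Rightarrow> 'e set \<Rightarrow> 'e set rvs" where
  "vs_quot A B =
     \<lparr>vcarrier = vs_coset A ` B,
      vadd = (\<lambda>P Q. {p + q | p q. p \<in> P \<and> q \<in> Q}),
      vzero = A,
      vscale = (\<lambda>c P. {c *\<^sub>R p + a | p a. p \<in> P \<and> a \<in> A})\<rparr>"

text \<open>The space of functions \<open>D \<rightarrow> T\<close> lying in \<open>C\<close>, with pointwise operations.\<close>

definition fun_space :: "'a set \<Rightarrow> 'b rvs \<Rightarrow> ('a \<Rightarrow> 'b) set \<Rightarrow> ('a \<Rightarrow> 'b) rvs" where
  "fun_space D T C =
     \<lparr>vcarrier = C,
      vadd = (\<lambda>g h. \<lambda>x\<in>D. vadd T (g x) (h x)),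
      vzero = (\<lambda>x\<in>D. vzero T),
      vscale = (\<lambda>c g. \<lambda>x\<in>D. vscale T c (g x))\<rparr>"

definition vs_hom :: "'a rvs \<Rightarrow> 'b rvs \<Rightarrow> ('a \<Rightarrow> 'b) rvs" where
  "vs_hom A B = fun_space (vcarrier A) B
     {h \<in> vcarrier A \<rightarrow>\<^sub>E vcarrier B.
        (\<forall>x\<in>vcarrier A. \<forall>y\<in>vcarrier A. h (vadd A x y) = vadd B (h x) (h y)) \<and>
        (\<forall>c. \<forall>x\<in>vcarrier A. h (vscale A c x) = vscale B c (h x))}"

definition vs_dual :: "'a rvs \<Rightarrow> ('a \<Rightarrow> real) rvs" where
  "vs_dual A = vs_hom A real_line"

definition vs_isos :: "'a rvs \<Rightarrow> 'b rvs \<Rightarrow> ('a \<Rightarrow> 'b) set" where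
  "vs_isos A B = {h \<in> vcarrier (vs_hom A B). bij_betw h (vcarrier A) (vcarrier B)}"

subsection \<open>Multilinear algebra\<close>

text \<open>For finite-dimensional spaces, the tensor product is the dual of the space of bilinear
  forms, the \<open>k\<close>-th tensor power is the dual of the space of \<open>k\<close>-linear forms, and the
  \<open>k\<close>-th exterior power is the dual of the space of alternating \<open>k\<close>-linear forms.
  A \<open>k\<close>-tuple is an extensional function on \<open>{..<k}\<close>.\<close>

definition vs_tuples :: "nat \<Rightarrow> 'e rvs \<Rightarrow> (nat \<Rightarrow> 'e) set" where
  "vs_tuples k F = {..<k} \<rightarrow>\<^sub>E vcarrier F"

definition mult_forms :: "nat \<Rightarrow> 'e rvs \<Rightarrow> ((nat \<Rightarrow> 'e) \<Rightarrow> real) rvs" where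
  "mult_forms k F = fun_space (vs_tuples k F) real_line
     {w \<in> extensional (vs_tuples k F).
        \<forall>t\<in>vs_tuples k F. \<forall>i<k. \<forall>x\<in>vcarrier F.
          (\<forall>y\<in>vcarrier F. w (t(i := vadd F x y)) = w (t(i := x)) + w (t(i := y))) \<and>
          (\<forall>c. w (t(i := vscale F c x)) = c * w (t(i := x)))}"

definition alt_forms :: "nat \<Rightarrow> 'e rvs \<Rightarrow> ((nat \<Rightarrow> 'e) \<Rightarrow> real) rvs" where
  "alt_forms k F = fun_space (vs_tuples k F) real_line
     {w \<in> vcarrier (mult_forms k F).
        \<forall>t\<in>vs_tuples k F. \<forall>i<k. \<forall>j<k. i \<noteq> j \<and> t i = t j \<longrightarrow> w t = 0}"

definition bilin_forms :: "'a rvs \<Rightarrow> 'b rvs \<Rightarrow> ('a \<times> 'b \<Rightarrow> real) rvs" where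
  "bilin_forms A B = fun_space (vcarrier A \<times> vcarrier B) real_line
     {w \<in> extensional (vcarrier A \<times> vcarrier B).
        (\<forall>x\<in>vcarrier A. (\<lambda>y\<in>vcarrier B. w (x, y)) \<in> vcarrier (vs_dual B)) \<and>
        (\<forall>y\<in>vcarrier B. (\<lambda>x\<in>vcarrier A. w (x, y)) \<in> vcarrier (vs_dual A))}"

definition top_forms :: "'e rvs \<Rightarrow> ((nat \<Rightarrow> 'e) \<Rightarrow> real) rvs" where
  "top_forms F = alt_forms (vs_dim F) F"

definition vs_det :: "'e rvs \<Rightarrow> (((nat \<Rightarrow> 'e) \<Rightarrow> real) \<Rightarrow> real) rvs" where
  "vs_det F = vs_dual (top_forms F)"

definition vs_tpow :: "nat \<Rightarrow> 'e rvs \<Rightarrow> (((nat \<Rightarrow> 'e) \<Rightarrow> real) \<Rightarrow> real) rvs" where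
  "vs_tpow k F = vs_dual (mult_forms k F)"

definition vs_tensor :: "'a rvs \<Rightarrow> 'b rvs \<Rightarrow> (('a \<times> 'b \<Rightarrow> real) \<Rightarrow> real) rvs" where
  "vs_tensor A B = vs_dual (bilin_forms A B)"

text \<open>The decomposable elements \<open>t\<^sub>0 \<and> \<dots> \<and> t\<^sub>k\<^sub>-\<^sub>1\<close> of \<open>det F\<close> (\<open>k = dim F\<close>),
  \<open>t\<^sub>0 \<otimes> \<dots> \<otimes> t\<^sub>k\<^sub>-\<^sub>1\<close>, and \<open>a \<otimes> b\<close>.\<close>

definition wedge :: "'e rvs \<Rightarrow> (nat \<Rightarrow> 'e) \<Rightarrow> ((nat \<Rightarrow> 'e) \<Rightarrow> real) \<Rightarrow> real" where
  "wedge F t = (\<lambda>w\<in>vcarrier (top_forms F). w (restrict t {..<vs_dim F}))"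

definition tprod :: "nat \<Rightarrow> 'e rvs \<Rightarrow> (nat \<Rightarrow> 'e) \<Rightarrow> ((nat \<Rightarrow> 'e) \<Rightarrow> real) \<Rightarrow> real" where
  "tprod k F t = (\<lambda>w\<in>vcarrier (mult_forms k F). w (restrict t {..<k}))"

definition tens :: "'a rvs \<Rightarrow> 'b rvs \<Rightarrow> 'a \<Rightarrow> 'b \<Rightarrow> ('a \<times> 'b \<Rightarrow> real) \<Rightarrow> real" where
  "tens A B a b = (\<lambda>w\<in>vcarrier (bilin_forms A B). w (a, b))"

text \<open>Functoriality: for linear \<open>h : A \<rightarrow> A'\<close> and \<open>k : B \<rightarrow> B'\<close>, the maps
  \<open>h\<^sup>\<or> : A'\<^sup>\<or> \<rightarrow> A\<^sup>\<or>\<close>, \<open>h\<^sup>\<otimes>\<^sup>n : A\<^sup>\<otimes>\<^sup>n \<rightarrow> A'\<^sup>\<otimes>\<^sup>n\<close> and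
  \<open>h \<otimes> k : A \<otimes> B \<rightarrow> A' \<otimes> B'\<close>.\<close>

definition dual_map :: "'a rvs \<Rightarrow> 'b rvs \<Rightarrow> ('a \<Rightarrow> 'b) \<Rightarrow> ('b \<Rightarrow> real) \<Rightarrow> ('a \<Rightarrow> real)" where
  "dual_map A A' h = (\<lambda>p\<in>vcarrier (vs_dual A'). \<lambda>x\<in>vcarrier A. p (h x))"

definition tpow_map ::
  "nat \<Rightarrow> 'a rvs \<Rightarrow> 'b rvs \<Rightarrow> ('a \<Rightarrow> 'b) \<Rightarrow>
   (((nat \<Rightarrow> 'a) \<Rightarrow> real) \<Rightarrow> real) \<Rightarrow> (((nat \<Rightarrow> 'b) \<Rightarrow> real) \<Rightarrow> real)" where
  "tpow_map n A A' h =
     (\<lambda>z\<in>vcarrier (vs_tpow n A). \<lambda>w\<in>vcarrier (mult_forms n A').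
        z (\<lambda>t\<in>vs_tuples n A. w (\<lambda>i\<in>{..<n}. h (t i))))"

definition tensor_map ::
  "'a rvs \<Rightarrow> 'b rvs \<Rightarrow> 'c rvs \<Rightarrow> 'd rvs \<Rightarrow> ('a \<Rightarrow> 'c) \<Rightarrow> ('b \<Rightarrow> 'd) \<Rightarrow>
   (('a \<times> 'b \<Rightarrow> real) \<Rightarrow> real) \<Rightarrow> (('c \<times> 'd \<Rightarrow> real) \<Rightarrow> real)" where
  "tensor_map A B A' B' h k =
     (\<lambda>z\<in>vcarrier (vs_tensor A B). \<lambda>w\<in>vcarrier (bilin_forms A' B').
        z (\<lambda>(a, b)\<in>vcarrier A \<times> vcarrier B. w (h a, k b)))"

text \<open>The canonical isomorphism
  \<open>det (Hom(A, B/A)) = (A\<^sup>\<or>)\<^sup>\<otimes>\<^sup>m \<otimes> det(B/A) = (A\<^sup>\<or>)\<^sup>\<otimes>\<^sup>n \<otimes> A \<otimes> det(B/A) = (A\<^sup>\<or>)\<^sup>\<otimes>\<^sup>n \<otimes> det B\<close>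
  for a line \<open>A\<close> in an \<open>n\<close>-dimensional space \<open>B\<close>, \<open>n = m + 1\<close>, the last step being
  \<open>a \<otimes> [b] \<mapsto> a \<and> b\<close>. If \<open>v \<in> A\<close> is nonzero with dual vector \<open>p \<in> A\<^sup>\<or>\<close>, \<open>p v = 1\<close>, and
  \<open>b\<^sub>i \<in> B\<close> represents \<open>\<phi>\<^sub>i v\<close>, so that \<open>\<phi>\<^sub>i\<close> is \<open>p \<otimes> [b\<^sub>i]\<close>, the composition maps
  \<open>\<phi>\<^sub>0 \<and> \<dots> \<and> \<phi>\<^sub>m\<^sub>-\<^sub>1\<close> to
  \<open>p\<^sup>\<otimes>\<^sup>m \<otimes> [b\<^sub>0] \<and> \<dots> \<and> [b\<^sub>m\<^sub>-\<^sub>1] = p\<^sup>\<otimes>\<^sup>n \<otimes> v \<otimes> [b\<^sub>0] \<and> \<dots> \<and> [b\<^sub>m\<^sub>-\<^sub>1]\<close>, that is, to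
  \<open>p\<^sup>\<otimes>\<^sup>n \<otimes> (v \<and> b\<^sub>0 \<and> \<dots> \<and> b\<^sub>m\<^sub>-\<^sub>1)\<close>.\<close>

definition det_tangent_iso ::
  "'e::real_vector set \<Rightarrow> 'e set \<Rightarrow>
   (((nat \<Rightarrow> 'e \<Rightarrow> 'e set) \<Rightarrow> real) \<Rightarrow> real) \<Rightarrow>
   ((((nat \<Rightarrow> 'e \<Rightarrow> real) \<Rightarrow> real) \<Rightarrow> real) \<times> (((nat \<Rightarrow> 'e) \<Rightarrow> real) \<Rightarrow> real) \<Rightarrow> real) \<Rightarrow> real" where
  "det_tangent_iso A B =
    (let L = vs_dual (vs_of A);
         T = vs_hom (vs_of A) (vs_quot A B);
         n = vs_dim (vs_of B)
     in THE \<kappa>.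
        \<kappa> \<in> vcarrier (vs_hom (vs_det T) (vs_tensor (vs_tpow n L) (vs_det (vs_of B)))) \<and>
        (\<forall>v\<in>A - {0}. \<forall>p\<in>vcarrier L. \<forall>\<phi>\<in>vs_tuples (vs_dim T) T. \<forall>b.
           p v = 1 \<and> (\<forall>i<vs_dim T. b i \<in> \<phi> i v) \<longrightarrow>
           \<kappa> (wedge T \<phi>) =
             tens (vs_tpow n L) (vs_det (vs_of B))
               (tprod n L (\<lambda>_. p))
               (wedge (vs_of B) (\<lambda>i. case i of 0 \<Rightarrow> v | Suc j \<Rightarrow> b j))))"

section \<open>Topological vector bundles\<close>

text \<open>A vector bundle is recorded by its base, its fibres and its sheaf of continuous local
  sections: \<open>bsec E U s\<close> says that \<open>s\<close> is a continuous section over the open set \<open>U\<close>.\<close>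

record ('x, 'e) vbundle =
  bbase :: "'x topology"
  bfib :: "'x \<Rightarrow> 'e rvs"
  bsec :: "'x set \<Rightarrow> ('x \<Rightarrow> 'e) \<Rightarrow> bool"

definition cont_on :: "'x topology \<Rightarrow> 'x set \<Rightarrow> ('x \<Rightarrow> 'b::topological_space) \<Rightarrow> bool" where
  "cont_on T U g \<longleftrightarrow> continuous_map (subtopology T U) euclidean g"

definition frame :: "('x, 'e) vbundle \<Rightarrow> 'x set \<Rightarrow> nat \<Rightarrow> (nat \<Rightarrow> 'x \<Rightarrow> 'e) \<Rightarrow> bool" where
  "frame E U r s \<longleftrightarrow>
     (\<forall>i<r. bsec E U (s i)) \<and> (\<forall>x\<in>U. vs_basis (bfib E x) r (\<lambda>i. s i x))"

definition vector_bundle :: "nat \<Rightarrow> ('x, 'e) vbundle \<Rightarrow> bool" where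
  "vector_bundle r E \<longleftrightarrow>
     (\<forall>x\<in>topspace (bbase E). real_vs (bfib E x)) \<and>
     (\<forall>U s. bsec E U s \<longrightarrow> openin (bbase E) U \<and> (\<forall>x\<in>U. s x \<in> vcarrier (bfib E x))) \<and>
     (\<forall>\<U> s. (\<forall>U\<in>\<U>. openin (bbase E) U) \<longrightarrow> (bsec E (\<Union>\<U>) s \<longleftrightarrow> (\<forall>U\<in>\<U>. bsec E U s))) \<and>
     (\<forall>x\<in>topspace (bbase E). \<exists>U b. openin (bbase E) U \<and> x \<in> U \<and> frame E U r b \<and>
        (\<forall>U' s. openin (bbase E) U' \<and> U' \<subseteq> U \<longrightarrow>
           (bsec E U' s \<longleftrightarrow>
             (\<exists>c. (\<forall>i<r. cont_on (bbase E) U' (c i)) \<and>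
                  (\<forall>y\<in>U'. s y = lincomb (bfib E y) r (\<lambda>i. c i y) (\<lambda>i. b i y))))))"

abbreviation line_bundle :: "('x, 'e) vbundle \<Rightarrow> bool" where
  "line_bundle \<equiv> vector_bundle 1"

definition line_bundle_isos ::
  "('x, 'e) vbundle \<Rightarrow> ('x, 'f) vbundle \<Rightarrow> ('x \<Rightarrow> 'e \<Rightarrow> 'f) set" where
  "line_bundle_isos E F =
     {\<phi> \<in> extensional (topspace (bbase E)).
        line_bundle E \<and> line_bundle F \<and> bbase E = bbase F \<and>
        (\<forall>x\<in>topspace (bbase E). \<phi> x \<in> vs_isos (bfib E x) (bfib F x)) \<and>
        (\<forall>U s. (\<forall>x\<in>U. s x \<in> vcarrier (bfib E x)) \<longrightarrow>
           (bsec E U s \<longleftrightarrow> bsec F U (\<lambda>x. \<phi> x (s x))))}"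

definition line_bundle_isomorphic :: "('x, 'e) vbundle \<Rightarrow> ('x, 'f) vbundle \<Rightarrow> bool" where
  "line_bundle_isomorphic E F \<longleftrightarrow> line_bundle_isos E F \<noteq> {}"

subsection \<open>Constructions\<close>

definition sub_bundle :: "'x topology \<Rightarrow> ('x \<Rightarrow> 'e::real_normed_vector set) \<Rightarrow> ('x, 'e) vbundle" where
  "sub_bundle T E =
     \<lparr>bbase = T, bfib = (\<lambda>x. vs_of (E x)),
      bsec = (\<lambda>U s. openin T U \<and> (\<forall>x\<in>U. s x \<in> E x) \<and> cont_on T U s)\<rparr>"

text \<open>The trivial bundle with fibre \<open>F\<close>. A map into a finite-dimensional space is continuous
  iff its composition with every linear form is.\<close>

definition trivial_bundle :: "'x topology \<Rightarrow> 'e rvs \<Rightarrow> ('x, 'e) vbundle" where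
  "trivial_bundle T F =
     \<lparr>bbase = T, bfib = (\<lambda>x. F),
      bsec = (\<lambda>U s. openin T U \<and> (\<forall>x\<in>U. s x \<in> vcarrier F) \<and>
         (\<forall>p\<in>vcarrier (vs_dual F). cont_on T U (\<lambda>x. p (s x))))\<rparr>"

definition quot_bundle ::
  "'x topology \<Rightarrow> ('x \<Rightarrow> 'e::real_normed_vector set) \<Rightarrow> ('x \<Rightarrow> 'e set) \<Rightarrow> ('x, 'e set) vbundle" where
  "quot_bundle T A B =
     \<lparr>bbase = T, bfib = (\<lambda>x. vs_quot (A x) (B x)),
      bsec = (\<lambda>U s. openin T U \<and>
         (\<forall>x\<in>U. \<exists>U' s'. x \<in> U' \<and> U' \<subseteq> U \<and> bsec (sub_bundle T B) U' s' \<and>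
            (\<forall>y\<in>U'. s y = vs_coset (A y) (s' y))))\<rparr>"

definition hom_bundle :: "('x, 'a) vbundle \<Rightarrow> ('x, 'b) vbundle \<Rightarrow> ('x, 'a \<Rightarrow> 'b) vbundle" where
  "hom_bundle E F =
     \<lparr>bbase = bbase E, bfib = (\<lambda>x. vs_hom (bfib E x) (bfib F x)),
      bsec = (\<lambda>U \<phi>. openin (bbase E) U \<and>
         (\<forall>x\<in>U. \<phi> x \<in> vcarrier (vs_hom (bfib E x) (bfib F x))) \<and>
         (\<forall>U' s. U' \<subseteq> U \<and> bsec E U' s \<longrightarrow> bsec F U' (\<lambda>x. \<phi> x (s x))))\<rparr>"

definition dual_bundle :: "('x, 'a) vbundle \<Rightarrow> ('x, 'a \<Rightarrow> real) vbundle" where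
  "dual_bundle E = hom_bundle E (trivial_bundle (bbase E) real_line)"

definition mult_forms_bundle ::
  "nat \<Rightarrow> ('x, 'e) vbundle \<Rightarrow> ('x, (nat \<Rightarrow> 'e) \<Rightarrow> real) vbundle" where
  "mult_forms_bundle k E =
     \<lparr>bbase = bbase E, bfib = (\<lambda>x. mult_forms k (bfib E x)),
      bsec = (\<lambda>U w. openin (bbase E) U \<and>
         (\<forall>x\<in>U. w x \<in> vcarrier (mult_forms k (bfib E x))) \<and>
         (\<forall>U' s. U' \<subseteq> U \<and> openin (bbase E) U' \<and> (\<forall>i. bsec E U' (s i)) \<longrightarrow>
            cont_on (bbase E) U' (\<lambda>x. w x (\<lambda>i\<in>{..<k}. s i x))))\<rparr>"

definition top_forms_bundle ::
  "('x, 'e) vbundle \<Rightarrow> ('x, (nat \<Rightarrow> 'e) \<Rightarrow> real) vbundle" where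
  "top_forms_bundle E =
     \<lparr>bbase = bbase E, bfib = (\<lambda>x. top_forms (bfib E x)),
      bsec = (\<lambda>U w. openin (bbase E) U \<and>
         (\<forall>x\<in>U. w x \<in> vcarrier (top_forms (bfib E x))) \<and>
         (\<forall>U' s. U' \<subseteq> U \<and> openin (bbase E) U' \<and> (\<forall>i. bsec E U' (s i)) \<longrightarrow>
            cont_on (bbase E) U' (\<lambda>x. w x (\<lambda>i\<in>{..<vs_dim (bfib E x)}. s i x))))\<rparr>"

definition bilin_forms_bundle ::
  "('x, 'a) vbundle \<Rightarrow> ('x, 'b) vbundle \<Rightarrow> ('x, 'a \<times> 'b \<Rightarrow> real) vbundle" where
  "bilin_forms_bundle E F =
     \<lparr>bbase = bbase E, bfib = (\<lambda>x. bilin_forms (bfib E x) (bfib F x)),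
      bsec = (\<lambda>U w. openin (bbase E) U \<and>
         (\<forall>x\<in>U. w x \<in> vcarrier (bilin_forms (bfib E x) (bfib F x))) \<and>
         (\<forall>U' s t. U' \<subseteq> U \<and> bsec E U' s \<and> bsec F U' t \<longrightarrow>
            cont_on (bbase E) U' (\<lambda>x. w x (s x, t x))))\<rparr>"

text \<open>The fibres of these bundles are \<^const>\<open>vs_det\<close>, \<^const>\<open>vs_tpow\<close> and
  \<^const>\<open>vs_tensor\<close> of the fibres.\<close>

definition det_bundle ::
  "('x, 'e) vbundle \<Rightarrow> ('x, ((nat \<Rightarrow> 'e) \<Rightarrow> real) \<Rightarrow> real) vbundle" where
  "det_bundle E = dual_bundle (top_forms_bundle E)"

definition tpow_bundle ::
  "nat \<Rightarrow> ('x, 'e) vbundle \<Rightarrow> ('x, ((nat \<Rightarrow> 'e) \<Rightarrow> real) \<Rightarrow> real) vbundle" where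
  "tpow_bundle k E = dual_bundle (mult_forms_bundle k E)"

definition tensor_bundle ::
  "('x, 'a) vbundle \<Rightarrow> ('x, 'b) vbundle \<Rightarrow> ('x, ('a \<times> 'b \<Rightarrow> real) \<Rightarrow> real) vbundle" where
  "tensor_bundle E F = dual_bundle (bilin_forms_bundle E F)"

text \<open>The continuous sections of \<open>g\<^sup>*E\<close> are, locally, the combinations of sections \<open>e\<^sub>i \<circ> g\<close>
  with continuous coefficients, where the \<open>e\<^sub>i\<close> are continuous sections of \<open>E\<close>.\<close>

definition pullback_bundle :: "'x topology \<Rightarrow> ('x \<Rightarrow> 'y) \<Rightarrow> ('y, 'e) vbundle \<Rightarrow> ('x, 'e) vbundle" where
  "pullback_bundle T g E =
     \<lparr>bbase = T, bfib = (\<lambda>x. bfib E (g x)),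
      bsec = (\<lambda>U s. openin T U \<and>
         (\<forall>x\<in>U. \<exists>U' U'' k c e. openin T U' \<and> x \<in> U' \<and> U' \<subseteq> U \<and> g ` U' \<subseteq> U'' \<and>
            (\<forall>i<k. cont_on T U' (c i) \<and> bsec E U'' (e i)) \<and>
            (\<forall>y\<in>U'. s y = lincomb (bfib E (g y)) k (\<lambda>i. c i y) (\<lambda>i. e i (g y)))))\<rparr>"

definition global_trivializations ::
  "('x, 'e) vbundle \<Rightarrow> 'f rvs \<Rightarrow> ('x \<Rightarrow> 'e \<Rightarrow> 'f) set" where
  "global_trivializations E F = line_bundle_isos E (trivial_bundle (bbase E) F)"

section \<open>Singular cohomology with coefficients in \<open>\<int>\<^sub>2\<close>\<close>

definition cochain_group :: "nat \<Rightarrow> 'a topology \<Rightarrow> (((nat \<Rightarrow> real) \<Rightarrow> 'a) \<Rightarrow> bit) monoid" where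
  "cochain_group p X =
     \<lparr>carrier = {c. \<forall>\<sigma>. \<not> singular_simplex p X \<sigma> \<longrightarrow> c \<sigma> = 0},
      mult = (\<lambda>c d \<sigma>. c \<sigma> + d \<sigma>), one = (\<lambda>_. 0)\<rparr>"

definition coboundary ::
  "nat \<Rightarrow> 'a topology \<Rightarrow> (((nat \<Rightarrow> real) \<Rightarrow> 'a) \<Rightarrow> bit) \<Rightarrow> ((nat \<Rightarrow> real) \<Rightarrow> 'a) \<Rightarrow> bit" where
  "coboundary p X c =
     (\<lambda>\<sigma>. if singular_simplex (Suc p) X \<sigma>
          then \<Sum>k\<le>Suc p. c (singular_face (Suc p) k \<sigma>) else 0)"

definition cocycle_group :: "nat \<Rightarrow> 'a topology \<Rightarrow> (((nat \<Rightarrow> real) \<Rightarrow> 'a) \<Rightarrow> bit) monoid" where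
  "cocycle_group p X = (cochain_group p X)
     \<lparr>carrier := {c \<in> carrier (cochain_group p X). coboundary p X c = (\<lambda>_. 0)}\<rparr>"

definition coboundaries :: "nat \<Rightarrow> 'a topology \<Rightarrow> (((nat \<Rightarrow> real) \<Rightarrow> 'a) \<Rightarrow> bit) set" where
  "coboundaries p X = (case p of 0 \<Rightarrow> {\<lambda>_. 0}
     | Suc q \<Rightarrow> coboundary q X ` carrier (cochain_group q X))"

definition cohomology :: "nat \<Rightarrow> 'a topology \<Rightarrow> (((nat \<Rightarrow> real) \<Rightarrow> 'a) \<Rightarrow> bit) set monoid" where
  "cohomology p X = cocycle_group p X Mod coboundaries p X"

definition coh_class ::
  "nat \<Rightarrow> 'a topology \<Rightarrow> (((nat \<Rightarrow> real) \<Rightarrow> 'a) \<Rightarrow> bit) \<Rightarrow> (((nat \<Rightarrow> real) \<Rightarrow> 'a) \<Rightarrow> bit) set" where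
  "coh_class p X c = coboundaries p X #>\<^bsub>cocycle_group p X\<^esub> c"

definition cochain_pullback ::
  "nat \<Rightarrow> 'a topology \<Rightarrow> ('a \<Rightarrow> 'b) \<Rightarrow> (((nat \<Rightarrow> real) \<Rightarrow> 'b) \<Rightarrow> bit) \<Rightarrow> ((nat \<Rightarrow> real) \<Rightarrow> 'a) \<Rightarrow> bit" where
  "cochain_pullback p X g c =
     (\<lambda>\<sigma>. if singular_simplex p X \<sigma> then c (simplex_map p g \<sigma>) else 0)"

text \<open>The map \<open>g\<^sup>* : H\<^sup>p(Y, \<int>\<^sub>2) \<rightarrow> H\<^sup>p(X, \<int>\<^sub>2)\<close>; all representatives of a class of \<open>Y\<close>
  contribute the same class of \<open>X\<close> to the union.\<close>

definition coh_pullback ::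
  "nat \<Rightarrow> 'a topology \<Rightarrow> ('a \<Rightarrow> 'b) \<Rightarrow> (((nat \<Rightarrow> real) \<Rightarrow> 'b) \<Rightarrow> bit) set \<Rightarrow>
   (((nat \<Rightarrow> real) \<Rightarrow> 'a) \<Rightarrow> bit) set" where
  "coh_pullback p X g K = (\<Union>c\<in>K. coh_class p X (cochain_pullback p X g c))"

subsection \<open>The first Stiefel-Whitney class\<close>

definition vertex0 :: "nat \<Rightarrow> real" where
  "vertex0 = (\<lambda>i. if i = 0 then 1 else 0)"

definition vertex1 :: "nat \<Rightarrow> real" where
  "vertex1 = (\<lambda>i. if i = 1 then 1 else 0)"

definition same_orientation :: "'e rvs \<Rightarrow> (nat \<Rightarrow> 'e) \<Rightarrow> (nat \<Rightarrow> 'e) \<Rightarrow> bool" where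
  "same_orientation F s t \<longleftrightarrow>
     (\<exists>w\<in>vcarrier (top_forms F).
        w (restrict s {..<vs_dim F}) > 0 \<and> w (restrict t {..<vs_dim F}) > 0)"

text \<open>Fix a basis \<open>b x\<close>, hence an orientation, of each fibre \<open>E\<^sub>x\<close> (with no continuity in
  \<open>x\<close>). The cochain below takes the value \<open>0\<close> on a path \<open>\<sigma>\<close> if transport along \<open>\<sigma>\<close>,
  that is, along a continuous frame of \<open>\<sigma>\<^sup>*E\<close>, respects the chosen orientations at the
  ends, and \<open>1\<close> otherwise. Another choice of the orientations changes it by a coboundary; its
  class is \<open>w\<^sub>1(E)\<close>, the obstruction to the orientability of \<open>E\<close>.\<close>

definition w1_cochain ::
  "('x, 'e) vbundle \<Rightarrow> ('x \<Rightarrow> nat \<Rightarrow> 'e) \<Rightarrow> ((nat \<Rightarrow> real) \<Rightarrow> 'x) \<Rightarrow> bit" where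
  "w1_cochain E b \<sigma> =
     (let I = subtopology (powertop_real UNIV) (standard_simplex 1) in
      if singular_simplex 1 (bbase E) \<sigma> \<and>
         \<not> (\<exists>r s. frame (pullback_bundle I \<sigma> E) (topspace I) r s \<and>
               same_orientation (bfib E (\<sigma> vertex0)) (\<lambda>i. s i vertex0) (b (\<sigma> vertex0)) \<and>
               same_orientation (bfib E (\<sigma> vertex1)) (\<lambda>i. s i vertex1) (b (\<sigma> vertex1)))
      then 1 else 0)"

definition w1 :: "('x, 'e) vbundle \<Rightarrow> (((nat \<Rightarrow> real) \<Rightarrow> 'x) \<Rightarrow> bit) set" where
  "w1 E = coh_class 1 (bbase E)
     (w1_cochain E (SOME b. \<forall>x\<in>topspace (bbase E). vs_basis (bfib E x) (vs_dim (bfib E x)) (b x)))"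

section \<open>Projective spaces\<close>

definition proj :: "'v::euclidean_space set \<Rightarrow> 'v set set" where
  "proj A = {l. subspace l \<and> dim l = 1 \<and> l \<subseteq> A}"

text \<open>The projective space of the whole type, with the quotient topology of \<open>V - {0}\<close>.\<close>

definition proj_top :: "'v::euclidean_space set topology" where
  "proj_top = topology (\<lambda>U. U \<subseteq> proj UNIV \<and> open {v. v \<noteq> 0 \<and> span {v} \<in> U})"

lemma openin_proj_top:
  "openin proj_top U \<longleftrightarrow> U \<subseteq> proj UNIV \<and> open {v. v \<noteq> 0 \<and> span {v} \<in> U}"
proof -
  have "istopology (\<lambda>U::'a set set. U \<subseteq> proj UNIV \<and> open {v. v \<noteq> 0 \<and> span {v} \<in> U})"
    unfolding istopology_def
  proof (intro conjI allI impI)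
    fix S T :: "'a set set"
    assume S: "S \<subseteq> proj UNIV \<and> open {v. v \<noteq> 0 \<and> span {v} \<in> S}"
      and T: "T \<subseteq> proj UNIV \<and> open {v. v \<noteq> 0 \<and> span {v} \<in> T}"
    show "S \<inter> T \<subseteq> proj UNIV" using S by blast
    have "{v. v \<noteq> 0 \<and> span {v} \<in> S \<inter> T} =
        {v. v \<noteq> 0 \<and> span {v} \<in> S} \<inter> {v. v \<noteq> 0 \<and> span {v} \<in> T}" by blast
    then show "open {v. v \<noteq> 0 \<and> span {v} \<in> S \<inter> T}" using S T by auto
  next
    fix K :: "'a set set set"
    assume K: "\<forall>S\<in>K. S \<subseteq> proj UNIV \<and> open {v. v \<noteq> 0 \<and> span {v} \<in> S}"
    show "\<Union> K \<subseteq> proj UNIV" using K by blast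
    have "{v. v \<noteq> 0 \<and> span {v} \<in> \<Union> K} = (\<Union>S\<in>K. {v. v \<noteq> 0 \<and> span {v} \<in> S})" by blast
    then show "open {v. v \<noteq> 0 \<and> span {v} \<in> \<Union> K}" using K by auto
  qed
  then show ?thesis unfolding proj_top_def by (simp add: topology_inverse')
qed

subsection \<open>Smooth submanifolds\<close>

text \<open>\<open>f\<close> is of class \<open>C\<^sup>k\<close> on the open set \<open>S\<close>: all iterated directional derivatives of order at
  most \<open>k\<close> exist and are continuous.\<close>

primrec Ck_on :: "nat \<Rightarrow> 'a::euclidean_space set \<Rightarrow> ('a \<Rightarrow> 'b::euclidean_space) \<Rightarrow> bool" where
  "Ck_on 0 S f \<longleftrightarrow> continuous_on S f"
| "Ck_on (Suc k) S f \<longleftrightarrow>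
     (\<forall>x\<in>S. f differentiable (at x)) \<and> (\<forall>v. Ck_on k S (\<lambda>x. frechet_derivative f (at x) v))"

definition smooth_on :: "'a::euclidean_space set \<Rightarrow> ('a \<Rightarrow> 'b::euclidean_space) \<Rightarrow> bool" where
  "smooth_on S f \<longleftrightarrow> (\<forall>k. Ck_on k S f)"

text \<open>Local parametrizations: near each of its points, \<open>X\<close> is the image of a smooth embedding
  \<open>u \<mapsto> [\<psi> u]\<close> of an open subset \<open>D \<inter> S\<close> of an \<open>m\<close>-dimensional space \<open>S\<close>, where \<open>\<psi>\<close> is a
  smooth lift to \<open>V - {0}\<close>. A linear subspace \<open>S\<close> of \<open>V\<close> serves as \<open>\<real>\<^sup>m\<close>. As the kernel of the
  differential of \<open>V - {0} \<rightarrow> \<P>(V)\<close> at \<open>v\<close> is \<open>span {v}\<close>, the last condition says that the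
  differential of \<open>u \<mapsto> [\<psi> u]\<close> is injective.\<close>

definition smooth_submanifold :: "nat \<Rightarrow> 'v::euclidean_space set set \<Rightarrow> bool" where
  "smooth_submanifold m X \<longleftrightarrow> X \<subseteq> proj UNIV \<and>
     (\<forall>l\<in>X. \<exists>U S D (\<psi> :: 'v \<Rightarrow> 'v).
        openin proj_top U \<and> l \<in> U \<and> subspace S \<and> dim S = m \<and> open D \<and>
        smooth_on D \<psi> \<and> (\<forall>u\<in>D \<inter> S. \<psi> u \<noteq> 0) \<and>
        homeomorphic_map (subtopology euclidean (D \<inter> S)) (subtopology proj_top (X \<inter> U))
          (\<lambda>u. span {\<psi> u}) \<and>
        (\<forall>u\<in>D \<inter> S. \<forall>h\<in>S. frechet_derivative \<psi> (at u) h \<in> span {\<psi> u} \<longrightarrow> h = 0))"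

text \<open>\<open>T\<^sub>l X\<close> as a subset of \<open>T\<^sub>l \<P>(V) = Hom(l, V/l)\<close>: the velocity at time \<open>0\<close> of a curve
  \<open>t \<mapsto> [c t]\<close> through \<open>l\<close> is the homomorphism that sends \<open>c 0\<close> to the class of \<open>c' 0\<close>.\<close>

definition tangent_space :: "'v::euclidean_space set set \<Rightarrow> 'v set \<Rightarrow> ('v \<Rightarrow> 'v set) set" where
  "tangent_space X l =
     {\<phi> \<in> vcarrier (vs_hom (vs_of l) (vs_quot l UNIV)).
        \<exists>(c :: real \<Rightarrow> 'v) d. (c has_vector_derivative d) (at 0) \<and> c 0 \<in> l \<and>
           (\<forall>\<^sub>F t in nhds 0. c t \<noteq> 0 \<and> span {c t} \<in> X) \<and> d \<in> \<phi> (c 0)}"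

definition taut_bundle :: "'v::euclidean_space set set \<Rightarrow> ('v set, 'v) vbundle" where
  "taut_bundle X = sub_bundle (subtopology proj_top X) (\<lambda>l. l)"

text \<open>The restriction to \<open>X\<close> of the tangent bundle of the projective space.\<close>

definition proj_tangent_bundle :: "'v::euclidean_space set set \<Rightarrow> ('v set, 'v \<Rightarrow> 'v set) vbundle" where
  "proj_tangent_bundle X =
     hom_bundle (taut_bundle X) (quot_bundle (subtopology proj_top X) (\<lambda>l. l) (\<lambda>_. UNIV))"

definition tangent_bundle :: "'v::euclidean_space set set \<Rightarrow> ('v set, 'v \<Rightarrow> 'v set) vbundle" where
  "tangent_bundle X =
     \<lparr>bbase = subtopology proj_top X,
      bfib = (\<lambda>l. (bfib (proj_tangent_bundle X) l)\<lparr>vcarrier := tangent_space X l\<rparr>),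
      bsec = (\<lambda>U s. bsec (proj_tangent_bundle X) U s \<and> (\<forall>l\<in>U. s l \<in> tangent_space X l))\<rparr>"

definition Y_fib :: "'v::euclidean_space set set \<Rightarrow> 'v set \<Rightarrow> 'v set" where
  "Y_fib X l = (THE Y. subspace Y \<and> l \<subseteq> Y \<and>
     tangent_space X l = vcarrier (vs_hom (vs_of l) (vs_quot l Y)))"

definition Y_bundle :: "'v::euclidean_space set set \<Rightarrow> ('v set, 'v) vbundle" where
  "Y_bundle X = sub_bundle (subtopology proj_top X) (Y_fib X)"

text \<open>For a map \<open>g\<close> of manifolds with tangent bundles \<open>TM\<close> and \<open>TN\<close>.\<close>

definition relatively_orientable ::
  "('y, 'f) vbundle \<Rightarrow> ('x, 'e) vbundle \<Rightarrow> ('y \<Rightarrow> 'x) \<Rightarrow> bool" where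
  "relatively_orientable TM TN g \<longleftrightarrow> continuous_map (bbase TM) (bbase TN) g \<and>
     line_bundle_isomorphic (pullback_bundle (bbase TM) g (det_bundle TN)) (det_bundle TM)"

subsection \<open>Projections\<close>

definition Hom_avoiding ::
  "'v::euclidean_space set set \<Rightarrow> ('v \<Rightarrow> 'w::euclidean_space) set" where
  "Hom_avoiding X = {f. linear f \<and> X \<inter> proj {v. f v = 0} = {}}"

definition proj_map :: "('v \<Rightarrow> 'w) \<Rightarrow> 'v set \<Rightarrow> 'w set" where
  "proj_map f l = f ` l"

definition pullback_det ::
  "'v::euclidean_space set set \<Rightarrow> ('v \<Rightarrow> 'w::euclidean_space) \<Rightarrow>
   ('v set, ((nat \<Rightarrow> 'w \<Rightarrow> 'w set) \<Rightarrow> real) \<Rightarrow> real) vbundle" where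
  "pullback_det X f =
     pullback_bundle (subtopology proj_top X) (proj_map f)
       (det_bundle (proj_tangent_bundle (proj UNIV)))"

text \<open>For \<open>l \<in> X\<close>, a vector space \<open>D\<close> and a linear map \<open>\<mu> : det W \<rightarrow> D\<close>, the composition
  \<open>det(T\<^sub>f\<^sub>(\<^sub>l\<^sub>) \<P>(W)) = (f(l)\<^sup>\<or>)\<^sup>\<otimes>\<^sup>n \<otimes> det W \<rightarrow> (l\<^sup>\<or>)\<^sup>\<otimes>\<^sup>n \<otimes> D\<close>
  of the canonical identification with \<open>(r\<^sub>f\<^sup>\<or>)\<^sup>\<otimes>\<^sup>n \<otimes> \<mu>\<close>, where \<open>r\<^sub>f : l \<rightarrow> f(l)\<close> is the
  restriction of \<open>f\<close>.\<close>

definition proj_det_map ::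
  "nat \<Rightarrow> ('v::euclidean_space \<Rightarrow> 'w::euclidean_space) \<Rightarrow> 'v set \<Rightarrow> 'd rvs \<Rightarrow>
   ((((nat \<Rightarrow> 'w) \<Rightarrow> real) \<Rightarrow> real) \<Rightarrow> 'd) \<Rightarrow>
   (((nat \<Rightarrow> 'w \<Rightarrow> 'w set) \<Rightarrow> real) \<Rightarrow> real) \<Rightarrow>
   ((((nat \<Rightarrow> 'v \<Rightarrow> real) \<Rightarrow> real) \<Rightarrow> real) \<times> 'd \<Rightarrow> real) \<Rightarrow> real" where
  "proj_det_map n f l D \<mu> =
    (let L = vs_of l; L' = vs_of (proj_map f l); r = restrict f l
     in compose (vcarrier (bfib (det_bundle (proj_tangent_bundle (proj UNIV))) (proj_map f l)))
          (tensor_map (vs_tpow n (vs_dual L')) (vs_det (vs_of UNIV)) (vs_tpow n (vs_dual L)) D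
             (tpow_map n (vs_dual L') (vs_dual L) (dual_map L L' r)) \<mu>)
          (det_tangent_iso (proj_map f l) UNIV))"

text \<open>The isomorphism \<open>\<nu> = (r\<^sub>f\<^sup>\<or>)\<^sup>\<otimes>\<^sup>n \<otimes> \<mu>\<close>, read through the canonical identifications of both sides.\<close>

definition nu_of_mu ::
  "nat \<Rightarrow> 'v::euclidean_space set set \<Rightarrow> ('v \<Rightarrow> 'w::euclidean_space) \<Rightarrow>
   ('v set \<Rightarrow> (((nat \<Rightarrow> 'w) \<Rightarrow> real) \<Rightarrow> real) \<Rightarrow> (((nat \<Rightarrow> 'v) \<Rightarrow> real) \<Rightarrow> real)) \<Rightarrow>
   'v set \<Rightarrow> (((nat \<Rightarrow> 'w \<Rightarrow> 'w set) \<Rightarrow> real) \<Rightarrow> real) \<Rightarrow> (((nat \<Rightarrow> 'v \<Rightarrow> 'v set) \<Rightarrow> real) \<Rightarrow> real)" where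
  "nu_of_mu n X f \<mu> =
    (\<lambda>l\<in>X. compose (vcarrier (bfib (pullback_det X f) l))
       (inv_into (vcarrier (bfib (det_bundle (tangent_bundle X)) l))
          (det_tangent_iso l (Y_fib X l)))
       (proj_det_map n f l (vs_det (vs_of (Y_fib X l))) (\<mu> l)))"

end

theory Submission
 imports Defs "Jordan_Normal_Form.Determinant"
begin

text \<open>Every bundle in the statement has explicit local generators: over a small open set of \<open>X\<close>
 there are a nonvanishing section \<open>v\<close> of the tautological bundle and vectors \<open>y\<^sub>i\<close> completing it to
 a frame of \<open>Y\<close>, and the line bundles involved are generated by wedge and tensor products of these.
 The canonical maps send generators to generators, which makes them isomorphisms and reduces the
 correspondence between \<open>\<mu>\<close> and \<open>\<nu>\<close> to an equality of coefficients. Hence relative orientability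
 means that \<open>det Y\<close> has a nowhere vanishing section. Along a path, frames of \<open>TX\<close> and of the
 tautological bundle yield a frame of \<open>det Y\<close>, and comparing its signs at the two ends with chosen
 orientations gives \<open>w\<^sub>1(TX) + n w\<^sub>1(\<lambda>)\<close>. A nowhere vanishing section provides a function on points
 whose coboundary this is; conversely such a function corrects the signs of normalized local
 generators so that they fit together.\<close>

section \<open>Determinants of real matrices indexed by natural numbers\<close>

text \<open>The canonical isomorphism and the fibre of \<open>Y\<close> are definite descriptions,
  so both have to be computed. For the first, replacing \<open>v\<close> by \<open>a v\<close>
  contributes \<open>a^(-n)\<close> through the powers of the dual vector and \<open>a^n\<close>
  through the wedge; the exponent \<open>n = m + 1\<close> makes these cancel. For the second, every
  differentiable curve in \<open>X\<close> has to be compared with a chart. Continuity of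
  coordinates comes from Cramer's rule, with \<open>dform\<close> inside one fibre and with Gram
  determinants of the ambient inner product where the fibre moves. The obstacle in the topological
  part is that the bases behind \<open>w1\<close> are chosen without continuity. The coefficient of
  a section of det Y in a basis, times the determinant \<open>orient\<close> of that basis against
  the chosen ones, depends on the point alone; divided by the orientation of a frame along a path it
  is continuous, since the choices cancel. Conversely, a sign does not determine a coefficient: its
  size is taken to be the inverse square root of a Gram determinant, which changes with the basis by
  exactly the absolute value required.\<close>

definition ddet :: "nat \<Rightarrow> (nat \<Rightarrow> nat \<Rightarrow> real) \<Rightarrow> real" where
 "ddet k M = Determinant.det (mat k k (\<lambda>(i, j). M i j))"

lemma ddet_leibniz:
 "ddet k M = (\<Sum>p | p permutes {0..<k}. signof p * (\<Prod>i = 0..<k. M i (p i)))"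
proof -
 have "(\<Prod>i = 0..<k. mat k k (\<lambda>(i, j). M i j) $$ (i, p i)) = (\<Prod>i = 0..<k. M i (p i))"
  if "p permutes {0..<k}" for p
  using that by (intro prod.cong) (auto dest: permutes_in_image)
 thus ?thesis
  unfolding ddet_def by (subst det_def'[of _ k]) (auto intro!: sum.cong)
qed

lemma ddet_cong:
 assumes "\<And>i j. i < k ==> j < k ==> M i j = N i j"
 shows "ddet k M = ddet k N"
proof -
 have "mat k k (\<lambda>(i, j). M i j) = mat k k (\<lambda>(i, j). N i j)"
  using assms by (intro eq_matI) auto
 thus ?thesis by (simp add: ddet_def)
qed

lemma ddet_row_linear:
 assumes "i < k"
 shows "ddet k (M(i := (%j. a * x j + b * y j))) = a * ddet k (M(i := x)) + b * ddet k (M(i := y))"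
proof -
 have split: "(\<Prod>l = 0..<k. (M(i := z)) l (p l)) = z (p i) * (\<Prod>l\<in>{0..<k} - {i}. M l (p l))"
  for z :: "nat \<Rightarrow> real" and p
 proof -
  have "(\<Prod>l = 0..<k. (M(i := z)) l (p l))
    = (M(i := z)) i (p i) * (\<Prod>l\<in>{0..<k} - {i}. (M(i := z)) l (p l))"
   using assms by (intro prod.remove) auto
  also have "(\<Prod>l\<in>{0..<k} - {i}. (M(i := z)) l (p l)) = (\<Prod>l\<in>{0..<k} - {i}. M l (p l))"
   by (intro prod.cong) auto
  finally show ?thesis by simp
 qed
 show ?thesis
  unfolding ddet_leibniz split
  by (simp add: sum_distrib_left algebra_simps flip: sum.distrib)
qed

lemma ddet_rows_eq:
 assumes "i < k" "j < k" "i \<noteq> j" "\<And>c. c < k ==> M i c = M j c"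
 shows "ddet k M = 0"
 unfolding ddet_def
 by (rule det_identical_rows[of _ k i j]) (use assms in \<open>auto intro!: eq_vecI\<close>)

lemma ddet_transpose: "ddet k (%i j. M j i) = ddet k M"
proof -
 have "mat k k (\<lambda>(i, j). M j i) = transpose_mat (mat k k (\<lambda>(i, j). M i j))"
  by (intro eq_matI) auto
 thus ?thesis by (simp add: ddet_def det_transpose[of _ k])
qed

lemma ddet_one: "ddet k (%i j. if i = j then 1 else 0) = 1"
proof -
 have "mat k k (\<lambda>(i, j). if i = j then 1 else 0) = (1\<^sub>m k :: real mat)"
  by (intro eq_matI) auto
 thus ?thesis by (simp add: ddet_def)
qed

text \<open>A square matrix with trivial kernel is invertible. The kernel is spelled out with sums
  because the application is to Gram matrices, where a kernel vector is a linear combination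
  orthogonal to all its own terms.\<close>

lemma ddet_nonzero:
 assumes "\<And>c. (\<And>i. i < k ==> (\<Sum>j<k. c j * M i j) = 0) ==> \<forall>j<k. c j = 0"
 shows "ddet k M \<noteq> 0"
proof
 assume "ddet k M = 0"
 then obtain v where v: "v \<in> carrier_vec k" "v \<noteq> 0\<^sub>v k"
  "mat k k (\<lambda>(i, j). M i j) *\<^sub>v v = 0\<^sub>v k"
  unfolding ddet_def by (subst (asm) det_0_iff_vec_prod_zero[of _ k]) auto
 have "(\<Sum>j<k. v $ j * M i j) = 0" if "i < k" for i
 proof -
  have "(mat k k (\<lambda>(i, j). M i j) *\<^sub>v v) $ i = (\<Sum>j<k. v $ j * M i j)"
   using that v(1) by (auto simp: scalar_prod_def lessThan_atLeast0 mult.commute intro!: sum.cong)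
  thus ?thesis using v(3) that by simp
 qed
 hence "\<forall>j<k. v $ j = 0" by (rule assms)
 hence "v = 0\<^sub>v k" using v(1) by (intro eq_vecI) auto
 with v(2) show False by simp
qed

text \<open>Expansion along a first row \<open>(1, 0, ..., 0)\<close>, which is the coordinate row
  of \<open>v\<close> in a basis starting with \<open>v\<close>. The first column is arbitrary: it
  holds the components along \<open>v\<close> that are lost in \<open>B/A\<close>. Transposing puts
  the zeros where the block rule expects them.\<close>

lemma ddet_Suc_block:
 assumes "M 0 0 = 1" "\<And>j. j < k ==> M 0 (Suc j) = 0"
 shows "ddet (Suc k) M = ddet k (%i j. M (Suc i) (Suc j))"
proof -
 let ?B = "four_block_mat (1\<^sub>m 1) (mat 1 k (\<lambda>(i, j). M (Suc j) 0)) (0\<^sub>m k 1)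
  (mat k k (\<lambda>(i, j). M (Suc j) (Suc i)))"
 have "mat (Suc k) (Suc k) (\<lambda>(i, j). M j i) = ?B"
  using assms by (intro eq_matI) (auto simp: less_Suc_eq_0_disj)
 hence "ddet (Suc k) (%i j. M j i) = ddet k (%i j. M (Suc j) (Suc i))"
  unfolding ddet_def using det_four_block_mat_lower_left_zero_col[OF _ _ refl, of "1\<^sub>m 1" _ k
   "mat k k (\<lambda>(i, j). M (Suc j) (Suc i))"] by auto
 thus ?thesis by (simp add: ddet_transpose[of _ M] ddet_transpose[of k "%i j. M (Suc i) (Suc j)"])
qed

section \<open>Linear algebra over explicit carriers\<close>

lemma real_vsD:
 assumes "real_vs F"
 shows "vzero F \<in> vcarrier F"
  and "x \<in> vcarrier F ==> y \<in> vcarrier F ==> vadd F x y \<in> vcarrier F"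
  and "x \<in> vcarrier F ==> y \<in> vcarrier F ==> vadd F x y = vadd F y x"
  and "x \<in> vcarrier F ==> y \<in> vcarrier F ==> z \<in> vcarrier F ==>
   vadd F (vadd F x y) z = vadd F x (vadd F y z)"
  and "x \<in> vcarrier F ==> vadd F (vzero F) x = x"
  and "x \<in> vcarrier F ==> vscale F a x \<in> vcarrier F"
  and "x \<in> vcarrier F ==> y \<in> vcarrier F ==>
   vscale F a (vadd F x y) = vadd F (vscale F a x) (vscale F a y)"
  and "x \<in> vcarrier F ==> vscale F (a + b) x = vadd F (vscale F a x) (vscale F b x)"
  and "x \<in> vcarrier F ==> vscale F (a * b) x = vscale F a (vscale F b x)"
  and "x \<in> vcarrier F ==> vscale F 1 x = x"
 using assms unfolding real_vs_def by blast+

lemma real_vs_cancel: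
 assumes F: "real_vs F" and x: "x \<in> vcarrier F" and y: "y \<in> vcarrier F" and z: "z \<in> vcarrier F"
  and eq: "vadd F x y = vadd F x z"
 shows "y = z"
proof -
 obtain x' where x': "x' \<in> vcarrier F" "vadd F x x' = vzero F"
  using F x unfolding real_vs_def by blast
 have "vadd F x' (vadd F x u) = u" if u: "u \<in> vcarrier F" for u
  using real_vsD(4)[OF F x'(1) x u] real_vsD(3)[OF F x'(1) x] x'(2) real_vsD(5)[OF F u] by simp
 thus ?thesis using eq y z by metis
qed

lemma vscale_zero:
 assumes F: "real_vs F" and x: "x \<in> vcarrier F"
 shows "vscale F 0 x = vzero F"
proof (rule real_vs_cancel[OF F real_vsD(6)[OF F x]])
 show "vscale F 0 x \<in> vcarrier F" "vzero F \<in> vcarrier F"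
  using real_vsD[OF F] x by auto
 have "vadd F (vscale F 0 x) (vscale F 0 x) = vscale F 0 x"
  using real_vsD(8)[OF F x, of 0 0] by simp
 also have "\<dots> = vadd F (vscale F 0 x) (vzero F)"
  using real_vsD[OF F] x by metis
 finally show "vadd F (vscale F 0 x) (vscale F 0 x) = vadd F (vscale F 0 x) (vzero F)" .
qed

lemma vscale_vzero:
 assumes F: "real_vs F"
 shows "vscale F a (vzero F) = vzero F"
 using vscale_zero[OF F real_vsD(1)[OF F]] real_vsD(9)[OF F real_vsD(1)[OF F], of a 0] by simp

lemma vadd_vzero:
 assumes F: "real_vs F" and "x \<in> vcarrier F"
 shows "vadd F x (vzero F) = x"
 using real_vsD[OF F] assms by metis

lemma lincomb_closed:
 assumes "real_vs F" "\<And>i. i < k ==> b i \<in> vcarrier F"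
 shows "lincomb F k c b \<in> vcarrier F"
 using assms(2) by (induction k) (simp_all add: real_vsD[OF assms(1)])

lemma lincomb_cong:
 assumes "\<And>i. i < k ==> c i = c' i" "\<And>i. i < k ==> b i = b' i"
 shows "lincomb F k c b = lincomb F k c' b'"
 using assms by (induction k) auto

lemma lincomb_restrict [simp]: "lincomb F k (restrict c {..<k}) b = lincomb F k c b"
 by (rule lincomb_cong) auto

lemma vadd_interchange:
 assumes F: "real_vs F" and c: "x \<in> vcarrier F" "y \<in> vcarrier F" "z \<in> vcarrier F" "u \<in> vcarrier F"
 shows "vadd F (vadd F x y) (vadd F z u) = vadd F (vadd F x z) (vadd F y u)"
proof -
 have "vadd F (vadd F x y) (vadd F z u) = vadd F x (vadd F y (vadd F z u))"
  using real_vsD[OF F] c by metis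
 also have "vadd F y (vadd F z u) = vadd F z (vadd F y u)"
  using real_vsD(4)[OF F c(2) c(3) c(4)] real_vsD(4)[OF F c(3) c(2) c(4)] real_vsD(3)[OF F c(2) c(3)]
  by simp
 also have "vadd F x (vadd F z (vadd F y u)) = vadd F (vadd F x z) (vadd F y u)"
  using real_vsD[OF F] c by metis
 finally show ?thesis .
qed

lemma lincomb_add:
 assumes F: "real_vs F" and "\<And>i. i < k ==> b i \<in> vcarrier F"
 shows "lincomb F k (%i. c i + d i) b = vadd F (lincomb F k c b) (lincomb F k d b)"
 using assms(2)
proof (induction k)
 case 0
 thus ?case by (simp add: real_vsD[OF F])
next
 case (Suc k)
 have cl: "lincomb F k e b \<in> vcarrier F" for e
  using Suc.prems by (intro lincomb_closed[OF F]) auto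
 have sc: "vscale F a (b k) \<in> vcarrier F" for a
  using Suc.prems real_vsD(6)[OF F] by auto
 show ?case
  using Suc by (simp add: real_vsD(8)[OF F] vadd_interchange[OF F cl cl sc sc])
qed

lemma lincomb_scale:
 assumes F: "real_vs F" and "\<And>i. i < k ==> b i \<in> vcarrier F"
 shows "lincomb F k (%i. a * c i) b = vscale F a (lincomb F k c b)"
 using assms(2)
proof (induction k)
 case 0
 thus ?case by (simp add: vscale_vzero[OF F])
next
 case (Suc k)
 have "lincomb F k c b \<in> vcarrier F"
  using Suc.prems by (intro lincomb_closed[OF F]) auto
 thus ?case
  using Suc by (simp add: real_vsD[OF F])
qed

lemma lincomb_zero:
 assumes F: "real_vs F" and "\<And>i. i < k ==> b i \<in> vcarrier F" and "\<And>i. i < k ==> c i = 0"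
 shows "lincomb F k c b = vzero F"
 using assms(2,3) by (induction k) (auto simp: vscale_zero[OF F] vadd_vzero[OF F] real_vsD[OF F])

lemma lincomb_delta:
 assumes F: "real_vs F" and "\<And>i. i < k ==> b i \<in> vcarrier F" and "j < k"
 shows "lincomb F k (%i. if i = j then 1 else 0) b = b j"
 using assms(2,3)
proof (induction k)
 case (Suc k)
 show ?case
 proof (cases "j = k")
  case True
  have "lincomb F k (%i. if i = j then 1 else 0) b = vzero F"
   using Suc.prems True by (intro lincomb_zero[OF F]) auto
  thus ?thesis using Suc.prems True by (simp add: real_vsD[OF F])
 next
  case False
  thus ?thesis using Suc by (simp add: vscale_zero[OF F] vadd_vzero[OF F])
 qed
qed simp

text \<open>Membership in \<open>vs_hom\<close> minus extensionality: coordinate maps and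
  \<open>inv_into\<close> are linear on the carrier without being \<open>undefined\<close> outside
  it.\<close>

definition vlinear :: "'a rvs \<Rightarrow> 'b rvs \<Rightarrow> ('a \<Rightarrow> 'b) \<Rightarrow> bool" where
 "vlinear A B h \<longleftrightarrow> (\<forall>x\<in>vcarrier A. h x \<in> vcarrier B) \<and>
   (\<forall>x\<in>vcarrier A. \<forall>y\<in>vcarrier A. h (vadd A x y) = vadd B (h x) (h y)) \<and>
   (\<forall>c. \<forall>x\<in>vcarrier A. h (vscale A c x) = vscale B c (h x))"

lemma vlinearD:
 assumes "vlinear A B h"
 shows "x \<in> vcarrier A ==> h x \<in> vcarrier B"
  and "x \<in> vcarrier A ==> y \<in> vcarrier A ==> h (vadd A x y) = vadd B (h x) (h y)"
  and "x \<in> vcarrier A ==> h (vscale A c x) = vscale B c (h x)"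
 using assms unfolding vlinear_def by auto

lemma fun_space_simps [simp]:
 "vcarrier (fun_space D T C) = C"
 "vadd (fun_space D T C) = (%g h. \<lambda>x\<in>D. vadd T (g x) (h x))"
 "vzero (fun_space D T C) = (\<lambda>x\<in>D. vzero T)"
 "vscale (fun_space D T C) = (%c g. \<lambda>x\<in>D. vscale T c (g x))"
 by (simp_all add: fun_space_def)

lemma vs_of_simps [simp]:
 "vcarrier (vs_of S) = S" "vadd (vs_of S) = (+)" "vzero (vs_of S) = 0" "vscale (vs_of S) = (*\<^sub>R)"
 by (simp_all add: vs_of_def)

lemma vs_hom_iff: "h \<in> vcarrier (vs_hom A B) \<longleftrightarrow> vlinear A B h \<and> h \<in> extensional (vcarrier A)"
 unfolding vs_hom_def vlinear_def by (auto simp: PiE_iff)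

lemma vs_hom_ops [simp]:
 "vadd (vs_hom A B) = (%g h. \<lambda>x\<in>vcarrier A. vadd B (g x) (h x))"
 "vzero (vs_hom A B) = (\<lambda>x\<in>vcarrier A. vzero B)"
 "vscale (vs_hom A B) = (%c g. \<lambda>x\<in>vcarrier A. vscale B c (g x))"
 by (simp_all add: vs_hom_def)

lemma restrict_vs_hom:
 assumes A: "real_vs A" and "vlinear A B h"
 shows "restrict h (vcarrier A) \<in> vcarrier (vs_hom A B)"
 using assms(2) real_vsD[OF A] by (auto simp: vs_hom_iff vlinear_def)

lemma vlinear_lincomb:
 assumes A: "real_vs A" and B: "real_vs B" and h: "vlinear A B h"
  and "\<And>i. i < k ==> b i \<in> vcarrier A"
 shows "h (lincomb A k c b) = lincomb B k c (%i. h (b i))"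
 using assms(4)
proof (induction k)
 case 0
 have "h (vscale A 0 (vzero A)) = vscale B 0 (h (vzero A))"
  using vlinearD[OF h] real_vsD[OF A] by blast
 thus ?case
  using vlinearD(1)[OF h real_vsD(1)[OF A]] by (simp add: vscale_vzero[OF A] vscale_zero[OF B])
next
 case (Suc k)
 have "lincomb A k c b \<in> vcarrier A"
  using Suc.prems by (intro lincomb_closed[OF A]) auto
 thus ?case
  using Suc by (simp add: vlinearD[OF h] real_vsD[OF A])
qed

text \<open>All spaces of homomorphisms and of forms are sets \<open>C\<close> of functions with
  pointwise operations, so the axioms reduce to closure of \<open>C\<close>. Negatives come from the
  scalar \<open>-1\<close>.\<close>

lemma real_vs_fun_space:
 assumes T: "real_vs T" and C: "C \<subseteq> D \<rightarrow>\<^sub>E vcarrier T" and "(\<lambda>x\<in>D. vzero T) \<in> C"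
  and "\<And>g h. g \<in> C ==> h \<in> C ==> (\<lambda>x\<in>D. vadd T (g x) (h x)) \<in> C"
  and sc: "\<And>c g. g \<in> C ==> (\<lambda>x\<in>D. vscale T c (g x)) \<in> C"
 shows "real_vs (fun_space D T C)"
proof -
 have c: "g x \<in> vcarrier T" if "g \<in> C" "x \<in> D" for g x using C that by auto
 have e: "g x = undefined" if "g \<in> C" "x \<notin> D" for g x using C that by auto
 have inv: "vadd T x (vscale T (-1) x) = vzero T" if "x \<in> vcarrier T" for x
  using real_vsD(8)[OF T that, of 1 "-1"] real_vsD(10)[OF T that] vscale_zero[OF T that] by simp
 have "\<exists>h\<in>C. (\<lambda>x\<in>D. vadd T (g x) (h x)) = (\<lambda>x\<in>D. vzero T)" if "g \<in> C" for g
  using sc[OF that, of "-1"] inv c[OF that] by (intro bexI[of _ "\<lambda>x\<in>D. vscale T (-1) (g x)"]) (auto simp: restrict_def)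
 thus ?thesis
  unfolding real_vs_def fun_space_simps
  using assms(3-5)
  by (intro conjI ballI allI; (simp; fail)?)
    (use real_vsD[OF T] c e in \<open>auto simp: fun_eq_iff intro: sym[OF e]\<close>)
qed

lemma real_vs_vs_of:
 assumes "subspace S"
 shows "real_vs (vs_of S)"
proof -
 have "\<exists>y\<in>S. x + y = 0" if "x \<in> S" for x
  using that subspace_neg[OF assms that] by (intro bexI[of _ "-x"]) auto
 thus ?thesis
  using assms unfolding real_vs_def by (auto simp: subspace_def algebra_simps)
qed

lemma real_vs_real_line [simp]: "real_vs real_line"
 by (rule real_vs_vs_of) simp

lemma real_vs_hom:
 assumes A: "real_vs A" and B: "real_vs B"
 shows "real_vs (vs_hom A B)"
 unfolding vs_hom_def
proof (rule real_vs_fun_space[OF B], unfold mem_Collect_eq, goal_cases)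
 case 2
 show ?case
  using real_vsD[OF A] real_vsD[OF B] vscale_vzero[OF B] by (auto intro!: PiE_I)
next
 case (3 g h)
 thus ?case
  using real_vsD[OF A] vadd_interchange[OF B] real_vsD(2,7)[OF B] by (auto simp: PiE_iff)
next
 case (4 c g)
 hence "vscale B c (vscale B d (g x)) = vscale B d (vscale B c (g x))" if "x \<in> vcarrier A" for d x
  using real_vsD(9)[OF B, of "g x" c d] real_vsD(9)[OF B, of "g x" d c] that
  by (simp add: PiE_iff mult.commute)
 thus ?case
  using 4 real_vsD[OF A] real_vsD(6,7)[OF B] by (auto simp: PiE_iff)
qed auto

lemma real_vs_dual: "real_vs A ==> real_vs (vs_dual A)"
 unfolding vs_dual_def by (intro real_vs_hom) simp_all

lemma vs_dual_iff:
 "p \<in> vcarrier (vs_dual A) \<longleftrightarrow> p \<in> extensional (vcarrier A) \<and>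
   (\<forall>x\<in>vcarrier A. \<forall>y\<in>vcarrier A. p (vadd A x y) = p x + p y) \<and>
   (\<forall>c. \<forall>x\<in>vcarrier A. p (vscale A c x) = c * p x)"
 unfolding vs_dual_def vs_hom_iff vlinear_def by auto

lemma vs_dual_ops [simp]:
 "vadd (vs_dual A) = (%g h. \<lambda>x\<in>vcarrier A. g x + h x)"
 "vzero (vs_dual A) = (\<lambda>x\<in>vcarrier A. 0)"
 "vscale (vs_dual A) = (%c g. \<lambda>x\<in>vcarrier A. c * g x)"
 by (simp_all add: vs_dual_def)

subsection \<open>Bases and coordinates\<close>

text \<open>Only the entries below \<open>k\<close> carry information; the description selects the
  coefficient vector that is \<open>undefined\<close> from \<open>k\<close> on.\<close>

definition vcoord :: "'e rvs \<Rightarrow> nat \<Rightarrow> (nat \<Rightarrow> 'e) \<Rightarrow> 'e \<Rightarrow> nat \<Rightarrow> real" where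
 "vcoord F k b x = (THE c. c \<in> {..<k} \<rightarrow>\<^sub>E UNIV \<and> x = lincomb F k c b)"

lemma vs_basis_mem: "vs_basis F k b ==> i < k ==> b i \<in> vcarrier F"
 by (simp add: vs_basis_def)

lemma vcoord_lincomb:
 assumes "vs_basis F k b" "x \<in> vcarrier F"
 shows "x = lincomb F k (vcoord F k b x) b"
proof -
 have "\<exists>!c. c \<in> {..<k} \<rightarrow>\<^sub>E UNIV \<and> x = lincomb F k c b"
  using assms by (simp add: vs_basis_def)
 from theI'[OF this] show ?thesis unfolding vcoord_def by blast
qed

lemma vcoord_unique:
 assumes F: "real_vs F" and b: "vs_basis F k b" and x: "x = lincomb F k c b" and i: "i < k"
 shows "vcoord F k b x i = c i"
proof -
 have xF: "x \<in> vcarrier F"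
  unfolding x by (rule lincomb_closed[OF F]) (rule vs_basis_mem[OF b])
 have "\<exists>!c. c \<in> {..<k} \<rightarrow>\<^sub>E UNIV \<and> x = lincomb F k c b"
  using b xF by (simp add: vs_basis_def)
 moreover have "restrict c {..<k} \<in> {..<k} \<rightarrow>\<^sub>E UNIV \<and> x = lincomb F k (restrict c {..<k}) b"
  using x by simp
 ultimately have "vcoord F k b x = restrict c {..<k}"
  using theI'[of "%c. c \<in> {..<k} \<rightarrow>\<^sub>E UNIV \<and> x = lincomb F k c b"] unfolding vcoord_def by blast
 with i show ?thesis by simp
qed

lemma vcoord_add:
 assumes F: "real_vs F" and b: "vs_basis F k b" and "x \<in> vcarrier F" "y \<in> vcarrier F" "i < k"
 shows "vcoord F k b (vadd F x y) i = vcoord F k b x i + vcoord F k b y i"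
proof (rule vcoord_unique[OF F b _ \<open>i < k\<close>])
 show "vadd F x y = lincomb F k (%i. vcoord F k b x i + vcoord F k b y i) b"
  by (subst lincomb_add[OF F vs_basis_mem[OF b]], assumption)
    (simp only: vcoord_lincomb[OF b assms(3), symmetric] vcoord_lincomb[OF b assms(4), symmetric])
qed

lemma vcoord_scale:
 assumes F: "real_vs F" and b: "vs_basis F k b" and "x \<in> vcarrier F" "i < k"
 shows "vcoord F k b (vscale F a x) i = a * vcoord F k b x i"
proof (rule vcoord_unique[OF F b _ \<open>i < k\<close>])
 show "vscale F a x = lincomb F k (%i. a * vcoord F k b x i) b"
  by (subst lincomb_scale[OF F vs_basis_mem[OF b]], assumption)
    (simp only: vcoord_lincomb[OF b assms(3), symmetric])
qed

lemma vcoord_basis: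
 assumes F: "real_vs F" and b: "vs_basis F k b" and "j < k" "i < k"
 shows "vcoord F k b (b j) i = (if i = j then 1 else 0)"
 by (rule vcoord_unique[OF F b _ \<open>i < k\<close>, of "b j" "%i. if i = j then 1 else 0"])
   (simp add: lincomb_delta[OF F vs_basis_mem[OF b] \<open>j < k\<close>])

text \<open>Spanning and independence in place of unique existence. As \<open>rvs\<close> has no
  subtraction, two expansions are compared by writing one as the other plus the combination of the
  differences and cancelling.\<close>

lemma vs_basisI:
 assumes F: "real_vs F" and b: "\<And>i. i < k ==> b i \<in> vcarrier F"
  and span: "\<And>x. x \<in> vcarrier F ==> \<exists>c. x = lincomb F k c b"
  and indep: "\<And>c. lincomb F k c b = vzero F ==> \<forall>i<k. c i = 0"
 shows "vs_basis F k b"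
 unfolding vs_basis_def
proof (intro conjI allI impI ballI)
 fix x assume "x \<in> vcarrier F"
 then obtain c where c: "x = lincomb F k c b" using span by blast
 show "\<exists>!c. c \<in> {..<k} \<rightarrow>\<^sub>E UNIV \<and> x = lincomb F k c b"
 proof (rule ex1I[of _ "restrict c {..<k}"])
  show "restrict c {..<k} \<in> {..<k} \<rightarrow>\<^sub>E UNIV \<and> x = lincomb F k (restrict c {..<k}) b"
   using c by simp
  fix d assume d: "d \<in> {..<k} \<rightarrow>\<^sub>E UNIV \<and> x = lincomb F k d b"
  have cl: "lincomb F k e b \<in> vcarrier F" for e using b by (rule lincomb_closed[OF F])
  have "vadd F (lincomb F k c b) (lincomb F k (%i. d i - c i) b) = lincomb F k d b"
   by (subst lincomb_add[OF F b, symmetric]) auto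
  also have "\<dots> = vadd F (lincomb F k c b) (vzero F)"
   using c d cl by (simp add: vadd_vzero[OF F])
  finally have "lincomb F k (%i. d i - c i) b = vzero F"
   using real_vs_cancel[OF F] cl real_vsD(1)[OF F] by metis
  hence "\<forall>i<k. d i - c i = 0" by (rule indep)
  thus "d = restrict c {..<k}" using d by (auto simp: PiE_iff extensional_def fun_eq_iff)
 qed
qed (use b in auto)

lemma vs_basis_indep:
 assumes F: "real_vs F" and b: "vs_basis F k b" and "lincomb F k c b = vzero F" "i < k"
 shows "c i = 0"
proof -
 have "vcoord F k b (vzero F) i = c i"
  using vcoord_unique[OF F b _ assms(4), of "vzero F" c] assms(3) by simp
 moreover have "vcoord F k b (vzero F) i = 0"
  using vcoord_unique[OF F b _ assms(4), of "vzero F" "%_. 0"]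
   lincomb_zero[OF F vs_basis_mem[OF b], where c = "%_. 0"] by simp
 ultimately show ?thesis by simp
qed

text \<open>This transports a change of basis matrix from one space to another without inverting it.\<close>

lemma vs_basis_image:
 assumes F: "real_vs F" and G: "real_vs G" and b: "vs_basis F k b"
  and h: "vlinear F G h" and inj: "inj_on h (vcarrier F)" and surj: "h ` vcarrier F = vcarrier G"
 shows "vs_basis G k (%i. h (b i))"
proof (rule vs_basisI[OF G])
 have hl: "h (lincomb F k c b) = lincomb G k c (%i. h (b i))" for c
  by (rule vlinear_lincomb[OF F G h]) (rule vs_basis_mem[OF b])
 {
  fix y assume "y \<in> vcarrier G"
  then obtain x where x: "x \<in> vcarrier F" "y = h x" using surj by auto
  have "y = lincomb G k (vcoord F k b x) (%i. h (b i))"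
   using hl[of "vcoord F k b x"] vcoord_lincomb[OF b x(1), symmetric] x(2) by simp
  thus "\<exists>c. y = lincomb G k c (%i. h (b i))" by blast
 next
  fix c assume "lincomb G k c (%i. h (b i)) = vzero G"
  hence "h (lincomb F k c b) = h (vzero F)"
   using hl vlinear_lincomb[OF F G h, of 0 b] by simp
  hence "lincomb F k c b = vzero F"
   using inj lincomb_closed[OF F vs_basis_mem[OF b]] real_vsD(1)[OF F] by (auto dest: inj_onD)
  thus "\<forall>i<k. c i = 0" using vs_basis_indep[OF F b] by blast
 }
 show "h (b i) \<in> vcarrier G" if "i < k" for i
  using vlinearD(1)[OF h] vs_basis_mem[OF b that] .
qed

text \<open>The coordinates of \<open>s\<close> with respect to \<open>b\<close> are reused as
  coefficients with respect to \<open>b'\<close> in another space. The linear map taking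
  \<open>b\<close> to \<open>b'\<close> is an isomorphism and carries \<open>s\<close> to the new
  family. This is what continues a frame along an interval with constant coefficients.\<close>

lemma vs_basis_change:
 assumes F: "real_vs F" and G: "real_vs G" and b: "vs_basis F k b" and s: "vs_basis F k s"
  and b': "vs_basis G k b'"
 shows "vs_basis G k (%i. lincomb G k (vcoord F k b (s i)) b')"
proof -
 define h where "h x = lincomb G k (vcoord F k b x) b'" for x
 have h: "vlinear F G h"
  unfolding vlinear_def
 proof (intro conjI ballI allI)
  fix x assume x: "x \<in> vcarrier F"
  show "h x \<in> vcarrier G"
   unfolding h_def by (rule lincomb_closed[OF G]) (rule vs_basis_mem[OF b'])
  fix a
  have "lincomb G k (vcoord F k b (vscale F a x)) b' = lincomb G k (%i. a * vcoord F k b x i) b'"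
   by (rule lincomb_cong) (simp_all add: vcoord_scale[OF F b x])
  thus "h (vscale F a x) = vscale G a (h x)"
   unfolding h_def by (simp add: lincomb_scale[OF G vs_basis_mem[OF b']])
 next
  fix x y assume x: "x \<in> vcarrier F" and y: "y \<in> vcarrier F"
  have "lincomb G k (vcoord F k b (vadd F x y)) b'
    = lincomb G k (%i. vcoord F k b x i + vcoord F k b y i) b'"
   by (rule lincomb_cong) (simp_all add: vcoord_add[OF F b x y])
  thus "h (vadd F x y) = vadd G (h x) (h y)"
   unfolding h_def by (simp add: lincomb_add[OF G vs_basis_mem[OF b']])
 qed
 have hl: "h (lincomb F k c b) = lincomb G k c b'" for c
  unfolding h_def by (rule lincomb_cong) (simp_all add: vcoord_unique[OF F b refl])
 have inj: "inj_on h (vcarrier F)"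
 proof
  fix x y assume x: "x \<in> vcarrier F" and y: "y \<in> vcarrier F" and eq: "h x = h y"
  have "vcoord F k b x i = vcoord F k b y i" if "i < k" for i
   using vcoord_unique[OF G b' _ that, of "h x" "vcoord F k b x"]
    vcoord_unique[OF G b' _ that, of "h x" "vcoord F k b y"] eq unfolding h_def by metis
  hence "lincomb F k (vcoord F k b x) b = lincomb F k (vcoord F k b y) b"
   by (intro lincomb_cong) auto
  thus "x = y" using vcoord_lincomb[OF b x] vcoord_lincomb[OF b y] by metis
 qed
 have "vcarrier G \<subseteq> h ` vcarrier F"
 proof
  fix y assume "y \<in> vcarrier G"
  from vcoord_lincomb[OF b' this] have "y = h (lincomb F k (vcoord G k b' y) b)"
   by (simp add: hl)
  thus "y \<in> h ` vcarrier F"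
   by (rule image_eqI) (rule lincomb_closed[OF F vs_basis_mem[OF b]])
 qed
 hence "h ` vcarrier F = vcarrier G" using vlinearD(1)[OF h] by auto
 from vs_basis_image[OF F G s h inj this] show ?thesis unfolding h_def .
qed

text \<open>Lines are spaces of rank \<open>1\<close> and line bundles are bundles of rank
  \<open>1\<close>; the literal must not be rewritten to \<open>Suc 0\<close>, or the rules about
  them would no longer match.\<close>

declare One_nat_def [simp del]

section \<open>Multilinear forms\<close>

lemma vs_tuples_iff: "t \<in> vs_tuples k F \<longleftrightarrow> (\<forall>i<k. t i \<in> vcarrier F) \<and> t \<in> extensional {..<k}"
 by (auto simp: vs_tuples_def PiE_iff)

lemma vs_tuples_upd [intro]:
 "t \<in> vs_tuples k F ==> i < k ==> x \<in> vcarrier F ==> t(i := x) \<in> vs_tuples k F"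
 by (auto simp: vs_tuples_iff extensional_def)

lemma restrict_vs_tuples: "(\<And>i. i < k ==> t i \<in> vcarrier F) ==> restrict t {..<k} \<in> vs_tuples k F"
 by (auto simp: vs_tuples_iff)

lemma mult_forms_iff:
 "w \<in> vcarrier (mult_forms k F) \<longleftrightarrow> w \<in> extensional (vs_tuples k F) \<and>
   (\<forall>t\<in>vs_tuples k F. \<forall>i<k. \<forall>x\<in>vcarrier F.
    (\<forall>y\<in>vcarrier F. w (t(i := vadd F x y)) = w (t(i := x)) + w (t(i := y))) \<and>
    (\<forall>c. w (t(i := vscale F c x)) = c * w (t(i := x))))"
 by (simp add: mult_forms_def)

lemma mult_formsD:
 assumes "w \<in> vcarrier (mult_forms k F)" "t \<in> vs_tuples k F" "i < k" "x \<in> vcarrier F"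
 shows "y \<in> vcarrier F ==> w (t(i := vadd F x y)) = w (t(i := x)) + w (t(i := y))"
  and "w (t(i := vscale F c x)) = c * w (t(i := x))"
 using assms unfolding mult_forms_iff by blast+

lemma alt_forms_iff:
 "w \<in> vcarrier (alt_forms k F) \<longleftrightarrow> w \<in> vcarrier (mult_forms k F) \<and>
   (\<forall>t\<in>vs_tuples k F. \<forall>i<k. \<forall>j<k. i \<noteq> j \<and> t i = t j \<longrightarrow> w t = 0)"
 by (simp add: alt_forms_def)

lemma form_ops [simp]:
 "vadd (mult_forms k F) = (%g h. \<lambda>x\<in>vs_tuples k F. g x + h x)"
 "vzero (mult_forms k F) = (\<lambda>x\<in>vs_tuples k F. 0)"
 "vscale (mult_forms k F) = (%c g. \<lambda>x\<in>vs_tuples k F. c * g x)"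
 "vadd (alt_forms k F) = (%g h. \<lambda>x\<in>vs_tuples k F. g x + h x)"
 "vzero (alt_forms k F) = (\<lambda>x\<in>vs_tuples k F. 0)"
 "vscale (alt_forms k F) = (%c g. \<lambda>x\<in>vs_tuples k F. c * g x)"
 "vadd (bilin_forms A B) = (%g h. \<lambda>x\<in>vcarrier A \<times> vcarrier B. g x + h x)"
 "vzero (bilin_forms A B) = (\<lambda>x\<in>vcarrier A \<times> vcarrier B. 0)"
 "vscale (bilin_forms A B) = (%c g. \<lambda>x\<in>vcarrier A \<times> vcarrier B. c * g x)"
 by (simp_all add: mult_forms_def alt_forms_def bilin_forms_def)

lemma PiE_UNIV_extensional: "D \<rightarrow>\<^sub>E UNIV = extensional D"
 by (simp add: PiE_def)

lemma real_vs_mult_forms: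
 assumes F: "real_vs F"
 shows "real_vs (mult_forms k F)"
 unfolding mult_forms_def
proof (rule real_vs_fun_space, goal_cases)
 case 2
 show ?case by (auto simp add: PiE_UNIV_extensional)
qed (auto simp: real_vsD[OF F] vs_tuples_upd algebra_simps simp del: fun_upd_apply)

lemma real_vs_alt_forms:
 assumes F: "real_vs F"
 shows "real_vs (alt_forms k F)"
proof -
 note M = real_vs_mult_forms[OF F, of k]
 show ?thesis
  unfolding alt_forms_def
 proof (rule real_vs_fun_space, goal_cases)
  case 2
  show ?case by (auto simp add: PiE_UNIV_extensional mult_forms_iff)
 next
  case 3
  thus ?case using real_vsD(1)[OF M] by auto
 next
  case (4 g h)
  thus ?case using real_vsD(2)[OF M, of g h] by auto
 next
  case (5 c g)
  thus ?case using real_vsD(6)[OF M, of g c] by auto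
 qed simp
qed

lemma real_vs_top_forms: "real_vs F ==> real_vs (top_forms F)"
 unfolding top_forms_def by (rule real_vs_alt_forms)

lemma mult_form_lincomb:
 assumes F: "real_vs F" and w: "w \<in> vcarrier (mult_forms n F)" and t: "t \<in> vs_tuples n F" and j: "j < n"
  and "\<And>i. i < k ==> b i \<in> vcarrier F"
 shows "w (t(j := lincomb F k c b)) = (\<Sum>s<k. c s * w (t(j := b s)))"
 using assms(5)
proof (induction k)
 case 0
 have "w (t(j := vscale F 0 (vzero F))) = 0"
  using mult_formsD(2)[OF w t j real_vsD(1)[OF F], of 0] by simp
 thus ?case by (simp only: vscale_vzero[OF F] lincomb.simps lessThan_0 sum.empty)
next
 case (Suc k)
 have "lincomb F k c b \<in> vcarrier F" "b k \<in> vcarrier F"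
  using Suc.prems by (auto intro: lincomb_closed[OF F])
 thus ?case
  using Suc by (simp add: mult_formsD[OF w t j] real_vsD[OF F] del: fun_upd_apply)
qed

text \<open>Expansion in one slot at a time: the first \<open>j\<close> slots are arbitrary, the others are basis
 vectors.\<close>

lemma mult_form_eq_on_tuples:
 assumes F: "real_vs F" and b: "vs_basis F k b"
  and w: "w \<in> vcarrier (mult_forms n F)" and w': "w' \<in> vcarrier (mult_forms n F)"
  and eq: "\<And>\<sigma>. (\<And>i. i < n ==> \<sigma> i < k) ==> w (\<lambda>i\<in>{..<n}. b (\<sigma> i)) = w' (\<lambda>i\<in>{..<n}. b (\<sigma> i))"
  and t: "t \<in> vs_tuples n F"
 shows "w t = w' t"
proof -
 have "t \<in> vs_tuples n F ==> (\<And>i. j \<le> i ==> i < n ==> \<exists>s<k. t i = b s) ==> w t = w' t" for j t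
 proof (induction j arbitrary: t)
  case 0
  then obtain \<sigma> where \<sigma>: "\<And>i. i < n ==> \<sigma> i < k \<and> t i = b (\<sigma> i)" by (metis zero_le)
  have "t = (\<lambda>i\<in>{..<n}. b (\<sigma> i))"
   using 0(1) \<sigma> by (auto simp: vs_tuples_iff extensional_def fun_eq_iff)
  moreover have "w (\<lambda>i\<in>{..<n}. b (\<sigma> i)) = w' (\<lambda>i\<in>{..<n}. b (\<sigma> i))" by (rule eq) (use \<sigma> in blast)
  ultimately show ?case by metis
 next
  case (Suc j)
  show ?case
  proof (cases "j < n")
   case False
   thus ?thesis using Suc by auto
  next
   case True
   let ?c = "vcoord F k b (t j)"
   have tj: "t j \<in> vcarrier F" using Suc.prems(1) True by (simp add: vs_tuples_iff)
   have te: "t(j := lincomb F k ?c b) = t" by (simp add: vcoord_lincomb[OF b tj, symmetric])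
   have "w (t(j := b s)) = w' (t(j := b s))" if "s < k" for s
   proof (rule Suc.IH)
    show "t(j := b s) \<in> vs_tuples n F"
     using Suc.prems(1) True vs_basis_mem[OF b that] by blast
    show "\<exists>s'<k. (t(j := b s)) i = b s'" if "j \<le> i" "i < n" for i
     using Suc.prems(2)[of i] that \<open>s < k\<close> by (cases "i = j") auto
   qed
   hence "w (t(j := lincomb F k ?c b)) = w' (t(j := lincomb F k ?c b))"
    by (simp add: mult_form_lincomb[OF F w Suc.prems(1) True vs_basis_mem[OF b]]
      mult_form_lincomb[OF F w' Suc.prems(1) True vs_basis_mem[OF b]])
   thus ?thesis using te by simp
  qed
 qed
 from this[of t n] t show ?thesis by auto
qed

text \<open>Polarization: the form vanishes when the sum of the two entries is put into both slots,
  and of the four terms of the expansion the two with equal entries vanish as well.\<close>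

lemma alt_form_swap:
 assumes F: "real_vs F" and w: "w \<in> vcarrier (alt_forms n F)" and t: "t \<in> vs_tuples n F"
  and i: "i < n" and j: "j < n" and ij: "i \<noteq> j"
 shows "w (t(i := t j, j := t i)) = - w t"
proof -
 note wm = w[unfolded alt_forms_iff, THEN conjunct1]
 have wa: "w s = 0" if "s \<in> vs_tuples n F" "s i = s j" for s
  using w i j ij that unfolding alt_forms_iff by blast
 have m: "t i \<in> vcarrier F" "t j \<in> vcarrier F" using t i j by (auto simp: vs_tuples_iff)
 let ?s = "vadd F (t i) (t j)"
 have s: "?s \<in> vcarrier F" using m by (simp add: real_vsD[OF F])
 have "w (t(i := ?s, j := ?s)) = 0"
  by (rule wa) (use t i j s in \<open>auto intro!: vs_tuples_upd\<close>)
 moreover have "w (t(i := ?s, j := ?s)) = w (t(i := ?s, j := t i)) + w (t(i := ?s, j := t j))"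
  by (rule mult_formsD(1)[OF wm _ j]) (use t i s m in auto)
 moreover have "w (t(i := ?s, j := z)) = w (t(i := t i, j := z)) + w (t(i := t j, j := z))"
  if "z \<in> vcarrier F" for z
  using mult_formsD(1)[OF wm vs_tuples_upd[OF t j that] i m] by (simp only: fun_upd_twist[OF ij])
 moreover have "w (t(i := t i, j := t i)) = 0" "w (t(i := t j, j := t j)) = 0"
  by (rule wa; use t i j m in auto)+
 moreover have "t(i := t i, j := t j) = t" by auto
 ultimately show ?thesis using m by (simp add: fun_upd_triv)
qed

text \<open>On a tuple of basis vectors an alternating form vanishes if an index repeats; otherwise
  pigeonhole forces \<open>k = n\<close>, the indices form a permutation, and transpositions reduce
  to the basis itself. For \<open>k < n\<close> no tuple of the second kind exists, so any two forms
  agree; this case yields the invariance of dimension.\<close>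

lemma alt_form_eqI:
 assumes F: "real_vs F" and b: "vs_basis F k b"
  and w: "w \<in> vcarrier (alt_forms n F)" and w': "w' \<in> vcarrier (alt_forms n F)"
  and eq: "k = n ==> w (restrict b {..<n}) = w' (restrict b {..<n})" and "k \<le> n"
 shows "w = w'"
proof (rule extensionalityI[of _ "vs_tuples n F"])
 note wm = w[unfolded alt_forms_iff, THEN conjunct1] and wm' = w'[unfolded alt_forms_iff, THEN conjunct1]
 show "w \<in> extensional (vs_tuples n F)" "w' \<in> extensional (vs_tuples n F)"
  using wm wm' by (auto simp: mult_forms_iff)
 fix t assume t: "t \<in> vs_tuples n F"
 show "w t = w' t"
 proof (rule mult_form_eq_on_tuples[OF F b wm wm' _ t])
  fix \<sigma> :: "nat \<Rightarrow> nat" assume \<sigma>: "\<And>i. i < n ==> \<sigma> i < k"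
  have tup: "(\<lambda>i\<in>{..<n}. b (\<tau> i)) \<in> vs_tuples n F" if "\<And>i. i < n ==> \<tau> i < k" for \<tau>
   using that vs_basis_mem[OF b] by (intro restrict_vs_tuples) auto
  show "w (\<lambda>i\<in>{..<n}. b (\<sigma> i)) = w' (\<lambda>i\<in>{..<n}. b (\<sigma> i))"
  proof (cases "inj_on \<sigma> {..<n}")
   case False
   then obtain i j where "i < n" "j < n" "i \<noteq> j" "\<sigma> i = \<sigma> j" by (auto simp: inj_on_def)
   hence "v (\<lambda>i\<in>{..<n}. b (\<sigma> i)) = 0" if "v \<in> vcarrier (alt_forms n F)" for v
    using that tup[OF \<sigma>] unfolding alt_forms_iff by fastforce
   from this[OF w] this[OF w'] show ?thesis by simp
  next
   case True
   have "card (\<sigma> ` {..<n}) \<le> card {..<k}"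
    using \<sigma> by (intro card_mono) auto
   hence kn: "k = n" using card_image[OF True] \<open>k \<le> n\<close> by simp
   \<comment> \<open>Completed by the identity above \<open>n\<close>, since \<open>permutes\<close>
     speaks of functions on all numbers.\<close>
   define p where "p i = (if i < n then \<sigma> i else i)" for i
   have "p permutes {..<n}"
   proof (rule bij_imp_permutes)
    have "inj_on p {..<n}" using True by (simp add: inj_on_def p_def)
    moreover have "p ` {..<n} \<subseteq> {..<n}" using \<sigma> kn by (auto simp: p_def)
    ultimately show "bij_betw p {..<n} {..<n}"
     by (simp add: bij_betw_def endo_inj_surj)
   qed (simp add: p_def)
   with finite_lessThan have "w (\<lambda>i\<in>{..<n}. b (p i)) = w' (\<lambda>i\<in>{..<n}. b (p i))"
   proof (induction rule: permutes_rev_induct)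
    case id
    thus ?case using eq[OF kn] by (simp only: id_apply)
   next
    case (swap i j p)
    let ?t = "\<lambda>i\<in>{..<n}. b (p i)"
    have t: "?t \<in> vs_tuples n F"
     using swap permutes_in_image[OF swap(4)] kn by (intro tup) auto
    have ij: "i < n" "j < n" "i \<noteq> j" using swap by auto
    have e: "(\<lambda>l\<in>{..<n}. b ((p \<circ> Transposition.transpose i j) l)) = ?t(i := ?t j, j := ?t i)"
     using ij by (auto simp: fun_eq_iff Transposition.transpose_def)
    show ?case
     unfolding e alt_form_swap[OF F w t ij] alt_form_swap[OF F w' t ij] by (simp only: swap.IH)
   qed
   moreover have "(\<lambda>i\<in>{..<n}. b (p i)) = (\<lambda>i\<in>{..<n}. b (\<sigma> i))" by (auto simp: p_def)
   ultimately show ?thesis by simp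
  qed
 qed
qed

subsection \<open>The determinant form of a basis\<close>

text \<open>The alternating form with value 1 on \<open>b\<close>, hence the generator dual to the
  wedge of \<open>b\<close>. Changes of basis, orientations and Cramer's rule are all expressed
  through its values.\<close>

definition dform :: "'e rvs \<Rightarrow> nat \<Rightarrow> (nat \<Rightarrow> 'e) \<Rightarrow> (nat \<Rightarrow> 'e) \<Rightarrow> real" where
 "dform F k b t = ddet k (%i. vcoord F k b (t i))"

lemma dform_cong: "(\<And>i. i < k ==> t i = t' i) ==> dform F k b t = dform F k b t'"
 unfolding dform_def by (rule ddet_cong) simp

lemma dform_basis:
 assumes "real_vs F" "vs_basis F k b"
 shows "dform F k b b = 1"
proof -
 have "dform F k b b = ddet k (%i j. if i = j then 1 else 0)"
  unfolding dform_def by (rule ddet_cong) (auto simp: vcoord_basis[OF assms])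
 thus ?thesis by (simp add: ddet_one)
qed

text \<open>Row operations on the coordinate matrix. The factor \<open>a\<close> lets one statement
  cover the zero form, used for the dimension, and an arbitrary multiple, used for the
  classification of top forms.\<close>

lemma dform_alt:
 assumes F: "real_vs F" and b: "vs_basis F k b"
 shows "(\<lambda>t\<in>vs_tuples k F. a * dform F k b t) \<in> vcarrier (alt_forms k F)"
proof -
 have upd: "dform F k b (t(i := x)) = ddet k ((%l. vcoord F k b (t l))(i := vcoord F k b x))" for t i x
  unfolding dform_def by (rule ddet_cong) simp
 have add: "dform F k b (t(i := vadd F x y)) = dform F k b (t(i := x)) + dform F k b (t(i := y))"
  if "i < k" "x \<in> vcarrier F" "y \<in> vcarrier F" for t i x y
 proof -
  have "dform F k b (t(i := vadd F x y))
    = ddet k ((%l. vcoord F k b (t l))(i := (%j. 1 * vcoord F k b x j + 1 * vcoord F k b y j)))"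
   unfolding upd by (rule ddet_cong) (simp add: vcoord_add[OF F b] that)
  also have "\<dots> = 1 * dform F k b (t(i := x)) + 1 * dform F k b (t(i := y))"
   unfolding upd by (rule ddet_row_linear[OF that(1)])
  finally show ?thesis by simp
 qed
 have scale: "dform F k b (t(i := vscale F c x)) = c * dform F k b (t(i := x))"
  if "i < k" "x \<in> vcarrier F" for t i x c
 proof -
  have "dform F k b (t(i := vscale F c x))
    = ddet k ((%l. vcoord F k b (t l))(i := (%j. c * vcoord F k b x j + 0 * vcoord F k b x j)))"
   unfolding upd by (rule ddet_cong) (simp add: vcoord_scale[OF F b] that)
  also have "\<dots> = c * dform F k b (t(i := x)) + 0 * dform F k b (t(i := x))"
   unfolding upd by (rule ddet_row_linear[OF that(1)])
  finally show ?thesis by simp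
 qed
 have alt: "dform F k b t = 0" if "i < k" "j < k" "i \<noteq> j" "t i = t j" for t i j
  unfolding dform_def using that by (intro ddet_rows_eq[of i k j]) auto
 show ?thesis
  unfolding alt_forms_iff mult_forms_iff
  using add scale alt real_vsD[OF F] by (auto simp: vs_tuples_upd algebra_simps simp del: fun_upd_apply)
qed

text \<open>If some basis were shorter than \<open>b\<close>, every alternating
  \<open>k\<close>-form would be zero, in particular \<open>dform F k b\<close>, whose value on
  \<open>b\<close> is 1.\<close>

lemma vs_dim_eq:
 assumes F: "real_vs F" and b: "vs_basis F k b"
 shows "vs_dim F = k"
proof -
 obtain b' where b': "vs_basis F (vs_dim F) b'"
  using LeastI[of "%k. \<exists>b. vs_basis F k b" k] b unfolding vs_dim_def by blast
 have le: "vs_dim F \<le> k" unfolding vs_dim_def using b by (intro Least_le) blast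
 have "\<not> vs_dim F < k"
 proof
  assume "vs_dim F < k"
  hence "(\<lambda>t\<in>vs_tuples k F. 1 * dform F k b t) = (\<lambda>t\<in>vs_tuples k F. 0 * dform F k b t)"
   by (intro alt_form_eqI[OF F b' dform_alt[OF F b] dform_alt[OF F b]]) auto
  moreover have "restrict b {..<k} \<in> vs_tuples k F"
   by (rule restrict_vs_tuples) (rule vs_basis_mem[OF b])
  ultimately have "dform F k b (restrict b {..<k}) = 0"
   by (metis (no_types, lifting) mult_1 mult_zero_left restrict_apply')
  moreover have "dform F k b (restrict b {..<k}) = dform F k b b" by (rule dform_cong) simp
  ultimately show False using dform_basis[OF F b] by simp
 qed
 with le show ?thesis by simp
qed

lemma dform_top_form:
 assumes F: "real_vs F" and b: "vs_basis F k b"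
 shows "(\<lambda>t\<in>vs_tuples k F. a * dform F k b t) \<in> vcarrier (top_forms F)"
 unfolding top_forms_def vs_dim_eq[OF F b] by (rule dform_alt[OF F b])

lemma top_form_eq:
 assumes F: "real_vs F" and b: "vs_basis F k b" and w: "w \<in> vcarrier (top_forms F)"
 shows "w = (\<lambda>t\<in>vs_tuples k F. w (restrict b {..<k}) * dform F k b t)"
proof (rule alt_form_eqI[OF F b _ dform_alt[OF F b]])
 show "w \<in> vcarrier (alt_forms k F)" using w by (simp add: top_forms_def vs_dim_eq[OF F b])
 have "restrict b {..<k} \<in> vs_tuples k F"
  by (rule restrict_vs_tuples) (rule vs_basis_mem[OF b])
 moreover have "dform F k b (restrict b {..<k}) = dform F k b b" by (rule dform_cong) simp
 ultimately show "w (restrict b {..<k}) =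
   (\<lambda>t\<in>vs_tuples k F. w (restrict b {..<k}) * dform F k b t) (restrict b {..<k})"
  using dform_basis[OF F b] by simp
qed simp

lemma top_form_apply:
 assumes F: "real_vs F" and b: "vs_basis F k b" and w: "w \<in> vcarrier (top_forms F)"
  and t: "\<And>i. i < k ==> t i \<in> vcarrier F"
 shows "w (restrict t {..<k}) = w (restrict b {..<k}) * dform F k b t"
proof -
 have "w (restrict t {..<k}) = w (restrict b {..<k}) * dform F k b (restrict t {..<k})"
  by (subst top_form_eq[OF F b w]) (simp add: restrict_vs_tuples t)
 also have "dform F k b (restrict t {..<k}) = dform F k b t" by (rule dform_cong) simp
 finally show ?thesis .
qed

text \<open>Multiplicativity of determinants without a matrix product: as a function of
  \<open>t\<close> the left side is a top form, hence its value on \<open>s\<close> times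
  \<open>dform F k s\<close>.\<close>

lemma dform_chain:
 assumes F: "real_vs F" and b: "vs_basis F k b" and s: "vs_basis F k s"
  and t: "\<And>i. i < k ==> t i \<in> vcarrier F"
 shows "dform F k b t = dform F k b s * dform F k s t"
proof -
 have r: "restrict u {..<k} \<in> vs_tuples k F" if "\<And>i. i < k ==> u i \<in> vcarrier F" for u
  using that by (rule restrict_vs_tuples)
 have c: "dform F k b (restrict u {..<k}) = dform F k b u" for u by (rule dform_cong) simp
 show ?thesis
  using top_form_apply[OF F s dform_top_form[OF F b, of 1] t] r[OF t] r[OF vs_basis_mem[OF s]] c
  by simp
qed

lemma dform_nonzero:
 assumes F: "real_vs F" and b: "vs_basis F k b" and s: "vs_basis F k s"
 shows "dform F k b s \<noteq> 0"
 using dform_chain[OF F s b vs_basis_mem[OF s]] dform_basis[OF F s] by auto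

text \<open>Top forms are multiples of \<open>dform F k t\<close>, so the form required by the
  definition may be taken to be \<open>dform F k t\<close> itself.\<close>

lemma same_orientation_iff:
 assumes F: "real_vs F" and s: "vs_basis F k s" and t: "vs_basis F k t"
 shows "same_orientation F s t \<longleftrightarrow> dform F k t s > 0"
proof
 assume "same_orientation F s t"
 then obtain w where w: "w \<in> vcarrier (top_forms F)" "w (restrict s {..<k}) > 0" "w (restrict t {..<k}) > 0"
  unfolding same_orientation_def vs_dim_eq[OF F s] by blast
 with top_form_apply[OF F t w(1) vs_basis_mem[OF s]] show "dform F k t s > 0"
  by (simp add: zero_less_mult_iff)
next
 assume d: "dform F k t s > 0"
 let ?w = "\<lambda>u\<in>vs_tuples k F. 1 * dform F k t u"
 have e: "?w (restrict u {..<k}) = dform F k t u" if "\<And>i. i < k ==> u i \<in> vcarrier F" for u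
 proof -
  have "dform F k t (restrict u {..<k}) = dform F k t u" by (rule dform_cong) simp
  thus ?thesis by (simp add: restrict_vs_tuples that)
 qed
 show "same_orientation F s t"
  unfolding same_orientation_def vs_dim_eq[OF F s]
  by (rule bexI[OF _ dform_top_form[OF F t, of 1]])
    (simp only: e[OF vs_basis_mem[OF s]] e[OF vs_basis_mem[OF t]] d dform_basis[OF F t], simp)
qed

lemma dform_scale_all:
 assumes F: "real_vs F" and b: "vs_basis F k b" and t: "\<And>i. i < k ==> t i \<in> vcarrier F"
 shows "dform F k b (%i. vscale F a (t i)) = a ^ k * dform F k b t"
proof -
 have "dform F k b (%i. vscale F a (t i)) = ddet k (%i j. a * vcoord F k b (t i) j)"
  unfolding dform_def by (rule ddet_cong) (simp add: vcoord_scale[OF F b] t)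
 also have "\<dots> = a ^ k * dform F k b t"
  unfolding dform_def ddet_leibniz by (simp add: prod.distrib sum_distrib_left algebra_simps)
 finally show ?thesis .
qed

section \<open>Lines\<close>

text \<open>A generator of a line is a basis of length 1, given as a constant family, so that facts
  about bases and frames apply to lines and line bundles unchanged.\<close>

abbreviation vline :: "'e rvs \<Rightarrow> 'e \<Rightarrow> bool" where
 "vline F e \<equiv> vs_basis F 1 (%_. e)"

abbreviation lcoef :: "'e rvs \<Rightarrow> 'e \<Rightarrow> 'e \<Rightarrow> real" where
 "lcoef F e x \<equiv> vcoord F 1 (%_. e) x 0"

lemma lincomb_1:
 assumes F: "real_vs F" and "b 0 \<in> vcarrier F"
 shows "lincomb F 1 c b = vscale F (c 0) (b 0)"
 using assms by (simp add: real_vsD One_nat_def)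

lemma vline_mem: "vline F e ==> e \<in> vcarrier F"
 by (simp add: vs_basis_def)

lemma lcoef_scale:
 assumes "real_vs F" "vline F e" "x \<in> vcarrier F"
 shows "x = vscale F (lcoef F e x) e"
 using vcoord_lincomb[OF assms(2,3)] lincomb_1[OF assms(1), of "%_. e"] vline_mem[OF assms(2)]
 by metis

lemma lcoef_unique:
 assumes F: "real_vs F" and e: "vline F e"
 shows "lcoef F e (vscale F a e) = a"
proof (rule vcoord_unique[OF F e, of _ "%_. a"])
 show "vscale F a e = lincomb F 1 (%_. a) (%_. e)"
  using lincomb_1[OF F, of "%_. e" "%_. a"] vline_mem[OF e] by metis
qed simp

lemma vlineI:
 assumes F: "real_vs F" and e: "e \<in> vcarrier F" and "\<And>x. x \<in> vcarrier F ==> \<exists>a. x = vscale F a e"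
  and "\<And>a. vscale F a e = vzero F ==> a = 0"
 shows "vline F e"
proof (rule vs_basisI[OF F])
 have l: "lincomb F 1 c (%_. e) = vscale F (c 0) e" for c
  using lincomb_1[OF F, of "%_. e"] e by blast
 show "\<exists>c. x = lincomb F 1 c (%_. e)" if x: "x \<in> vcarrier F" for x
 proof -
  obtain a where "x = vscale F a e" using assms(3)[OF x] by blast
  thus ?thesis unfolding l by (intro exI[of _ "%_. a"])
 qed
 show "\<forall>i<1. c i = 0" if "lincomb F 1 c (%_. e) = vzero F" for c
  using assms(4) that unfolding l by auto
qed (use e in auto)

lemma vline_scale:
 assumes F: "real_vs F" and e: "vline F e" and "a \<noteq> 0"
 shows "vline F (vscale F a e)"
proof (rule vlineI[OF F])
 have eF: "e \<in> vcarrier F" by (rule vline_mem[OF e])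
 show "vscale F a e \<in> vcarrier F" by (simp add: real_vsD[OF F] eF)
 show "\<exists>c. x = vscale F c (vscale F a e)" if "x \<in> vcarrier F" for x
  using lcoef_scale[OF F e that] real_vsD(9)[OF F eF, of "lcoef F e x / a" a] \<open>a \<noteq> 0\<close>
  by (intro exI[of _ "lcoef F e x / a"]) simp
 show "c = 0" if "vscale F c (vscale F a e) = vzero F" for c
 proof -
  have "vscale F (c * a) e = vscale F 0 e"
   using that real_vsD(9)[OF F eF, of c a] by (simp add: vscale_zero[OF F eF])
  hence "c * a = 0" using lcoef_unique[OF F e] by metis
  with \<open>a \<noteq> 0\<close> show ?thesis by simp
 qed
qed

lemma vline_nonzero_coef:
 assumes F: "real_vs F" and e: "vline F e" and x: "vline F x"
 shows "lcoef F e x \<noteq> 0"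
proof
 assume "lcoef F e x = 0"
 hence "x = vzero F" using lcoef_scale[OF F e vline_mem[OF x]] vscale_zero[OF F vline_mem[OF e]] by simp
 hence "vscale F 1 x = vscale F 0 x" using vscale_vzero[OF F] by simp
 thus False using lcoef_unique[OF F x] by (metis zero_neq_one)
qed

text \<open>A functional on a line is determined by its value at a generator, so one with nonzero
  value there generates the dual. Since determinants, tensor powers and tensor products are duals of
  spaces of forms, this also gives their generators.\<close>

lemma vline_dual:
 assumes A: "real_vs A" and e: "vline A e" and p: "p \<in> vcarrier (vs_dual A)" and pe: "p e \<noteq> 0"
 shows "vline (vs_dual A) p"
proof (rule vlineI[OF real_vs_dual[OF A] p])
 fix q assume q: "q \<in> vcarrier (vs_dual A)"
 have "q = vscale (vs_dual A) (q e / p e) p"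
 proof (rule extensionalityI[of _ "vcarrier A"])
  fix x assume x: "x \<in> vcarrier A"
  have "r x = lcoef A e x * r e" if "r \<in> vcarrier (vs_dual A)" for r
   using that vline_mem[OF e] lcoef_scale[OF A e x] unfolding vs_dual_iff by metis
  from this[OF p] this[OF q] show "q x = vscale (vs_dual A) (q e / p e) p x" using x pe by simp
 qed (use q in \<open>auto simp: vs_dual_iff\<close>)
 thus "\<exists>a. q = vscale (vs_dual A) a p" by blast
next
 fix a assume "vscale (vs_dual A) a p = vzero (vs_dual A)"
 hence "(\<lambda>x\<in>vcarrier A. a * p x) e = (\<lambda>x\<in>vcarrier A. 0) e" by simp
 thus "a = 0" using pe vline_mem[OF e] by simp
qed

definition lmap :: "'a rvs \<Rightarrow> 'b rvs \<Rightarrow> 'a \<Rightarrow> 'b \<Rightarrow> 'a \<Rightarrow> 'b" where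
 "lmap A B e y = (\<lambda>x\<in>vcarrier A. vscale B (lcoef A e x) y)"

lemma lmap_hom:
 assumes A: "real_vs A" and B: "real_vs B" and e: "vline A e" and y: "y \<in> vcarrier B"
 shows "lmap A B e y \<in> vcarrier (vs_hom A B)"
 unfolding lmap_def
 by (rule restrict_vs_hom[OF A])
   (simp add: vlinear_def real_vsD[OF B] y vcoord_add[OF A e] vcoord_scale[OF A e])

lemma lmap_apply:
 assumes A: "real_vs A" and B: "real_vs B" and e: "vline A e" and y: "y \<in> vcarrier B"
 shows "lmap A B e y e = y"
 using lcoef_unique[OF A e, of 1] vline_mem[OF e] real_vsD(10)[OF A vline_mem[OF e]] real_vsD(10)[OF B y]
 by (simp add: lmap_def)

lemma line_hom_apply:
 assumes A: "real_vs A" and e: "vline A e" and h: "h \<in> vcarrier (vs_hom A B)" and x: "x \<in> vcarrier A"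
 shows "h x = vscale B (lcoef A e x) (h e)"
 using lcoef_scale[OF A e x] vline_mem[OF e] h unfolding vs_hom_iff vlinear_def by metis

lemma line_hom_eqI:
 assumes A: "real_vs A" and e: "vline A e"
  and h: "h \<in> vcarrier (vs_hom A B)" and h': "h' \<in> vcarrier (vs_hom A B)" and "h e = h' e"
 shows "h = h'"
proof (rule extensionalityI[of _ "vcarrier A"])
 fix x assume "x \<in> vcarrier A"
 thus "h x = h' x"
  using line_hom_apply[OF A e h] line_hom_apply[OF A e h'] \<open>h e = h' e\<close> by simp
qed (use h h' in \<open>auto simp: vs_hom_iff\<close>)

lemma line_hom_iso:
 assumes A: "real_vs A" and B: "real_vs B" and e: "vline A e"
  and h: "h \<in> vcarrier (vs_hom A B)" and he: "vline B (h e)"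
 shows "h \<in> vs_isos A B"
proof -
 have ha: "h (vscale A c e) = vscale B c (h e)" for c
  using h vline_mem[OF e] unfolding vs_hom_iff vlinear_def by blast
 have "inj_on h (vcarrier A)"
 proof
  fix x y assume x: "x \<in> vcarrier A" and y: "y \<in> vcarrier A" and "h x = h y"
  hence "lcoef A e x = lcoef A e y"
   using lcoef_scale[OF A e] ha lcoef_unique[OF B he] by metis
  thus "x = y" using lcoef_scale[OF A e] x y by metis
 qed
 moreover have "h ` vcarrier A = vcarrier B"
 proof
  show "h ` vcarrier A \<subseteq> vcarrier B" using h by (auto simp: vs_hom_iff vlinear_def)
  show "vcarrier B \<subseteq> h ` vcarrier A"
  proof
   fix y assume "y \<in> vcarrier B"
   from lcoef_scale[OF B he this] have "y = h (vscale A (lcoef B (h e) y) e)" using ha by simp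
   moreover have "vscale A (lcoef B (h e) y) e \<in> vcarrier A"
    using real_vsD(6)[OF A vline_mem[OF e]] .
   ultimately show "y \<in> h ` vcarrier A" by (rule image_eqI)
  qed
 qed
 ultimately show ?thesis using h by (simp add: vs_isos_def bij_betw_def)
qed

lemma vs_iso_line:
 assumes A: "real_vs A" and B: "real_vs B" and e: "vline A e" and h: "h \<in> vs_isos A B"
 shows "vline B (h e)"
 using vs_basis_image[OF A B e, of h] h by (auto simp: vs_isos_def vs_hom_iff bij_betw_def)

lemma lmap_iso:
 assumes A: "real_vs A" and B: "real_vs B" and e: "vline A e" and y: "vline B y"
 shows "lmap A B e y \<in> vs_isos A B"
 using line_hom_iso[OF A B e lmap_hom[OF A B e vline_mem[OF y]]] lmap_apply[OF A B e vline_mem[OF y]] y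
 by simp

section \<open>Tensor powers, tensor products and determinants of lines\<close>

text \<open>The constant tuple \<open>e\<close> is turned into \<open>t\<close> slot by slot from
  the left; each slot releases one coefficient.\<close>

lemma mult_form_line:
 assumes L: "real_vs L" and e: "vline L e" and w: "w \<in> vcarrier (mult_forms n L)"
  and t: "\<And>i. i < n ==> t i \<in> vcarrier L"
 shows "w (restrict t {..<n}) = (\<Prod>i<n. lcoef L e (t i)) * w (\<lambda>i\<in>{..<n}. e)"
proof -
 have "j \<le> n ==> w (\<lambda>i\<in>{..<n}. if i < j then t i else e)
   = (\<Prod>i<j. lcoef L e (t i)) * w (\<lambda>i\<in>{..<n}. e)" for j
 proof (induction j)
  case 0
  thus ?case by (simp only: not_less_zero if_False lessThan_0 prod.empty mult_1)
 next
  case (Suc j)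
  let ?t = "\<lambda>i\<in>{..<n}. if i < j then t i else e"
  have tup: "?t \<in> vs_tuples n L"
   using t vline_mem[OF e] by (intro restrict_vs_tuples) auto
  have "(\<lambda>i\<in>{..<n}. if i < Suc j then t i else e) = ?t(j := t j)"
   using Suc.prems by (auto simp: fun_eq_iff less_Suc_eq)
  also have "\<dots> = ?t(j := vscale L (lcoef L e (t j)) e)"
   using lcoef_scale[OF L e t[of j]] Suc.prems by simp
  finally have "w (\<lambda>i\<in>{..<n}. if i < Suc j then t i else e) = lcoef L e (t j) * w (?t(j := e))"
   using mult_formsD(2)[OF w tup _ vline_mem[OF e]] Suc.prems by simp
  also have "?t(j := e) = ?t" using Suc.prems by (auto simp: fun_eq_iff)
  finally show ?case using Suc by simp
 qed
 from this[of n] have "w (\<lambda>i\<in>{..<n}. if i < n then t i else e)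
   = (\<Prod>i<n. lcoef L e (t i)) * w (\<lambda>i\<in>{..<n}. e)" by simp
 moreover have "(\<lambda>i\<in>{..<n}. if i < n then t i else e) = restrict t {..<n}" by auto
 ultimately show ?thesis by simp
qed

text \<open>The \<open>n\<close>-th power of the coordinate with respect to \<open>e\<close>; it
  takes the value 1 on the constant tuple \<open>e\<close> and is dual to the tensor power of
  \<open>e\<close>.\<close>

definition mform :: "nat \<Rightarrow> 'e rvs \<Rightarrow> 'e \<Rightarrow> (nat \<Rightarrow> 'e) \<Rightarrow> real" where
 "mform n L e = (\<lambda>t\<in>vs_tuples n L. \<Prod>i<n. lcoef L e (t i))"

lemma mform_mem:
 assumes L: "real_vs L" and e: "vline L e"
 shows "mform n L e \<in> vcarrier (mult_forms n L)"
proof -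
 have split: "(\<Prod>l<n. lcoef L e ((t(i := x)) l)) = lcoef L e x * (\<Prod>l\<in>{..<n} - {i}. lcoef L e (t l))"
  if "i < n" for t i x
 proof -
  have "(\<Prod>l<n. lcoef L e ((t(i := x)) l))
    = lcoef L e ((t(i := x)) i) * (\<Prod>l\<in>{..<n} - {i}. lcoef L e ((t(i := x)) l))"
   using that by (intro prod.remove) auto
  also have "(\<Prod>l\<in>{..<n} - {i}. lcoef L e ((t(i := x)) l)) = (\<Prod>l\<in>{..<n} - {i}. lcoef L e (t l))"
   by (intro prod.cong) auto
  finally show ?thesis by simp
 qed
 show ?thesis
  unfolding mult_forms_iff mform_def
  by (auto simp: vs_tuples_upd real_vsD[OF L] split vcoord_add[OF L e] vcoord_scale[OF L e]
    algebra_simps simp del: fun_upd_apply)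
qed

lemma const_tuple: "e \<in> vcarrier L ==> (\<lambda>i\<in>{..<n}. e) \<in> vs_tuples n L"
 by (rule restrict_vs_tuples)

lemma lcoef_self:
 assumes "real_vs L" "vline L e"
 shows "lcoef L e e = 1"
 using lcoef_unique[OF assms, of 1] real_vsD(10)[OF assms(1) vline_mem[OF assms(2)]] by simp

lemma mform_self:
 assumes "real_vs L" "vline L e"
 shows "mform n L e (\<lambda>i\<in>{..<n}. e) = 1"
 using const_tuple[OF vline_mem[OF assms(2)], of n] lcoef_self[OF assms] by (simp add: mform_def)

lemma vline_mult_forms:
 assumes L: "real_vs L" and e: "vline L e"
 shows "vline (mult_forms n L) (mform n L e)"
proof (rule vlineI[OF real_vs_mult_forms[OF L] mform_mem[OF L e]])
 fix w assume w: "w \<in> vcarrier (mult_forms n L)"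
 have "w = vscale (mult_forms n L) (w (\<lambda>i\<in>{..<n}. e)) (mform n L e)"
 proof (rule extensionalityI[of _ "vs_tuples n L"])
  fix t assume t: "t \<in> vs_tuples n L"
  hence "restrict t {..<n} = t" by (auto simp: vs_tuples_iff extensional_restrict)
  thus "w t = vscale (mult_forms n L) (w (\<lambda>i\<in>{..<n}. e)) (mform n L e) t"
   using mult_form_line[OF L e w, of t] t by (simp add: vs_tuples_iff mform_def)
 qed (use w in \<open>auto simp: mult_forms_iff\<close>)
 thus "\<exists>a. w = vscale (mult_forms n L) a (mform n L e)" by blast
next
 fix a assume "vscale (mult_forms n L) a (mform n L e) = vzero (mult_forms n L)"
 hence "vscale (mult_forms n L) a (mform n L e) (\<lambda>i\<in>{..<n}. e) = vzero (mult_forms n L) (\<lambda>i\<in>{..<n}. e)"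
  by simp
 thus "a = 0"
  using mform_self[OF L e, of n] const_tuple[OF vline_mem[OF e], of n] by simp
qed

lemma tprod_mem:
 assumes "\<And>i. i < n ==> t i \<in> vcarrier L" "real_vs L"
 shows "tprod n L t \<in> vcarrier (vs_tpow n L)"
 using restrict_vs_tuples[of n t L] assms real_vsD[OF real_vs_mult_forms[OF assms(2), of n]]
 unfolding tprod_def vs_tpow_def vs_dual_iff by auto

lemma vline_tpow:
 assumes L: "real_vs L" and e: "vline L e"
 shows "vline (vs_tpow n L) (tprod n L (%_. e))"
 unfolding vs_tpow_def
proof (rule vline_dual[OF real_vs_mult_forms[OF L] vline_mult_forms[OF L e]])
 show "tprod n L (%_. e) \<in> vcarrier (vs_dual (mult_forms n L))"
  using tprod_mem[of n "%_. e" L] vline_mem[OF e] L by (simp add: vs_tpow_def)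
 show "tprod n L (%_. e) (mform n L e) \<noteq> 0"
  by (simp add: tprod_def mform_mem[OF L e] mform_self[OF L e])
qed

lemma tprod_scale:
 assumes L: "real_vs L" and e: "vline L e"
 shows "tprod n L (%_. vscale L c e) = vscale (vs_tpow n L) (c ^ n) (tprod n L (%_. e))"
proof (rule extensionalityI[of _ "vcarrier (mult_forms n L)"])
 fix w assume w: "w \<in> vcarrier (mult_forms n L)"
 show "tprod n L (%_. vscale L c e) w = vscale (vs_tpow n L) (c ^ n) (tprod n L (%_. e)) w"
  using mult_form_line[OF L e w, of "%_. vscale L c e"] w
  by (simp add: tprod_def vs_tpow_def lcoef_unique[OF L e] real_vsD(6)[OF L vline_mem[OF e]])
qed (auto simp: tprod_def vs_tpow_def)

lemma real_vs_tpow: "real_vs L ==> real_vs (vs_tpow n L)"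
 unfolding vs_tpow_def by (intro real_vs_dual real_vs_mult_forms)

lemma bilin_forms_iff:
 assumes A: "real_vs A" and B: "real_vs B"
 shows "w \<in> vcarrier (bilin_forms A B) \<longleftrightarrow> w \<in> extensional (vcarrier A \<times> vcarrier B) \<and>
  (\<forall>x\<in>vcarrier A. \<forall>y\<in>vcarrier B.
    (\<forall>x'\<in>vcarrier A. w (vadd A x x', y) = w (x, y) + w (x', y)) \<and>
    (\<forall>y'\<in>vcarrier B. w (x, vadd B y y') = w (x, y) + w (x, y')) \<and>
    (\<forall>c. w (vscale A c x, y) = c * w (x, y) \<and> w (x, vscale B c y) = c * w (x, y)))"
 unfolding bilin_forms_def vs_dual_iff using real_vsD[OF A] real_vsD[OF B]
 by (simp only: fun_space_simps mem_Collect_eq restrict_apply') (auto simp: restrict_extensional)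

lemma bilin_formsD:
 assumes "real_vs A" "real_vs B" "w \<in> vcarrier (bilin_forms A B)" "x \<in> vcarrier A" "y \<in> vcarrier B"
 shows "x' \<in> vcarrier A ==> w (vadd A x x', y) = w (x, y) + w (x', y)"
  and "y' \<in> vcarrier B ==> w (x, vadd B y y') = w (x, y) + w (x, y')"
  and "w (vscale A c x, y) = c * w (x, y)" and "w (x, vscale B c y) = c * w (x, y)"
 using assms(3-5) unfolding bilin_forms_iff[OF assms(1,2)] by blast+

lemma real_vs_bilin_forms:
 assumes A: "real_vs A" and B: "real_vs B"
 shows "real_vs (bilin_forms A B)"
proof -
 let ?C = "{w. w \<in> vcarrier (bilin_forms A B)}"
 have "bilin_forms A B = fun_space (vcarrier A \<times> vcarrier B) real_line ?C"
  by (simp add: bilin_forms_def)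
 moreover have "real_vs (fun_space (vcarrier A \<times> vcarrier B) real_line ?C)"
 proof (rule real_vs_fun_space, goal_cases)
  case 2
  show ?case by (auto simp add: PiE_UNIV_extensional bilin_forms_iff[OF A B])
 qed (auto simp: bilin_forms_iff[OF A B] real_vsD[OF A] real_vsD[OF B] algebra_simps)
 ultimately show ?thesis by metis
qed

definition bform :: "'a rvs \<Rightarrow> 'b rvs \<Rightarrow> 'a \<Rightarrow> 'b \<Rightarrow> 'a \<times> 'b \<Rightarrow> real" where
 "bform A B e e' = (\<lambda>z\<in>vcarrier A \<times> vcarrier B. lcoef A e (fst z) * lcoef B e' (snd z))"

lemma bform_mem:
 assumes A: "real_vs A" and B: "real_vs B" and e: "vline A e" and e': "vline B e'"
 shows "bform A B e e' \<in> vcarrier (bilin_forms A B)"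
 unfolding bilin_forms_iff[OF A B] bform_def
 by (auto simp: real_vsD[OF A] real_vsD[OF B] vcoord_add[OF A e] vcoord_scale[OF A e]
   vcoord_add[OF B e'] vcoord_scale[OF B e'] algebra_simps)

lemma bilin_form_line:
 assumes A: "real_vs A" and B: "real_vs B" and e: "vline A e" and e': "vline B e'"
  and w: "w \<in> vcarrier (bilin_forms A B)" and x: "x \<in> vcarrier A" and y: "y \<in> vcarrier B"
 shows "w (x, y) = lcoef A e x * lcoef B e' y * w (e, e')"
 using bilin_formsD(3)[OF A B w vline_mem[OF e] y, of "lcoef A e x"]
  bilin_formsD(4)[OF A B w vline_mem[OF e] vline_mem[OF e'], of "lcoef B e' y"]
  lcoef_scale[OF A e x] lcoef_scale[OF B e' y] by simp

lemma bform_self: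
 assumes "real_vs A" "real_vs B" "vline A e" "vline B e'"
 shows "bform A B e e' (e, e') = 1"
 using assms by (simp add: bform_def vline_mem lcoef_self)

lemma vline_bilin_forms:
 assumes A: "real_vs A" and B: "real_vs B" and e: "vline A e" and e': "vline B e'"
 shows "vline (bilin_forms A B) (bform A B e e')"
proof (rule vlineI[OF real_vs_bilin_forms[OF A B] bform_mem[OF A B e e']])
 fix w assume w: "w \<in> vcarrier (bilin_forms A B)"
 have "w = vscale (bilin_forms A B) (w (e, e')) (bform A B e e')"
 proof (rule extensionalityI[of _ "vcarrier A \<times> vcarrier B"])
  fix z assume z: "z \<in> vcarrier A \<times> vcarrier B"
  thus "w z = vscale (bilin_forms A B) (w (e, e')) (bform A B e e') z"
   using bilin_form_line[OF A B e e' w, of "fst z" "snd z"] by (auto simp: bform_def)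
 qed (use w in \<open>auto simp: bilin_forms_iff[OF A B]\<close>)
 thus "\<exists>a. w = vscale (bilin_forms A B) a (bform A B e e')" by blast
next
 fix a assume "vscale (bilin_forms A B) a (bform A B e e') = vzero (bilin_forms A B)"
 hence "vscale (bilin_forms A B) a (bform A B e e') (e, e') = vzero (bilin_forms A B) (e, e')"
  by simp
 thus "a = 0" using bform_self[OF assms] vline_mem[OF e] vline_mem[OF e'] by simp
qed

lemma tens_mem:
 assumes "real_vs A" "real_vs B" "x \<in> vcarrier A" "y \<in> vcarrier B"
 shows "tens A B x y \<in> vcarrier (vs_tensor A B)"
 using assms real_vsD[OF real_vs_bilin_forms[OF assms(1,2)]]
 unfolding tens_def vs_tensor_def vs_dual_iff by auto

lemma vline_tensor:
 assumes A: "real_vs A" and B: "real_vs B" and e: "vline A e" and e': "vline B e'"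
 shows "vline (vs_tensor A B) (tens A B e e')"
 unfolding vs_tensor_def
proof (rule vline_dual[OF real_vs_bilin_forms[OF A B] vline_bilin_forms[OF assms]])
 show "tens A B e e' \<in> vcarrier (vs_dual (bilin_forms A B))"
  using tens_mem[OF A B vline_mem[OF e] vline_mem[OF e']] by (simp add: vs_tensor_def)
 show "tens A B e e' (bform A B e e') \<noteq> 0"
  by (simp add: tens_def bform_mem[OF assms] bform_self[OF assms])
qed

lemma tens_scale:
 assumes A: "real_vs A" and B: "real_vs B" and x: "x \<in> vcarrier A" and y: "y \<in> vcarrier B"
 shows "tens A B (vscale A a x) (vscale B b y) = vscale (vs_tensor A B) (a * b) (tens A B x y)"
proof (rule extensionalityI[of _ "vcarrier (bilin_forms A B)"])
 fix w assume w: "w \<in> vcarrier (bilin_forms A B)"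
 show "tens A B (vscale A a x) (vscale B b y) w = vscale (vs_tensor A B) (a * b) (tens A B x y) w"
  using bilin_formsD(3)[OF A B w x real_vsD(6)[OF B y]] bilin_formsD(4)[OF A B w x y] w
  by (simp add: tens_def vs_tensor_def)
qed (auto simp: tens_def vs_tensor_def)

lemma real_vs_tensor: "real_vs A ==> real_vs B ==> real_vs (vs_tensor A B)"
 unfolding vs_tensor_def by (intro real_vs_dual real_vs_bilin_forms)

lemma wedge_mem:
 assumes F: "real_vs F" and b: "vs_basis F k b" and t: "\<And>i. i < k ==> t i \<in> vcarrier F"
 shows "wedge F t \<in> vcarrier (vs_det F)"
 using restrict_vs_tuples[of k t F] t real_vsD[OF real_vs_top_forms[OF F]]
 unfolding wedge_def vs_det_def vs_dual_iff
 by (auto simp: top_forms_def vs_dim_eq[OF F b])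

lemma real_vs_det: "real_vs F ==> real_vs (vs_det F)"
 unfolding vs_det_def by (intro real_vs_dual real_vs_top_forms)

lemma wedge_eq:
 assumes F: "real_vs F" and b: "vs_basis F k b" and t: "\<And>i. i < k ==> t i \<in> vcarrier F"
 shows "wedge F t = vscale (vs_det F) (dform F k b t) (wedge F b)"
proof (rule extensionalityI[of _ "vcarrier (top_forms F)"])
 fix w assume w: "w \<in> vcarrier (top_forms F)"
 show "wedge F t w = vscale (vs_det F) (dform F k b t) (wedge F b) w"
  using top_form_apply[OF F b w t] w by (simp add: wedge_def vs_det_def vs_dim_eq[OF F b])
qed (auto simp: wedge_def vs_det_def)

lemma wedge_cong:
 assumes "real_vs F" "vs_basis F k b" "\<And>i. i < k ==> t i = t' i"
 shows "wedge F t = wedge F t'"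
proof -
 have "restrict t {..<k} = restrict t' {..<k}" using assms(3) by auto
 thus ?thesis by (simp add: wedge_def vs_dim_eq[OF assms(1,2)])
qed

definition topform :: "'e rvs \<Rightarrow> nat \<Rightarrow> (nat \<Rightarrow> 'e) \<Rightarrow> (nat \<Rightarrow> 'e) \<Rightarrow> real" where
 "topform F k b = (\<lambda>t\<in>vs_tuples k F. dform F k b t)"

lemma topform_mem:
 assumes "real_vs F" "vs_basis F k b"
 shows "topform F k b \<in> vcarrier (top_forms F)"
 using dform_top_form[OF assms, of 1] by (simp add: topform_def)

lemma topform_restrict:
 assumes "\<And>i. i < k ==> t i \<in> vcarrier F"
 shows "topform F k b (restrict t {..<k}) = dform F k b t"
proof -
 have "dform F k b (restrict t {..<k}) = dform F k b t" by (rule dform_cong) simp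
 thus ?thesis using restrict_vs_tuples[of k t F] assms by (simp add: topform_def)
qed

lemma topform_self:
 assumes "real_vs F" "vs_basis F k b"
 shows "topform F k b (restrict b {..<k}) = 1"
 using topform_restrict[of k b F b] vs_basis_mem[OF assms(2)] dform_basis[OF assms] by simp

lemma vline_top_forms:
 assumes F: "real_vs F" and b: "vs_basis F k b"
 shows "vline (top_forms F) (topform F k b)"
proof (rule vlineI[OF real_vs_top_forms[OF F] topform_mem[OF F b]])
 have top: "top_forms F = alt_forms k F" by (simp add: top_forms_def vs_dim_eq[OF F b])
 fix w assume w: "w \<in> vcarrier (top_forms F)"
 have "w = vscale (top_forms F) (w (restrict b {..<k})) (topform F k b)"
  by (subst top_form_eq[OF F b w]) (auto simp: top topform_def)
 thus "\<exists>a. w = vscale (top_forms F) a (topform F k b)" by blast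
next
 fix a assume z: "vscale (top_forms F) a (topform F k b) = vzero (top_forms F)"
 have "restrict b {..<k} \<in> vs_tuples k F"
  by (rule restrict_vs_tuples) (rule vs_basis_mem[OF b])
 thus "a = 0"
  using fun_cong[OF z, of "restrict b {..<k}"] topform_self[OF F b]
  by (simp add: top_forms_def vs_dim_eq[OF F b])
qed

lemma vline_wedge:
 assumes F: "real_vs F" and b: "vs_basis F k b"
 shows "vline (vs_det F) (wedge F b)"
 unfolding vs_det_def
proof (rule vline_dual[OF real_vs_top_forms[OF F] vline_top_forms[OF F b]])
 show "wedge F b \<in> vcarrier (vs_dual (top_forms F))"
  using wedge_mem[OF F b vs_basis_mem[OF b]] by (simp add: vs_det_def)
 show "wedge F b (topform F k b) \<noteq> 0"
  by (simp add: wedge_def topform_mem[OF F b] vs_dim_eq[OF F b] topform_self[OF F b])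
qed

subsection \<open>Functoriality on decomposable elements\<close>

lemma tensor_map_tens:
 assumes A: "real_vs A" and B: "real_vs B" and A': "real_vs A'" and B': "real_vs B'"
  and h: "vlinear A A' h" and k: "vlinear B B' k" and x: "x \<in> vcarrier A" and y: "y \<in> vcarrier B"
 shows "tensor_map A B A' B' h k (tens A B x y) = tens A' B' (h x) (k y)"
proof (rule extensionalityI[of _ "vcarrier (bilin_forms A' B')"])
 fix w assume w: "w \<in> vcarrier (bilin_forms A' B')"
 have "(\<lambda>(a, b)\<in>vcarrier A \<times> vcarrier B. w (h a, k b)) \<in> vcarrier (bilin_forms A B)"
  unfolding bilin_forms_iff[OF A B]
  by (auto simp: real_vsD[OF A] real_vsD[OF B] vlinearD[OF h] vlinearD[OF k] bilin_formsD[OF A' B' w])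
 thus "tensor_map A B A' B' h k (tens A B x y) w = tens A' B' (h x) (k y) w"
  using w x y tens_mem[OF A B x y] by (simp add: tensor_map_def tens_def)
qed (auto simp: tensor_map_def tens_def tens_mem[OF A B x y, unfolded tens_def])

lemma tensor_map_hom:
 assumes A: "real_vs A" and B: "real_vs B" and A': "real_vs A'" and B': "real_vs B'"
  and h: "vlinear A A' h" and k: "vlinear B B' k"
 shows "tensor_map A B A' B' h k \<in> vcarrier (vs_hom (vs_tensor A B) (vs_tensor A' B'))"
proof -
 have pb: "(\<lambda>(a, b)\<in>vcarrier A \<times> vcarrier B. w (h a, k b)) \<in> vcarrier (bilin_forms A B)"
  if w: "w \<in> vcarrier (bilin_forms A' B')" for w
  unfolding bilin_forms_iff[OF A B]
  by (auto simp: real_vsD[OF A] real_vsD[OF B] vlinearD[OF h] vlinearD[OF k] bilin_formsD[OF A' B' w])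
 \<comment> \<open>Pullback of bilinear forms along \<open>h\<close> and \<open>k\<close>. The map
   on tensors is its dual, so its linearity rests on \<open>?p\<close> commuting with the operations
   on forms.\<close>
 let ?p = "%w. (\<lambda>(a, b)\<in>vcarrier A \<times> vcarrier B. w (h a, k b))"
 have padd: "?p (vadd (bilin_forms A' B') w w') = vadd (bilin_forms A B) (?p w) (?p w')" for w w'
  using vlinearD(1)[OF h] vlinearD(1)[OF k] by (auto simp: fun_eq_iff)
 have pscale: "?p (vscale (bilin_forms A' B') c w) = vscale (bilin_forms A B) c (?p w)" for c w
  using vlinearD(1)[OF h] vlinearD(1)[OF k] by (auto simp: fun_eq_iff)
 have mem: "(\<lambda>w\<in>vcarrier (bilin_forms A' B'). z (?p w)) \<in> vcarrier (vs_tensor A' B')"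
  if z: "z \<in> vcarrier (vs_tensor A B)" for z
  using z pb real_vsD[OF real_vs_bilin_forms[OF A' B']]
  unfolding vs_tensor_def vs_dual_iff by (simp del: form_ops add: padd pscale)
 show ?thesis
  unfolding tensor_map_def
 proof (rule restrict_vs_hom[OF real_vs_tensor[OF A B]], unfold vlinear_def, intro conjI ballI allI)
  fix z assume z: "z \<in> vcarrier (vs_tensor A B)"
  show "(\<lambda>w\<in>vcarrier (bilin_forms A' B'). z (?p w)) \<in> vcarrier (vs_tensor A' B')" by (rule mem[OF z])
 qed (auto simp: vs_tensor_def fun_eq_iff pb)
qed

lemma tpow_map_tprod:
 assumes A: "real_vs A" and A': "real_vs A'" and h: "vlinear A A' h"
  and t: "\<And>i. i < n ==> t i \<in> vcarrier A"
 shows "tpow_map n A A' h (tprod n A t) = tprod n A' (%i. h (t i))"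
proof (rule extensionalityI[of _ "vcarrier (mult_forms n A')"])
 fix w assume w: "w \<in> vcarrier (mult_forms n A')"
 have e: "(\<lambda>l\<in>{..<n}. h ((s(i := x)) l)) = (\<lambda>l\<in>{..<n}. h (s l))(i := h x)" if "i < n" for s i x
  using that by (auto simp: fun_eq_iff)
 have tup: "(\<lambda>l\<in>{..<n}. h (s l)) \<in> vs_tuples n A'" if "s \<in> vs_tuples n A" for s
  using that by (intro restrict_vs_tuples) (simp add: vs_tuples_iff vlinearD(1)[OF h])
 have "(\<lambda>s\<in>vs_tuples n A. w (\<lambda>i\<in>{..<n}. h (s i))) \<in> vcarrier (mult_forms n A)"
  unfolding mult_forms_iff
  by (auto simp: vs_tuples_upd e real_vsD[OF A] vlinearD[OF h] mult_formsD[OF w tup] simp del: fun_upd_apply)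
 moreover have "(\<lambda>i\<in>{..<n}. h (restrict t {..<n} i)) = (\<lambda>i\<in>{..<n}. h (t i))" by auto
 moreover have "restrict t {..<n} \<in> vs_tuples n A" using t by (rule restrict_vs_tuples)
 ultimately show "tpow_map n A A' h (tprod n A t) w = tprod n A' (%i. h (t i)) w"
  using w tprod_mem[of n t A] t A by (simp add: tpow_map_def tprod_def)
qed (use tprod_mem[of n t A] t A in \<open>auto simp: tpow_map_def tprod_def\<close>)

lemma tpow_map_hom:
 assumes A: "real_vs A" and A': "real_vs A'" and h: "vlinear A A' h"
 shows "tpow_map n A A' h \<in> vcarrier (vs_hom (vs_tpow n A) (vs_tpow n A'))"
proof -
 let ?p = "%w. (\<lambda>s\<in>vs_tuples n A. w (\<lambda>i\<in>{..<n}. h (s i)))"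
 have e: "(\<lambda>l\<in>{..<n}. h ((s(i := x)) l)) = (\<lambda>l\<in>{..<n}. h (s l))(i := h x)" if "i < n" for s i x
  using that by (auto simp: fun_eq_iff)
 have tup: "(\<lambda>l\<in>{..<n}. h (s l)) \<in> vs_tuples n A'" if "s \<in> vs_tuples n A" for s
  using that by (intro restrict_vs_tuples) (simp add: vs_tuples_iff vlinearD(1)[OF h])
 have pb: "?p w \<in> vcarrier (mult_forms n A)" if w: "w \<in> vcarrier (mult_forms n A')" for w
  unfolding mult_forms_iff
  by (auto simp: vs_tuples_upd e real_vsD[OF A] vlinearD[OF h] mult_formsD[OF w tup] simp del: fun_upd_apply)
 have padd: "?p (vadd (mult_forms n A') w w') = vadd (mult_forms n A) (?p w) (?p w')" for w w'
  using tup by (auto simp: fun_eq_iff)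
 have pscale: "?p (vscale (mult_forms n A') c w) = vscale (mult_forms n A) c (?p w)" for c w
  using tup by (auto simp: fun_eq_iff)
 have mem: "(\<lambda>w\<in>vcarrier (mult_forms n A'). z (?p w)) \<in> vcarrier (vs_tpow n A')"
  if z: "z \<in> vcarrier (vs_tpow n A)" for z
  using z pb real_vsD[OF real_vs_mult_forms[OF A']]
  unfolding vs_tpow_def vs_dual_iff by (simp del: form_ops add: padd pscale)
 show ?thesis
  unfolding tpow_map_def
 proof (rule restrict_vs_hom[OF real_vs_tpow[OF A]], unfold vlinear_def, intro conjI ballI allI)
  fix z assume z: "z \<in> vcarrier (vs_tpow n A)"
  show "(\<lambda>w\<in>vcarrier (mult_forms n A'). z (?p w)) \<in> vcarrier (vs_tpow n A')" by (rule mem[OF z])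
 qed (auto simp: vs_tpow_def fun_eq_iff pb)
qed

lemma dual_map_hom:
 assumes A: "real_vs A" and A': "real_vs A'" and h: "vlinear A A' h"
 shows "dual_map A A' h \<in> vcarrier (vs_hom (vs_dual A') (vs_dual A))"
 unfolding dual_map_def
proof (rule restrict_vs_hom[OF real_vs_dual[OF A']], unfold vlinear_def, intro conjI ballI allI)
 fix p assume p: "p \<in> vcarrier (vs_dual A')"
 show "(\<lambda>x\<in>vcarrier A. p (h x)) \<in> vcarrier (vs_dual A)"
  using p by (simp add: vs_dual_iff vlinearD[OF h] real_vsD[OF A])
qed (auto simp: vlinearD(1)[OF h])

section \<open>Subspaces, quotients and the canonical isomorphism\<close>

lemma lincomb_vs_of: "lincomb (vs_of S) k c b = (\<Sum>i<k. c i *\<^sub>R b i)"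
 by (induction k) auto

lemma mem_coset_iff: "p \<in> vs_coset A b \<longleftrightarrow> p - b \<in> A"
 unfolding vs_coset_def by (auto intro: exI[of _ "p - b"])

lemma coset_eq_iff:
 assumes "subspace A"
 shows "vs_coset A b = vs_coset A c \<longleftrightarrow> b - c \<in> A"
proof
 assume "vs_coset A b = vs_coset A c"
 moreover have "b \<in> vs_coset A b" using subspace_0[OF assms] by (simp add: mem_coset_iff)
 ultimately show "b - c \<in> A" by (simp add: mem_coset_iff)
next
 assume bc: "b - c \<in> A"
 have "p - b \<in> A \<longleftrightarrow> p - c \<in> A" for p
  using subspace_add[OF assms bc, of "p - b"] subspace_diff[OF assms _ bc, of "p - c"] by auto
 thus "vs_coset A b = vs_coset A c" by (auto simp: mem_coset_iff)
qed

lemma coset_self: "subspace A ==> b \<in> vs_coset A b"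
 by (simp add: mem_coset_iff subspace_0)

lemma coset_eqI: "subspace A ==> b \<in> vs_coset A c ==> vs_coset A c = vs_coset A b"
 using coset_eq_iff[of A b c] by (simp add: mem_coset_iff)

lemma quot_simps:
 "vcarrier (vs_quot A B) = vs_coset A ` B" "vzero (vs_quot A B) = A"
 by (simp_all add: vs_quot_def)

lemma quot_add:
 assumes "subspace A"
 shows "vadd (vs_quot A B) (vs_coset A b) (vs_coset A c) = vs_coset A (b + c)"
proof -
 have "{p + q |p q. p \<in> vs_coset A b \<and> q \<in> vs_coset A c} = vs_coset A (b + c)" (is "?L = ?R")
 proof
  show "?L \<subseteq> ?R"
  proof
   fix x assume "x \<in> ?L"
   then obtain p q where "x = p + q" "p - b \<in> A" "q - c \<in> A" by (auto simp: mem_coset_iff)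
   thus "x \<in> ?R" using subspace_add[OF assms, of "p - b" "q - c"] by (simp add: mem_coset_iff algebra_simps)
  qed
  show "?R \<subseteq> ?L"
  proof
   fix x assume "x \<in> ?R"
   hence "x - c \<in> vs_coset A b" by (simp add: mem_coset_iff algebra_simps)
   moreover have "c \<in> vs_coset A c" by (rule coset_self[OF assms])
   moreover have "x = (x - c) + c" by simp
   ultimately show "x \<in> ?L" by blast
  qed
 qed
 thus ?thesis by (simp add: vs_quot_def)
qed

lemma quot_scale:
 assumes "subspace A"
 shows "vscale (vs_quot A B) a (vs_coset A b) = vs_coset A (a *\<^sub>R b)"
proof -
 have "{a *\<^sub>R p + q |p q. p \<in> vs_coset A b \<and> q \<in> A} = vs_coset A (a *\<^sub>R b)" (is "?L = ?R")
 proof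
  show "?L \<subseteq> ?R"
  proof
   fix x assume "x \<in> ?L"
   then obtain p q where x: "x = a *\<^sub>R p + q" "p - b \<in> A" "q \<in> A" by (auto simp: mem_coset_iff)
   hence "a *\<^sub>R (p - b) + q \<in> A" using assms by (simp add: subspace_add subspace_scale)
   thus "x \<in> ?R" using x(1) by (simp add: mem_coset_iff algebra_simps)
  qed
  show "?R \<subseteq> ?L"
  proof
   fix x assume "x \<in> ?R"
   hence "x - a *\<^sub>R b \<in> A" by (simp add: mem_coset_iff)
   moreover have "b \<in> vs_coset A b" by (rule coset_self[OF assms])
   moreover have "x = a *\<^sub>R b + (x - a *\<^sub>R b)" by simp
   ultimately show "x \<in> ?L" by blast
  qed
 qed
 thus ?thesis by (simp add: vs_quot_def)
qed

lemma coset_zero: "vs_coset A 0 = A"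
 by (simp add: vs_coset_def)

lemma real_vs_quot:
 assumes A: "subspace A" and B: "subspace B"
 shows "real_vs (vs_quot A B)"
proof -
 have neg: "\<exists>y\<in>vs_coset A ` B. vadd (vs_quot A B) (vs_coset A b) y = A" if "b \<in> B" for b
  by (rule bexI[of _ "vs_coset A (- b)"])
    (use subspace_neg[OF B that] in \<open>simp_all add: quot_add[OF A] coset_zero\<close>)
 have zero: "vadd (vs_quot A B) A (vs_coset A b) = vs_coset A b" for b
  using quot_add[OF A, of B 0 b] by (simp add: coset_zero)
 have mem: "A \<in> vs_coset A ` B" using coset_zero[of A] subspace_0[OF B] by (metis imageI)
 show ?thesis
  unfolding real_vs_def
  using neg zero mem subspace_add[OF B] subspace_scale[OF B]
  by (auto simp: quot_simps quot_add[OF A] quot_scale[OF A] algebra_simps)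
qed

lemma lincomb_quot:
 assumes "subspace A"
 shows "lincomb (vs_quot A B) k c (%i. vs_coset A (b i)) = vs_coset A (\<Sum>i<k. c i *\<^sub>R b i)"
 by (induction k) (simp_all add: quot_simps coset_zero quot_add[OF assms] quot_scale[OF assms])

lemma lincomb_hom:
 "lincomb (vs_hom A B) k c b = (\<lambda>x\<in>vcarrier A. lincomb B k c (%i. b i x))"
 by (induction k) (auto simp: fun_eq_iff)

text \<open>The homomorphism \<open>p \<otimes> [y] : A \<rightarrow> B/A\<close>, where \<open>p\<close> is the form dual to \<open>v \<in> A\<close>.\<close>

definition tangent_vec :: "'e::real_vector set \<Rightarrow> 'e \<Rightarrow> 'e \<Rightarrow> 'e \<Rightarrow> 'e set" where
 "tangent_vec A v y = (\<lambda>x\<in>A. vs_coset A (lcoef (vs_of A) v x *\<^sub>R y))"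

definition dual_vec :: "'e rvs \<Rightarrow> 'e \<Rightarrow> 'e \<Rightarrow> real" where
 "dual_vec A v = lmap A real_line v 1"

lemma dual_vec_mem:
 assumes "real_vs A" "vline A v"
 shows "dual_vec A v \<in> vcarrier (vs_dual A)"
 unfolding dual_vec_def vs_dual_def by (rule lmap_hom) (use assms in auto)

lemma dual_vec_self:
 assumes "real_vs A" "vline A v"
 shows "dual_vec A v v = 1"
 unfolding dual_vec_def by (rule lmap_apply) (use assms in auto)

lemma dual_vec_unique:
 assumes A: "real_vs A" and v: "vline A v" and p: "p \<in> vcarrier (vs_dual A)" "p v = 1"
 shows "p = dual_vec A v"
 by (rule line_hom_eqI[OF A v, of _ real_line])
   (use assms dual_vec_self[OF A v] dual_vec_mem[OF A v] in \<open>auto simp: vs_dual_def\<close>)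

lemma vline_dual_vec:
 assumes "real_vs A" "vline A v"
 shows "vline (vs_dual A) (dual_vec A v)"
 by (rule vline_dual[OF assms dual_vec_mem[OF assms]]) (simp add: dual_vec_self[OF assms])

lemma dual_vec_scale:
 assumes A: "real_vs A" and v: "vline A v" and a: "a \<noteq> 0"
 shows "dual_vec A (vscale A a v) = vscale (vs_dual A) (1 / a) (dual_vec A v)"
proof (rule dual_vec_unique[symmetric, OF A vline_scale[OF A v a]])
 show "vscale (vs_dual A) (1 / a) (dual_vec A v) \<in> vcarrier (vs_dual A)"
  by (rule real_vsD(6)[OF real_vs_dual[OF A] dual_vec_mem[OF A v]])
 have "dual_vec A v (vscale A a v) = a * dual_vec A v v"
  using dual_vec_mem[OF A v] vline_mem[OF v] unfolding vs_dual_iff by blast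
 thus "vscale (vs_dual A) (1 / a) (dual_vec A v) (vscale A a v) = 1"
  using a dual_vec_self[OF A v] real_vsD(6)[OF A vline_mem[OF v]] by simp
qed

text \<open>Used for \<open>l\<close> inside the fibre of \<open>Y\<close> with \<open>y\<close>
  moving along a chart, and for \<open>f(l)\<close> inside all of \<open>W\<close> with fixed
  complementary vectors; both canonical identifications are thereby computed at once. Here
  \<open>B\<close> has dimension \<open>Suc m\<close> and \<open>Hom(A, B/A)\<close> has dimension
  \<open>m\<close>.\<close>

locale line_in_space =
 fixes A B :: "'e::real_vector set" and v :: 'e and m :: nat and y :: "nat \<Rightarrow> 'e"
 assumes sub_A: "subspace A" and sub_B: "subspace B"
  and line_A: "vline (vs_of A) v"
  and basis_B: "vs_basis (vs_of B) (Suc m) (case_nat v y)"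
begin

abbreviation "T \<equiv> vs_hom (vs_of A) (vs_quot A B)"
abbreviation "\<phi>\<^sub>0 \<equiv> %i. tangent_vec A v (y i)"

lemma real_vs_A: "real_vs (vs_of A)" and real_vs_B: "real_vs (vs_of B)" and real_vs_T: "real_vs T"
 using sub_A sub_B by (auto intro: real_vs_vs_of real_vs_hom real_vs_quot)

lemma v_mem: "v \<in> A"
 using vline_mem[OF line_A] by simp

lemma y_mem: "i < m ==> y i \<in> B"
 using vs_basis_mem[OF basis_B, of "Suc i"] by simp

lemma A_subset: "A \<subseteq> B"
proof
 fix x assume "x \<in> A"
 hence "x = lcoef (vs_of A) v x *\<^sub>R v" using lcoef_scale[OF real_vs_A line_A] by simp
 moreover have "v \<in> B" using vs_basis_mem[OF basis_B, of 0] by simp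
 ultimately show "x \<in> B" using subspace_scale[OF sub_B] by metis
qed

lemma tangent_vec_mem:
 assumes "b \<in> B"
 shows "tangent_vec A v b \<in> vcarrier T"
 unfolding tangent_vec_def vs_hom_iff vlinear_def
 using assms subspace_add[OF sub_A] subspace_scale[OF sub_A] subspace_scale[OF sub_B]
  vcoord_add[OF real_vs_A line_A] vcoord_scale[OF real_vs_A line_A]
 by (auto simp: quot_simps quot_add[OF sub_A] quot_scale[OF sub_A] algebra_simps)

lemma tangent_vec_apply: "tangent_vec A v b (a *\<^sub>R v) = vs_coset A (a *\<^sub>R b)"
 using lcoef_unique[OF real_vs_A line_A, of a] v_mem subspace_scale[OF sub_A]
 by (simp add: tangent_vec_def)

lemma tangent_vec_self: "tangent_vec A v b v = vs_coset A b"
 using tangent_vec_apply[of b 1] by simp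

lemma T_eq_tangent_vec:
 assumes "\<phi> \<in> vcarrier T" "b \<in> \<phi> v"
 shows "b \<in> B" "\<phi> = tangent_vec A v b"
proof -
 have "\<phi> v \<in> vs_coset A ` B" using assms(1) v_mem by (auto simp: vs_hom_iff vlinear_def quot_simps)
 then obtain b' where b': "b' \<in> B" "\<phi> v = vs_coset A b'" by auto
 have "b - b' \<in> A" using assms(2) b'(2) by (simp add: mem_coset_iff)
 hence "b - b' \<in> B" using A_subset by auto
 from subspace_add[OF sub_B this b'(1)] show b: "b \<in> B" by simp
 have "\<phi> v = tangent_vec A v b v"
  using b'(2) coset_eqI[OF sub_A, of b b'] assms(2) tangent_vec_self by simp
 thus "\<phi> = tangent_vec A v b"
  using line_hom_eqI[OF real_vs_A line_A assms(1) tangent_vec_mem[OF b]] by simp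
qed

lemma lincomb_T: "lincomb T m c \<phi>\<^sub>0 = tangent_vec A v (\<Sum>i<m. c i *\<^sub>R y i)"
 unfolding lincomb_hom
proof (rule restrict_ext[THEN trans])
 fix x assume x: "x \<in> vcarrier (vs_of A)"
 have "lincomb (vs_quot A B) m c (%i. tangent_vec A v (y i) x)
   = lincomb (vs_quot A B) m c (%i. vs_coset A (lcoef (vs_of A) v x *\<^sub>R y i))"
  using x by (intro lincomb_cong) (auto simp: tangent_vec_def)
 thus "lincomb (vs_quot A B) m c (%i. tangent_vec A v (y i) x)
   = vs_coset A (lcoef (vs_of A) v x *\<^sub>R (\<Sum>i<m. c i *\<^sub>R y i))"
  by (simp add: lincomb_quot[OF sub_A] scaleR_sum_right mult.commute)
qed (simp add: tangent_vec_def)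

lemma B_expand:
 assumes "b \<in> B"
 shows "b = vcoord (vs_of B) (Suc m) (case_nat v y) b 0 *\<^sub>R v
  + (\<Sum>i<m. vcoord (vs_of B) (Suc m) (case_nat v y) b (Suc i) *\<^sub>R y i)"
 using vcoord_lincomb[OF basis_B, of b] assms unfolding lincomb_vs_of
 by (simp add: sum.lessThan_Suc_shift del: sum.lessThan_Suc)

lemma coset_y:
 assumes "b \<in> B"
 shows "vs_coset A b = vs_coset A (\<Sum>i<m. vcoord (vs_of B) (Suc m) (case_nat v y) b (Suc i) *\<^sub>R y i)"
 using B_expand[OF assms] subspace_scale[OF sub_A v_mem] coset_eq_iff[OF sub_A]
 by (metis add_diff_cancel_right')

lemma tangent_vec_eq_iff:
 "tangent_vec A v b = tangent_vec A v c \<longleftrightarrow> b - c \<in> A"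
proof
 assume "tangent_vec A v b = tangent_vec A v c"
 thus "b - c \<in> A" using tangent_vec_self coset_eq_iff[OF sub_A] by metis
next
 assume bc: "b - c \<in> A"
 hence "vs_coset A (a *\<^sub>R b) = vs_coset A (a *\<^sub>R c)" for a
  using coset_eq_iff[OF sub_A] subspace_scale[OF sub_A bc, of a] by (simp add: algebra_simps)
 thus "tangent_vec A v b = tangent_vec A v c" by (simp add: tangent_vec_def)
qed

lemma sum_y_mem: "(\<Sum>i<m. c i *\<^sub>R y i) \<in> B"
 using y_mem by (intro subspace_sum[OF sub_B]) (auto intro: subspace_scale[OF sub_B])

lemma T_lincomb:
 assumes "b \<in> B"
 shows "tangent_vec A v b
  = lincomb T m (%i. vcoord (vs_of B) (Suc m) (case_nat v y) b (Suc i)) \<phi>\<^sub>0"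
 unfolding lincomb_T tangent_vec_eq_iff
 using coset_y[OF assms] coset_eq_iff[OF sub_A] by blast

lemma basis_T: "vs_basis T m \<phi>\<^sub>0"
proof (rule vs_basisI[OF real_vs_T])
 show "\<phi>\<^sub>0 i \<in> vcarrier T" if "i < m" for i by (rule tangent_vec_mem[OF y_mem[OF that]])
next
 fix \<phi> assume \<phi>: "\<phi> \<in> vcarrier T"
 hence "\<phi> v \<in> vs_coset A ` B" using v_mem by (auto simp: vs_hom_iff vlinear_def quot_simps)
 then obtain b where "b \<in> \<phi> v" using coset_self[OF sub_A] by auto
 with T_eq_tangent_vec[OF \<phi>] have "b \<in> B" "\<phi> = tangent_vec A v b" by blast+
 thus "\<exists>c. \<phi> = lincomb T m c \<phi>\<^sub>0" using T_lincomb by blast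
next
 fix c assume "lincomb T m c \<phi>\<^sub>0 = vzero T"
 hence "tangent_vec A v (\<Sum>i<m. c i *\<^sub>R y i) v = vzero T v" by (simp add: lincomb_T)
 hence "vs_coset A (\<Sum>i<m. c i *\<^sub>R y i) = vs_coset A 0"
  using v_mem by (simp add: tangent_vec_self quot_simps coset_zero)
 hence "(\<Sum>i<m. c i *\<^sub>R y i) \<in> A" by (simp add: coset_eq_iff[OF sub_A])
 hence "(\<Sum>i<m. c i *\<^sub>R y i) = lcoef (vs_of A) v (\<Sum>i<m. c i *\<^sub>R y i) *\<^sub>R v" (is "_ = ?a *\<^sub>R v")
  using lcoef_scale[OF real_vs_A line_A] by simp
 \<comment> \<open>A combination of the \<open>y i\<close> that lies in \<open>A\<close> is
   \<open>?a\<close> times \<open>v\<close>; moving it to the other side gives a relation in the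
   basis of \<open>B\<close>, with coefficient \<open>- ?a\<close> at index 0.\<close>
 hence "lincomb (vs_of B) (Suc m) (case_nat (- ?a) c) (case_nat v y) = vzero (vs_of B)"
  unfolding lincomb_vs_of by (simp add: sum.lessThan_Suc_shift del: sum.lessThan_Suc)
 from vs_basis_indep[OF real_vs_B basis_B this] show "\<forall>i<m. c i = 0"
  by (metis Suc_less_eq old.nat.simps(5))
qed

lemma dim_T: "vs_dim T = m" and dim_B: "vs_dim (vs_of B) = Suc m"
 using vs_dim_eq[OF real_vs_T basis_T] vs_dim_eq[OF real_vs_B basis_B] by auto

text \<open>Representatives of \<phi> \<open>v\<close> differ by multiples of \<open>v\<close>,
  which affect only coordinate 0. The remaining coordinates, shifted by one, are those of
  \<phi>.\<close>

lemma vcoord_T: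
 assumes "\<phi> \<in> vcarrier T" "b \<in> \<phi> v" "i < m"
 shows "vcoord T m \<phi>\<^sub>0 \<phi> i = vcoord (vs_of B) (Suc m) (case_nat v y) b (Suc i)"
 by (rule vcoord_unique[OF real_vs_T basis_T _ assms(3)])
   (use T_eq_tangent_vec[OF assms(1,2)] T_lincomb in metis)

text \<open>In a basis starting with \<open>v\<close>, the row of \<open>v\<close> is
  \<open>(1, 0, ..., 0)\<close>; deleting it with the first column leaves the coordinate matrix of
  \<phi>. This is the identification of \<open>a\<close> tensor \<open>[b]\<close> with
  \<open>a\<close> wedge \<open>b\<close> in coordinates.\<close>

lemma dform_T:
 assumes "\<And>i. i < m ==> \<phi> i \<in> vcarrier T" "\<And>i. i < m ==> b i \<in> \<phi> i v"
 shows "dform (vs_of B) (Suc m) (case_nat v y) (case_nat v b) = dform T m \<phi>\<^sub>0 \<phi>"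
proof -
 have "dform (vs_of B) (Suc m) (case_nat v y) (case_nat v b)
   = ddet m (%i j. vcoord (vs_of B) (Suc m) (case_nat v y) (b i) (Suc j))"
  unfolding dform_def
 proof (subst ddet_Suc_block)
  show "vcoord (vs_of B) (Suc m) (case_nat v y) (case_nat v b 0) 0 = 1"
   using vcoord_basis[OF real_vs_B basis_B, of 0 0] by simp
  show "vcoord (vs_of B) (Suc m) (case_nat v y) (case_nat v b 0) (Suc j) = 0" if "j < m" for j
   using vcoord_basis[OF real_vs_B basis_B, of 0 "Suc j"] that by simp
 qed simp
 also have "\<dots> = dform T m \<phi>\<^sub>0 \<phi>"
  unfolding dform_def by (rule ddet_cong, rule vcoord_T[symmetric]) (use assms in auto)
 finally show ?thesis .
qed

lemma rep_mem:
 assumes "\<phi> \<in> vcarrier T" "b \<in> \<phi> (a *\<^sub>R v)" "a \<noteq> 0"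
 shows "(1 / a) *\<^sub>R b \<in> \<phi> v"
proof -
 have "\<phi> (a *\<^sub>R v) = vscale (vs_quot A B) a (\<phi> v)" "\<phi> v \<in> vs_coset A ` B"
  using assms(1) v_mem by (auto simp: vs_hom_iff vlinear_def quot_simps)
 then obtain c where c: "\<phi> v = vs_coset A c" "\<phi> (a *\<^sub>R v) = vs_coset A (a *\<^sub>R c)"
  by (auto simp: quot_scale[OF sub_A])
 have "(1 / a) *\<^sub>R (b - a *\<^sub>R c) \<in> A"
  using assms(2) c(2) by (intro subspace_scale[OF sub_A]) (simp add: mem_coset_iff)
 thus ?thesis using assms(3) by (simp add: c(1) mem_coset_iff scaleR_diff_right)
qed

lemma rep_B:
 assumes "\<phi> \<in> vcarrier T" "b \<in> \<phi> (a *\<^sub>R v)" "a \<noteq> 0"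
 shows "b \<in> B"
proof -
 have "(1 / a) *\<^sub>R b \<in> B" using T_eq_tangent_vec(1)[OF assms(1) rep_mem[OF assms]] .
 from subspace_scale[OF sub_B this, of a] show ?thesis using assms(3) by simp
qed

text \<open>The choice of the representatives does not matter, since \<open>v \<and> v = 0\<close>.\<close>

lemma dform_rep:
 assumes \<phi>: "\<And>i. i < m ==> \<phi> i \<in> vcarrier T"
  and b: "\<And>i. i < m ==> b i \<in> \<phi> i (a *\<^sub>R v)" and a: "a \<noteq> 0"
 shows "dform (vs_of B) (Suc m) (case_nat v y) (case_nat (a *\<^sub>R v) b) = a ^ Suc m * dform T m \<phi>\<^sub>0 \<phi>"
proof -
 let ?b = "%i. (1 / a) *\<^sub>R b i"
 have r: "?b i \<in> \<phi> i v" if "i < m" for i by (rule rep_mem[OF \<phi>[OF that] b[OF that] a])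
 have "dform (vs_of B) (Suc m) (case_nat v y) (case_nat (a *\<^sub>R v) b)
   = dform (vs_of B) (Suc m) (case_nat v y) (%i. vscale (vs_of B) a (case_nat v ?b i))"
  by (rule dform_cong) (use a in \<open>auto split: nat.split\<close>)
 also have "\<dots> = a ^ Suc m * dform (vs_of B) (Suc m) (case_nat v y) (case_nat v ?b)"
  by (rule dform_scale_all[OF real_vs_B basis_B])
    (use r T_eq_tangent_vec(1)[OF \<phi>] v_mem A_subset in \<open>auto split: nat.split\<close>)
 also have "dform (vs_of B) (Suc m) (case_nat v y) (case_nat v ?b) = dform T m \<phi>\<^sub>0 \<phi>"
  by (rule dform_T) (use \<phi> r in auto)
 finally show ?thesis .
qed

lemma wedge_rep:
 assumes \<phi>: "\<And>i. i < m ==> \<phi> i \<in> vcarrier T"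
  and b: "\<And>i. i < m ==> b i \<in> \<phi> i (a *\<^sub>R v)" and a: "a \<noteq> 0"
 shows "wedge (vs_of B) (case_nat (a *\<^sub>R v) b)
  = vscale (vs_det (vs_of B)) (a ^ Suc m * dform T m \<phi>\<^sub>0 \<phi>) (wedge (vs_of B) (case_nat v y))"
proof -
 have "case_nat (a *\<^sub>R v) b i \<in> vcarrier (vs_of B)" if "i < Suc m" for i
  using that rep_B[OF \<phi> b a] subspace_scale[OF sub_B] v_mem A_subset by (auto split: nat.split)
 from wedge_eq[OF real_vs_B basis_B this] show ?thesis
  by (simp only: dform_rep[OF assms])
qed

abbreviation "L \<equiv> vs_dual (vs_of A)"
abbreviation "target \<equiv> vs_tensor (vs_tpow (Suc m) L) (vs_det (vs_of B))"
abbreviation "gen_source \<equiv> wedge T \<phi>\<^sub>0"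
abbreviation "gen_target \<equiv> tens (vs_tpow (Suc m) L) (vs_det (vs_of B))
 (tprod (Suc m) L (%_. dual_vec (vs_of A) v)) (wedge (vs_of B) (case_nat v y))"

lemma real_vs_L: "real_vs L" and real_vs_target: "real_vs target"
 and real_vs_detB: "real_vs (vs_det (vs_of B))" and real_vs_detT: "real_vs (vs_det T)"
 and real_vs_tpowL: "real_vs (vs_tpow (Suc m) L)"
 using real_vs_A real_vs_B real_vs_T
 by (auto intro!: real_vs_dual real_vs_tensor real_vs_tpow real_vs_det)

lemma vline_L: "vline L (dual_vec (vs_of A) v)"
 by (rule vline_dual_vec[OF real_vs_A line_A])

lemma vline_source: "vline (vs_det T) gen_source"
 by (rule vline_wedge[OF real_vs_T basis_T])

lemma vline_target: "vline target gen_target"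
 by (rule vline_tensor[OF real_vs_tpowL real_vs_detB vline_tpow[OF real_vs_L vline_L]
    vline_wedge[OF real_vs_B basis_B]])

text \<open>The description has a solution because the prescribed values are compatible for all
  choices of \<open>w\<close>, \<open>p\<close>, \<phi> and \<open>b\<close>, and only one because
  it prescribes the value at a generator of a line. From here on the canonical isomorphism is known
  by where it sends one generator.\<close>

lemma det_tangent_iso_unique:
 shows "det_tangent_iso A B = lmap (vs_det T) target gen_source gen_target"
proof -
 let ?\<kappa> = "lmap (vs_det T) target gen_source gen_target"
 let ?P = "%\<kappa>. \<kappa> \<in> vcarrier (vs_hom (vs_det T) target) \<and>
  (\<forall>w\<in>A - {0}. \<forall>p\<in>vcarrier L. \<forall>\<phi>\<in>vs_tuples m T. \<forall>b.
    p w = 1 \<and> (\<forall>i<m. b i \<in> \<phi> i w) \<longrightarrow>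
    \<kappa> (wedge T \<phi>) = tens (vs_tpow (Suc m) L) (vs_det (vs_of B)) (tprod (Suc m) L (%_. p))
     (wedge (vs_of B) (%i. case i of 0 \<Rightarrow> w | Suc j \<Rightarrow> b j)))"
 have hom: "?\<kappa> \<in> vcarrier (vs_hom (vs_det T) target)"
  by (rule lmap_hom[OF real_vs_detT real_vs_target vline_source vline_mem[OF vline_target]])
 have P: "?P ?\<kappa>"
 proof (intro conjI hom ballI allI impI; elim conjE)
  fix w p \<phi> b
  assume w: "w \<in> A - {0}" and p: "p \<in> vcarrier L" and \<phi>': "\<phi> \<in> vs_tuples m T" and pw: "p w = 1"
   and b: "\<forall>i<m. b i \<in> \<phi> i w"
  define a where "a = lcoef (vs_of A) v w"
  have wa: "w = a *\<^sub>R v" using lcoef_scale[OF real_vs_A line_A, of w] w by (simp add: a_def)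
  have a: "a \<noteq> 0" using wa w by auto
  have \<phi>: "\<phi> i \<in> vcarrier T" if "i < m" for i using \<phi>' that by (simp add: vs_tuples_iff)
  have lw: "vline (vs_of A) w" using vline_scale[OF real_vs_A line_A a] wa by simp
  have "p = dual_vec (vs_of A) (vscale (vs_of A) a v)"
   using dual_vec_unique[OF real_vs_A lw p pw] wa by simp
  hence p: "p = vscale L (1 / a) (dual_vec (vs_of A) v)"
   by (simp only: dual_vec_scale[OF real_vs_A line_A a])
  have wr: "wedge (vs_of B) (case_nat (a *\<^sub>R v) b)
   = vscale (vs_det (vs_of B)) (a ^ Suc m * dform T m \<phi>\<^sub>0 \<phi>) (wedge (vs_of B) (case_nat v y))"
   by (rule wedge_rep[OF \<phi> _ a]) (use b wa in auto)
  have "tens (vs_tpow (Suc m) L) (vs_det (vs_of B)) (tprod (Suc m) L (%_. p))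
     (wedge (vs_of B) (case_nat w b))
   = vscale target ((1 / a) ^ Suc m * (a ^ Suc m * dform T m \<phi>\<^sub>0 \<phi>)) gen_target"
   unfolding p tprod_scale[OF real_vs_L vline_L] wa wr
   by (rule tens_scale[OF real_vs_tpowL real_vs_detB
      vline_mem[OF vline_tpow[OF real_vs_L vline_L]] vline_mem[OF vline_wedge[OF real_vs_B basis_B]]])
  \<comment> \<open>For \<open>w = a v\<close> the dual vector scales by \<open>1 / a\<close> in
    each of \<open>m + 1\<close> tensor factors. The wedge scales by \<open>a\<close> once for
    \<open>w\<close> and once for each of the \<open>m\<close> representatives of \<phi>
    \<open>w\<close>. The exponents agree.\<close>
  also have "(1 / a) ^ Suc m * (a ^ Suc m * dform T m \<phi>\<^sub>0 \<phi>) = dform T m \<phi>\<^sub>0 \<phi>"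
   using a by (simp add: power_divide)
  also have "vscale target (dform T m \<phi>\<^sub>0 \<phi>) gen_target
   = ?\<kappa> (vscale (vs_det T) (dform T m \<phi>\<^sub>0 \<phi>) gen_source)"
   using real_vsD(6)[OF real_vs_detT vline_mem[OF vline_source]]
   by (simp add: lmap_def lcoef_unique[OF real_vs_detT vline_source])
  also have "vscale (vs_det T) (dform T m \<phi>\<^sub>0 \<phi>) gen_source = wedge T \<phi>"
   by (rule wedge_eq[OF real_vs_T basis_T \<phi>, symmetric])
  finally show "?\<kappa> (wedge T \<phi>) = tens (vs_tpow (Suc m) L) (vs_det (vs_of B)) (tprod (Suc m) L (%_. p))
     (wedge (vs_of B) (%i. case i of 0 \<Rightarrow> w | Suc j \<Rightarrow> b j))" by simp
 qed
 \<comment> \<open>The prescription is evaluated at \<open>v\<close>, its dual vector, the basis of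
   \<open>T\<close> and the representatives \<open>y i\<close>. The basis has to be restricted to
   become a tuple, which leaves its wedge unchanged.\<close>
 have unique: "\<kappa> = ?\<kappa>" if \<kappa>: "?P \<kappa>" for \<kappa>
 proof (rule line_hom_eqI[OF real_vs_detT vline_source _ hom])
  let ?\<phi> = "restrict \<phi>\<^sub>0 {..<m}"
  have w: "wedge T ?\<phi> = gen_source" by (rule wedge_cong[OF real_vs_T basis_T]) simp
  have "v \<noteq> 0"
   using vs_basis_indep[OF real_vs_A line_A, of "%_. 1" 0] by (auto simp: lincomb_vs_of)
  hence "v \<in> A - {0}" using v_mem by simp
  moreover have "?\<phi> \<in> vs_tuples m T"
   by (rule restrict_vs_tuples) (rule vs_basis_mem[OF basis_T])
  moreover have "\<forall>i<m. y i \<in> ?\<phi> i v" by (simp add: tangent_vec_self coset_self[OF sub_A])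
  ultimately have "\<kappa> (wedge T ?\<phi>) = gen_target"
   using \<kappa> dual_vec_mem[OF real_vs_A line_A] dual_vec_self[OF real_vs_A line_A] by blast
  thus "\<kappa> gen_source = ?\<kappa> gen_source"
   by (simp add: w lmap_apply[OF real_vs_detT real_vs_target vline_source vline_mem[OF vline_target]])
 qed (use \<kappa> in blast)
 have "(THE \<kappa>. ?P \<kappa>) = ?\<kappa>" by (rule the_equality[of ?P, OF P unique])
 thus ?thesis by (simp only: det_tangent_iso_def Let_def dim_T dim_B)
qed

lemma det_tangent_iso_iso: "det_tangent_iso A B \<in> vs_isos (vs_det T) target"
 unfolding det_tangent_iso_unique
 by (rule lmap_iso[OF real_vs_detT real_vs_target vline_source vline_target])

lemma det_tangent_iso_gen: "det_tangent_iso A B gen_source = gen_target"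
 unfolding det_tangent_iso_unique
 by (rule lmap_apply[OF real_vs_detT real_vs_target vline_source vline_mem[OF vline_target]])

end

section \<open>Continuous functions on open sets\<close>

lemma cont_on_openin:
 assumes "openin T U"
 shows "cont_on T U g \<longleftrightarrow> (\<forall>V. open V \<longrightarrow> openin T {x \<in> U. g x \<in> V})"
proof -
 have "topspace T \<inter> U = U" using openin_subset[OF assms] by auto
 thus ?thesis
  using assms unfolding cont_on_def continuous_map_def
  by (auto simp: openin_open_subtopology)
qed

text \<open>Pointwise limits reduce the sum, product, quotient and power rules below to the
  corresponding limit rules.\<close>

lemma cont_on_tendsto:
 "cont_on T U g \<longleftrightarrow> (\<forall>x\<in>topspace T \<inter> U. (g \<longlongrightarrow> g x) (atin (subtopology T U) x))"
 by (simp add: cont_on_def continuous_map_atin)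

lemma cont_on_cong:
 assumes "cont_on T U g" "\<And>x. x \<in> U ==> g x = h x"
 shows "cont_on T U h"
 using assms unfolding cont_on_def by (elim continuous_map_eq) auto

lemma cont_on_cong_iff:
 "(\<And>x. x \<in> U ==> g x = h x) ==> cont_on T U g \<longleftrightarrow> cont_on T U h"
 using cont_on_cong[of T U g h] cont_on_cong[of T U h g] by auto

lemma cont_on_subset: "cont_on T U g ==> U' \<subseteq> U ==> cont_on T U' g"
 unfolding cont_on_def using continuous_map_from_subtopology_mono by blast

lemma cont_on_Union:
 assumes "\<And>U. U \<in> \<U> ==> openin T U" "\<And>U. U \<in> \<U> ==> cont_on T U g"
 shows "cont_on T (\<Union>\<U>) g"
proof -
 have o: "openin T (\<Union>\<U>)" using assms(1) by blast
 have "openin T {x \<in> \<Union>\<U>. g x \<in> V}" if V: "open V" for V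
 proof -
  have "{x \<in> \<Union>\<U>. g x \<in> V} = (\<Union>U\<in>\<U>. {x \<in> U. g x \<in> V})" by auto
  moreover have "openin T {x \<in> U. g x \<in> V}" if "U \<in> \<U>" for U
   using assms[OF that] V cont_on_openin by blast
  ultimately show ?thesis by auto
 qed
 thus ?thesis using cont_on_openin[OF o] by blast
qed

lemma cont_on_local:
 assumes "\<And>x. x \<in> U ==> \<exists>U'. openin T U' \<and> x \<in> U' \<and> U' \<subseteq> U \<and> cont_on T U' g"
 shows "cont_on T U g"
proof -
 let ?\<U> = "{U'. openin T U' \<and> U' \<subseteq> U \<and> cont_on T U' g}"
 have "\<Union>?\<U> = U" using assms by blast
 moreover have "cont_on T (\<Union>?\<U>) g" by (rule cont_on_Union) auto
 ultimately show ?thesis by simp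
qed

lemma cont_on_const [simp]: "cont_on T U (%_. c)"
 by (simp add: cont_on_def)

lemma cont_on_add: "cont_on T U f ==> cont_on T U g ==> cont_on T U (%x. f x + g x :: 'b::real_normed_vector)"
 by (simp add: cont_on_tendsto tendsto_add)

lemma cont_on_mult: "cont_on T U f ==> cont_on T U g ==> cont_on T U (%x. f x * g x :: real)"
 by (simp add: cont_on_tendsto tendsto_mult)

lemma cont_on_scaleR:
 "cont_on T U f ==> cont_on T U g ==> cont_on T U (%x. f x *\<^sub>R g x :: 'b::real_normed_vector)"
 by (simp add: cont_on_tendsto tendsto_scaleR)

lemma cont_on_inner:
 "cont_on T U f ==> cont_on T U g ==> cont_on T U (%x. inner (f x) (g x :: 'b::real_inner))"
 by (simp add: cont_on_tendsto tendsto_inner)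

lemma cont_on_divide:
 "cont_on T U f ==> cont_on T U g ==> (\<And>x. x \<in> U ==> g x \<noteq> 0) ==> cont_on T U (%x. f x / g x :: real)"
 by (simp add: cont_on_tendsto tendsto_divide)

lemma cont_on_sum:
 "(\<And>i. i \<in> I ==> cont_on T U (f i)) ==> cont_on T U (%x. \<Sum>i\<in>I. f i x :: 'b::real_normed_vector)"
 by (simp add: cont_on_tendsto tendsto_sum)

lemma cont_on_prod:
 "(\<And>i. i \<in> I ==> cont_on T U (f i)) ==> cont_on T U (%x. \<Prod>i\<in>I. f i x :: real)"
 by (simp add: cont_on_tendsto tendsto_prod)

lemma cont_on_power: "cont_on T U f ==> cont_on T U (%x. f x ^ n :: real)"
 by (simp add: cont_on_tendsto tendsto_power)

lemma cont_on_isCont: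
 "cont_on T U f ==> (\<And>x. x \<in> U ==> isCont h (f x)) ==> cont_on T U (%x. h (f x))"
 by (simp add: cont_on_tendsto isCont_tendsto_compose)

lemma cont_on_ddet:
 "(\<And>i j. i < k ==> j < k ==> cont_on T U (%x. M x i j)) ==> cont_on T U (%x. ddet k (M x))"
 unfolding ddet_leibniz
 by (intro cont_on_sum cont_on_mult cont_on_prod cont_on_const) (auto dest: permutes_in_image)

lemma cont_on_compose:
 assumes g: "continuous_map (subtopology T U) T' g" and V: "g ` (topspace T \<inter> U) \<subseteq> V" and h: "cont_on T' V h"
 shows "cont_on T U (%x. h (g x))"
proof -
 have "continuous_map (subtopology T U) (subtopology T' V) g"
  using g V by (auto simp: continuous_map_in_subtopology)
 from continuous_map_compose[OF this h[unfolded cont_on_def]] show ?thesis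
  by (simp add: cont_on_def o_def)
qed

section \<open>Local frames\<close>

text \<open>These are the first three conditions in the definition of a vector bundle; only local triviality is missing.\<close>

definition section_sheaf :: "('x, 'e) vbundle \<Rightarrow> bool" where
 "section_sheaf E \<longleftrightarrow>
   (\<forall>x\<in>topspace (bbase E). real_vs (bfib E x)) \<and>
   (\<forall>U s. bsec E U s \<longrightarrow> openin (bbase E) U \<and> (\<forall>x\<in>U. s x \<in> vcarrier (bfib E x))) \<and>
   (\<forall>\<U> s. (\<forall>U\<in>\<U>. openin (bbase E) U) \<longrightarrow> (bsec E (\<Union>\<U>) s \<longleftrightarrow> (\<forall>U\<in>\<U>. bsec E U s)))"

text \<open>\<open>frame\<close> asks only for sections that form a basis at each point. This adds
  the local triviality clause, that the sections over open subsets are exactly the continuous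
  combinations. In a vector bundle the clause follows from \<open>frame\<close>, by
  \<open>frame_lframe\<close>.\<close>

definition lframe :: "('x, 'e) vbundle \<Rightarrow> 'x set \<Rightarrow> nat \<Rightarrow> (nat \<Rightarrow> 'x \<Rightarrow> 'e) \<Rightarrow> bool" where
 "lframe E U r b \<longleftrightarrow> openin (bbase E) U \<and> frame E U r b \<and>
   (\<forall>U' s. openin (bbase E) U' \<and> U' \<subseteq> U \<longrightarrow>
    (bsec E U' s \<longleftrightarrow>
     (\<exists>c. (\<forall>i<r. cont_on (bbase E) U' (c i)) \<and>
        (\<forall>y\<in>U'. s y = lincomb (bfib E y) r (%i. c i y) (%i. b i y)))))"

abbreviation lgen :: "('x, 'e) vbundle \<Rightarrow> 'x set \<Rightarrow> ('x \<Rightarrow> 'e) \<Rightarrow> bool" where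
 "lgen E U e \<equiv> lframe E U 1 (%_. e)"

lemma vector_bundle_iff:
 "vector_bundle r E \<longleftrightarrow> section_sheaf E \<and> (\<forall>x\<in>topspace (bbase E). \<exists>U b. x \<in> U \<and> lframe E U r b)"
 unfolding vector_bundle_def section_sheaf_def lframe_def by (simp add: conj_ac)

lemma line_bundleI:
 assumes "section_sheaf E" "\<And>x. x \<in> topspace (bbase E) ==> \<exists>U e. x \<in> U \<and> lgen E U e"
 shows "line_bundle E"
 using assms unfolding vector_bundle_iff by blast

lemma vcoord_zero:
 assumes F: "real_vs F" and b: "vs_basis F k b" and i: "i < k"
 shows "vcoord F k b (vzero F) i = 0"
 using vcoord_scale[OF F b real_vsD(1)[OF F] i, of 0] by (simp add: vscale_vzero[OF F])

lemma vs_basis_cong: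
 assumes "\<And>i. i < k ==> b i = b' i"
 shows "vs_basis F k b \<longleftrightarrow> vs_basis F k b'"
proof -
 have "lincomb F k c b = lincomb F k c b'" for c using assms by (intro lincomb_cong) auto
 thus ?thesis using assms by (simp add: vs_basis_def)
qed

lemma lframe_bsec: "lframe E U r b ==> i < r ==> bsec E U (b i)"
 unfolding lframe_def frame_def by blast

lemma lframe_cong:
 assumes b: "lframe E U r b" and eq: "\<And>i. i < r ==> b i = b' i"
 shows "lframe E U r b'"
proof -
 have l: "lincomb F r c (%i. b i y) = lincomb F r c (%i. b' i y)" for F c y
  using eq by (intro lincomb_cong) auto
 have v: "vs_basis F r (%i. b i y) \<longleftrightarrow> vs_basis F r (%i. b' i y)" for F y
  using eq by (intro vs_basis_cong) auto
 have "openin (bbase E) U \<and> ((\<forall>i<r. bsec E U (b i)) \<and>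
   (\<forall>x\<in>U. vs_basis (bfib E x) r (%i. b' i x))) \<and>
   (\<forall>U' s. openin (bbase E) U' \<and> U' \<subseteq> U \<longrightarrow>
    (bsec E U' s \<longleftrightarrow> (\<exists>c. (\<forall>i<r. cont_on (bbase E) U' (c i)) \<and>
     (\<forall>y\<in>U'. s y = lincomb (bfib E y) r (%i. c i y) (%i. b' i y)))))"
  using b[unfolded lframe_def frame_def] unfolding l v .
 moreover have "bsec E U (b' i)" if "i < r" for i using lframe_bsec[OF b that] eq[OF that] by simp
 ultimately show ?thesis unfolding lframe_def frame_def by blast
qed

context
 fixes E :: "('x, 'e) vbundle"
 assumes sh: "section_sheaf E"
begin

lemma sheaf_real_vs: "x \<in> topspace (bbase E) ==> real_vs (bfib E x)"
 using sh by (simp add: section_sheaf_def)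

lemma sheaf_openin: "bsec E U s ==> openin (bbase E) U"
 and sheaf_mem: "bsec E U s ==> x \<in> U ==> s x \<in> vcarrier (bfib E x)"
 using sh by (auto simp: section_sheaf_def)

lemma sheaf_Union: "(\<And>U. U \<in> \<U> ==> openin (bbase E) U) ==> bsec E (\<Union>\<U>) s \<longleftrightarrow> (\<forall>U\<in>\<U>. bsec E U s)"
 by (rule sh[unfolded section_sheaf_def, THEN conjunct2, THEN conjunct2, rule_format])

text \<open>Restriction is hidden in the gluing equivalence: the family \<open>{U, U'}\<close> has
  union \<open>U\<close>, so a section over \<open>U\<close> is a section over each member.\<close>

lemma sheaf_restrict:
 assumes "bsec E U s" "openin (bbase E) U'" "U' \<subseteq> U"
 shows "bsec E U' s"
proof -
 have "\<Union>{U, U'} = U" using assms(3) by auto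
 hence "bsec E (\<Union>{U, U'}) s" using assms(1) by simp
 moreover have "openin (bbase E) V" if "V \<in> {U, U'}" for V
  using that assms sheaf_openin by auto
 ultimately show ?thesis using sheaf_Union[of "{U, U'}" s] by blast
qed

lemma sheaf_local:
 assumes "\<And>x. x \<in> U ==> \<exists>U'. x \<in> U' \<and> U' \<subseteq> U \<and> bsec E U' s"
 shows "bsec E U s"
proof -
 let ?\<U> = "{U'. U' \<subseteq> U \<and> bsec E U' s}"
 have "\<Union>?\<U> = U" using assms by blast
 moreover have "bsec E (\<Union>?\<U>) s"
  using sheaf_Union[of ?\<U> s] sheaf_openin by blast
 ultimately show ?thesis by simp
qed

lemma lframe_openin: "lframe E U r b ==> openin (bbase E) U"
 by (simp add: lframe_def)

lemma lframe_basis: "lframe E U r b ==> y \<in> U ==> vs_basis (bfib E y) r (%i. b i y)"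
 by (simp add: lframe_def frame_def)

lemma lframe_real_vs: "lframe E U r b ==> y \<in> U ==> real_vs (bfib E y)"
 using sheaf_real_vs openin_subset lframe_openin by blast

lemma lframe_subset:
 assumes b: "lframe E U r b" and U': "openin (bbase E) U'" "U' \<subseteq> U"
 shows "lframe E U' r b"
 unfolding lframe_def frame_def
proof (intro conjI allI impI U'(1) ballI)
 show "bsec E U' (b i)" if "i < r" for i by (rule sheaf_restrict[OF lframe_bsec[OF b that] U'])
 show "vs_basis (bfib E x) r (%i. b i x)" if "x \<in> U'" for x using lframe_basis[OF b] that U'(2) by blast
 fix V s assume "openin (bbase E) V \<and> V \<subseteq> U'"
 hence "openin (bbase E) V \<and> V \<subseteq> U" using U'(2) by blast
 thus "bsec E V s \<longleftrightarrow> (\<exists>c. (\<forall>i<r. cont_on (bbase E) V (c i)) \<and>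
   (\<forall>y\<in>V. s y = lincomb (bfib E y) r (%i. c i y) (%i. b i y)))"
  using b unfolding lframe_def by blast
qed

text \<open>Coordinates in a basis are unique, so the existence of continuous coefficients becomes
  the continuity of definite functions. Together with \<open>lframeI\<close> this is the working
  form of local triviality.\<close>

lemma bsec_iff_coords:
 assumes b: "lframe E U r b" and U': "openin (bbase E) U'" "U' \<subseteq> U"
 shows "bsec E U' s \<longleftrightarrow> (\<forall>y\<in>U'. s y \<in> vcarrier (bfib E y)) \<and>
  (\<forall>i<r. cont_on (bbase E) U' (%y. vcoord (bfib E y) r (%i. b i y) (s y) i))"
proof -
 have iff: "bsec E U' s \<longleftrightarrow> (\<exists>c. (\<forall>i<r. cont_on (bbase E) U' (c i)) \<and>
   (\<forall>y\<in>U'. s y = lincomb (bfib E y) r (%i. c i y) (%i. b i y)))"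
  using b U' by (simp add: lframe_def)
 show ?thesis
 proof
  assume s: "bsec E U' s"
  then obtain c where c: "\<forall>i<r. cont_on (bbase E) U' (c i)"
   "\<forall>y\<in>U'. s y = lincomb (bfib E y) r (%i. c i y) (%i. b i y)"
   using iff by blast
  have vc: "vcoord (bfib E y) r (%i. b i y) (s y) i = c i y" if "y \<in> U'" "i < r" for y i
  proof -
   have y: "y \<in> U" using that U' by blast
   show ?thesis
    by (rule vcoord_unique[OF lframe_real_vs[OF b y] lframe_basis[OF b y] _ that(2)])
      (use c(2) that in blast)
  qed
  have "cont_on (bbase E) U' (%y. vcoord (bfib E y) r (%i. b i y) (s y) i)" if i: "i < r" for i
  proof -
   have "cont_on (bbase E) U' (c i)" using c(1) i by blast
   thus ?thesis by (rule cont_on_cong) (rule vc[symmetric, OF _ i])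
  qed
  thus "(\<forall>y\<in>U'. s y \<in> vcarrier (bfib E y)) \<and>
   (\<forall>i<r. cont_on (bbase E) U' (%y. vcoord (bfib E y) r (%i. b i y) (s y) i))"
   using sheaf_mem[OF s] by blast
 next
  assume a: "(\<forall>y\<in>U'. s y \<in> vcarrier (bfib E y)) \<and>
   (\<forall>i<r. cont_on (bbase E) U' (%y. vcoord (bfib E y) r (%i. b i y) (s y) i))"
  have "s y = lincomb (bfib E y) r (%i. vcoord (bfib E y) r (%i. b i y) (s y) i) (%i. b i y)"
   if "y \<in> U'" for y
  proof -
   have y: "y \<in> U" using that U' by blast
   show ?thesis by (rule vcoord_lincomb[OF lframe_basis[OF b y]]) (use a that in blast)
  qed
  thus "bsec E U' s"
   unfolding iff using a by (intro exI[of _ "%i y. vcoord (bfib E y) r (%i. b i y) (s y) i"]) blast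
 qed
qed

text \<open>Sections are total functions and \<open>bsec\<close> is a bare predicate on them; that
  values outside \<open>U\<close> do not matter comes from local frames, whose criterion mentions
  only points of the open set.\<close>

lemma bsec_cong:
 assumes "vector_bundle r E" "bsec E U s" "\<And>y. y \<in> U ==> s y = s' y"
 shows "bsec E U s'"
proof (rule sheaf_local)
 fix x assume x: "x \<in> U"
 have U: "openin (bbase E) U" using sheaf_openin[OF assms(2)] .
 hence "x \<in> topspace (bbase E)" using openin_subset x by blast
 then obtain V b where V: "x \<in> V" "lframe E V r b" using assms(1) unfolding vector_bundle_iff by blast
 have o: "openin (bbase E) (U \<inter> V)" using U lframe_openin[OF V(2)] by blast
 have "bsec E (U \<inter> V) s" using sheaf_restrict[OF assms(2) o] by blast
 moreover have iff: "bsec E (U \<inter> V) t \<longleftrightarrow> (\<exists>c. (\<forall>i<r. cont_on (bbase E) (U \<inter> V) (c i)) \<and>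
   (\<forall>y\<in>U \<inter> V. t y = lincomb (bfib E y) r (%i. c i y) (%i. b i y)))" for t
  using V(2) o unfolding lframe_def by blast
 ultimately obtain c where c: "\<forall>i<r. cont_on (bbase E) (U \<inter> V) (c i)"
   "\<forall>y\<in>U \<inter> V. s y = lincomb (bfib E y) r (%i. c i y) (%i. b i y)" by blast
 have "s' y = lincomb (bfib E y) r (%i. c i y) (%i. b i y)" if "y \<in> U \<inter> V" for y
  using c(2) assms(3)[of y] that by simp
 with c(1) have "bsec E (U \<inter> V) s'" unfolding iff by blast
 thus "\<exists>U'. x \<in> U' \<and> U' \<subseteq> U \<and> bsec E U' s'" using x V(1) by blast
qed

lemma lgen_line: "lgen E U e ==> y \<in> U ==> vline (bfib E y) (e y)"
 using lframe_basis by blast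

lemma bsec_iff_lcoef:
 assumes "lgen E U e" "openin (bbase E) U'" "U' \<subseteq> U"
 shows "bsec E U' s \<longleftrightarrow> (\<forall>y\<in>U'. s y \<in> vcarrier (bfib E y)) \<and>
  cont_on (bbase E) U' (%y. lcoef (bfib E y) (e y) (s y))"
 using bsec_iff_coords[OF assms] by auto

end

text \<open>The converse of \<open>bsec_iff_coords\<close>: the frame members are themselves
  sections because their coordinates are constantly 0 or 1.\<close>

lemma lframeI:
 assumes U: "openin (bbase E) U" and F: "\<And>y. y \<in> U ==> real_vs (bfib E y)"
  and b: "\<And>y. y \<in> U ==> vs_basis (bfib E y) r (%i. b i y)"
  and sec: "\<And>U' s. openin (bbase E) U' ==> U' \<subseteq> U ==> bsec E U' s \<longleftrightarrow>
   (\<forall>y\<in>U'. s y \<in> vcarrier (bfib E y)) \<and>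
   (\<forall>i<r. cont_on (bbase E) U' (%y. vcoord (bfib E y) r (%i. b i y) (s y) i))"
 shows "lframe E U r b"
 unfolding lframe_def frame_def
proof (intro conjI allI impI U ballI)
 fix i assume i: "i < r"
 have "cont_on (bbase E) U (%y. vcoord (bfib E y) r (%i. b i y) (b i y) j)" if "j < r" for j
  by (rule cont_on_cong[of _ _ "%_. if j = i then 1 else 0"])
    (auto simp: vcoord_basis[OF F b] i that)
 thus "bsec E U (b i)" using sec[OF U, of "b i"] vs_basis_mem[OF b i] by blast
next
 fix U' s assume U': "openin (bbase E) U' \<and> U' \<subseteq> U"
 show "bsec E U' s \<longleftrightarrow> (\<exists>c. (\<forall>i<r. cont_on (bbase E) U' (c i)) \<and>
   (\<forall>y\<in>U'. s y = lincomb (bfib E y) r (%i. c i y) (%i. b i y)))" (is "_ = ?R")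
 proof
  assume "bsec E U' s"
  hence a: "\<forall>y\<in>U'. s y \<in> vcarrier (bfib E y)"
   "\<forall>i<r. cont_on (bbase E) U' (%y. vcoord (bfib E y) r (%i. b i y) (s y) i)"
   using sec U' by blast+
  have "s y = lincomb (bfib E y) r (%i. vcoord (bfib E y) r (%i. b i y) (s y) i) (%i. b i y)"
   if "y \<in> U'" for y
  proof -
   have y: "y \<in> U" using that U' by blast
   show ?thesis by (rule vcoord_lincomb[OF b[OF y]]) (use a that in blast)
  qed
  with a(2) show ?R by (intro exI[of _ "%i y. vcoord (bfib E y) r (%i. b i y) (s y) i"]) blast
 next
  assume ?R
  then obtain c where c: "\<forall>i<r. cont_on (bbase E) U' (c i)"
   "\<forall>y\<in>U'. s y = lincomb (bfib E y) r (%i. c i y) (%i. b i y)" by blast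
  have vc: "vcoord (bfib E y) r (%i. b i y) (s y) i = c i y" if "y \<in> U'" "i < r" for y i
  proof -
   have y: "y \<in> U" using that U' by blast
   show ?thesis
    by (rule vcoord_unique[OF F[OF y] b[OF y] _ that(2)]) (use c(2) that in blast)
  qed
  have "cont_on (bbase E) U' (%y. vcoord (bfib E y) r (%i. b i y) (s y) i)" if i: "i < r" for i
  proof -
   have "cont_on (bbase E) U' (c i)" using c(1) i by blast
   thus ?thesis by (rule cont_on_cong) (rule vc[symmetric, OF _ i])
  qed
  moreover have "s y \<in> vcarrier (bfib E y)" if "y \<in> U'" for y
  proof -
   have y: "y \<in> U" using that U' by blast
   have "lincomb (bfib E y) r (%i. c i y) (%i. b i y) \<in> vcarrier (bfib E y)"
    by (rule lincomb_closed[OF F[OF y]]) (rule vs_basis_mem[OF b[OF y]])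
   thus ?thesis using c(2) that by simp
  qed
  ultimately show "bsec E U' s" using sec U' by blast
 qed
qed (rule b)

lemma lgenI:
 assumes "openin (bbase E) U" "\<And>y. y \<in> U ==> real_vs (bfib E y)"
  and "\<And>y. y \<in> U ==> vline (bfib E y) (e y)"
  and "\<And>U' s. openin (bbase E) U' ==> U' \<subseteq> U ==> bsec E U' s \<longleftrightarrow>
   (\<forall>y\<in>U'. s y \<in> vcarrier (bfib E y)) \<and> cont_on (bbase E) U' (%y. lcoef (bfib E y) (e y) (s y))"
 shows "lgen E U e"
 by (rule lframeI) (use assms in auto)

text \<open>Sections of bundles of homomorphisms and of forms are those that behave well on test
  data \<open>t\<close>: a section, a sequence of sections or a pair. If test data restrict and the
  good behaviour \<open>R\<close> glues, the sheaf conditions follow once for all of these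
  constructions.\<close>

lemma sheaf_test:
 assumes fib: "\<And>x. x \<in> topspace (bbase E) ==> real_vs (bfib E x)"
  and sec: "\<And>U s. bsec E U s \<longleftrightarrow> openin (bbase E) U \<and> (\<forall>x\<in>U. s x \<in> vcarrier (bfib E x)) \<and>
   (\<forall>U' t. U' \<subseteq> U \<and> Q U' t \<longrightarrow> R U' s t)"
  and Qo: "\<And>U t. Q U t ==> openin (bbase E) U"
  and Qr: "\<And>U U' t. Q U t ==> openin (bbase E) U' ==> U' \<subseteq> U ==> Q U' t"
  and R: "\<And>\<U> s t. (\<And>U. U \<in> \<U> ==> openin (bbase E) U \<and> R U s t) ==> R (\<Union>\<U>) s t"
 shows "section_sheaf E"
 unfolding section_sheaf_def
proof (intro conjI allI impI)
 fix \<U> :: "'a set set" and s assume o: "\<forall>U\<in>\<U>. openin (bbase E) U"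
 show "bsec E (\<Union>\<U>) s \<longleftrightarrow> (\<forall>U\<in>\<U>. bsec E U s)"
 proof
  assume "bsec E (\<Union>\<U>) s"
  thus "\<forall>U\<in>\<U>. bsec E U s" unfolding sec using o by blast
 next
  assume a: "\<forall>U\<in>\<U>. bsec E U s"
  have "R U' s t" if U': "U' \<subseteq> \<Union>\<U>" "Q U' t" for U' t
  proof -
   \<comment> \<open>Test data over \<open>U'\<close> need not live over a single member of the
     cover, so they are cut down to the intersections, tested there, and the results are glued
     back.\<close>
   have "R (\<Union>((%U. U \<inter> U') ` \<U>)) s t"
   proof (rule R)
    fix V assume "V \<in> (%U. U \<inter> U') ` \<U>"
    then obtain U where U: "U \<in> \<U>" "V = U \<inter> U'" by blast
    hence V: "openin (bbase E) V" using o Qo[OF U'(2)] by blast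
    have "Q V t" using Qr[OF U'(2) V] U(2) by blast
    moreover have "\<forall>U' t. U' \<subseteq> U \<and> Q U' t \<longrightarrow> R U' s t" using sec[of U s] a U(1) by blast
    ultimately show "openin (bbase E) V \<and> R V s t" using V U(2) by blast
   qed
   moreover have "\<Union>((%U. U \<inter> U') ` \<U>) = U'" using U'(1) by blast
   ultimately show ?thesis by simp
  qed
  thus "bsec E (\<Union>\<U>) s" using a o unfolding sec by blast
 qed
qed (use fib sec in blast)+

section \<open>Frames of the derived bundles\<close>

lemma trivial_bundle_simps [simp]: "bbase (trivial_bundle T F) = T" "bfib (trivial_bundle T F) = (%_. F)"
 by (simp_all add: trivial_bundle_def)

lemma trivial_bundle_sheaf:
 assumes "real_vs F"
 shows "section_sheaf (trivial_bundle T F)"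
 unfolding section_sheaf_def
proof (intro conjI allI impI)
 fix \<U> :: "'b set set" and s :: "'b \<Rightarrow> 'a" assume o: "\<forall>U\<in>\<U>. openin (bbase (trivial_bundle T F)) U"
 have c: "cont_on T (\<Union>\<U>) g \<longleftrightarrow> (\<forall>U\<in>\<U>. cont_on T U g)" for g :: "'b \<Rightarrow> real"
 proof (intro iffI ballI)
  show "cont_on T U g" if "cont_on T (\<Union>\<U>) g" "U \<in> \<U>" for U
   using that cont_on_subset[OF that(1) Union_upper[OF that(2)]] by simp
  show "cont_on T (\<Union>\<U>) g" if "\<forall>U\<in>\<U>. cont_on T U g"
   by (rule cont_on_Union) (use o that in auto)
 qed
 have sec: "bsec (trivial_bundle T F) W s \<longleftrightarrow> openin T W \<and> (\<forall>x\<in>W. s x \<in> vcarrier F) \<and>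
   (\<forall>p\<in>vcarrier (vs_dual F). cont_on T W (%x. p (s x)))" for W
  by (simp add: trivial_bundle_def)
 have "openin T (\<Union>\<U>)" "\<forall>U\<in>\<U>. openin T U" using o by auto
 thus "bsec (trivial_bundle T F) (\<Union>\<U>) s \<longleftrightarrow> (\<forall>U\<in>\<U>. bsec (trivial_bundle T F) U s)"
  unfolding sec c by (simp only: Union_iff simp_thms Ball_def Bex_def) meson
qed (use assms in \<open>auto simp: trivial_bundle_def\<close>)

lemma lgen_trivial:
 assumes F: "real_vs F" and e: "vline F e" and U: "openin T U"
 shows "lgen (trivial_bundle T F) U (%_. e)"
proof (rule lgenI)
 fix U' and s :: "_ \<Rightarrow> 'a" assume U': "openin (bbase (trivial_bundle T F)) U'"
 have "p x = p e * lcoef F e x" if "p \<in> vcarrier (vs_dual F)" "x \<in> vcarrier F" for p x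
  using lcoef_scale[OF F e that(2)] that(1) vline_mem[OF e] unfolding vs_dual_iff by (metis mult.commute)
 hence "cont_on T U' (%x. p (s x))"
  if "\<forall>y\<in>U'. s y \<in> vcarrier F" "cont_on T U' (%y. lcoef F e (s y))" "p \<in> vcarrier (vs_dual F)" for p
  using that by (intro cont_on_cong[OF cont_on_mult[OF cont_on_const[of _ _ "p e"] that(2)]]) auto
 moreover have "cont_on T U' (%y. lcoef F e (s y))"
  if "\<forall>y\<in>U'. s y \<in> vcarrier F" "\<forall>p\<in>vcarrier (vs_dual F). cont_on T U' (%x. p (s x))"
 proof (rule cont_on_cong)
  show "cont_on T U' (%x. dual_vec F e (s x))" using that(2) dual_vec_mem[OF F e] by blast
  show "dual_vec F e (s x) = lcoef F e (s x)" if "x \<in> U'" for x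
   using \<open>\<forall>y\<in>U'. s y \<in> vcarrier F\<close> that by (simp add: dual_vec_def lmap_def)
 qed
 ultimately show "bsec (trivial_bundle T F) U' s \<longleftrightarrow>
   (\<forall>y\<in>U'. s y \<in> vcarrier (bfib (trivial_bundle T F) y)) \<and>
   cont_on (bbase (trivial_bundle T F)) U' (%y. lcoef (bfib (trivial_bundle T F) y) e (s y))"
  using U' by (auto simp: trivial_bundle_def)
qed (use assms in auto)

lemma bsec_real_line:
 assumes "openin T U"
 shows "bsec (trivial_bundle T real_line) U s \<longleftrightarrow> cont_on T U s"
proof -
 have v: "vline real_line 1" by (rule vlineI) auto
 have "lcoef real_line 1 x = x" for x using lcoef_unique[OF _ v, of x] by simp
 thus ?thesis
  using bsec_iff_lcoef[OF trivial_bundle_sheaf lgen_trivial[OF _ v], of T U U s] assms by simp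
qed

lemma hom_bundle_simps [simp]:
 "bbase (hom_bundle E F) = bbase E" "bfib (hom_bundle E F) = (%x. vs_hom (bfib E x) (bfib F x))"
 by (simp_all add: hom_bundle_def)

lemma hom_bundle_sheaf:
 assumes E: "section_sheaf E" and F: "section_sheaf F" and base: "bbase F = bbase E"
 shows "section_sheaf (hom_bundle E F)"
proof (rule sheaf_test[where Q = "bsec E" and R = "%U \<phi> s. bsec F U (%x. \<phi> x (s x))"])
 show "bsec (hom_bundle E F) U s \<longleftrightarrow> openin (bbase (hom_bundle E F)) U \<and>
   (\<forall>x\<in>U. s x \<in> vcarrier (bfib (hom_bundle E F) x)) \<and>
   (\<forall>U' t. U' \<subseteq> U \<and> bsec E U' t \<longrightarrow> bsec F U' (%x. s x (t x)))" for U s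
  by (simp add: hom_bundle_def)
next
 fix \<U> s t assume a: "\<And>U. U \<in> \<U> ==> openin (bbase (hom_bundle E F)) U \<and> bsec F U (%x. s x (t x))"
 hence "\<And>U. U \<in> \<U> ==> openin (bbase F) U" by (simp add: base)
 from sheaf_Union[OF F, of \<U>, OF this] a show "bsec F (\<Union>\<U>) (%x. s x (t x))" by blast
next
 show "real_vs (bfib (hom_bundle E F) x)" if "x \<in> topspace (bbase (hom_bundle E F))" for x
  using that sheaf_real_vs[OF E] sheaf_real_vs[OF F] by (simp add: real_vs_hom base)
 show "openin (bbase (hom_bundle E F)) U" if "bsec E U t" for U t
  using sheaf_openin[OF E that] by simp
 show "bsec E U' t" if "bsec E U t" "openin (bbase (hom_bundle E F)) U'" "U' \<subseteq> U" for U U' t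
  using sheaf_restrict[OF E that(1)] that by simp
qed

lemma dual_bundle_simps [simp]:
 "bbase (dual_bundle E) = bbase E" "bfib (dual_bundle E) = (%x. vs_dual (bfib E x))"
 by (simp_all add: dual_bundle_def vs_dual_def)

lemma dual_bundle_sheaf: "section_sheaf E ==> section_sheaf (dual_bundle E)"
 unfolding dual_bundle_def by (intro hom_bundle_sheaf trivial_bundle_sheaf) auto

text \<open>If \<eta> \<open>(e) = 1\<close>, the coefficient of a functional with respect to \<eta>
  is its value on \<open>e\<close>. Testing continuity on \<open>e\<close> suffices, since every
  other section is a continuous multiple of it.\<close>

lemma lgen_dual:
 assumes sh: "section_sheaf E" and e: "lgen E U e"
  and \<eta>: "\<And>y. y \<in> U ==> \<eta> y \<in> vcarrier (vs_dual (bfib E y))" "\<And>y. y \<in> U ==> \<eta> y (e y) = 1"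
 shows "lgen (dual_bundle E) U \<eta>"
proof (rule lgenI)
 note R = lframe_real_vs[OF sh e] and L = lgen_line[OF sh e]
 have U: "openin (bbase E) U" using lframe_openin[OF sh e] .
 thus "openin (bbase (dual_bundle E)) U" by simp
 show "vline (bfib (dual_bundle E) y) (\<eta> y)" if "y \<in> U" for y
  using vline_dual[OF R[OF that] L[OF that] \<eta>(1)[OF that]] \<eta>(2)[OF that] by simp
 show "real_vs (bfib (dual_bundle E) y)" if "y \<in> U" for y
  using R[OF that] by (simp add: real_vs_dual)
 have lc: "lcoef (vs_dual (bfib E y)) (\<eta> y) p = p (e y)"
  if y: "y \<in> U" and p: "p \<in> vcarrier (vs_dual (bfib E y))" for y p
 proof -
  have vl: "vline (vs_dual (bfib E y)) (\<eta> y)"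
   using vline_dual[OF R[OF y] L[OF y] \<eta>(1)[OF y]] \<eta>(2)[OF y] by simp
  have "p (e y) = vscale (vs_dual (bfib E y)) (lcoef (vs_dual (bfib E y)) (\<eta> y) p) (\<eta> y) (e y)"
   using lcoef_scale[OF real_vs_dual[OF R[OF y]] vl p] by simp
  thus ?thesis using \<eta>(2)[OF y] vline_mem[OF L[OF y]] by simp
 qed
 fix U' \<phi> assume U': "openin (bbase (dual_bundle E)) U'" "U' \<subseteq> U"
 have sub: "openin (bbase E) V" if "bsec E V s" for V s using sheaf_openin[OF sh that] .
 show "bsec (dual_bundle E) U' \<phi> \<longleftrightarrow> (\<forall>y\<in>U'. \<phi> y \<in> vcarrier (bfib (dual_bundle E) y)) \<and>
   cont_on (bbase (dual_bundle E)) U' (%y. lcoef (bfib (dual_bundle E) y) (\<eta> y) (\<phi> y))"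
 proof (cases "\<forall>y\<in>U'. \<phi> y \<in> vcarrier (vs_dual (bfib E y))")
  case True
  have "cont_on (bbase E) U' (%y. lcoef (vs_dual (bfib E y)) (\<eta> y) (\<phi> y))
    \<longleftrightarrow> cont_on (bbase E) U' (%y. \<phi> y (e y))"
   by (rule cont_on_cong_iff, rule lc) (use True U'(2) in auto)
  moreover have "(\<forall>V s. V \<subseteq> U' \<and> bsec E V s \<longrightarrow> cont_on (bbase E) V (%x. \<phi> x (s x)))
    \<longleftrightarrow> cont_on (bbase E) U' (%y. \<phi> y (e y))"
  proof
   assume "\<forall>V s. V \<subseteq> U' \<and> bsec E V s \<longrightarrow> cont_on (bbase E) V (%x. \<phi> x (s x))"
   moreover have "bsec E U' e"
    using lframe_bsec[OF e, of 0] sheaf_restrict[OF sh] U' by auto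
   ultimately show "cont_on (bbase E) U' (%y. \<phi> y (e y))" by blast
  next
   assume c: "cont_on (bbase E) U' (%y. \<phi> y (e y))"
   show "\<forall>V s. V \<subseteq> U' \<and> bsec E V s \<longrightarrow> cont_on (bbase E) V (%x. \<phi> x (s x))"
   proof (intro allI impI; elim conjE)
    fix V s assume V: "V \<subseteq> U'" and s: "bsec E V s"
    have VU: "V \<subseteq> U" using V U'(2) by blast
    have m: "s y \<in> vcarrier (bfib E y)" if "y \<in> V" for y using sheaf_mem[OF sh s that] .
    have "cont_on (bbase E) V (%y. lcoef (bfib E y) (e y) (s y))"
     using bsec_iff_lcoef[OF sh e sub[OF s] VU] s by blast
    from cont_on_mult[OF this cont_on_subset[OF c V]] show "cont_on (bbase E) V (%x. \<phi> x (s x))"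
    proof (rule cont_on_cong)
     fix y assume y: "y \<in> V"
     hence "\<phi> y \<in> vcarrier (vs_dual (bfib E y))" using True V by blast
     moreover have "s y = vscale (bfib E y) (lcoef (bfib E y) (e y) (s y)) (e y)"
      using lcoef_scale[OF R L m[OF y]] y VU by blast
     ultimately show "lcoef (bfib E y) (e y) (s y) * \<phi> y (e y) = \<phi> y (s y)"
      using vline_mem[OF L] y VU unfolding vs_dual_iff by (metis subsetD)
    qed
   qed
  qed
  moreover have "(\<forall>V s. V \<subseteq> U' \<and> bsec E V s \<longrightarrow> bsec (trivial_bundle (bbase E) real_line) V (%x. \<phi> x (s x)))
    \<longleftrightarrow> (\<forall>V s. V \<subseteq> U' \<and> bsec E V s \<longrightarrow> cont_on (bbase E) V (%x. \<phi> x (s x)))"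
   using bsec_real_line[OF sub] by blast
  ultimately show ?thesis
   using True U' by (simp add: dual_bundle_def hom_bundle_def vs_dual_def)
 next
  case False
  thus ?thesis by (auto simp: dual_bundle_def hom_bundle_def vs_dual_def)
 qed
qed

lemma top_forms_bundle_simps [simp]:
 "bbase (top_forms_bundle E) = bbase E" "bfib (top_forms_bundle E) = (%x. top_forms (bfib E x))"
 by (simp_all add: top_forms_bundle_def)

lemma mult_forms_bundle_simps [simp]:
 "bbase (mult_forms_bundle k E) = bbase E" "bfib (mult_forms_bundle k E) = (%x. mult_forms k (bfib E x))"
 by (simp_all add: mult_forms_bundle_def)

lemma bilin_forms_bundle_simps [simp]:
 "bbase (bilin_forms_bundle E F) = bbase E"
 "bfib (bilin_forms_bundle E F) = (%x. bilin_forms (bfib E x) (bfib F x))"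
 by (simp_all add: bilin_forms_bundle_def)

lemma cont_on_Union':
 "(\<And>U. U \<in> \<U> ==> openin T U \<and> cont_on T U g) ==> cont_on T (\<Union>\<U>) g"
 by (rule cont_on_Union) auto

lemma top_forms_bundle_sheaf:
 assumes E: "section_sheaf E"
 shows "section_sheaf (top_forms_bundle E)"
 by (rule sheaf_test[where Q = "%U s. openin (bbase E) U \<and> (\<forall>i. bsec E U (s i))"
    and R = "%U w s. cont_on (bbase E) U (%x. w x (\<lambda>i\<in>{..<vs_dim (bfib E x)}. s i x))"])
   (auto intro: sheaf_restrict[OF E] real_vs_top_forms sheaf_real_vs[OF E] cont_on_Union'
    simp: top_forms_bundle_def)

lemma mult_forms_bundle_sheaf:
 assumes E: "section_sheaf E"
 shows "section_sheaf (mult_forms_bundle k E)"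
 by (rule sheaf_test[where Q = "%U s. openin (bbase E) U \<and> (\<forall>i. bsec E U (s i))"
    and R = "%U w s. cont_on (bbase E) U (%x. w x (\<lambda>i\<in>{..<k}. s i x))"])
   (auto intro: sheaf_restrict[OF E] real_vs_mult_forms sheaf_real_vs[OF E] cont_on_Union'
    simp: mult_forms_bundle_def)

lemma bilin_forms_bundle_sheaf:
 assumes E: "section_sheaf E" and F: "section_sheaf F" and base: "bbase F = bbase E"
 shows "section_sheaf (bilin_forms_bundle E F)"
 by (rule sheaf_test[where Q = "%U st. bsec E U (fst st) \<and> bsec F U (snd st)"
    and R = "%U w st. cont_on (bbase E) U (%x. w x (fst st x, snd st x))"])
   (use base in \<open>auto intro: sheaf_restrict[OF E] sheaf_restrict[OF F] real_vs_bilin_forms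
    sheaf_real_vs[OF E] sheaf_real_vs[OF F, unfolded base] cont_on_Union' sheaf_openin[OF E]
    simp: bilin_forms_bundle_def\<close>)

text \<open>A form over \<open>U\<close> is continuous iff its value on the frame is, since its value on arbitrary
 sections is obtained from it by multiplication with a polynomial in their coordinates.\<close>

lemma cont_on_dform:
 assumes sh: "section_sheaf E" and b: "lframe E U r b" and V: "openin (bbase E) V" "V \<subseteq> U"
  and s: "\<And>i. i < r ==> bsec E V (s i)"
 shows "cont_on (bbase E) V (%x. dform (bfib E x) r (%i. b i x) (%i. s i x))"
 unfolding dform_def using bsec_iff_coords[OF sh b V] s by (intro cont_on_ddet) blast

lemma lgen_top_forms:
 assumes sh: "section_sheaf E" and b: "lframe E U r b"
 shows "lgen (top_forms_bundle E) U (%y. topform (bfib E y) r (%i. b i y))"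
proof (rule lgenI)
 note R = lframe_real_vs[OF sh b] and B = lframe_basis[OF sh b]
 show U: "openin (bbase (top_forms_bundle E)) U" using lframe_openin[OF sh b] by simp
 show "real_vs (bfib (top_forms_bundle E) y)" if "y \<in> U" for y
  using R[OF that] by (simp add: real_vs_top_forms)
 show "vline (bfib (top_forms_bundle E) y) (topform (bfib E y) r (%i. b i y))" if "y \<in> U" for y
  using vline_top_forms[OF R[OF that] B[OF that]] by simp
 fix V w assume V: "openin (bbase (top_forms_bundle E)) V" "V \<subseteq> U"
 have lc: "lcoef (top_forms (bfib E y)) (topform (bfib E y) r (%i. b i y)) u
   = u (restrict (%i. b i y) {..<r})" if y: "y \<in> U" and u: "u \<in> vcarrier (top_forms (bfib E y))" for y u
 proof -
  let ?F = "bfib E y" and ?D = "topform (bfib E y) r (%i. b i y)"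
  have "u = vscale (top_forms ?F) (u (restrict (%i. b i y) {..<r})) ?D"
   by (subst top_form_eq[OF R[OF y] B[OF y] u])
     (auto simp: topform_def top_forms_def vs_dim_eq[OF R[OF y] B[OF y]])
  thus ?thesis
   using lcoef_unique[OF real_vs_top_forms[OF R[OF y]] vline_top_forms[OF R[OF y] B[OF y]]] by metis
 qed
 show "bsec (top_forms_bundle E) V w \<longleftrightarrow> (\<forall>y\<in>V. w y \<in> vcarrier (bfib (top_forms_bundle E) y)) \<and>
   cont_on (bbase (top_forms_bundle E)) V
    (%y. lcoef (bfib (top_forms_bundle E) y) (topform (bfib E y) r (%i. b i y)) (w y))"
 proof (cases "\<forall>y\<in>V. w y \<in> vcarrier (top_forms (bfib E y))")
  case True
  have "cont_on (bbase E) V (%y. lcoef (top_forms (bfib E y)) (topform (bfib E y) r (%i. b i y)) (w y))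
    \<longleftrightarrow> cont_on (bbase E) V (%y. w y (restrict (%i. b i y) {..<r}))"
   by (rule cont_on_cong_iff, rule lc) (use True V(2) in auto)
  moreover have "(\<forall>U' s. U' \<subseteq> V \<and> openin (bbase E) U' \<and> (\<forall>i. bsec E U' (s i)) \<longrightarrow>
      cont_on (bbase E) U' (%x. w x (\<lambda>i\<in>{..<vs_dim (bfib E x)}. s i x)))
    \<longleftrightarrow> cont_on (bbase E) V (%y. w y (restrict (%i. b i y) {..<r}))"
  proof
   assume a: "\<forall>U' s. U' \<subseteq> V \<and> openin (bbase E) U' \<and> (\<forall>i. bsec E U' (s i)) \<longrightarrow>
      cont_on (bbase E) U' (%x. w x (\<lambda>i\<in>{..<vs_dim (bfib E x)}. s i x))"
   \<comment> \<open>The test demands a section for every index, also beyond the rank. The frame is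
     therefore padded with the zero section, which also covers rank 0.\<close>
   define z where "z i = (if i < r then b i else (%y. vzero (bfib E y)))" for i
   have "cont_on (bbase E) V (%y. vcoord (bfib E y) r (%i. b i y) (vzero (bfib E y)) i)"
    if i: "i < r" for i
   proof (rule cont_on_cong[OF cont_on_const[of _ _ 0]])
    fix y assume "y \<in> V"
    hence "y \<in> U" using V(2) by blast
    from vcoord_zero[OF R[OF this] B[OF this] i]
    show "0 = vcoord (bfib E y) r (%i. b i y) (vzero (bfib E y)) i" by simp
   qed
   moreover have "vzero (bfib E y) \<in> vcarrier (bfib E y)" if "y \<in> V" for y
    using real_vsD(1)[OF R] that V(2) by blast
   ultimately have "bsec E V (%y. vzero (bfib E y))"
    using bsec_iff_coords[OF sh b, of V "%y. vzero (bfib E y)"] V by simp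
   hence "bsec E V (z i)" for i
    using lframe_bsec[OF b, of i] sheaf_restrict[OF sh, of U "b i" V] V by (auto simp: z_def)
   hence "cont_on (bbase E) V (%x. w x (\<lambda>i\<in>{..<vs_dim (bfib E x)}. z i x))"
    using a V by auto
   thus "cont_on (bbase E) V (%y. w y (restrict (%i. b i y) {..<r}))"
   proof (rule cont_on_cong)
    fix y assume "y \<in> V"
    hence "vs_dim (bfib E y) = r" using vs_dim_eq[OF R B] V(2) by blast
    moreover have "(\<lambda>i\<in>{..<r}. z i y) = restrict (%i. b i y) {..<r}" by (auto simp: z_def)
    ultimately show "w y (\<lambda>i\<in>{..<vs_dim (bfib E y)}. z i y) = w y (restrict (%i. b i y) {..<r})"
     by simp
   qed
  next
   assume c: "cont_on (bbase E) V (%y. w y (restrict (%i. b i y) {..<r}))"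
   show "\<forall>U' s. U' \<subseteq> V \<and> openin (bbase E) U' \<and> (\<forall>i. bsec E U' (s i)) \<longrightarrow>
      cont_on (bbase E) U' (%x. w x (\<lambda>i\<in>{..<vs_dim (bfib E x)}. s i x))"
   proof (intro allI impI; elim conjE)
    fix U' and s :: "nat \<Rightarrow> _" assume U': "U' \<subseteq> V" "openin (bbase E) U'" and s: "\<forall>i. bsec E U' (s i)"
    have UU: "U' \<subseteq> U" using U'(1) V(2) by blast
    have "cont_on (bbase E) U' (%x. dform (bfib E x) r (%i. b i x) (%i. s i x))"
     using cont_on_dform[OF sh b U'(2) UU] s by blast
    from cont_on_mult[OF cont_on_subset[OF c U'(1)] this]
    show "cont_on (bbase E) U' (%x. w x (\<lambda>i\<in>{..<vs_dim (bfib E x)}. s i x))"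
    proof (rule cont_on_cong)
     fix y assume y: "y \<in> U'"
     hence yU: "y \<in> U" using UU by blast
     have "w y \<in> vcarrier (top_forms (bfib E y))" using True y U'(1) by blast
     from top_form_apply[OF R[OF yU] B[OF yU] this, of "%i. s i y"]
     show "w y (restrict (%i. b i y) {..<r}) * dform (bfib E y) r (%i. b i y) (%i. s i y)
      = w y (\<lambda>i\<in>{..<vs_dim (bfib E y)}. s i y)"
      using sheaf_mem[OF sh s[rule_format] y] by (simp add: vs_dim_eq[OF R[OF yU] B[OF yU]])
    qed
   qed
  qed
  ultimately show ?thesis using True V by (simp add: top_forms_bundle_def)
 next
  case False
  thus ?thesis by (auto simp: top_forms_bundle_def)
 qed
qed

lemma lgen_mult_forms:
 assumes sh: "section_sheaf E" and e: "lgen E U e"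
 shows "lgen (mult_forms_bundle k E) U (%y. mform k (bfib E y) (e y))"
proof (rule lgenI)
 note R = lframe_real_vs[OF sh e] and L = lgen_line[OF sh e]
 show U: "openin (bbase (mult_forms_bundle k E)) U" using lframe_openin[OF sh e] by simp
 show "real_vs (bfib (mult_forms_bundle k E) y)" if "y \<in> U" for y
  using R[OF that] by (simp add: real_vs_mult_forms)
 show "vline (bfib (mult_forms_bundle k E) y) (mform k (bfib E y) (e y))" if "y \<in> U" for y
  using vline_mult_forms[OF R[OF that] L[OF that]] by simp
 fix V w assume V: "openin (bbase (mult_forms_bundle k E)) V" "V \<subseteq> U"
 have lc: "lcoef (mult_forms k (bfib E y)) (mform k (bfib E y) (e y)) u = u (\<lambda>i\<in>{..<k}. e y)"
  if y: "y \<in> U" and u: "u \<in> vcarrier (mult_forms k (bfib E y))" for y u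
 proof -
  let ?F = "bfib E y"
  have "u (\<lambda>i\<in>{..<k}. e y)
   = vscale (mult_forms k ?F) (lcoef (mult_forms k ?F) (mform k ?F (e y)) u) (mform k ?F (e y)) (\<lambda>i\<in>{..<k}. e y)"
   using lcoef_scale[OF real_vs_mult_forms[OF R[OF y]] vline_mult_forms[OF R[OF y] L[OF y]] u] by simp
  thus ?thesis
   using const_tuple[OF vline_mem[OF L[OF y]], of k] mform_self[OF R[OF y] L[OF y], of k] by simp
 qed
 show "bsec (mult_forms_bundle k E) V w \<longleftrightarrow> (\<forall>y\<in>V. w y \<in> vcarrier (bfib (mult_forms_bundle k E) y)) \<and>
   cont_on (bbase (mult_forms_bundle k E)) V
    (%y. lcoef (bfib (mult_forms_bundle k E) y) (mform k (bfib E y) (e y)) (w y))"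
 proof (cases "\<forall>y\<in>V. w y \<in> vcarrier (mult_forms k (bfib E y))")
  case True
  have "cont_on (bbase E) V (%y. lcoef (mult_forms k (bfib E y)) (mform k (bfib E y) (e y)) (w y))
    \<longleftrightarrow> cont_on (bbase E) V (%y. w y (\<lambda>i\<in>{..<k}. e y))"
   by (rule cont_on_cong_iff, rule lc) (use True V(2) in auto)
  moreover have "(\<forall>U' s. U' \<subseteq> V \<and> openin (bbase E) U' \<and> (\<forall>i. bsec E U' (s i)) \<longrightarrow>
      cont_on (bbase E) U' (%x. w x (\<lambda>i\<in>{..<k}. s i x)))
    \<longleftrightarrow> cont_on (bbase E) V (%y. w y (\<lambda>i\<in>{..<k}. e y))"
  proof
   assume a: "\<forall>U' s. U' \<subseteq> V \<and> openin (bbase E) U' \<and> (\<forall>i. bsec E U' (s i)) \<longrightarrow>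
      cont_on (bbase E) U' (%x. w x (\<lambda>i\<in>{..<k}. s i x))"
   have "bsec E V e" using lframe_bsec[OF e, of 0] sheaf_restrict[OF sh, of U e V] V by auto
   thus "cont_on (bbase E) V (%y. w y (\<lambda>i\<in>{..<k}. e y))" 
    using a[rule_format, of V "%_. e"] V by auto
  next
   assume c: "cont_on (bbase E) V (%y. w y (\<lambda>i\<in>{..<k}. e y))"
   show "\<forall>U' s. U' \<subseteq> V \<and> openin (bbase E) U' \<and> (\<forall>i. bsec E U' (s i)) \<longrightarrow>
      cont_on (bbase E) U' (%x. w x (\<lambda>i\<in>{..<k}. s i x))"
   proof (intro allI impI; elim conjE)
    fix U' and s :: "nat \<Rightarrow> _" assume U': "U' \<subseteq> V" "openin (bbase E) U'" and s: "\<forall>i. bsec E U' (s i)"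
    have UU: "U' \<subseteq> U" using U'(1) V(2) by blast
    have "cont_on (bbase E) U' (%x. \<Prod>i<k. lcoef (bfib E x) (e x) (s i x))"
     using bsec_iff_lcoef[OF sh e U'(2) UU] s by (intro cont_on_prod) blast
    from cont_on_mult[OF this cont_on_subset[OF c U'(1)]]
    show "cont_on (bbase E) U' (%x. w x (\<lambda>i\<in>{..<k}. s i x))"
    proof (rule cont_on_cong)
     fix y assume y: "y \<in> U'"
     hence yU: "y \<in> U" using UU by blast
     have "w y \<in> vcarrier (mult_forms k (bfib E y))" using True y U'(1) by blast
     from mult_form_line[OF R[OF yU] L[OF yU] this, of "%i. s i y"]
     show "(\<Prod>i<k. lcoef (bfib E y) (e y) (s i y)) * w y (\<lambda>i\<in>{..<k}. e y) = w y (\<lambda>i\<in>{..<k}. s i y)"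
      using sheaf_mem[OF sh s[rule_format] y] by simp
    qed
   qed
  qed
  ultimately show ?thesis using True V by (simp add: mult_forms_bundle_def)
 next
  case False
  thus ?thesis by (auto simp: mult_forms_bundle_def)
 qed
qed

lemma lgen_bilin_forms:
 assumes E: "section_sheaf E" and e: "lgen E U e" and F: "section_sheaf F" and f: "lgen F U f"
  and base: "bbase F = bbase E"
 shows "lgen (bilin_forms_bundle E F) U (%y. bform (bfib E y) (bfib F y) (e y) (f y))"
proof (rule lgenI)
 note R = lframe_real_vs[OF E e] and L = lgen_line[OF E e]
 note R' = lframe_real_vs[OF F f] and L' = lgen_line[OF F f]
 show U: "openin (bbase (bilin_forms_bundle E F)) U" using lframe_openin[OF E e] by simp
 show "real_vs (bfib (bilin_forms_bundle E F) y)" if "y \<in> U" for y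
  using R[OF that] R'[OF that] by (simp add: real_vs_bilin_forms)
 show "vline (bfib (bilin_forms_bundle E F) y) (bform (bfib E y) (bfib F y) (e y) (f y))" if "y \<in> U" for y
  using vline_bilin_forms[OF R[OF that] R'[OF that] L[OF that] L'[OF that]] by simp
 fix V w assume V: "openin (bbase (bilin_forms_bundle E F)) V" "V \<subseteq> U"
 have lc: "lcoef (bilin_forms (bfib E y) (bfib F y)) (bform (bfib E y) (bfib F y) (e y) (f y)) u = u (e y, f y)"
  if y: "y \<in> U" and u: "u \<in> vcarrier (bilin_forms (bfib E y) (bfib F y))" for y u
 proof -
  let ?B = "bilin_forms (bfib E y) (bfib F y)" and ?b = "bform (bfib E y) (bfib F y) (e y) (f y)"
  have "u (e y, f y) = vscale ?B (lcoef ?B ?b u) ?b (e y, f y)"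
   using lcoef_scale[OF real_vs_bilin_forms[OF R[OF y] R'[OF y]]
     vline_bilin_forms[OF R[OF y] R'[OF y] L[OF y] L'[OF y]] u] by simp
  thus ?thesis
   using vline_mem[OF L[OF y]] vline_mem[OF L'[OF y]] bform_self[OF R[OF y] R'[OF y] L[OF y] L'[OF y]] by simp
 qed
 show "bsec (bilin_forms_bundle E F) V w \<longleftrightarrow> (\<forall>y\<in>V. w y \<in> vcarrier (bfib (bilin_forms_bundle E F) y)) \<and>
   cont_on (bbase (bilin_forms_bundle E F)) V
    (%y. lcoef (bfib (bilin_forms_bundle E F) y) (bform (bfib E y) (bfib F y) (e y) (f y)) (w y))"
 proof (cases "\<forall>y\<in>V. w y \<in> vcarrier (bilin_forms (bfib E y) (bfib F y))")
  case True
  have "cont_on (bbase E) V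
    (%y. lcoef (bilin_forms (bfib E y) (bfib F y)) (bform (bfib E y) (bfib F y) (e y) (f y)) (w y))
    \<longleftrightarrow> cont_on (bbase E) V (%y. w y (e y, f y))"
   by (rule cont_on_cong_iff, rule lc) (use True V(2) in auto)
  moreover have "(\<forall>U' s t. U' \<subseteq> V \<and> bsec E U' s \<and> bsec F U' t \<longrightarrow> cont_on (bbase E) U' (%x. w x (s x, t x)))
    \<longleftrightarrow> cont_on (bbase E) V (%y. w y (e y, f y))"
  proof
   assume a: "\<forall>U' s t. U' \<subseteq> V \<and> bsec E U' s \<and> bsec F U' t \<longrightarrow> cont_on (bbase E) U' (%x. w x (s x, t x))"
   have "bsec E V e" using lframe_bsec[OF e, of 0] sheaf_restrict[OF E, of U e V] V by auto
   moreover have "bsec F V f"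
    using lframe_bsec[OF f, of 0] sheaf_restrict[OF F, of U f V] V base by auto
   ultimately show "cont_on (bbase E) V (%y. w y (e y, f y))" using a by blast
  next
   assume c: "cont_on (bbase E) V (%y. w y (e y, f y))"
   show "\<forall>U' s t. U' \<subseteq> V \<and> bsec E U' s \<and> bsec F U' t \<longrightarrow> cont_on (bbase E) U' (%x. w x (s x, t x))"
   proof (intro allI impI; elim conjE)
    fix U' s t assume U': "U' \<subseteq> V" and s: "bsec E U' s" and t: "bsec F U' t"
    have UU: "U' \<subseteq> U" using U' V(2) by blast
    have "cont_on (bbase E) U' (%x. lcoef (bfib E x) (e x) (s x))"
     using bsec_iff_lcoef[OF E e sheaf_openin[OF E s] UU] s by blast
    moreover have "cont_on (bbase E) U' (%x. lcoef (bfib F x) (f x) (t x))"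
     using bsec_iff_lcoef[OF F f sheaf_openin[OF F t] UU] t base by simp
    ultimately have "cont_on (bbase E) U'
      (%x. lcoef (bfib E x) (e x) (s x) * lcoef (bfib F x) (f x) (t x) * w x (e x, f x))"
     using cont_on_subset[OF c U'] by (intro cont_on_mult)
    thus "cont_on (bbase E) U' (%x. w x (s x, t x))"
    proof (rule cont_on_cong)
     fix y assume y: "y \<in> U'"
     hence yU: "y \<in> U" using UU by blast
     have "w y \<in> vcarrier (bilin_forms (bfib E y) (bfib F y))" using True y U' by blast
     from bilin_form_line[OF R[OF yU] R'[OF yU] L[OF yU] L'[OF yU] this
       sheaf_mem[OF E s y] sheaf_mem[OF F t y]]
     show "lcoef (bfib E y) (e y) (s y) * lcoef (bfib F y) (f y) (t y) * w y (e y, f y) = w y (s y, t y)"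
      by simp
    qed
   qed
  qed
  ultimately show ?thesis using True V by (simp add: bilin_forms_bundle_def)
 next
  case False
  thus ?thesis by (auto simp: bilin_forms_bundle_def)
 qed
qed

lemma det_bundle_simps [simp]:
 "bbase (det_bundle E) = bbase E" "bfib (det_bundle E) = (%x. vs_det (bfib E x))"
 by (simp_all add: det_bundle_def vs_det_def)

lemma tpow_bundle_simps [simp]:
 "bbase (tpow_bundle k E) = bbase E" "bfib (tpow_bundle k E) = (%x. vs_tpow k (bfib E x))"
 by (simp_all add: tpow_bundle_def vs_tpow_def)

lemma tensor_bundle_simps [simp]:
 "bbase (tensor_bundle E F) = bbase E" "bfib (tensor_bundle E F) = (%x. vs_tensor (bfib E x) (bfib F x))"
 by (simp_all add: tensor_bundle_def vs_tensor_def)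

lemma det_bundle_sheaf: "section_sheaf E ==> section_sheaf (det_bundle E)"
 unfolding det_bundle_def by (intro dual_bundle_sheaf top_forms_bundle_sheaf)

lemma tpow_bundle_sheaf: "section_sheaf E ==> section_sheaf (tpow_bundle k E)"
 unfolding tpow_bundle_def by (intro dual_bundle_sheaf mult_forms_bundle_sheaf)

lemma tensor_bundle_sheaf:
 "section_sheaf E ==> section_sheaf F ==> bbase F = bbase E ==> section_sheaf (tensor_bundle E F)"
 unfolding tensor_bundle_def by (intro dual_bundle_sheaf bilin_forms_bundle_sheaf)

text \<open>Determinants, tensor powers and tensor products are dual bundles of bundles of forms. A
  decomposable element takes the value 1 on the generating form, so \<open>lgen_dual\<close>
  applies; the next two lemmas argue in the same way.\<close>

lemma lgen_det:
 assumes sh: "section_sheaf E" and b: "lframe E U r b"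
 shows "lgen (det_bundle E) U (%y. wedge (bfib E y) (%i. b i y))"
 unfolding det_bundle_def
proof (rule lgen_dual[OF top_forms_bundle_sheaf[OF sh] lgen_top_forms[OF sh b]])
 fix y assume y: "y \<in> U"
 note R = lframe_real_vs[OF sh b y] and B = lframe_basis[OF sh b y]
 show "wedge (bfib E y) (%i. b i y) \<in> vcarrier (vs_dual (bfib (top_forms_bundle E) y))"
  using wedge_mem[OF R B vs_basis_mem[OF B]] by (simp add: vs_det_def)
 show "wedge (bfib E y) (%i. b i y) (topform (bfib E y) r (%i. b i y)) = 1"
  using topform_mem[OF R B] topform_self[OF R B] by (simp add: wedge_def vs_dim_eq[OF R B])
qed

lemma lgen_tpow:
 assumes sh: "section_sheaf E" and e: "lgen E U e"
 shows "lgen (tpow_bundle k E) U (%y. tprod k (bfib E y) (%_. e y))"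
 unfolding tpow_bundle_def
proof (rule lgen_dual[OF mult_forms_bundle_sheaf[OF sh] lgen_mult_forms[OF sh e]])
 fix y assume y: "y \<in> U"
 note R = lframe_real_vs[OF sh e y] and L = lgen_line[OF sh e y]
 show "tprod k (bfib E y) (%_. e y) \<in> vcarrier (vs_dual (bfib (mult_forms_bundle k E) y))"
  using tprod_mem[of k "%_. e y" "bfib E y"] vline_mem[OF L] R by (simp add: vs_tpow_def)
 show "tprod k (bfib E y) (%_. e y) (mform k (bfib E y) (e y)) = 1"
  using mform_mem[OF R L] mform_self[OF R L] by (simp add: tprod_def)
qed

lemma lgen_tensor:
 assumes E: "section_sheaf E" and e: "lgen E U e" and F: "section_sheaf F" and f: "lgen F U f"
  and base: "bbase F = bbase E"
 shows "lgen (tensor_bundle E F) U (%y. tens (bfib E y) (bfib F y) (e y) (f y))"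
 unfolding tensor_bundle_def
proof (rule lgen_dual[OF bilin_forms_bundle_sheaf[OF E F base] lgen_bilin_forms[OF assms]])
 fix y assume y: "y \<in> U"
 note R = lframe_real_vs[OF E e y] and L = lgen_line[OF E e y]
 note R' = lframe_real_vs[OF F f y] and L' = lgen_line[OF F f y]
 show "tens (bfib E y) (bfib F y) (e y) (f y) \<in> vcarrier (vs_dual (bfib (bilin_forms_bundle E F) y))"
  using tens_mem[OF R R' vline_mem[OF L] vline_mem[OF L']] by (simp add: vs_tensor_def)
 show "tens (bfib E y) (bfib F y) (e y) (f y) (bform (bfib E y) (bfib F y) (e y) (f y)) = 1"
  using bform_mem[OF R R' L L'] bform_self[OF R R' L L'] by (simp add: tens_def)
qed

lemma lgen_dual_vec:
 assumes sh: "section_sheaf E" and e: "lgen E U e"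
 shows "lgen (dual_bundle E) U (%y. dual_vec (bfib E y) (e y))"
 by (rule lgen_dual[OF sh e])
   (use dual_vec_mem[OF lframe_real_vs[OF sh e] lgen_line[OF sh e]]
    dual_vec_self[OF lframe_real_vs[OF sh e] lgen_line[OF sh e]] in auto)

section \<open>Gram determinants and subbundles of a trivial bundle\<close>

lemma ddet_mult: "ddet k (%i j. \<Sum>l<k. M i l * N l j) = ddet k M * ddet k N"
proof -
 have "mat k k (\<lambda>(i, j). \<Sum>l<k. M i l * N l j) = mat k k (\<lambda>(i, j). M i j) * mat k k (\<lambda>(i, j). N i j)"
  by (intro eq_matI) (auto simp: scalar_prod_def lessThan_atLeast0 intro!: sum.cong)
 thus ?thesis by (simp add: ddet_def det_mult[of _ k])
qed

text \<open>For \<open>s = t\<close> this is the squared volume of the parallelepiped spanned by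
  \<open>s\<close>. It depends only on the ambient inner product and so stays continuous when the
  subspace varies.\<close>

definition gram :: "nat \<Rightarrow> (nat \<Rightarrow> 'e::real_inner) \<Rightarrow> (nat \<Rightarrow> 'e) \<Rightarrow> real" where
 "gram k s t = ddet k (%i j. inner (s i) (t j))"

lemma gram_commute: "gram k s t = gram k t s"
 unfolding gram_def by (subst ddet_transpose[symmetric]) (simp add: inner_commute)

text \<open>Expanding the rows in \<open>b\<close> factors the matrix of inner products into the
  coordinate matrix of \<open>t\<close> and the matrix of \<open>b\<close> against
  \<open>u\<close>.\<close>

lemma gram_dform:
 fixes S :: "'e::real_inner set"
 assumes S: "subspace S" and b: "vs_basis (vs_of S) k b" and t: "\<And>i. i < k ==> t i \<in> S"
 shows "gram k t u = dform (vs_of S) k b t * gram k b u"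
proof -
 have "gram k t u = ddet k (%i j. \<Sum>l<k. vcoord (vs_of S) k b (t i) l * inner (b l) (u j))"
  unfolding gram_def
 proof (rule ddet_cong)
  fix i j assume i: "i < k"
  have "t i = (\<Sum>l<k. vcoord (vs_of S) k b (t i) l *\<^sub>R b l)"
   using vcoord_lincomb[OF b, of "t i"] t[OF i] by (simp add: lincomb_vs_of)
  hence "inner (t i) (u j) = inner (\<Sum>l<k. vcoord (vs_of S) k b (t i) l *\<^sub>R b l) (u j)"
   by simp
  thus "inner (t i) (u j) = (\<Sum>l<k. vcoord (vs_of S) k b (t i) l * inner (b l) (u j))"
   by (simp add: inner_sum_left)
 qed
 thus ?thesis by (simp add: ddet_mult dform_def gram_def)
qed

lemma gram_square:
 fixes S :: "'e::real_inner set"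
 assumes S: "subspace S" and b: "vs_basis (vs_of S) k b" and t: "\<And>i. i < k ==> t i \<in> S"
 shows "gram k t t = (dform (vs_of S) k b t)\<^sup>2 * gram k b b"
 using gram_dform[OF assms, where u = t] gram_dform[OF assms, where u = b] gram_commute[of k b t]
 by (simp add: power2_eq_square)

text \<open>A kernel vector of the Gram matrix gives a combination of the \<open>b i\<close>
  orthogonal to every \<open>b i\<close>, hence to itself, hence zero.\<close>

lemma gram_nonzero:
 fixes S :: "'e::real_inner set"
 assumes S: "subspace S" and b: "vs_basis (vs_of S) k b"
 shows "gram k b b \<noteq> 0"
 unfolding gram_def
proof (rule ddet_nonzero)
 fix c assume c: "\<And>i. i < k ==> (\<Sum>j<k. c j * inner (b i) (b j)) = 0"
 let ?s = "\<Sum>j<k. c j *\<^sub>R b j"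
 have "inner (b i) ?s = 0" if "i < k" for i using c[OF that] by (simp add: inner_sum_right)
 hence "inner ?s ?s = 0" by (subst inner_sum_left) simp
 hence "lincomb (vs_of S) k c b = vzero (vs_of S)" by (simp add: lincomb_vs_of)
 from vs_basis_indep[OF real_vs_vs_of[OF S] b this] show "\<forall>j<k. c j = 0" by blast
qed

text \<open>Cramer's rule: after expanding \<open>x\<close>, only the term with \<open>b i\<close>
  in slot \<open>i\<close> survives, as in the others a basis vector occurs twice.\<close>

lemma dform_replace:
 assumes F: "real_vs F" and b: "vs_basis F k b" and i: "i < k" and x: "x \<in> vcarrier F"
 shows "dform F k b (b(i := x)) = vcoord F k b x i"
proof -
 let ?c = "vcoord F k b x" and ?b = "restrict b {..<k}"
 have w: "topform F k b \<in> vcarrier (alt_forms k F)"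
  using topform_mem[OF F b] by (simp add: top_forms_def vs_dim_eq[OF F b])
 hence wm: "topform F k b \<in> vcarrier (mult_forms k F)" by (simp add: alt_forms_iff)
 have bt: "?b \<in> vs_tuples k F" by (rule restrict_vs_tuples) (rule vs_basis_mem[OF b])
 have upd: "topform F k b (?b(i := z)) = dform F k b (b(i := z))" if "z \<in> vcarrier F" for z
 proof -
  have "?b(i := z) \<in> vs_tuples k F" using bt i that by blast
  moreover have "dform F k b (?b(i := z)) = dform F k b (b(i := z))" by (rule dform_cong) simp
  ultimately show ?thesis by (simp add: topform_def del: fun_upd_apply)
 qed
 have z: "topform F k b (?b(i := b s)) = (if s = i then 1 else 0)" if s: "s < k" for s
 proof (cases "s = i")
  case True
  thus ?thesis using upd[OF vs_basis_mem[OF b s]] dform_basis[OF F b] by simp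
 next
  case False
  have "?b(i := b s) \<in> vs_tuples k F" using bt i vs_basis_mem[OF b s] by blast
  moreover have "(?b(i := b s)) i = (?b(i := b s)) s" using False s by simp
  ultimately have "topform F k b (?b(i := b s)) = 0"
   using w i s False unfolding alt_forms_iff by blast
  thus ?thesis using False by simp
 qed
 have "dform F k b (b(i := x)) = topform F k b (?b(i := lincomb F k ?c b))"
  using upd[OF x] vcoord_lincomb[OF b x] by metis
 also have "\<dots> = (\<Sum>s<k. ?c s * topform F k b (?b(i := b s)))"
  by (rule mult_form_lincomb[OF F wm bt i]) (rule vs_basis_mem[OF b])
 also have "\<dots> = (\<Sum>s<k. if s = i then ?c s else 0)"
  by (rule sum.cong) (simp_all add: z)
 also have "\<dots> = ?c i" using i by simp
 finally show ?thesis .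
qed

text \<open>Cramer's rule with both determinants paired against \<open>b\<close>. The right side is
  a quotient of polynomials in inner products, so coordinates in a moving subspace depend
  continuously on the data.\<close>

lemma vcoord_gram:
 fixes S :: "'e::real_inner set"
 assumes S: "subspace S" and b: "vs_basis (vs_of S) k b" and i: "i < k" and x: "x \<in> S"
 shows "vcoord (vs_of S) k b x i = gram k (b(i := x)) b / gram k b b"
proof -
 have "gram k (b(i := x)) b = dform (vs_of S) k b (b(i := x)) * gram k b b"
  by (rule gram_dform[OF S b]) (use x vs_basis_mem[OF b] in auto)
 thus ?thesis
  using dform_replace[OF real_vs_vs_of[OF S] b i, of x] x gram_nonzero[OF S b] by simp
qed

lemma cont_on_gram:
 assumes "\<And>i. i < k ==> cont_on T U (s i)" "\<And>i. i < k ==> cont_on T U (t i)"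
 shows "cont_on T U (%x. gram k (%i. s i x) (%i. t i x))"
 unfolding gram_def using assms by (intro cont_on_ddet cont_on_inner)

lemma sub_bundle_simps [simp]: "bbase (sub_bundle T B) = T" "bfib (sub_bundle T B) = (%x. vs_of (B x))"
 by (simp_all add: sub_bundle_def)

lemma bsec_sub_bundle:
 "bsec (sub_bundle T B) U s \<longleftrightarrow> openin T U \<and> (\<forall>x\<in>U. s x \<in> B x) \<and> cont_on T U s"
 by (simp add: sub_bundle_def)

lemma sub_bundle_sheaf:
 assumes "\<And>x. x \<in> topspace T ==> subspace (B x)"
 shows "section_sheaf (sub_bundle T B)"
proof (rule sheaf_test[where Q = "\<lambda>U (t :: unit). openin T U" and R = "%U s t. cont_on T U s"])
 show "bsec (sub_bundle T B) U s \<longleftrightarrow> openin (bbase (sub_bundle T B)) U \<and>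
   (\<forall>x\<in>U. s x \<in> vcarrier (bfib (sub_bundle T B) x)) \<and>
   (\<forall>U' (t :: unit). U' \<subseteq> U \<and> openin T U' \<longrightarrow> cont_on T U' s)" for U s
  using cont_on_subset[of T U s] by (auto simp: bsec_sub_bundle)
qed (use assms in \<open>auto intro: real_vs_vs_of cont_on_Union'\<close>)

text \<open>A section of a subbundle is a continuous map into the ambient space. By
  \<open>vcoord_gram\<close> its coordinates are then continuous, and conversely it is the
  continuous combination of the \<open>b i\<close> with these coordinates.\<close>

lemma lframe_sub_bundle:
 fixes b :: "nat \<Rightarrow> 'x \<Rightarrow> 'e::real_inner"
 assumes U: "openin T U" and S: "\<And>x. x \<in> U ==> subspace (B x)"
  and b: "\<And>x. x \<in> U ==> vs_basis (vs_of (B x)) r (%i. b i x)"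
  and c: "\<And>i. i < r ==> cont_on T U (b i)"
 shows "lframe (sub_bundle T B) U r b"
proof (rule lframeI)
 fix V s assume V: "openin (bbase (sub_bundle T B)) V" "V \<subseteq> U"
 have cV: "cont_on T V (b i)" if "i < r" for i using cont_on_subset[OF c[OF that] V(2)] .
 show "bsec (sub_bundle T B) V s \<longleftrightarrow> (\<forall>y\<in>V. s y \<in> vcarrier (bfib (sub_bundle T B) y)) \<and>
   (\<forall>i<r. cont_on (bbase (sub_bundle T B)) V
    (%y. vcoord (bfib (sub_bundle T B) y) r (%i. b i y) (s y) i))"
 proof (cases "\<forall>y\<in>V. s y \<in> B y")
  case True
  have "cont_on T V (%y. vcoord (vs_of (B y)) r (%i. b i y) (s y) i)" if s: "cont_on T V s" and i: "i < r" for i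
  proof (rule cont_on_cong)
   have "cont_on T V (%x. (%l. if l = i then s x else b l x) l)" if "l < r" for l
    using s cV[OF that] by (cases "l = i") auto
   thus "cont_on T V (%x. gram r (%l. if l = i then s x else b l x) (%l. b l x)
     / gram r (%l. b l x) (%l. b l x))"
    using cV gram_nonzero[OF S b] V(2) by (intro cont_on_divide cont_on_gram) auto
   fix x assume "x \<in> V"
   hence x: "x \<in> U" "s x \<in> B x" using True V(2) by auto
   have "(%l. b l x)(i := s x) = (%l. if l = i then s x else b l x)" by auto
   thus "gram r (%l. if l = i then s x else b l x) (%l. b l x) / gram r (%l. b l x) (%l. b l x)
     = vcoord (vs_of (B x)) r (%i. b i x) (s x) i"
    using vcoord_gram[OF S[OF x(1)] b[OF x(1)] i x(2)] by simp
  qed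
  moreover have "cont_on T V s" if "\<And>i. i < r ==> cont_on T V (%y. vcoord (vs_of (B y)) r (%i. b i y) (s y) i)"
  proof (rule cont_on_cong)
   show "cont_on T V (%y. \<Sum>i<r. vcoord (vs_of (B y)) r (%i. b i y) (s y) i *\<^sub>R b i y)"
    using that cV by (intro cont_on_sum cont_on_scaleR) auto
   fix x assume "x \<in> V"
   hence x: "x \<in> U" "s x \<in> B x" using True V(2) by auto
   show "(\<Sum>i<r. vcoord (vs_of (B x)) r (%i. b i x) (s x) i *\<^sub>R b i x) = s x"
    using vcoord_lincomb[OF b[OF x(1)], of "s x"] x(2) by (simp add: lincomb_vs_of)
  qed
  ultimately show ?thesis using True V(1) by (auto simp: bsec_sub_bundle)
 next
  case False
  thus ?thesis by (auto simp: bsec_sub_bundle)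
 qed
qed (use U S b in \<open>auto intro: real_vs_vs_of\<close>)

section \<open>Bundles \<open>Hom(A, B/A)\<close>\<close>

lemma quot_bundle_simps [simp]:
 "bbase (quot_bundle T A B) = T" "bfib (quot_bundle T A B) = (%x. vs_quot (A x) (B x))"
 by (simp_all add: quot_bundle_def)

lemma bsec_quot_bundle:
 "bsec (quot_bundle T A B) U s \<longleftrightarrow> openin T U \<and>
   (\<forall>x\<in>U. \<exists>U' s'. x \<in> U' \<and> U' \<subseteq> U \<and> bsec (sub_bundle T B) U' s' \<and> (\<forall>y\<in>U'. s y = vs_coset (A y) (s' y)))"
 by (simp add: quot_bundle_def)

lemma quot_bundle_sheaf:
 assumes A: "\<And>x. x \<in> topspace T ==> subspace (A x)" and B: "\<And>x. x \<in> topspace T ==> subspace (B x)"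
 shows "section_sheaf (quot_bundle T A B)"
 unfolding section_sheaf_def
proof (intro conjI allI impI ballI)
 show "real_vs (bfib (quot_bundle T A B) x)" if "x \<in> topspace (bbase (quot_bundle T A B))" for x
  using that A B by (simp add: real_vs_quot)
 show "openin (bbase (quot_bundle T A B)) U" if "bsec (quot_bundle T A B) U s" for U s
  using that by (simp add: bsec_quot_bundle)
 show "s x \<in> vcarrier (bfib (quot_bundle T A B) x)" if s: "bsec (quot_bundle T A B) U s" and x: "x \<in> U" for U s x
 proof -
  obtain U' s' where "x \<in> U'" "bsec (sub_bundle T B) U' s'" "\<forall>y\<in>U'. s y = vs_coset (A y) (s' y)"
   using x s unfolding bsec_quot_bundle by meson
  thus ?thesis by (auto simp: quot_simps bsec_sub_bundle)
 qed
 fix \<U> :: "'a set set" and s assume o: "\<forall>U\<in>\<U>. openin (bbase (quot_bundle T A B)) U"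
 note sub = sub_bundle_sheaf[of T B, OF B]
 show "bsec (quot_bundle T A B) (\<Union>\<U>) s \<longleftrightarrow> (\<forall>U\<in>\<U>. bsec (quot_bundle T A B) U s)"
 proof
  assume a: "bsec (quot_bundle T A B) (\<Union>\<U>) s"
  show "\<forall>U\<in>\<U>. bsec (quot_bundle T A B) U s"
  proof
   fix U assume U: "U \<in> \<U>"
   have oU: "openin T U" using o U by simp
   have "\<exists>U' s'. x \<in> U' \<and> U' \<subseteq> U \<and> bsec (sub_bundle T B) U' s' \<and> (\<forall>y\<in>U'. s y = vs_coset (A y) (s' y))"
    if x: "x \<in> U" for x
   proof -
    have "x \<in> \<Union>\<U>" using x U by blast
    then obtain V s' where V: "x \<in> V" "bsec (sub_bundle T B) V s'" "\<forall>y\<in>V. s y = vs_coset (A y) (s' y)"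
     using a unfolding bsec_quot_bundle by meson
    have "openin T (V \<inter> U)" using oU V(2) by (auto simp: bsec_sub_bundle)
    hence "bsec (sub_bundle T B) (V \<inter> U) s'"
     using sheaf_restrict[OF sub V(2), of "V \<inter> U"] by simp
    thus ?thesis using V(1,3) x by (intro exI[of _ "V \<inter> U"] exI[of _ s']) auto
   qed
   thus "bsec (quot_bundle T A B) U s" using oU unfolding bsec_quot_bundle by blast
  qed
 next
  assume a: "\<forall>U\<in>\<U>. bsec (quot_bundle T A B) U s"
  have "\<exists>U' s'. x \<in> U' \<and> U' \<subseteq> \<Union>\<U> \<and> bsec (sub_bundle T B) U' s' \<and> (\<forall>y\<in>U'. s y = vs_coset (A y) (s' y))"
   if x: "x \<in> \<Union>\<U>" for x
  proof -
   obtain U where U: "U \<in> \<U>" "x \<in> U" using x by blast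
   then obtain V s' where V: "x \<in> V" "V \<subseteq> U" "bsec (sub_bundle T B) V s'" "\<forall>y\<in>V. s y = vs_coset (A y) (s' y)"
    using a unfolding bsec_quot_bundle by meson
   thus ?thesis using U(1) by (intro exI[of _ V] exI[of _ s']) auto
  qed
  moreover have "openin T (\<Union>\<U>)" using o by auto
  ultimately show "bsec (quot_bundle T A B) (\<Union>\<U>) s" unfolding bsec_quot_bundle by blast
 qed
qed

abbreviation hq_bundle :: "'x topology \<Rightarrow> ('x \<Rightarrow> 'e::real_normed_vector set) \<Rightarrow> ('x \<Rightarrow> 'e set) \<Rightarrow>
  ('x, 'e \<Rightarrow> 'e set) vbundle" where
 "hq_bundle T A B \<equiv> hom_bundle (sub_bundle T A) (quot_bundle T A B)"

lemma hq_bundle_sheaf: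
 assumes "\<And>x. x \<in> topspace T ==> subspace (A x)" "\<And>x. x \<in> topspace T ==> subspace (B x)"
 shows "section_sheaf (hq_bundle T A B)"
 using assms by (intro hom_bundle_sheaf sub_bundle_sheaf quot_bundle_sheaf) auto

lemma bsec_hq_bundle:
 "bsec (hq_bundle T A B) U \<phi> \<longleftrightarrow> openin T U \<and>
   (\<forall>x\<in>U. \<phi> x \<in> vcarrier (vs_hom (vs_of (A x)) (vs_quot (A x) (B x)))) \<and>
   (\<forall>U' s. U' \<subseteq> U \<and> bsec (sub_bundle T A) U' s \<longrightarrow> bsec (quot_bundle T A B) U' (%x. \<phi> x (s x)))"
 by (simp add: hom_bundle_def)

text \<open>A section \<phi> is determined by \<phi> \<open>(v)\<close>, which locally lifts to a
  continuous map into \<open>B\<close>. The coordinates of \<phi> are those of the lift in the basis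
  \<open>v, y 0, ...\<close>, with the first one dropped.\<close>

lemma lframe_hq_bundle:
 fixes A B :: "'x \<Rightarrow> 'e::real_inner set" and v :: "'x \<Rightarrow> 'e" and y :: "nat \<Rightarrow> 'x \<Rightarrow> 'e"
 assumes U: "openin T U" and AB: "\<And>x. x \<in> U ==> line_in_space (A x) (B x) (v x) m (%i. y i x)"
  and v: "cont_on T U v" and y: "\<And>i. i < m ==> cont_on T U (y i)"
 shows "lframe (hq_bundle T A B) U m (%i x. tangent_vec (A x) (v x) (y i x))"
proof (rule lframeI)
 let ?E = "hq_bundle T A B"
 let ?b = "%x. case_nat (v x) (%i. y i x)"
 show "openin (bbase ?E) U" using U by simp
 show "real_vs (bfib ?E x)" if "x \<in> U" for x
  using line_in_space.real_vs_T[OF AB[OF that]] by simp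
 show "vs_basis (bfib ?E x) m (%i. tangent_vec (A x) (v x) (y i x))" if "x \<in> U" for x
  using line_in_space.basis_T[OF AB[OF that]] by simp
 have fr: "lframe (sub_bundle T B) U (Suc m) (%i x. case_nat (v x) (%i. y i x) i)"
 proof (rule lframe_sub_bundle[OF U])
  show "subspace (B x)" if "x \<in> U" for x using AB[OF that] by (simp add: line_in_space_def)
  show "vs_basis (vs_of (B x)) (Suc m) (%i. case_nat (v x) (%i. y i x) i)" if "x \<in> U" for x
   using AB[OF that] by (simp add: line_in_space_def)
  show "cont_on T U (%x. case_nat (v x) (%i. y i x) i)" if "i < Suc m" for i
   using v y that by (cases i) auto
 qed
 fix V \<phi> assume V: "openin (bbase ?E) V" "V \<subseteq> U"
 hence oV: "openin T V" by simp
 have ABV: "line_in_space (A x) (B x) (v x) m (%i. y i x)" if "x \<in> V" for x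
  using AB that V(2) by blast
 show "bsec ?E V \<phi> \<longleftrightarrow> (\<forall>x\<in>V. \<phi> x \<in> vcarrier (bfib ?E x)) \<and>
   (\<forall>i<m. cont_on (bbase ?E) V (%x. vcoord (bfib ?E x) m (%i. tangent_vec (A x) (v x) (y i x)) (\<phi> x) i))"
 proof (intro iffI conjI)
  assume s: "bsec ?E V \<phi>"
  thus m: "\<forall>x\<in>V. \<phi> x \<in> vcarrier (bfib ?E x)" by (simp add: bsec_hq_bundle)
  have "bsec (sub_bundle T A) V v"
   using cont_on_subset[OF v V(2)] oV line_in_space.v_mem[OF ABV] by (simp add: bsec_sub_bundle)
  hence q: "bsec (quot_bundle T A B) V (%x. \<phi> x (v x))"
   using s unfolding bsec_hq_bundle by blast
  show "\<forall>i<m. cont_on (bbase ?E) V (%x. vcoord (bfib ?E x) m (%i. tangent_vec (A x) (v x) (y i x)) (\<phi> x) i)"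
  proof (intro allI impI cont_on_local)
   fix i x assume i: "i < m" and x: "x \<in> V"
   obtain W s' where W: "x \<in> W" "W \<subseteq> V" "bsec (sub_bundle T B) W s'"
    "\<forall>y\<in>W. \<phi> y (v y) = vs_coset (A y) (s' y)"
    using q x unfolding bsec_quot_bundle by meson
   have oW: "openin T W" using W(3) by (simp add: bsec_sub_bundle)
   have sB: "section_sheaf (sub_bundle (subtopology T W) B)"
    by (rule sub_bundle_sheaf) (use AB W(2) V(2) in \<open>auto simp: line_in_space_def\<close>)
   have WU: "W \<subseteq> U" using W(2) V(2) by blast
   have "\<exists>c. (\<forall>i<Suc m. cont_on T W (c i)) \<and>
     (\<forall>y\<in>W. s' y = lincomb (vs_of (B y)) (Suc m) (%i. c i y) (?b y))"
    using fr W(3) oW WU unfolding lframe_def by simp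
   then obtain c where c: "\<forall>i<Suc m. cont_on T W (c i)"
     "\<forall>y\<in>W. s' y = lincomb (vs_of (B y)) (Suc m) (%i. c i y) (?b y)" by blast
   have "cont_on T W (c (Suc i))" using c(1) i by simp
   hence "cont_on T W (%x. vcoord (bfib ?E x) m (%i. tangent_vec (A x) (v x) (y i x)) (\<phi> x) i)"
   proof (rule cont_on_cong)
    fix z assume z: "z \<in> W"
    have zV: "z \<in> V" using z W(2) by blast
    interpret line_in_space "A z" "B z" "v z" m "%i. y i z" by (rule ABV[OF zV])
    have "s' z \<in> \<phi> z (v z)" using W(4) z coset_self[OF sub_A] by simp
    hence "vcoord (bfib ?E z) m (%i. tangent_vec (A z) (v z) (y i z)) (\<phi> z) i = vcoord (vs_of (B z)) (Suc m) (?b z) (s' z) (Suc i)"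
     using vcoord_T[OF _ _ i] m zV by simp
    also have "\<dots> = c (Suc i) z"
     by (rule vcoord_unique[OF real_vs_B basis_B]) (use c(2) z i in auto)
    finally show "c (Suc i) z = vcoord (bfib ?E z) m (%i. tangent_vec (A z) (v z) (y i z)) (\<phi> z) i" ..
   qed
   thus "\<exists>U'. openin (bbase ?E) U' \<and> x \<in> U' \<and> U' \<subseteq> V \<and> cont_on (bbase ?E) U'
     (%x. vcoord (bfib ?E x) m (%i. tangent_vec (A x) (v x) (y i x)) (\<phi> x) i)"
    using oW W(1,2) by (intro exI[of _ W]) simp
  qed
 next
  assume a: "(\<forall>x\<in>V. \<phi> x \<in> vcarrier (bfib ?E x)) \<and>
   (\<forall>i<m. cont_on (bbase ?E) V (%x. vcoord (bfib ?E x) m (%i. tangent_vec (A x) (v x) (y i x)) (\<phi> x) i))"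
  define c where "c i x = vcoord (bfib ?E x) m (%i. tangent_vec (A x) (v x) (y i x)) (\<phi> x) i" for i x
  have cc: "cont_on T V (c i)" if "i < m" for i using a that unfolding c_def by simp
  have \<phi>: "\<phi> x = tangent_vec (A x) (v x) (\<Sum>i<m. c i x *\<^sub>R y i x)" if "x \<in> V" for x
  proof -
   interpret line_in_space "A x" "B x" "v x" m "%i. y i x" by (rule ABV[OF that])
   show ?thesis
    using vcoord_lincomb[OF basis_T, of "\<phi> x"] a that lincomb_T[of "%i. c i x"] by (simp add: c_def)
  qed
  show "bsec ?E V \<phi>"
   unfolding bsec_hq_bundle
  proof (intro conjI oV allI impI; (elim conjE)?)
   show "\<forall>x\<in>V. \<phi> x \<in> vcarrier (vs_hom (vs_of (A x)) (vs_quot (A x) (B x)))" using a by simp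
   fix W s assume W: "W \<subseteq> V" and s: "bsec (sub_bundle T A) W s"
   have oW: "openin T W" using s by (simp add: bsec_sub_bundle)
   have la: "lgen (sub_bundle T A) U v"
    by (rule lframe_sub_bundle[OF U]) (use AB v in \<open>auto simp: line_in_space_def\<close>)
   have "\<exists>a. (\<forall>i<1. cont_on T W (a i)) \<and>
     (\<forall>x\<in>W. s x = lincomb (vs_of (A x)) 1 (%i. a i x) (%i. v x))"
    using la s oW W V(2) unfolding lframe_def by auto
   then obtain a' where a': "\<forall>i<1. cont_on T W (a' i)"
    "\<forall>x\<in>W. s x = lincomb (vs_of (A x)) 1 (%i. a' i x) (%i. v x)" by blast
   \<comment> \<open>With \<open>s = a' v\<close>, linearity makes this the lift of \<phi>
     \<open>(s)\<close>: the coefficient of \<open>s\<close> times the lift of \<phi>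
     \<open>(v)\<close>.\<close>
   let ?s = "%x. a' 0 x *\<^sub>R (\<Sum>i<m. c i x *\<^sub>R y i x)"
   have "bsec (sub_bundle T B) W ?s"
    unfolding bsec_sub_bundle
   proof (intro conjI oW ballI)
    show "?s x \<in> B x" if "x \<in> W" for x
    proof -
     have xV: "x \<in> V" using that W by blast
     interpret line_in_space "A x" "B x" "v x" m "%i. y i x" by (rule ABV[OF xV])
     show ?thesis by (rule subspace_scale[OF sub_B sum_y_mem])
    qed
    show "cont_on T W ?s"
     using a'(1) cont_on_subset[OF cc W] cont_on_subset[OF y, of _ W] W V(2)
     by (intro cont_on_scaleR cont_on_sum) auto
   qed
   moreover have "\<phi> x (s x) = vs_coset (A x) (?s x)" if "x \<in> W" for x
   proof -
    have xV: "x \<in> V" using that W by blast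
    interpret line_in_space "A x" "B x" "v x" m "%i. y i x" by (rule ABV[OF xV])
    have "s x = a' 0 x *\<^sub>R v x" using a'(2) that by (simp add: lincomb_vs_of One_nat_def)
    thus ?thesis using \<phi>[OF xV] tangent_vec_apply by simp
   qed
   ultimately show "bsec (quot_bundle T A B) W (%x. \<phi> x (s x))"
    unfolding bsec_quot_bundle using oW by blast
  qed
 qed
qed

section \<open>Pullbacks\<close>

lemma pullback_bundle_simps [simp]:
 "bbase (pullback_bundle T g E) = T" "bfib (pullback_bundle T g E) = (%x. bfib E (g x))"
 by (simp_all add: pullback_bundle_def)

lemma bsec_pullback:
 "bsec (pullback_bundle T g E) U s \<longleftrightarrow> openin T U \<and>
   (\<forall>x\<in>U. \<exists>U' U'' k c e. openin T U' \<and> x \<in> U' \<and> U' \<subseteq> U \<and> g ` U' \<subseteq> U'' \<and>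
      (\<forall>i<k. cont_on T U' (c i) \<and> bsec E U'' (e i)) \<and>
      (\<forall>y\<in>U'. s y = lincomb (bfib E (g y)) k (%i. c i y) (%i. e i (g y))))"
 by (simp add: pullback_bundle_def)

lemma bsec_pullbackE:
 assumes s: "bsec (pullback_bundle T g E) U s" and x: "x \<in> U"
 obtains U' U'' k c e where "openin T U'" "x \<in> U'" "U' \<subseteq> U" "g ` U' \<subseteq> U''"
  "\<forall>i<k. cont_on T U' (c i) \<and> bsec E U'' (e i)"
  "\<forall>y\<in>U'. s y = lincomb (bfib E (g y)) k (%i. c i y) (%i. e i (g y))"
 using s[unfolded bsec_pullback, THEN conjunct2, THEN bspec, OF x]
 by (elim exE conjE) (rule that)

lemma pullback_sheaf:
 assumes E: "section_sheaf E" and g: "g ` topspace T \<subseteq> topspace (bbase E)"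
 shows "section_sheaf (pullback_bundle T g E)"
 unfolding section_sheaf_def
proof (intro conjI allI impI ballI)
 let ?P = "pullback_bundle T g E"
 let ?L = "%s x U. \<exists>U' U'' k c e. openin T U' \<and> x \<in> U' \<and> U' \<subseteq> U \<and> g ` U' \<subseteq> U'' \<and>
      (\<forall>i<k. cont_on T U' (c i) \<and> bsec E U'' (e i)) \<and>
      (\<forall>y\<in>U'. s y = lincomb (bfib E (g y)) k (%i. c i y) (%i. e i (g y)))"
 show "real_vs (bfib ?P x)" if "x \<in> topspace (bbase ?P)" for x
  using that g sheaf_real_vs[OF E] by auto
 show "openin (bbase ?P) U" if "bsec ?P U s" for U s
  using that by (simp add: bsec_pullback)
 show "s x \<in> vcarrier (bfib ?P x)" if s: "bsec ?P U s" and x: "x \<in> U" for U s x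
 proof -
  obtain U' U'' k c e where U': "x \<in> U'" "U' \<subseteq> U" "g ` U' \<subseteq> U''" "\<forall>i<k. cont_on T U' (c i) \<and> bsec E U'' (e i)"
   "\<forall>y\<in>U'. s y = lincomb (bfib E (g y)) k (%i. c i y) (%i. e i (g y))"
   by (rule bsec_pullbackE[OF s x])
  have "openin T U" using s by (simp add: bsec_pullback)
  hence "x \<in> topspace T" using x openin_subset by blast
  hence "real_vs (bfib E (g x))" using g sheaf_real_vs[OF E] by blast
  hence "lincomb (bfib E (g x)) k (%i. c i x) (%i. e i (g x)) \<in> vcarrier (bfib E (g x))"
   by (rule lincomb_closed) (use U' sheaf_mem[OF E] in blast)
  thus ?thesis using U'(1,5) by simp
 qed
 fix \<U> and s assume "\<forall>U\<in>\<U>. openin (bbase ?P) U"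
 hence o: "\<And>U. U \<in> \<U> ==> openin T U" and oU: "openin T (\<Union>\<U>)" by auto
 have sec: "bsec ?P U s \<longleftrightarrow> openin T U \<and> (\<forall>x\<in>U. ?L s x U)" for U by (rule bsec_pullback)
 have shrink: "?L s x W" if "?L s x U" "openin T W" "x \<in> W" for x U W
 proof -
  from that(1) obtain U' U'' k c e where *: "openin T U'" "x \<in> U'" "g ` U' \<subseteq> U''"
   "\<forall>i<k. cont_on T U' (c i) \<and> bsec E U'' (e i)"
   "\<forall>y\<in>U'. s y = lincomb (bfib E (g y)) k (%i. c i y) (%i. e i (g y))"
   by blast
  show ?thesis
  proof (intro exI conjI)
   show "openin T (U' \<inter> W)" using *(1) that(2) by blast
   show "g ` (U' \<inter> W) \<subseteq> U''" using *(3) by blast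
   show "\<forall>i<k. cont_on T (U' \<inter> W) (c i) \<and> bsec E U'' (e i)" using *(4) cont_on_subset by blast
   show "\<forall>y\<in>U' \<inter> W. s y = lincomb (bfib E (g y)) k (%i. c i y) (%i. e i (g y))" using *(5) by blast
  qed (use *(2) that(3) in auto)
 qed
 have grow: "?L s x W" if "?L s x U" "U \<subseteq> W" for x U W
 proof -
  from that(1) obtain U' U'' k c e where *: "openin T U'" "x \<in> U'" "U' \<subseteq> U" "g ` U' \<subseteq> U''"
   "\<forall>i<k. cont_on T U' (c i) \<and> bsec E U'' (e i)"
   "\<forall>y\<in>U'. s y = lincomb (bfib E (g y)) k (%i. c i y) (%i. e i (g y))"
   by blast
  have "U' \<subseteq> W" using *(3) that(2) by blast
  with * show ?thesis
   by (intro exI[of _ U'] exI[of _ U''] exI[of _ k] exI[of _ c] exI[of _ e]) simp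
 qed
 show "bsec ?P (\<Union>\<U>) s \<longleftrightarrow> (\<forall>U\<in>\<U>. bsec ?P U s)"
 proof
  assume a: "bsec ?P (\<Union>\<U>) s"
  show "\<forall>U\<in>\<U>. bsec ?P U s"
  proof
   fix U assume U: "U \<in> \<U>"
   have "\<forall>x\<in>\<Union>\<U>. ?L s x (\<Union>\<U>)" using a unfolding bsec_pullback by (rule conjunct2)
   hence L: "?L s x (\<Union>\<U>)" if "x \<in> U" for x by (rule bspec) (use that U in blast)
   have "\<forall>x\<in>U. ?L s x U"
    by (rule ballI) (rule shrink[OF L o[OF U]])
   thus "bsec ?P U s" unfolding bsec_pullback using o[OF U] by (intro conjI)
  qed
 next
  assume a: "\<forall>U\<in>\<U>. bsec ?P U s"
  have "?L s x (\<Union>\<U>)" if x: "x \<in> \<Union>\<U>" for x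
  proof -
   obtain U where U: "U \<in> \<U>" "x \<in> U" using x by blast
   hence "bsec ?P U s" using a by blast
   hence "\<forall>x\<in>U. ?L s x U" unfolding bsec_pullback by (rule conjunct2)
   from bspec[OF this U(2)] show ?thesis by (rule grow) (rule Union_upper[OF U(1)])
  qed
  hence "\<forall>x\<in>\<Union>\<U>. ?L s x (\<Union>\<U>)" by (rule ballI)
  thus "bsec ?P (\<Union>\<U>) s" unfolding bsec_pullback using oU by (intro conjI)
 qed
qed

lemma vcoord_lincomb_lincomb:
 assumes F: "real_vs F" and b: "vs_basis F r b" and e: "\<And>i. i < k ==> e i \<in> vcarrier F" and j: "j < r"
 shows "vcoord F r b (lincomb F k c e) j = (\<Sum>i<k. c i * vcoord F r b (e i) j)"
 using e
proof (induction k)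
 case 0
 thus ?case by (simp add: vcoord_zero[OF F b j])
next
 case (Suc k)
 have "lincomb F k c e \<in> vcarrier F" using Suc.prems by (intro lincomb_closed[OF F]) auto
 thus ?case
  using Suc by (simp add: vcoord_add[OF F b _ _ j] vcoord_scale[OF F b _ j] real_vsD(6)[OF F])
qed

text \<open>Locally a section of the pullback combines some number \<open>k\<close> of sections
  \<open>e i\<close> composed with \<open>g\<close>, with \<open>k\<close> unrelated to the rank.
  Expanding each \<open>e i\<close> in \<open>b\<close> before composing with \<open>g\<close> gives
  continuous coordinates; conversely the frame itself, with \<open>k = r\<close>, is an admissible
  choice.\<close>

lemma lframe_pullback:
 assumes E: "section_sheaf E" and b: "lframe E V r b" and W: "openin T W"
  and g: "continuous_map (subtopology T W) (bbase E) g" and gW: "g ` W \<subseteq> V"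
 shows "lframe (pullback_bundle T g E) W r (%i x. b i (g x))"
proof (rule lframeI)
 let ?P = "pullback_bundle T g E"
 show "openin (bbase ?P) W" using W by simp
 note R = lframe_real_vs[OF E b] and B = lframe_basis[OF E b]
 show "real_vs (bfib ?P x)" if "x \<in> W" for x using R gW that by auto
 show "vs_basis (bfib ?P x) r (%i. b i (g x))" if "x \<in> W" for x using B[of "g x"] gW that by auto
 fix W' s assume "openin (bbase ?P) W'" and W'W: "W' \<subseteq> W"
 hence W': "openin T W'" by simp
 have gc: "continuous_map (subtopology T Z) (bbase E) g" if "Z \<subseteq> W" for Z
  using continuous_map_from_subtopology_mono[OF g that] .
 show "bsec ?P W' s \<longleftrightarrow> (\<forall>y\<in>W'. s y \<in> vcarrier (bfib ?P y)) \<and>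
   (\<forall>i<r. cont_on (bbase ?P) W' (%y. vcoord (bfib ?P y) r (%i. b i (g y)) (s y) i))"
 proof (intro iffI conjI)
  assume s: "bsec ?P W' s"
  have loc: "\<exists>U'. openin T U' \<and> x \<in> U' \<and> U' \<subseteq> W' \<and> (\<forall>y\<in>U'. s y \<in> vcarrier (bfib E (g y))) \<and>
    (\<forall>j<r. cont_on T U' (%y. vcoord (bfib E (g y)) r (%i. b i (g y)) (s y) j))" if x: "x \<in> W'" for x
  proof -
   obtain U' U'' k c e where U': "openin T U'" "x \<in> U'" "U' \<subseteq> W'" "g ` U' \<subseteq> U''"
    "\<forall>i<k. cont_on T U' (c i) \<and> bsec E U'' (e i)"
    "\<forall>y\<in>U'. s y = lincomb (bfib E (g y)) k (%i. c i y) (%i. e i (g y))"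
    by (rule bsec_pullbackE[OF s x])
   have U'W: "U' \<subseteq> W" using U'(3) W'W by blast
   have em: "e i (g y) \<in> vcarrier (bfib E (g y))" if "i < k" "y \<in> U'" for i y
    using U'(4,5) that sheaf_mem[OF E] by blast
   have sm: "s y \<in> vcarrier (bfib E (g y))" if y: "y \<in> U'" for y
   proof -
    have "real_vs (bfib E (g y))" using R gW U'W y by blast
    thus ?thesis using U'(6) y em by (auto intro!: lincomb_closed)
   qed
   have "cont_on T U' (%y. vcoord (bfib E (g y)) r (%i. b i (g y)) (s y) j)" if j: "j < r" for j
   proof (rule cont_on_cong)
    have "cont_on T U' (%y. vcoord (bfib E (g y)) r (%i. b i (g y)) (e i (g y)) j)" if i: "i < k" for i
    proof (rule cont_on_compose[OF gc[OF U'W]])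
     have ei: "bsec E U'' (e i)" using U'(5) i by blast
     have o: "openin (bbase E) (U'' \<inter> V)" using sheaf_openin[OF E ei] lframe_openin[OF E b] by blast
     have "bsec E (U'' \<inter> V) (e i)" using sheaf_restrict[OF E ei o] by blast
     thus "cont_on (bbase E) (U'' \<inter> V) (%z. vcoord (bfib E z) r (%i. b i z) (e i z) j)"
      using bsec_iff_coords[OF E b o] j by blast
     show "g ` (topspace T \<inter> U') \<subseteq> U'' \<inter> V" using U'(4) gW U'W by blast
    qed
    thus "cont_on T U' (%y. \<Sum>i<k. c i y * vcoord (bfib E (g y)) r (%i. b i (g y)) (e i (g y)) j)"
     using U'(5) by (intro cont_on_sum cont_on_mult) auto
    fix y assume y: "y \<in> U'"
    have gy: "g y \<in> V" using gW U'W y by blast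
    show "(\<Sum>i<k. c i y * vcoord (bfib E (g y)) r (%i. b i (g y)) (e i (g y)) j)
      = vcoord (bfib E (g y)) r (%i. b i (g y)) (s y) j"
     using vcoord_lincomb_lincomb[OF R[OF gy] B[OF gy] _ j, of k "%i. e i (g y)" "%i. c i y"] em[OF _ y]
      U'(6) y by simp
   qed
   thus ?thesis using U'(1-3) sm by blast
  qed
  show "\<forall>y\<in>W'. s y \<in> vcarrier (bfib ?P y)" using loc by fastforce
  show "\<forall>i<r. cont_on (bbase ?P) W' (%y. vcoord (bfib ?P y) r (%i. b i (g y)) (s y) i)"
  proof (intro allI impI cont_on_local)
   fix j x assume j: "j < r" and x: "x \<in> W'"
   from loc[OF x] obtain U' where "openin T U'" "x \<in> U'" "U' \<subseteq> W'"
    "\<forall>j<r. cont_on T U' (%y. vcoord (bfib E (g y)) r (%i. b i (g y)) (s y) j)" by blast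
   thus "\<exists>U'. openin (bbase ?P) U' \<and> x \<in> U' \<and> U' \<subseteq> W' \<and> cont_on (bbase ?P) U'
     (%y. vcoord (bfib ?P y) r (%i. b i (g y)) (s y) j)"
    using j by (intro exI[of _ U']) simp
  qed
 next
  assume a: "(\<forall>y\<in>W'. s y \<in> vcarrier (bfib ?P y)) \<and>
   (\<forall>i<r. cont_on (bbase ?P) W' (%y. vcoord (bfib ?P y) r (%i. b i (g y)) (s y) i))"
  have sy: "s y = lincomb (bfib E (g y)) r (vcoord (bfib E (g y)) r (%i. b i (g y)) (s y)) (%i. b i (g y))"
   if "y \<in> W'" for y
  proof -
   have gy: "g y \<in> V" using gW W'W that by blast
   show ?thesis by (rule vcoord_lincomb[OF B[OF gy]]) (use a that in simp)
  qed
  have "\<exists>U' U'' k c e. openin T U' \<and> x \<in> U' \<and> U' \<subseteq> W' \<and> g ` U' \<subseteq> U'' \<and>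
      (\<forall>i<k. cont_on T U' (c i) \<and> bsec E U'' (e i)) \<and>
      (\<forall>y\<in>U'. s y = lincomb (bfib E (g y)) k (%i. c i y) (%i. e i (g y)))" if "x \<in> W'" for x
  proof (intro exI conjI)
   show "g ` W' \<subseteq> V" using gW W'W by blast
   show "\<forall>i<r. cont_on T W' (%y. vcoord (bfib E (g y)) r (%i. b i (g y)) (s y) i) \<and> bsec E V (b i)"
    using a lframe_bsec[OF b] by simp
   show "\<forall>y\<in>W'. s y = lincomb (bfib E (g y)) r (%i. vcoord (bfib E (g y)) r (%i. b i (g y)) (s y) i)
     (%i. b i (g y))" using sy by blast
  qed (use W' that in auto)
  thus "bsec ?P W' s" unfolding bsec_pullback using W' by blast
 qed
qed

section \<open>Isomorphisms of line bundles\<close>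

lemma line_bundle_sheaf: "vector_bundle r E ==> section_sheaf E"
 by (simp add: vector_bundle_iff)

lemma bsec_cong_iff:
 assumes E: "vector_bundle r E" and eq: "\<And>y. y \<in> U ==> s y = s' y"
 shows "bsec E U s \<longleftrightarrow> bsec E U s'"
proof
 show "bsec E U s'" if "bsec E U s"
  by (rule bsec_cong[OF line_bundle_sheaf[OF E] E that]) (rule eq)
 show "bsec E U s" if "bsec E U s'"
  by (rule bsec_cong[OF line_bundle_sheaf[OF E] E that]) (rule eq[symmetric])
qed

lemma line_hom_lcoef:
 assumes A: "real_vs A" and B: "real_vs B" and e: "vline A e" and f: "vline B f"
  and h: "h \<in> vcarrier (vs_hom A B)" and he: "h e = vscale B c f" and x: "x \<in> vcarrier A"
 shows "lcoef B f (h x) = lcoef A e x * c"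
proof -
 have "h x = vscale B (lcoef A e x * c) f"
  using line_hom_apply[OF A e h x] he real_vsD(9)[OF B vline_mem[OF f]] by simp
 thus ?thesis using lcoef_unique[OF B f] by simp
qed

lemma vs_isos_hom: "h \<in> vs_isos A B ==> h \<in> vcarrier (vs_hom A B)"
 by (simp add: vs_isos_def)

lemma vs_isos_mem: "h \<in> vs_isos A B ==> x \<in> vcarrier A ==> h x \<in> vcarrier B"
 by (simp add: vs_isos_def vs_hom_iff vlinear_def)

lemma line_bundle_isos_intro:
 assumes "line_bundle E" "line_bundle F" "bbase E = bbase F" "\<phi> \<in> extensional (topspace (bbase E))"
  and "\<And>x. x \<in> topspace (bbase E) ==> \<phi> x \<in> vs_isos (bfib E x) (bfib F x)"
  and "\<And>U s. \<forall>x\<in>U. s x \<in> vcarrier (bfib E x) ==> bsec E U s \<longleftrightarrow> bsec F U (%x. \<phi> x (s x))"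
 shows "\<phi> \<in> line_bundle_isos E F"
 unfolding line_bundle_isos_def mem_Collect_eq
proof (intro conjI allI impI ballI assms(1-4))
 show "\<phi> x \<in> vs_isos (bfib E x) (bfib F x)" if "x \<in> topspace (bbase E)" for x
  by (rule assms(5)[OF that])
 show "bsec E U s \<longleftrightarrow> bsec F U (%x. \<phi> x (s x))" if "\<forall>x\<in>U. s x \<in> vcarrier (bfib E x)" for U s
  by (rule assms(6)[OF that])
qed

text \<open>In terms of local generators \<phi> is multiplication by \<open>c\<close>. Since \<phi>
  is bijective on fibres, \<open>c\<close> has no zero, and the coefficients before and after are
  continuous together; gluing then treats arbitrary open sets.\<close>

lemma line_bundle_isosI:
 assumes E: "line_bundle E" and F: "line_bundle F" and base: "bbase E = bbase F"
  and ext: "\<phi> \<in> extensional (topspace (bbase E))"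
  and iso: "\<And>x. x \<in> topspace (bbase E) ==> \<phi> x \<in> vs_isos (bfib E x) (bfib F x)"
  and loc: "\<And>x. x \<in> topspace (bbase E) ==> \<exists>U e f c. x \<in> U \<and> lgen E U e \<and> lgen F U f \<and>
   cont_on (bbase E) U c \<and> (\<forall>y\<in>U. \<phi> y (e y) = vscale (bfib F y) (c y) (f y))"
 shows "\<phi> \<in> line_bundle_isos E F"
proof -
 note shE = line_bundle_sheaf[OF E] and shF = line_bundle_sheaf[OF F]
 have local: "bsec E W s \<longleftrightarrow> bsec F W (%x. \<phi> x (s x))"
  if e: "lgen E V e" and f: "lgen F V f" and c: "cont_on (bbase E) V c"
   and \<phi>: "\<forall>y\<in>V. \<phi> y (e y) = vscale (bfib F y) (c y) (f y)"
   and W: "openin (bbase E) W" "W \<subseteq> V" and s: "\<forall>x\<in>W. s x \<in> vcarrier (bfib E x)" for V W e f c s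
 proof -
  have top: "y \<in> topspace (bbase E)" if "y \<in> W" for y using W(1) that openin_subset by blast
  have coef: "lcoef (bfib F y) (f y) (\<phi> y (s y)) = lcoef (bfib E y) (e y) (s y) * c y" if y: "y \<in> W" for y
  proof -
   have yV: "y \<in> V" using y W(2) by blast
   show ?thesis
    by (rule line_hom_lcoef[OF lframe_real_vs[OF shE e yV] lframe_real_vs[OF shF f yV]
       lgen_line[OF shE e yV] lgen_line[OF shF f yV] vs_isos_hom[OF iso[OF top[OF y]]]])
      (use \<phi> yV s y in auto)
  qed
  have nz: "c y \<noteq> 0" if y: "y \<in> W" for y
  proof -
   have yV: "y \<in> V" using y W(2) by blast
   have "vline (bfib F y) (\<phi> y (e y))"
    by (rule vs_iso_line[OF lframe_real_vs[OF shE e yV] lframe_real_vs[OF shF f yV]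
       lgen_line[OF shE e yV] iso[OF top[OF y]]])
   from vline_nonzero_coef[OF lframe_real_vs[OF shF f yV] lgen_line[OF shF f yV] this]
   show ?thesis
    using \<phi> yV lcoef_unique[OF lframe_real_vs[OF shF f yV] lgen_line[OF shF f yV]] by simp
  qed
  have cW: "cont_on (bbase E) W c" by (rule cont_on_subset[OF c W(2)])
  have WF: "openin (bbase F) W" using W(1) base by simp
  have "cont_on (bbase E) W (%y. lcoef (bfib E y) (e y) (s y)) \<longleftrightarrow>
    cont_on (bbase E) W (%y. lcoef (bfib F y) (f y) (\<phi> y (s y)))"
  proof
   assume "cont_on (bbase E) W (%y. lcoef (bfib E y) (e y) (s y))"
   from cont_on_mult[OF this cW] show "cont_on (bbase E) W (%y. lcoef (bfib F y) (f y) (\<phi> y (s y)))"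
    by (rule cont_on_cong) (simp add: coef)
  next
   assume "cont_on (bbase E) W (%y. lcoef (bfib F y) (f y) (\<phi> y (s y)))"
   from cont_on_divide[OF this cW nz] show "cont_on (bbase E) W (%y. lcoef (bfib E y) (e y) (s y))"
    by (rule cont_on_cong) (simp_all add: coef nz)
  qed
  moreover have "\<phi> y (s y) \<in> vcarrier (bfib F y)" if "y \<in> W" for y
   using vs_isos_mem[OF iso[OF top[OF that]]] s that by blast
  ultimately show ?thesis
   using bsec_iff_lcoef[OF shE e W] bsec_iff_lcoef[OF shF f WF W(2)] s base by simp
 qed
 have "bsec E U s \<longleftrightarrow> bsec F U (%x. \<phi> x (s x))" if s: "\<forall>x\<in>U. s x \<in> vcarrier (bfib E x)" for U s
 proof (cases "openin (bbase E) U")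
  case False
  thus ?thesis using sheaf_openin[OF shE] sheaf_openin[OF shF] base by metis
 next
  case U: True
  have cover: "\<exists>W. x \<in> W \<and> W \<subseteq> U \<and> openin (bbase E) W \<and>
    (bsec E W s \<longleftrightarrow> bsec F W (%x. \<phi> x (s x)))" if x: "x \<in> U" for x
  proof -
   have "x \<in> topspace (bbase E)" using U x openin_subset by blast
   from loc[OF this] obtain V e f c where V: "x \<in> V" "lgen E V e" "lgen F V f" "cont_on (bbase E) V c"
    "\<forall>y\<in>V. \<phi> y (e y) = vscale (bfib F y) (c y) (f y)" by blast
   have W: "openin (bbase E) (U \<inter> V)" using U lframe_openin[OF shE V(2)] by blast
   have "bsec E (U \<inter> V) s \<longleftrightarrow> bsec F (U \<inter> V) (%x. \<phi> x (s x))"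
    by (rule local[OF V(2-5) W]) (use s in auto)
   thus ?thesis using W V(1) x by (intro exI[of _ "U \<inter> V"]) auto
  qed
  show ?thesis
  proof
   assume a: "bsec E U s"
   show "bsec F U (%x. \<phi> x (s x))"
    by (rule sheaf_local[OF shF]) (use cover sheaf_restrict[OF shE a] in blast)
  next
   assume a: "bsec F U (%x. \<phi> x (s x))"
   show "bsec E U s"
    by (rule sheaf_local[OF shE]) (use cover sheaf_restrict[OF shF a] base in metis)
  qed
 qed
 from line_bundle_isos_intro[OF E F base ext iso this] show ?thesis .
qed

lemma line_bundle_isosD:
 assumes "\<phi> \<in> line_bundle_isos E F"
 shows "line_bundle E" "line_bundle F" "bbase E = bbase F" "\<phi> \<in> extensional (topspace (bbase E))"
  and "x \<in> topspace (bbase E) ==> \<phi> x \<in> vs_isos (bfib E x) (bfib F x)"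
  and "(\<And>x. x \<in> U ==> s x \<in> vcarrier (bfib E x)) ==> bsec E U s \<longleftrightarrow> bsec F U (%x. \<phi> x (s x))"
 using assms unfolding line_bundle_isos_def by auto

lemma line_bundle_iso_coef:
 assumes \<phi>: "\<phi> \<in> line_bundle_isos E F" and e: "lgen E U e" and f: "lgen F U f"
 shows "cont_on (bbase E) U (%y. lcoef (bfib F y) (f y) (\<phi> y (e y)))"
proof -
 note D = line_bundle_isosD[OF \<phi>]
 note shE = line_bundle_sheaf[OF D(1)] and shF = line_bundle_sheaf[OF D(2)]
 have s: "bsec E U e" using lframe_bsec[OF e, of 0] by simp
 have "bsec F U (%x. \<phi> x (e x))" using D(6)[of U e] s sheaf_mem[OF shE s] by blast
 thus ?thesis
  using bsec_iff_lcoef[OF shF f lframe_openin[OF shF f] order_refl] D(3) by simp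
qed

lemma vs_isos_inverse:
 assumes A: "real_vs A" and B: "real_vs B" and h: "h \<in> vs_isos A B"
 shows "restrict (inv_into (vcarrier A) h) (vcarrier B) \<in> vs_isos B A"
proof -
 have hl: "vlinear A B h" and bij: "bij_betw h (vcarrier A) (vcarrier B)"
  using h by (auto simp: vs_isos_def vs_hom_iff)
 let ?g = "inv_into (vcarrier A) h"
 have gm: "?g y \<in> vcarrier A" and hg: "h (?g y) = y" if "y \<in> vcarrier B" for y
  using bij_betw_inv_into_right[OF bij that] bij_betwE[OF bij_betw_inv_into[OF bij]] that by auto
 have gh: "?g (h x) = x" if "x \<in> vcarrier A" for x using bij_betw_inv_into_left[OF bij that] .
 have "vlinear B A ?g"
  unfolding vlinear_def
 proof (intro conjI ballI allI)
  fix x y assume x: "x \<in> vcarrier B" and y: "y \<in> vcarrier B"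
  have "h (vadd A (?g x) (?g y)) = vadd B x y" using vlinearD(2)[OF hl gm[OF x] gm[OF y]] hg x y by simp
  thus "?g (vadd B x y) = vadd A (?g x) (?g y)"
   using gh[OF real_vsD(2)[OF A gm[OF x] gm[OF y]]] by simp
 next
  fix c x assume x: "x \<in> vcarrier B"
  have "h (vscale A c (?g x)) = vscale B c x" using vlinearD(3)[OF hl gm[OF x]] hg x by simp
  thus "?g (vscale B c x) = vscale A c (?g x)" using gh[OF real_vsD(6)[OF A gm[OF x]]] by metis
 qed (rule gm)
 hence "restrict ?g (vcarrier B) \<in> vcarrier (vs_hom B A)" by (rule restrict_vs_hom[OF B])
 moreover have "bij_betw (restrict ?g (vcarrier B)) (vcarrier B) (vcarrier A)"
  using bij_betw_inv_into[OF bij] by (simp add: bij_betw_def)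
 ultimately show ?thesis by (simp add: vs_isos_def)
qed

lemma line_bundle_isos_inverse:
 assumes \<phi>: "\<phi> \<in> line_bundle_isos E F"
 shows "(\<lambda>x\<in>topspace (bbase E). restrict (inv_into (vcarrier (bfib E x)) (\<phi> x)) (vcarrier (bfib F x)))
  \<in> line_bundle_isos F E" (is "?\<psi> \<in> _")
proof -
 note D = line_bundle_isosD[OF \<phi>]
 note shE = line_bundle_sheaf[OF D(1)] and shF = line_bundle_sheaf[OF D(2)]
 have iso: "?\<psi> x \<in> vs_isos (bfib F x) (bfib E x)" if "x \<in> topspace (bbase E)" for x
  using vs_isos_inverse[OF sheaf_real_vs[OF shE that] sheaf_real_vs[OF shF] D(5)[OF that]] that D(3) by simp
 have right: "\<phi> x (?\<psi> x y) = y" if "x \<in> topspace (bbase E)" "y \<in> vcarrier (bfib F x)" for x y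
  using D(5)[OF that(1)] bij_betw_inv_into_right that by (auto simp: vs_isos_def)
 have "bsec F U s \<longleftrightarrow> bsec E U (%x. ?\<psi> x (s x))" if s: "\<forall>x\<in>U. s x \<in> vcarrier (bfib F x)" for U s
 proof (cases "openin (bbase E) U")
  case False
  thus ?thesis using sheaf_openin[OF shE] sheaf_openin[OF shF] D(3) by metis
 next
  case True
  hence top: "x \<in> topspace (bbase E)" if "x \<in> U" for x using that openin_subset by blast
  have m: "?\<psi> x (s x) \<in> vcarrier (bfib E x)" if "x \<in> U" for x
   using vs_isos_mem[OF iso[OF top[OF that]]] s that by blast
  have "bsec E U (%x. ?\<psi> x (s x)) \<longleftrightarrow> bsec F U (%x. \<phi> x (?\<psi> x (s x)))"
   by (rule D(6)) (rule m)
  also have "\<dots> \<longleftrightarrow> bsec F U s"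
   by (rule bsec_cong_iff[OF D(2)]) (rule right[OF top], use s in auto)
  finally show ?thesis by simp
 qed
 moreover have "?\<psi> \<in> extensional (topspace (bbase F))" using D(3) by simp
 moreover have "?\<psi> x \<in> vs_isos (bfib F x) (bfib E x)" if "x \<in> topspace (bbase F)" for x
  using iso that D(3) by simp
 ultimately show ?thesis
  using line_bundle_isos_intro[OF D(2) D(1) D(3)[symmetric], of ?\<psi>] by blast
qed

lemma line_bundle_isos_inverse_bij:
 "bij_betw (%\<phi>. \<lambda>x\<in>topspace (bbase E). restrict (inv_into (vcarrier (bfib E x)) (\<phi> x)) (vcarrier (bfib F x)))
   (line_bundle_isos E F) (line_bundle_isos F E)"
proof -
 \<comment> \<open>\<open>?i\<close> and \<open>?j\<close> are the same construction at two types,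
   one for each direction; an abbreviation inside a proof has a single type.\<close>
 let ?i = "\<lambda>(E :: ('a, 'b) vbundle) (F :: ('a, 'c) vbundle) \<phi>.
  \<lambda>x\<in>topspace (bbase E). restrict (inv_into (vcarrier (bfib E x)) (\<phi> x)) (vcarrier (bfib F x))"
 let ?j = "\<lambda>(E :: ('a, 'c) vbundle) (F :: ('a, 'b) vbundle) \<phi>.
  \<lambda>x\<in>topspace (bbase E). restrict (inv_into (vcarrier (bfib E x)) (\<phi> x)) (vcarrier (bfib F x))"
 have twice: "restrict (inv_into B (restrict (inv_into A h) B)) A = h"
  if "bij_betw h A B" "h \<in> extensional A" for h :: "'x \<Rightarrow> 'y" and A B
 proof (rule extensionalityI[of _ A])
  fix x assume x: "x \<in> A"
  hence hx: "h x \<in> B" using that(1) bij_betwE by blast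
  have inj: "inj_on (restrict (inv_into A h) B) B"
   using bij_betw_inv_into[OF that(1)] by (simp add: bij_betw_def)
  have "restrict (inv_into A h) B (h x) = x" using hx bij_betw_inv_into_left[OF that(1) x] by simp
  hence "inv_into B (restrict (inv_into A h) B) x = h x" using inv_into_f_f[OF inj hx] by simp
  thus "restrict (inv_into B (restrict (inv_into A h) B)) A x = h x" using x by simp
 qed (use that in auto)
 have 1: "?j F E (?i E F \<phi>) = \<phi>" if "\<phi> \<in> line_bundle_isos E F" for \<phi>
 proof (rule extensionalityI[of _ "topspace (bbase E)"])
  note D = line_bundle_isosD[OF that]
  show "?j F E (?i E F \<phi>) \<in> extensional (topspace (bbase E))" "\<phi> \<in> extensional (topspace (bbase E))"
   using D(3,4) by auto
  fix x assume x: "x \<in> topspace (bbase E)"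
  show "?j F E (?i E F \<phi>) x = \<phi> x"
   using twice[of "\<phi> x" "vcarrier (bfib E x)" "vcarrier (bfib F x)"] D(5)[OF x] x D(3)
   by (simp add: vs_isos_def vs_hom_iff)
 qed
 have 2: "?i E F (?j F E \<phi>) = \<phi>" if "\<phi> \<in> line_bundle_isos F E" for \<phi>
 proof (rule extensionalityI[of _ "topspace (bbase E)"])
  note D = line_bundle_isosD[OF that]
  show "?i E F (?j F E \<phi>) \<in> extensional (topspace (bbase E))" "\<phi> \<in> extensional (topspace (bbase E))"
   using D(3,4) by auto
  fix x assume x: "x \<in> topspace (bbase E)"
  hence x': "x \<in> topspace (bbase F)" using D(3) by simp
  show "?i E F (?j F E \<phi>) x = \<phi> x"
   using twice[of "\<phi> x" "vcarrier (bfib F x)" "vcarrier (bfib E x)"] D(5)[OF x'] x x'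
   by (simp add: vs_isos_def vs_hom_iff)
 qed
 show ?thesis
  by (rule bij_betw_byWitness[where f' = "?j F E"])
    (use 1 2 line_bundle_isos_inverse in auto)
qed

lemma line_bundle_isomorphic_sym: "line_bundle_isomorphic E F ==> line_bundle_isomorphic F E"
 unfolding line_bundle_isomorphic_def using line_bundle_isos_inverse by blast

lemma vs_isos_compose:
 assumes A: "real_vs A" and h: "h \<in> vs_isos A B" and k: "k \<in> vs_isos B C"
 shows "compose (vcarrier A) k h \<in> vs_isos A C"
proof -
 have "vlinear A C (%x. k (h x))"
  using h k unfolding vs_isos_def vs_hom_iff vlinear_def by auto
 hence "compose (vcarrier A) k h \<in> vcarrier (vs_hom A C)"
  unfolding compose_def by (rule restrict_vs_hom[OF A])
 moreover have "bij_betw (compose (vcarrier A) k h) (vcarrier A) (vcarrier C)"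
  using h k by (intro bij_betw_compose) (auto simp: vs_isos_def)
 ultimately show ?thesis by (simp add: vs_isos_def)
qed

lemma line_bundle_isomorphic_trans:
 assumes "line_bundle_isomorphic E F" "line_bundle_isomorphic F G"
 shows "line_bundle_isomorphic E G"
proof -
 obtain \<phi> \<psi> where \<phi>: "\<phi> \<in> line_bundle_isos E F" and \<psi>: "\<psi> \<in> line_bundle_isos F G"
  using assms unfolding line_bundle_isomorphic_def by blast
 note D = line_bundle_isosD[OF \<phi>] and D' = line_bundle_isosD[OF \<psi>]
 note shE = line_bundle_sheaf[OF D(1)] and shG = line_bundle_sheaf[OF D'(2)]
 let ?\<chi> = "\<lambda>x\<in>topspace (bbase E). compose (vcarrier (bfib E x)) (\<psi> x) (\<phi> x)"
 have iso: "?\<chi> x \<in> vs_isos (bfib E x) (bfib G x)" if "x \<in> topspace (bbase E)" for x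
  using vs_isos_compose[OF sheaf_real_vs[OF shE that] D(5)[OF that] D'(5)] that D(3) by simp
 have "bsec E U s \<longleftrightarrow> bsec G U (%x. ?\<chi> x (s x))" if s: "\<forall>x\<in>U. s x \<in> vcarrier (bfib E x)" for U s
 proof (cases "openin (bbase E) U")
  case False
  thus ?thesis using sheaf_openin[OF shE] sheaf_openin[OF shG] D(3) D'(3) by metis
 next
  case True
  hence top: "x \<in> topspace (bbase E)" if "x \<in> U" for x using that openin_subset by blast
  have "bsec E U s \<longleftrightarrow> bsec F U (%x. \<phi> x (s x))" by (rule D(6)) (use s in auto)
  also have "\<dots> \<longleftrightarrow> bsec G U (%x. \<psi> x (\<phi> x (s x)))"
   by (rule D'(6)) (use s vs_isos_mem[OF D(5)[OF top]] in auto)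
  also have "\<dots> \<longleftrightarrow> bsec G U (%x. ?\<chi> x (s x))"
  proof -
   have "?\<chi> x (s x) = \<psi> x (\<phi> x (s x))" if "x \<in> U" for x
    using s that top[OF that] by (simp add: compose_def)
   thus ?thesis by (intro bsec_cong_iff[OF D'(2)]) simp
  qed
  finally show ?thesis .
 qed
 from line_bundle_isos_intro[OF D(1) D'(2) trans[OF D(3) D'(3)] restrict_extensional iso this]
 have "?\<chi> \<in> line_bundle_isos E G" .
 thus ?thesis unfolding line_bundle_isomorphic_def by blast
qed

text \<open>With respect to local generators an isomorphism of line bundles is a continuous function
  without zeros. A fibrewise operation \<Phi> that leaves this function unchanged is injective and
  surjective on each fibre and respects continuity in both directions, although the two pairs of
  bundles may have nothing else in common.\<close>

lemma line_bundle_isos_transfer: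
 fixes E1 :: "('x, 'a) vbundle" and F1 :: "('x, 'b) vbundle"
  and E2 :: "('x, 'c) vbundle" and F2 :: "('x, 'd) vbundle"
 assumes E1: "line_bundle E1" and F1: "line_bundle F1" and E2: "line_bundle E2" and F2: "line_bundle F2"
  and base: "bbase E1 = T" "bbase F1 = T" "bbase E2 = T" "bbase F2 = T"
  and loc: "\<And>x. x \<in> topspace T ==> \<exists>U e1 f1 e2 f2. x \<in> U \<and>
   lgen E1 U e1 \<and> lgen F1 U f1 \<and> lgen E2 U e2 \<and> lgen F2 U f2 \<and>
   (\<forall>y\<in>U. \<forall>h\<in>vs_isos (bfib E1 y) (bfib F1 y). \<Phi> y h \<in> vs_isos (bfib E2 y) (bfib F2 y) \<and>
    lcoef (bfib F2 y) (f2 y) (\<Phi> y h (e2 y)) = lcoef (bfib F1 y) (f1 y) (h (e1 y)))"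
 shows "bij_betw (%\<mu>. \<lambda>x\<in>topspace T. \<Phi> x (\<mu> x)) (line_bundle_isos E1 F1) (line_bundle_isos E2 F2)"
proof -
 note s1 = line_bundle_sheaf[OF E1] and s1' = line_bundle_sheaf[OF F1]
  and s2 = line_bundle_sheaf[OF E2] and s2' = line_bundle_sheaf[OF F2]
 have point: "\<exists>e1 f1 e2 f2. vline (bfib E1 x) e1 \<and> vline (bfib F1 x) f1 \<and> vline (bfib E2 x) e2 \<and>
   vline (bfib F2 x) f2 \<and>
   (\<forall>h\<in>vs_isos (bfib E1 x) (bfib F1 x). \<Phi> x h \<in> vs_isos (bfib E2 x) (bfib F2 x) \<and>
    lcoef (bfib F2 x) f2 (\<Phi> x h e2) = lcoef (bfib F1 x) f1 (h e1))"
  if x: "x \<in> topspace T" for x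
 proof -
  from loc[OF x] obtain U e1 f1 e2 f2 where "x \<in> U" "lgen E1 U e1" "lgen F1 U f1" "lgen E2 U e2" "lgen F2 U f2"
   "\<forall>h\<in>vs_isos (bfib E1 x) (bfib F1 x). \<Phi> x h \<in> vs_isos (bfib E2 x) (bfib F2 x) \<and>
    lcoef (bfib F2 x) (f2 x) (\<Phi> x h (e2 x)) = lcoef (bfib F1 x) (f1 x) (h (e1 x))"
   by meson
  thus ?thesis
   using lgen_line[OF s1] lgen_line[OF s1'] lgen_line[OF s2] lgen_line[OF s2']
   by (intro exI[of _ "e1 x"] exI[of _ "f1 x"] exI[of _ "e2 x"] exI[of _ "f2 x"]) blast
 qed
 have R: "real_vs (bfib E1 x)" "real_vs (bfib F1 x)" "real_vs (bfib E2 x)" "real_vs (bfib F2 x)"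
  if "x \<in> topspace T" for x
  using sheaf_real_vs[OF s1] sheaf_real_vs[OF s1'] sheaf_real_vs[OF s2] sheaf_real_vs[OF s2'] that base
  by simp_all
 have inj: "h = h'" if x: "x \<in> topspace T" and h: "h \<in> vs_isos (bfib E1 x) (bfib F1 x)"
  and h': "h' \<in> vs_isos (bfib E1 x) (bfib F1 x)" and eq: "\<Phi> x h = \<Phi> x h'" for x h h'
 proof -
  from point[OF x] obtain e1 f1 e2 f2 where
   e: "vline (bfib E1 x) e1" "vline (bfib F1 x) f1"
   and c: "\<And>h. h \<in> vs_isos (bfib E1 x) (bfib F1 x) ==>
    lcoef (bfib F2 x) f2 (\<Phi> x h e2) = lcoef (bfib F1 x) f1 (h e1)" by blast
  have "lcoef (bfib F1 x) f1 (h e1) = lcoef (bfib F1 x) f1 (h' e1)" using c[OF h] c[OF h'] eq by simp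
  hence "h e1 = h' e1"
   using lcoef_scale[OF R(2)[OF x] e(2)] vs_isos_mem[OF h vline_mem[OF e(1)]]
    vs_isos_mem[OF h' vline_mem[OF e(1)]] by metis
  thus ?thesis
   using line_hom_eqI[OF R(1)[OF x] e(1) vs_isos_hom[OF h] vs_isos_hom[OF h']] by simp
 qed
 have surj: "\<exists>h\<in>vs_isos (bfib E1 x) (bfib F1 x). \<Phi> x h = k"
  if x: "x \<in> topspace T" and k: "k \<in> vs_isos (bfib E2 x) (bfib F2 x)" for x k
 proof -
  from point[OF x] obtain e1 f1 e2 f2 where
   e: "vline (bfib E1 x) e1" "vline (bfib F1 x) f1" "vline (bfib E2 x) e2" "vline (bfib F2 x) f2"
   and c: "\<And>h. h \<in> vs_isos (bfib E1 x) (bfib F1 x) ==> \<Phi> x h \<in> vs_isos (bfib E2 x) (bfib F2 x) \<and>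
    lcoef (bfib F2 x) f2 (\<Phi> x h e2) = lcoef (bfib F1 x) f1 (h e1)" by blast
  \<comment> \<open>The preimage of \<open>k\<close> must have the coefficient of \<open>k\<close>.
    That coefficient is nonzero because \<open>k\<close> is an isomorphism, so the linear map it
    defines is one too.\<close>
  define a where "a = lcoef (bfib F2 x) f2 (k e2)"
  have a: "a \<noteq> 0"
   unfolding a_def
   by (rule vline_nonzero_coef[OF R(4)[OF x] e(4) vs_iso_line[OF R(3)[OF x] R(4)[OF x] e(3) k]])
  let ?y = "vscale (bfib F1 x) a f1"
  have y: "vline (bfib F1 x) ?y" by (rule vline_scale[OF R(2)[OF x] e(2) a])
  let ?h = "lmap (bfib E1 x) (bfib F1 x) e1 ?y"
  have h: "?h \<in> vs_isos (bfib E1 x) (bfib F1 x)" by (rule lmap_iso[OF R(1)[OF x] R(2)[OF x] e(1) y])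
  have "?h e1 = ?y" by (rule lmap_apply[OF R(1)[OF x] R(2)[OF x] e(1) vline_mem[OF y]])
  hence "lcoef (bfib F1 x) f1 (?h e1) = a" using lcoef_unique[OF R(2)[OF x] e(2)] by simp
  hence "lcoef (bfib F2 x) f2 (\<Phi> x ?h e2) = lcoef (bfib F2 x) f2 (k e2)"
   using c[OF h] by (simp add: a_def)
  hence "\<Phi> x ?h e2 = k e2"
   using lcoef_scale[OF R(4)[OF x] e(4)] c[OF h] vs_isos_mem[OF _ vline_mem[OF e(3)]] k by metis
  hence "\<Phi> x ?h = k"
   using line_hom_eqI[OF R(3)[OF x] e(3)] vs_isos_hom[OF k] vs_isos_hom c[OF h] by blast
  thus ?thesis using h by blast
 qed
 show ?thesis
 proof (rule bij_betw_imageI)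
  show "inj_on (%\<mu>. \<lambda>x\<in>topspace T. \<Phi> x (\<mu> x)) (line_bundle_isos E1 F1)"
  proof
   fix \<mu> \<mu>' assume \<mu>: "\<mu> \<in> line_bundle_isos E1 F1" and \<mu>': "\<mu>' \<in> line_bundle_isos E1 F1"
    and eq: "(\<lambda>x\<in>topspace T. \<Phi> x (\<mu> x)) = (\<lambda>x\<in>topspace T. \<Phi> x (\<mu>' x))"
   show "\<mu> = \<mu>'"
   proof (rule extensionalityI[of _ "topspace T"])
    show "\<mu> \<in> extensional (topspace T)" "\<mu>' \<in> extensional (topspace T)"
     using line_bundle_isosD(4)[OF \<mu>] line_bundle_isosD(4)[OF \<mu>'] base by auto
    fix x assume x: "x \<in> topspace T"
    show "\<mu> x = \<mu>' x"
     using inj[OF x line_bundle_isosD(5)[OF \<mu>] line_bundle_isosD(5)[OF \<mu>']] x base fun_cong[OF eq, of x]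
     by simp
   qed
  qed
  show "(%\<mu>. \<lambda>x\<in>topspace T. \<Phi> x (\<mu> x)) ` line_bundle_isos E1 F1 = line_bundle_isos E2 F2"
  proof
   show "(%\<mu>. \<lambda>x\<in>topspace T. \<Phi> x (\<mu> x)) ` line_bundle_isos E1 F1 \<subseteq> line_bundle_isos E2 F2"
   proof (rule image_subsetI)
    fix \<mu> assume \<mu>: "\<mu> \<in> line_bundle_isos E1 F1"
    have iso1: "\<mu> x \<in> vs_isos (bfib E1 x) (bfib F1 x)" if "x \<in> topspace T" for x
     using line_bundle_isosD(5)[OF \<mu>] that base by simp
    let ?\<nu> = "\<lambda>x\<in>topspace T. \<Phi> x (\<mu> x)"
    show "?\<nu> \<in> line_bundle_isos E2 F2"
    proof (rule line_bundle_isosI[OF E2 F2])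
     show "bbase E2 = bbase F2" "?\<nu> \<in> extensional (topspace (bbase E2))" using base by auto
     fix x assume "x \<in> topspace (bbase E2)"
     hence x: "x \<in> topspace T" using base by simp
     from loc[OF x] obtain U e1 f1 e2 f2 where U: "x \<in> U" "lgen E1 U e1" "lgen F1 U f1" "lgen E2 U e2" "lgen F2 U f2"
      and c: "\<forall>y\<in>U. \<forall>h\<in>vs_isos (bfib E1 y) (bfib F1 y). \<Phi> y h \<in> vs_isos (bfib E2 y) (bfib F2 y) \<and>
       lcoef (bfib F2 y) (f2 y) (\<Phi> y h (e2 y)) = lcoef (bfib F1 y) (f1 y) (h (e1 y))"
      by meson
     have UT: "y \<in> topspace T" if "y \<in> U" for y
      using lframe_openin[OF s1 U(2)] base that openin_subset by fastforce
     show "?\<nu> x \<in> vs_isos (bfib E2 x) (bfib F2 x)" using c U(1) iso1[OF x] x by simp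
     have "cont_on (bbase E2) U (%y. lcoef (bfib F1 y) (f1 y) (\<mu> y (e1 y)))"
      using line_bundle_iso_coef[OF \<mu> U(2,3)] base by simp
     moreover have "?\<nu> y (e2 y) = vscale (bfib F2 y) (lcoef (bfib F1 y) (f1 y) (\<mu> y (e1 y))) (f2 y)"
      if y: "y \<in> U" for y
     proof -
      have i: "\<Phi> y (\<mu> y) \<in> vs_isos (bfib E2 y) (bfib F2 y)"
       and q: "lcoef (bfib F2 y) (f2 y) (\<Phi> y (\<mu> y) (e2 y)) = lcoef (bfib F1 y) (f1 y) (\<mu> y (e1 y))"
       using c y iso1[OF UT[OF y]] by blast+
      have "\<Phi> y (\<mu> y) (e2 y) \<in> vcarrier (bfib F2 y)"
       using vs_isos_mem[OF i vline_mem[OF lgen_line[OF s2 U(4) y]]] .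
      from lcoef_scale[OF R(4)[OF UT[OF y]] lgen_line[OF s2' U(5) y] this]
      show ?thesis using q UT[OF y] by simp
     qed
     ultimately show "\<exists>U e f c. x \<in> U \<and> lgen E2 U e \<and> lgen F2 U f \<and> cont_on (bbase E2) U c \<and>
       (\<forall>y\<in>U. ?\<nu> y (e y) = vscale (bfib F2 y) (c y) (f y))"
      using U by (intro exI[of _ U] exI[of _ e2] exI[of _ f2]) blast
    qed
   qed
   show "line_bundle_isos E2 F2 \<subseteq> (%\<mu>. \<lambda>x\<in>topspace T. \<Phi> x (\<mu> x)) ` line_bundle_isos E1 F1"
   proof
    fix \<nu> assume \<nu>: "\<nu> \<in> line_bundle_isos E2 F2"
    have iso2: "\<nu> x \<in> vs_isos (bfib E2 x) (bfib F2 x)" if "x \<in> topspace T" for x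
     using line_bundle_isosD(5)[OF \<nu>] that base by simp
    define \<mu> where "\<mu> = (\<lambda>x\<in>topspace T. SOME h. h \<in> vs_isos (bfib E1 x) (bfib F1 x) \<and> \<Phi> x h = \<nu> x)"
    have \<mu>x: "\<mu> x \<in> vs_isos (bfib E1 x) (bfib F1 x) \<and> \<Phi> x (\<mu> x) = \<nu> x" if "x \<in> topspace T" for x
     using someI_ex[of "%h. h \<in> vs_isos (bfib E1 x) (bfib F1 x) \<and> \<Phi> x h = \<nu> x"]
      surj[OF that iso2[OF that]] that unfolding \<mu>_def by auto
    have "\<mu> \<in> line_bundle_isos E1 F1"
    proof (rule line_bundle_isosI[OF E1 F1])
     show "bbase E1 = bbase F1" "\<mu> \<in> extensional (topspace (bbase E1))" using base by (auto simp: \<mu>_def)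
     fix x assume "x \<in> topspace (bbase E1)"
     hence x: "x \<in> topspace T" using base by simp
     thus "\<mu> x \<in> vs_isos (bfib E1 x) (bfib F1 x)" using \<mu>x by blast
     from loc[OF x] obtain U e1 f1 e2 f2 where U: "x \<in> U" "lgen E1 U e1" "lgen F1 U f1" "lgen E2 U e2" "lgen F2 U f2"
      and c: "\<forall>y\<in>U. \<forall>h\<in>vs_isos (bfib E1 y) (bfib F1 y). \<Phi> y h \<in> vs_isos (bfib E2 y) (bfib F2 y) \<and>
       lcoef (bfib F2 y) (f2 y) (\<Phi> y h (e2 y)) = lcoef (bfib F1 y) (f1 y) (h (e1 y))"
      by meson
     have UT: "y \<in> topspace T" if "y \<in> U" for y
      using lframe_openin[OF s1 U(2)] base that openin_subset by fastforce
     have "cont_on (bbase E1) U (%y. lcoef (bfib F2 y) (f2 y) (\<nu> y (e2 y)))"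
      using line_bundle_iso_coef[OF \<nu> U(4,5)] base by simp
     moreover have "\<mu> y (e1 y) = vscale (bfib F1 y) (lcoef (bfib F2 y) (f2 y) (\<nu> y (e2 y))) (f1 y)"
      if y: "y \<in> U" for y
     proof -
      have q: "lcoef (bfib F2 y) (f2 y) (\<nu> y (e2 y)) = lcoef (bfib F1 y) (f1 y) (\<mu> y (e1 y))"
       using c y \<mu>x[OF UT[OF y]] by metis
      have "\<mu> y (e1 y) \<in> vcarrier (bfib F1 y)"
       using vs_isos_mem[OF _ vline_mem[OF lgen_line[OF s1 U(2) y]]] \<mu>x[OF UT[OF y]] by blast
      from lcoef_scale[OF R(2)[OF UT[OF y]] lgen_line[OF s1' U(3) y] this]
      show ?thesis using q by simp
     qed
     ultimately show "\<exists>U e f c. x \<in> U \<and> lgen E1 U e \<and> lgen F1 U f \<and> cont_on (bbase E1) U c \<and>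
       (\<forall>y\<in>U. \<mu> y (e y) = vscale (bfib F1 y) (c y) (f y))"
      using U by (intro exI[of _ U] exI[of _ e1] exI[of _ f1]) blast
    qed
    moreover have "\<nu> = (\<lambda>x\<in>topspace T. \<Phi> x (\<mu> x))"
     by (rule extensionalityI[of _ "topspace T"])
       (use line_bundle_isosD(4)[OF \<nu>] base \<mu>x in auto)
    ultimately show "\<nu> \<in> (%\<mu>. \<lambda>x\<in>topspace T. \<Phi> x (\<mu> x)) ` line_bundle_isos E1 F1" by blast
   qed
  qed
 qed
qed

section \<open>Projective spaces\<close>

lemma topspace_proj_top [simp]: "topspace proj_top = proj UNIV"
proof -
 have "{v :: 'a. v \<noteq> 0 \<and> span {v} \<in> proj UNIV} = - {0}"
  by (auto simp: proj_def dim_singleton)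
 hence "openin (proj_top :: 'a set topology) (proj UNIV)"
  by (simp add: openin_proj_top open_Compl)
 moreover have "topspace (proj_top :: 'a set topology) \<subseteq> proj UNIV"
  using openin_topspace[of "proj_top :: 'a set topology"] unfolding openin_proj_top by (rule conjunct1)
 ultimately show ?thesis using openin_subset by blast
qed

lemma projD:
 assumes "l \<in> proj UNIV"
 shows "subspace l" "dim l = 1"
 using assms by (auto simp: proj_def)

lemma span_in_proj: "v \<noteq> 0 ==> span {v} \<in> proj UNIV"
 by (simp add: proj_def)

lemma proj_eq_span:
 assumes l: "l \<in> proj UNIV" and v: "v \<in> l" "v \<noteq> 0"
 shows "l = span {v}"
proof -
 have "span {v} \<subseteq> l" using v projD(1)[OF l] by (simp add: span_minimal)
 moreover have "dim (span {v}) = dim l" using projD(2)[OF l] v by (simp add: dim_singleton)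
 ultimately have "span {v} = l" using projD(1)[OF l] by (intro subspace_dim_equal) auto
 thus ?thesis by simp
qed

lemma proj_obtain:
 assumes l: "l \<in> proj UNIV"
 obtains v where "v \<in> l" "v \<noteq> 0" "l = span {v}"
proof -
 have "\<not> l \<subseteq> {0}" using projD(2)[OF l] dim_eq_0[of l] by auto
 then obtain v where "v \<in> l" "v \<noteq> 0" by blast
 with proj_eq_span[OF l] that show ?thesis by blast
qed

lemma vline_span:
 assumes "v \<noteq> 0"
 shows "vline (vs_of (span {v})) v"
proof (rule vlineI)
 show "\<exists>a. x = vscale (vs_of (span {v})) a v" if "x \<in> vcarrier (vs_of (span {v}))" for x
  using that by (auto simp: span_singleton)
qed (use assms in \<open>auto intro: real_vs_vs_of span_base\<close>)

lemma vline_proj: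
 assumes "l \<in> proj UNIV" "v \<in> l" "v \<noteq> 0"
 shows "vline (vs_of l) v"
 using vline_span[OF assms(3)] proj_eq_span[OF assms] by simp

text \<open>The universal property of the quotient topology: preimages are tested on their cones in
  \<open>V - {0}\<close>.\<close>

lemma cont_on_proj:
 fixes g :: "'v::euclidean_space set \<Rightarrow> 'b::topological_space"
 assumes U: "openin proj_top U" and c: "continuous_on {v. v \<noteq> 0 \<and> span {v} \<in> U} (%v. g (span {v}))"
 shows "cont_on proj_top U g"
 unfolding cont_on_openin[OF U]
proof (intro allI impI)
 fix V :: "'b set" assume V: "open V"
 have o: "open {v. v \<noteq> 0 \<and> span {v} \<in> U}" using U by (simp add: openin_proj_top)
 have "open ({v. v \<noteq> 0 \<and> span {v} \<in> U} \<inter> (%v. g (span {v})) -` V)"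
  using c V by (simp add: continuous_on_open_vimage[OF o] Int_commute)
 moreover have "{v. v \<noteq> 0 \<and> span {v} \<in> {x \<in> U. g x \<in> V}}
   = {v. v \<noteq> 0 \<and> span {v} \<in> U} \<inter> (%v. g (span {v})) -` V" by auto
 moreover have "U \<subseteq> proj UNIV" using U by (simp add: openin_proj_top)
 ultimately show "openin proj_top {x \<in> U. g x \<in> V}"
  unfolding openin_proj_top by (intro conjI) (blast, simp only:)
qed

text \<open>The point where \<open>l\<close> meets the affine hyperplane \<open>q = 1\<close>, that
  is, the affine chart of projective space read as a nonvanishing section of the tautological bundle
  over \<open>norm_dom q\<close>.\<close>

definition norm_sec :: "('v::euclidean_space \<Rightarrow> real) \<Rightarrow> 'v set \<Rightarrow> 'v" where
 "norm_sec q l = (THE x. x \<in> l \<and> q x = 1)"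

definition norm_dom :: "('v::euclidean_space \<Rightarrow> real) \<Rightarrow> 'v set set" where
 "norm_dom q = {l \<in> proj UNIV. \<exists>x\<in>l. q x \<noteq> 0}"

lemma norm_sec_eq:
 assumes q: "linear q" and l: "l \<in> proj UNIV" and x: "x \<in> l" "q x = 1"
 shows "norm_sec q l = x"
 unfolding norm_sec_def
proof (rule the_equality)
 have "x \<noteq> 0" using x(2) linear_0[OF q] by auto
 hence lx: "l = span {x}" using proj_eq_span[OF l x(1)] by blast
 fix z assume z: "z \<in> l \<and> q z = 1"
 then obtain a where "z = a *\<^sub>R x" unfolding lx span_singleton by auto
 thus "z = x" using z x(2) linear_scale[OF q, of a x] by simp
qed (use x in auto)

lemma norm_sec_span:
 assumes q: "linear q" and v: "q v \<noteq> 0"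
 shows "norm_sec q (span {v}) = (1 / q v) *\<^sub>R v"
proof (rule norm_sec_eq[OF q])
 have "v \<noteq> 0" using v linear_0[OF q] by auto
 thus "span {v} \<in> proj UNIV" by (rule span_in_proj)
 show "(1 / q v) *\<^sub>R v \<in> span {v}" by (simp add: span_base span_scale)
 show "q ((1 / q v) *\<^sub>R v) = 1" using v linear_scale[OF q, of "1 / q v" v] by simp
qed

lemma norm_dom_span:
 assumes q: "linear q"
 shows "v \<noteq> 0 \<and> span {v} \<in> norm_dom q \<longleftrightarrow> q v \<noteq> 0"
 using span_in_proj[of v] linear_0[OF q]
 by (auto simp: norm_dom_def span_singleton linear_scale[OF q] intro: bexI[of _ v] exI[of _ 1])

lemma openin_norm_dom:
 assumes q: "linear q"
 shows "openin proj_top (norm_dom q)"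
proof -
 have "{v. v \<noteq> 0 \<and> span {v} \<in> norm_dom q} = q -` (- {0})"
  using norm_dom_span[OF q] by auto
 moreover have "open (q -` (- {0}))"
  using linear_continuous_on[of q UNIV] q by (intro open_vimage) (auto simp: linear_conv_bounded_linear)
 ultimately show ?thesis by (simp add: openin_proj_top) (auto simp: norm_dom_def)
qed

lemma norm_sec_props:
 assumes q: "linear q" and l: "l \<in> norm_dom q"
 shows "norm_sec q l \<in> l" "q (norm_sec q l) = 1" "norm_sec q l \<noteq> 0" "l \<in> proj UNIV"
proof -
 show lp: "l \<in> proj UNIV" using l by (simp add: norm_dom_def)
 obtain x where x: "x \<in> l" "q x \<noteq> 0" using l by (auto simp: norm_dom_def)
 hence lx: "l = span {x}" using proj_eq_span[OF lp x(1)] linear_0[OF q] by auto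
 have "norm_sec q l = (1 / q x) *\<^sub>R x" unfolding lx by (rule norm_sec_span[OF q x(2)])
 thus "norm_sec q l \<in> l" "q (norm_sec q l) = 1"
  using x subspace_scale[OF projD(1)[OF lp] x(1)] linear_scale[OF q, of "1 / q x" x] by simp_all
 thus "norm_sec q l \<noteq> 0" using linear_0[OF q] by auto
qed

lemma cont_on_norm_sec:
 assumes q: "linear q"
 shows "cont_on proj_top (norm_dom q) (norm_sec q)"
proof (rule cont_on_proj[OF openin_norm_dom[OF q]])
 have eq: "{v. v \<noteq> 0 \<and> span {v} \<in> norm_dom q} = {v. q v \<noteq> 0}" using norm_dom_span[OF q] by blast
 have "continuous_on {v. q v \<noteq> 0} q"
  using linear_continuous_on[of q] q by (simp add: linear_conv_bounded_linear)
 hence "continuous_on {v. q v \<noteq> 0} (%v. (1 / q v) *\<^sub>R v)"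
  by (intro continuous_intros) auto
 thus "continuous_on {v. v \<noteq> 0 \<and> span {v} \<in> norm_dom q} (%v. norm_sec q (span {v}))"
  unfolding eq by (rule continuous_on_eq) (simp add: norm_sec_span[OF q])
qed

lemma norm_dom_exists:
 assumes "l \<in> proj UNIV" "v \<in> l" "v \<noteq> 0"
 shows "linear (inner v)" "l \<in> norm_dom (inner v)"
 using assms by (auto simp: norm_dom_def intro!: bounded_linear.linear bounded_linear_inner_right bexI[of _ v])

section \<open>Bases of subspaces of a Euclidean space\<close>

lemma vs_basis_exists:
 fixes S :: "'e::euclidean_space set"
 assumes S: "subspace S"
 obtains b where "vs_basis (vs_of S) (dim S) b"
proof -
 obtain B where B: "B \<subseteq> S" "independent B" "S \<subseteq> span B" "card B = dim S" by (rule basis_exists)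
 have fin: "finite B" using B(2) independent_imp_finite by blast
 obtain b where b: "bij_betw b {..<dim S} B"
  using ex_bij_betw_nat_finite[OF fin] B(4) by (auto simp: lessThan_atLeast0)
 have inj: "inj_on b {..<dim S}" and im: "b ` {..<dim S} = B" using b by (auto simp: bij_betw_def)
 have "vs_basis (vs_of S) (dim S) b"
 proof (rule vs_basisI[OF real_vs_vs_of[OF S]])
  show "b i \<in> vcarrier (vs_of S)" if "i < dim S" for i using im B(1) that by auto
 next
  fix x assume "x \<in> vcarrier (vs_of S)"
  hence "x \<in> span B" using B(3) by auto
  then obtain u where "x = (\<Sum>z\<in>B. u z *\<^sub>R z)" using span_finite[OF fin] by auto
  also have "\<dots> = (\<Sum>i<dim S. u (b i) *\<^sub>R b i)"
   using sum.reindex[OF inj, of "%z. u z *\<^sub>R z"] im by simp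
  finally show "\<exists>c. x = lincomb (vs_of S) (dim S) c b"
   unfolding lincomb_vs_of by (intro exI[of _ "%i. u (b i)"])
 next
  fix c assume "lincomb (vs_of S) (dim S) c b = vzero (vs_of S)"
  hence z: "(\<Sum>i<dim S. c i *\<^sub>R b i) = 0" by (simp add: lincomb_vs_of)
  let ?u = "%z. c (inv_into {..<dim S} b z)"
  have "(\<Sum>z\<in>B. ?u z *\<^sub>R z) = (\<Sum>i<dim S. ?u (b i) *\<^sub>R b i)"
   using sum.reindex[OF inj, of "%z. ?u z *\<^sub>R z"] im by simp
  also have "\<dots> = (\<Sum>i<dim S. c i *\<^sub>R b i)"
   by (rule sum.cong) (simp_all add: inv_into_f_f[OF inj])
  finally have "(\<Sum>z\<in>B. ?u z *\<^sub>R z) = 0" using z by simp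
  hence "?u z = 0" if "z \<in> B" for z by (rule independentD[OF B(2) fin order_refl _ that])
  thus "\<forall>i<dim S. c i = 0" using im inv_into_f_f[OF inj] by (metis imageI lessThan_iff)
 qed
 with that show ?thesis by blast
qed

text \<open>The vectors \<open>b\<close> span the hyperplane orthogonal to \<open>a\<close> and stay
  fixed while \<open>v\<close> runs through the parallel affine hyperplane. Thus one
  \<open>b\<close> completes the normalized generators of all lines in an affine chart.\<close>

lemma hyperplane_basis:
 fixes a :: "'w::euclidean_space"
 assumes "a \<noteq> 0"
 obtains b where "\<And>i. i < DIM('w) - 1 ==> inner a (b i) = 0"
  "\<And>v. inner a v = 1 ==> vs_basis (vs_of UNIV) (Suc (DIM('w) - 1)) (case_nat v b)"
proof -
 let ?H = "{x. inner a x = 0}"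
 have H: "subspace ?H" by (rule subspace_hyperplane)
 have dH: "dim ?H = DIM('w) - 1" using dim_hyperplane[OF assms] .
 obtain b where b: "vs_basis (vs_of ?H) (DIM('w) - 1) b" using vs_basis_exists[OF H] dH by metis
 have bH: "inner a (b i) = 0" if "i < DIM('w) - 1" for i using vs_basis_mem[OF b that] by simp
 have "vs_basis (vs_of UNIV) (Suc (DIM('w) - 1)) (case_nat v b)" if v: "inner a v = 1" for v
 proof (rule vs_basisI)
  fix x :: 'w
  have "x - inner a x *\<^sub>R v \<in> vcarrier (vs_of ?H)" using v by (simp add: inner_diff_right)
  from vcoord_lincomb[OF b this] obtain c where "x - inner a x *\<^sub>R v = (\<Sum>i<DIM('w) - 1. c i *\<^sub>R b i)"
   unfolding lincomb_vs_of by blast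
  hence "x = (\<Sum>i<Suc (DIM('w) - 1). case_nat (inner a x) c i *\<^sub>R case_nat v b i)"
   unfolding sum.lessThan_Suc_shift by (simp add: algebra_simps)
  thus "\<exists>c. x = lincomb (vs_of UNIV) (Suc (DIM('w) - 1)) c (case_nat v b)"
   unfolding lincomb_vs_of by blast
 next
  fix c assume "lincomb (vs_of UNIV) (Suc (DIM('w) - 1)) c (case_nat v b) = vzero (vs_of UNIV)"
  hence z: "c 0 *\<^sub>R v + (\<Sum>i<DIM('w) - 1. c (Suc i) *\<^sub>R b i) = 0"
   unfolding lincomb_vs_of sum.lessThan_Suc_shift by simp
  have "inner a (c 0 *\<^sub>R v + (\<Sum>i<DIM('w) - 1. c (Suc i) *\<^sub>R b i)) = c 0"
   using v bH by (simp add: inner_add_right inner_sum_right)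
  hence c0: "c 0 = 0" using z by simp
  hence "lincomb (vs_of ?H) (DIM('w) - 1) (%i. c (Suc i)) b = vzero (vs_of ?H)"
   using z by (simp add: lincomb_vs_of)
  hence "c (Suc i) = 0" if "i < DIM('w) - 1" for i
   using vs_basis_indep[OF real_vs_vs_of[OF H] b, of "%i. c (Suc i)"] that by blast
  show "\<forall>i<Suc (DIM('w) - 1). c i = 0"
  proof (intro allI impI)
   fix i assume "i < Suc (DIM('w) - 1)"
   thus "c i = 0" using c0 \<open>\<And>i. i < DIM('w) - 1 ==> c (Suc i) = 0\<close> by (cases i) auto
  qed
 qed (auto intro: real_vs_vs_of)
 with bH that show ?thesis by blast
qed

section \<open>Charts and the bundle \<open>Y\<close>\<close>

locale chart =
 fixes m :: nat and X :: "'v::euclidean_space set set" and U S D and \<psi> :: "'v \<Rightarrow> 'v"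
 assumes X: "X \<subseteq> proj UNIV" and U: "openin proj_top U" and S: "subspace S" "dim S = m" and D: "open D"
  and smooth: "smooth_on D \<psi>" and nz: "\<And>u. u \<in> D \<inter> S ==> \<psi> u \<noteq> 0"
  and homeo: "homeomorphic_map (subtopology euclidean (D \<inter> S)) (subtopology proj_top (X \<inter> U)) (%u. span {\<psi> u})"
  and immersion: "\<And>u h. u \<in> D \<inter> S ==> h \<in> S ==> frechet_derivative \<psi> (at u) h \<in> span {\<psi> u} ==> h = 0"
begin

abbreviation "d\<psi> u \<equiv> frechet_derivative \<psi> (at u)"

lemma differentiable: "u \<in> D ==> \<psi> differentiable (at u)"
 and continuous_derivative: "continuous_on D (%u. d\<psi> u h)"
 using smooth[unfolded smooth_on_def, rule_format, of 1] by (auto simp: One_nat_def)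

lemma has_derivative: "u \<in> D ==> (\<psi> has_derivative d\<psi> u) (at u)"
 using differentiable by (simp add: frechet_derivative_works)

lemma linear_derivative: "u \<in> D ==> linear (d\<psi> u)"
 using has_derivative has_derivative_linear by blast

lemma continuous_\<psi>: "continuous_on D \<psi>"
 using differentiable differentiable_imp_continuous_on by (metis differentiable_on_def differentiable_at_withinI)

text \<open>The tangent space of the cone over \<open>X\<close> at \<psi> \<open>u\<close>; it turns
  out to be the fibre of \<open>Y\<close> over the line of \<psi> \<open>u\<close>.\<close>

definition Ych :: "'v \<Rightarrow> 'v set" where
 "Ych u = {a *\<^sub>R \<psi> u + d\<psi> u h | a h. h \<in> S}"

text \<open>One basis of \<open>S\<close> for all parameters, so that the vectors d\<psi>
  \<open>u (base i)\<close> depend continuously on \<open>u\<close>.\<close>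

definition base :: "nat \<Rightarrow> 'v" where
 "base = (SOME b. vs_basis (vs_of S) m b)"

lemma base: "vs_basis (vs_of S) m base"
 unfolding base_def using vs_basis_exists[OF S(1)] S(2) by (metis someI)

lemma chart_line: "u \<in> D \<inter> S ==> span {\<psi> u} \<in> X \<inter> U"
 using homeo nz X by (auto simp: homeomorphic_map_def quotient_map_def image_iff dest!: equalityD1)

text \<open>Independence is the immersion condition: a relation places a derivative in the line of
  \<psi> \<open>u\<close>, so its direction vanishes, and then \<psi> \<open>u\<close> being nonzero
  kills the remaining coefficient.\<close>

lemma line_in_Ych:
 assumes u: "u \<in> D \<inter> S"
 shows "line_in_space (span {\<psi> u}) (Ych u) (\<psi> u) m (%i. d\<psi> u (base i))"
proof
 have lin: "linear (d\<psi> u)" using linear_derivative u by blast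
 show "subspace (span {\<psi> u})" by simp
 show sY: "subspace (Ych u)"
  unfolding subspace_def
 proof (intro conjI ballI allI)
  show "0 \<in> Ych u" unfolding Ych_def using subspace_0[OF S(1)] linear_0[OF lin]
   by (auto intro!: exI[of _ 0])
  fix x y assume "x \<in> Ych u" "y \<in> Ych u"
  then obtain a h b k where x: "x = a *\<^sub>R \<psi> u + d\<psi> u h" "h \<in> S" and y: "y = b *\<^sub>R \<psi> u + d\<psi> u k" "k \<in> S"
   unfolding Ych_def by blast
  have "x + y = (a + b) *\<^sub>R \<psi> u + d\<psi> u (h + k)" using x y linear_add[OF lin] by (simp add: algebra_simps)
  thus "x + y \<in> Ych u" unfolding Ych_def using subspace_add[OF S(1) x(2) y(2)] by blast
 next
  fix c x assume "x \<in> Ych u"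
  then obtain a h where x: "x = a *\<^sub>R \<psi> u + d\<psi> u h" "h \<in> S" unfolding Ych_def by blast
  have "c *\<^sub>R x = (c * a) *\<^sub>R \<psi> u + d\<psi> u (c *\<^sub>R h)" using x linear_scale[OF lin] by (simp add: algebra_simps)
  thus "c *\<^sub>R x \<in> Ych u" unfolding Ych_def using subspace_scale[OF S(1) x(2)] by blast
 qed
 show "vline (vs_of (span {\<psi> u})) (\<psi> u)" by (rule vline_span[OF nz[OF u]])
 have dsum: "(\<Sum>i<m. c i *\<^sub>R d\<psi> u (base i)) = d\<psi> u (\<Sum>i<m. c i *\<^sub>R base i)" for c
  by (simp add: linear_sum[OF lin] linear_scale[OF lin])
 have sumS: "(\<Sum>i<m. c i *\<^sub>R base i) \<in> S" for c
  using vs_basis_mem[OF base] by (intro subspace_sum[OF S(1)] subspace_scale[OF S(1)]) auto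
 show "vs_basis (vs_of (Ych u)) (Suc m) (case_nat (\<psi> u) (%i. d\<psi> u (base i)))"
 proof (rule vs_basisI[OF real_vs_vs_of[OF sY]])
  show "case_nat (\<psi> u) (%i. d\<psi> u (base i)) i \<in> vcarrier (vs_of (Ych u))" if "i < Suc m" for i
  proof (cases i)
   case 0
   have "\<psi> u = 1 *\<^sub>R \<psi> u + d\<psi> u 0" using linear_0[OF lin] by simp
   hence "\<psi> u \<in> Ych u" unfolding Ych_def using subspace_0[OF S(1)] by blast
   thus ?thesis using 0 by simp
  next
   case (Suc j)
   have "d\<psi> u (base j) = 0 *\<^sub>R \<psi> u + d\<psi> u (base j)" by simp
   moreover have "base j \<in> S" using Suc that vs_basis_mem[OF base, of j] by simp
   ultimately have "d\<psi> u (base j) \<in> Ych u" unfolding Ych_def by blast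
   thus ?thesis using Suc by simp
  qed
 next
  fix x assume "x \<in> vcarrier (vs_of (Ych u))"
  then obtain a h where x: "x = a *\<^sub>R \<psi> u + d\<psi> u h" "h \<in> S" unfolding Ych_def by auto
  obtain c where "h = (\<Sum>i<m. c i *\<^sub>R base i)"
   using vcoord_lincomb[OF base, of h] x(2) unfolding lincomb_vs_of by auto
  hence "x = (\<Sum>i<Suc m. case_nat a c i *\<^sub>R case_nat (\<psi> u) (%i. d\<psi> u (base i)) i)"
   unfolding sum.lessThan_Suc_shift using x(1) dsum by simp
  thus "\<exists>c. x = lincomb (vs_of (Ych u)) (Suc m) c (case_nat (\<psi> u) (%i. d\<psi> u (base i)))"
   unfolding lincomb_vs_of by blast
 next
  fix c assume "lincomb (vs_of (Ych u)) (Suc m) c (case_nat (\<psi> u) (%i. d\<psi> u (base i))) = vzero (vs_of (Ych u))"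
  hence z: "c 0 *\<^sub>R \<psi> u + d\<psi> u (\<Sum>i<m. c (Suc i) *\<^sub>R base i) = 0"
   unfolding lincomb_vs_of sum.lessThan_Suc_shift using dsum[of "%i. c (Suc i)"] by simp
  hence "d\<psi> u (\<Sum>i<m. c (Suc i) *\<^sub>R base i) = (- c 0) *\<^sub>R \<psi> u" by (simp add: eq_neg_iff_add_eq_0 add.commute)
  hence "d\<psi> u (\<Sum>i<m. c (Suc i) *\<^sub>R base i) \<in> span {\<psi> u}" by (simp add: span_base span_scale span_neg)
  hence h0: "(\<Sum>i<m. c (Suc i) *\<^sub>R base i) = 0" by (rule immersion[OF u sumS])
  hence "lincomb (vs_of S) m (%i. c (Suc i)) base = vzero (vs_of S)" by (simp add: lincomb_vs_of)
  hence cs: "c (Suc i) = 0" if "i < m" for i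
   using vs_basis_indep[OF real_vs_vs_of[OF S(1)] base, of "%i. c (Suc i)"] that by blast
  have "c 0 = 0" using z h0 linear_0[OF lin] nz[OF u] by simp
  with cs show "\<forall>i<Suc m. c i = 0" by (auto simp: less_Suc_eq_0_disj)
 qed
qed

text \<open>In the chart the curve is
 \<open>a(t) \<psi>(u(t))\<close>, where \<open>u\<close> is continuous; as \<open>\<psi>\<close> is an immersion modulo \<open>\<psi> u\<^sub>0\<close>,
 differentiability of the curve forces \<open>u(t) - u\<^sub>0 = O(t)\<close>.\<close>

lemma velocity_in_Ych:
 assumes u0: "u0 \<in> D \<inter> S" and c: "(c has_vector_derivative d) (at 0)" and c0: "c 0 \<in> span {\<psi> u0}"
  and ev: "\<forall>\<^sub>F t in nhds 0. c t \<noteq> 0 \<and> span {c t} \<in> X"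
 shows "d \<in> Ych u0"
proof -
 have uD: "u0 \<in> D" and uS: "u0 \<in> S" using u0 by auto
 define L where "L = d\<psi> u0"
 have linL: "linear L" unfolding L_def by (rule linear_derivative[OF uD])
 interpret Y: line_in_space "span {\<psi> u0}" "Ych u0" "\<psi> u0" m "%i. d\<psi> u0 (base i)"
  by (rule line_in_Ych[OF u0])
 let ?p0 = "\<psi> u0"
 have p0: "?p0 \<noteq> 0" by (rule nz[OF u0])
 have memY: "a *\<^sub>R ?p0 + L h \<in> Ych u0" if "h \<in> S" for a h
  unfolding Ych_def L_def using that by blast
 \<comment> \<open>A linear map that kills \<psi> \<open>u0\<close> and inverts the derivative on
   \<open>S\<close>. It is a left inverse of the derivative followed by the orthogonal projection
   \<open>q\<close> along \<psi> \<open>u0\<close>; that composition is injective on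
   \<open>S\<close> by the immersion condition.\<close>
 obtain p where p: "linear p" "p ?p0 = 0" "\<And>h. h \<in> S ==> p (L h) = h"
 proof -
  define q where "q x = x - (inner ?p0 x / inner ?p0 ?p0) *\<^sub>R ?p0" for x
  have linq: "linear q"
   by (rule linearI) (simp_all add: q_def inner_add_right add_divide_distrib algebra_simps)
  have qp: "q ?p0 = 0" using p0 by (simp add: q_def)
  have inj: "inj_on (q \<circ> L) S"
  proof
   fix x y assume x: "x \<in> S" and y: "y \<in> S" and "(q \<circ> L) x = (q \<circ> L) y"
   hence "q (L (x - y)) = 0" by (simp add: linear_diff[OF linL] linear_diff[OF linq])
   hence "L (x - y) = (inner ?p0 (L (x - y)) / inner ?p0 ?p0) *\<^sub>R ?p0" by (simp add: q_def)
   hence "L (x - y) \<in> span {?p0}" by (metis span_base span_scale insertI1)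
   hence "x - y = 0"
    using immersion[OF u0 subspace_diff[OF S(1) x y]] by (simp add: L_def)
   thus "x = y" by simp
  qed
  obtain g where g: "linear g" "\<forall>v\<in>S. g ((q \<circ> L) v) = v"
   using linear_exists_left_inverse_on[OF linear_compose[OF linL linq] S(1) inj] by blast
  show ?thesis
  proof (rule that[of "g \<circ> q"])
   show "linear (g \<circ> q)" by (rule linear_compose[OF linq g(1)])
   show "(g \<circ> q) ?p0 = 0" using qp linear_0[OF g(1)] by simp
   show "(g \<circ> q) (L h) = h" if "h \<in> S" for h using g(2) that by simp
  qed
 qed
 obtain K where K: "K > 0" "\<And>x. norm (p x) \<le> K * norm x"
  using linear_bounded_pos[OF p(1)] by blast
 have cd: "(c has_derivative (%t. t *\<^sub>R d)) (at 0)" using c by (simp add: has_vector_derivative_def)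
 have ccont: "(c \<longlongrightarrow> c 0) (nhds 0)"
  using has_derivative_continuous[OF cd] by (simp add: continuous_at tendsto_at_iff_tendsto_nhds)
 have "c 0 \<noteq> 0" using eventually_nhds_x_imp_x[OF ev] by blast
 hence spanc0: "span {c 0} = span {?p0}"
  using proj_eq_span[OF span_in_proj[OF p0] c0] by simp
 obtain g where g: "continuous_map (subtopology proj_top (X \<inter> U)) (top_of_set (D \<inter> S)) g"
  and gs: "\<And>u. u \<in> D \<inter> S ==> g (span {\<psi> u}) = u"
  and sg: "\<And>l. l \<in> X \<inter> U ==> span {\<psi> (g l)} = l"
 proof -
  have "topspace (subtopology proj_top (X \<inter> U)) = X \<inter> U" using X by auto
  with homeo that show ?thesis unfolding homeomorphic_map_maps homeomorphic_maps_def by auto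
 qed
 have gDS: "g l \<in> D \<inter> S" if "l \<in> X \<inter> U" for l
  using g that X by (auto simp: continuous_map_def)
 have evU: "\<forall>\<^sub>F t in nhds 0. c t \<noteq> 0 \<and> span {c t} \<in> G" if G: "openin proj_top G" "span {?p0} \<in> G" for G
 proof -
  have "open {v. v \<noteq> 0 \<and> span {v} \<in> G}" using G(1) by (simp add: openin_proj_top)
  moreover have "c 0 \<in> {v. v \<noteq> 0 \<and> span {v} \<in> G}" using \<open>c 0 \<noteq> 0\<close> spanc0 G(2) by simp
  ultimately have "\<forall>\<^sub>F t in nhds 0. c t \<in> {v. v \<noteq> 0 \<and> span {v} \<in> G}" by (rule topological_tendstoD[OF ccont])
  thus ?thesis by (rule eventually_mono) simp
 qed
 have p0U: "span {?p0} \<in> X \<inter> U" by (rule chart_line[OF u0])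
 define w where "w t = g (span {c t}) - u0" for t
 have evXU: "\<forall>\<^sub>F t in nhds 0. span {c t} \<in> X \<inter> U"
  using ev evU[OF U] p0U by (auto elim: eventually_elim2)
 have evw: "\<forall>\<^sub>F t in nhds 0. norm (w t) < e" if "e > 0" for e
 proof -
  have "openin (subtopology proj_top (X \<inter> U)) {l \<in> topspace (subtopology proj_top (X \<inter> U)). g l \<in> (D \<inter> S) \<inter> ball u0 e}"
   by (rule openin_continuous_map_preimage[OF g]) (simp add: openin_open_Int)
  then obtain G where G: "openin proj_top G"
   "{l \<in> topspace (subtopology proj_top (X \<inter> U)). g l \<in> (D \<inter> S) \<inter> ball u0 e} = G \<inter> (X \<inter> U)"
   unfolding openin_subtopology by blast
  have Ge: "l \<in> G \<and> l \<in> X \<inter> U \<longleftrightarrow> l \<in> X \<inter> U \<and> g l \<in> ball u0 e" for l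
   using G(2) X gDS by auto
  have "span {?p0} \<in> G" using Ge[of "span {?p0}"] gs[OF u0] p0U that by simp
  from evU[OF G(1) this] evXU show ?thesis
   by (rule eventually_elim2) (use Ge in \<open>auto simp: w_def dist_norm norm_minus_commute\<close>)
 qed
 have wS: "w t \<in> S" if "span {c t} \<in> X \<inter> U" for t
  unfolding w_def using subspace_diff[OF S(1)] gDS[OF that] uS by blast
 define R where "R u = \<psi> u - ?p0 - L (u - u0)" for u
 have evR: "\<forall>\<^sub>F t in nhds 0. norm (R (u0 + w t)) \<le> e * norm (w t)" if "e > 0" for e
 proof -
  obtain \<delta> where \<delta>: "\<delta> > 0" "\<And>y. norm (y - u0) < \<delta> ==> norm (\<psi> y - ?p0 - L (y - u0)) \<le> e * norm (y - u0)"
   using has_derivative[OF uD] \<open>e > 0\<close> unfolding has_derivative_at_alt L_def by blast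
  from evw[OF \<delta>(1)] show ?thesis
  proof (rule eventually_mono)
   fix t assume "norm (w t) < \<delta>"
   thus "norm (R (u0 + w t)) \<le> e * norm (w t)" using \<delta>(2)[of "u0 + w t"] by (simp add: R_def)
  qed
 qed
 have eva: "\<forall>\<^sub>F t in nhds 0. \<exists>a. c t = a *\<^sub>R \<psi> (u0 + w t)"
  using evXU
 proof (rule eventually_mono)
  fix t assume t: "span {c t} \<in> X \<inter> U"
  have "c t \<in> span {\<psi> (g (span {c t}))}" using sg[OF t] by (simp add: span_base)
  thus "\<exists>a. c t = a *\<^sub>R \<psi> (u0 + w t)" by (auto simp: w_def span_singleton)
 qed
 \<comment> \<open>Bounds for the scalar \<open>a\<close> in \<open>c t = a\<close> \<psi>
   \<open>(u0 + w t)\<close>. Near 0 both norms involved stay within a factor 2 of their limits,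
   whence the factor 4 in the quotient.\<close>
 define \<alpha> where "\<alpha> = norm (c 0) / (4 * norm ?p0)"
 define \<beta> where "\<beta> = 4 * norm (c 0) / norm ?p0"
 have \<alpha>: "\<alpha> > 0" and \<beta>: "\<beta> > 0" using \<open>c 0 \<noteq> 0\<close> p0 by (auto simp: \<alpha>_def \<beta>_def)
 have ncp: "((%t. norm (c t)) \<longlongrightarrow> norm (c 0)) (nhds 0)" using ccont by (rule tendsto_norm)
 have evc: "\<forall>\<^sub>F t in nhds 0. norm (c 0) / 2 < norm (c t) \<and> norm (c t) < 2 * norm (c 0)"
  using order_tendstoD(1)[OF ncp, of "norm (c 0) / 2"] order_tendstoD(2)[OF ncp, of "2 * norm (c 0)"]
   \<open>c 0 \<noteq> 0\<close> by (intro eventually_conj) simp_all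
 have wlim: "((%t. u0 + w t) \<longlongrightarrow> u0) (nhds 0)"
  using evw by (intro tendstoI) (auto simp: dist_norm)
 have "isCont \<psi> u0" using continuous_\<psi> uD by (simp add: continuous_on_eq_continuous_at[OF D])
 hence n\<psi>: "((%t. norm (\<psi> (u0 + w t))) \<longlongrightarrow> norm ?p0) (nhds 0)"
  by (rule tendsto_norm[OF isCont_tendsto_compose[OF _ wlim]])
 have ev\<psi>: "\<forall>\<^sub>F t in nhds 0. norm ?p0 / 2 < norm (\<psi> (u0 + w t)) \<and> norm (\<psi> (u0 + w t)) < 2 * norm ?p0"
  using order_tendstoD(1)[OF n\<psi>, of "norm ?p0 / 2"] order_tendstoD(2)[OF n\<psi>, of "2 * norm ?p0"]
   p0 by (intro eventually_conj) simp_all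
 have bounds: "\<alpha> \<le> \<bar>a\<bar> \<and> \<bar>a\<bar> \<le> \<beta>"
  if "c t = a *\<^sub>R \<psi> (u0 + w t)" "norm (c 0) / 2 < norm (c t) \<and> norm (c t) < 2 * norm (c 0)"
   "norm ?p0 / 2 < norm (\<psi> (u0 + w t)) \<and> norm (\<psi> (u0 + w t)) < 2 * norm ?p0" for a t
 proof -
  have n: "norm (c t) = \<bar>a\<bar> * norm (\<psi> (u0 + w t))" using that(1) by simp
  have "norm (c 0) / 2 \<le> \<bar>a\<bar> * (2 * norm ?p0)"
   using that(2,3) n mult_left_mono[of "norm (\<psi> (u0 + w t))" "2 * norm ?p0" "\<bar>a\<bar>"] by simp
  moreover have "\<bar>a\<bar> * (norm ?p0 / 2) \<le> 2 * norm (c 0)"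
   using that(2,3) n mult_left_mono[of "norm ?p0 / 2" "norm (\<psi> (u0 + w t))" "\<bar>a\<bar>"] by simp
  ultimately show ?thesis using p0 by (simp add: \<alpha>_def \<beta>_def field_simps)
 qed
 have pc0: "p (c 0) = 0"
  using c0 p(2) linear_scale[OF p(1)] by (auto simp: span_singleton)
 have evcd: "\<forall>\<^sub>F t in nhds 0. norm (c t - c 0 - t *\<^sub>R d) \<le> e * \<bar>t\<bar>" if "e > 0" for e
 proof -
  obtain \<delta> where "\<delta> > 0" "\<And>t. norm (t - 0) < \<delta> ==> norm (c t - c 0 - (t - 0) *\<^sub>R d) \<le> e * norm (t - 0)"
   using cd \<open>e > 0\<close> unfolding has_derivative_at_alt by blast
  thus ?thesis unfolding eventually_nhds_metric by (auto simp: dist_norm)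
 qed
 \<comment> \<open>Applying \<open>p\<close> to \<open>c t - c 0\<close> gives at least \<alpha>
   times half of \<open>norm (w t)\<close>, the other half being absorbed by the remainder, and at
   most \<open>K (norm d + 1)\<close> times the absolute value of \<open>t\<close>. The constant is
   the quotient.\<close>
 define C where "C = 2 * K * (norm d + 1) / \<alpha>"
 have C: "C \<ge> 0" using K(1) \<alpha> by (simp add: C_def)
 have e1: "\<forall>\<^sub>F t in nhds 0. norm (c t - c 0 - t *\<^sub>R d) \<le> 1 * \<bar>t\<bar>" by (rule evcd) simp
 have e2: "\<forall>\<^sub>F t in nhds 0. norm (R (u0 + w t)) \<le> 1 / (2 * K) * norm (w t)"
  by (rule evR) (use K(1) in simp)
 have small: "\<forall>\<^sub>F t in nhds 0. norm (w t) \<le> C * \<bar>t\<bar>"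
  using eva evXU evc ev\<psi> e1 e2
 proof eventually_elim
  case (elim t)
  then obtain a where a: "c t = a *\<^sub>R \<psi> (u0 + w t)" by blast
  have b: "\<alpha> \<le> \<bar>a\<bar>" using bounds[OF a] elim by blast
  have "p (\<psi> (u0 + w t)) = w t + p (R (u0 + w t))"
  proof -
   have "\<psi> (u0 + w t) = ?p0 + L (w t) + R (u0 + w t)" by (simp add: R_def)
   thus ?thesis using p linear_add[OF p(1)] wS[of t] elim by simp
  qed
  hence pc: "p (c t) = a *\<^sub>R (w t + p (R (u0 + w t)))" using a linear_scale[OF p(1)] by simp
  have "norm (p (R (u0 + w t))) \<le> K * norm (R (u0 + w t))" by (rule K(2))
  also have "\<dots> \<le> K * (norm (w t) / (2 * K))" using elim K(1) by (intro mult_left_mono) auto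
  also have "\<dots> = norm (w t) / 2" using K(1) by simp
  finally have "norm (w t) / 2 \<le> norm (w t + p (R (u0 + w t)))"
   using norm_diff_ineq[of "w t" "p (R (u0 + w t))"] by linarith
  hence "\<alpha> * (norm (w t) / 2) \<le> \<bar>a\<bar> * norm (w t + p (R (u0 + w t)))"
   using b \<alpha> by (intro mult_mono) auto
  also have "\<dots> = norm (p (c t - c 0))" using pc pc0 linear_diff[OF p(1)] by simp
  also have "\<dots> \<le> K * norm (c t - c 0)" by (rule K(2))
  also have "norm (c t - c 0) \<le> norm (c t - c 0 - t *\<^sub>R d) + norm (t *\<^sub>R d)"
   using norm_triangle_ineq[of "c t - c 0 - t *\<^sub>R d" "t *\<^sub>R d"] by simp
  also have "\<dots> \<le> (norm d + 1) * \<bar>t\<bar>" using elim by (simp add: algebra_simps)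
  finally have "\<alpha> * (norm (w t) / 2) \<le> K * ((norm d + 1) * \<bar>t\<bar>)" using K(1) by simp
  thus ?case using \<alpha> by (simp add: C_def field_simps)
 qed
 \<comment> \<open>The part \<open>z\<close> of the velocity orthogonal to \<open>Ych u0\<close> has
   to vanish. Since \<open>inner z d = inner z z\<close>, it is enough to make
   \<open>inner z d\<close> arbitrarily small.\<close>
 obtain y z where y: "y \<in> span (Ych u0)" and z: "\<And>x. x \<in> span (Ych u0) ==> Linear_Algebra.orthogonal z x" and d: "d = y + z"
  using orthogonal_subspace_decomp_exists[of "Ych u0" d] by blast
 have spanY: "span (Ych u0) = Ych u0" using Y.sub_B by simp
 have zY: "inner z x = 0" if "x \<in> Ych u0" for x using z[of x] that spanY by (simp add: Linear_Algebra.orthogonal_def)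
 have zd: "inner z d = inner z z" using d zY y spanY by (simp add: inner_add_right)
 have zc0: "inner z (c 0) = 0" using c0 zY Y.A_subset by blast
 \<comment> \<open>Both \<psi> \<open>u0\<close> and the linear part at \<open>w t\<close> lie in
   \<open>Ych u0\<close>, so \<open>z\<close> sees only the remainder in \<open>c t\<close>. By
   \<open>small\<close> that remainder is at most \<open>e C\<close> times the absolute value of
   \<open>t\<close>; the summand 1 accounts for the error in the derivative of
   \<open>c\<close>.\<close>
 have bd: "\<bar>inner z d\<bar> \<le> e * (norm z * (\<beta> * C + 1))" if e: "e > 0" for e
 proof -
  have "\<forall>\<^sub>F t in nhds 0. \<bar>inner z d\<bar> * \<bar>t\<bar> \<le> e * (norm z * (\<beta> * C + 1)) * \<bar>t\<bar>"
   using eva evXU evc ev\<psi> evcd[OF e] evR[OF e] small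
  proof eventually_elim
   case (elim t)
   then obtain a where a: "c t = a *\<^sub>R \<psi> (u0 + w t)" by blast
   have b: "\<bar>a\<bar> \<le> \<beta>" using bounds[OF a] elim by blast
   have "\<psi> (u0 + w t) = (1 *\<^sub>R ?p0 + L (w t)) + R (u0 + w t)" by (simp add: R_def)
   hence "inner z (c t) = a * inner z (R (u0 + w t))"
    using a zY[OF memY[OF wS[of t], of 1]] elim by (simp add: inner_add_right)
   hence "\<bar>inner z (c t)\<bar> = \<bar>a\<bar> * \<bar>inner z (R (u0 + w t))\<bar>" by (simp add: abs_mult)
   also have "\<dots> \<le> \<beta> * (norm z * norm (R (u0 + w t)))"
    using b \<beta> Cauchy_Schwarz_ineq2[of z "R (u0 + w t)"] by (intro mult_mono) auto
   also have "\<dots> \<le> \<beta> * (norm z * (e * (C * \<bar>t\<bar>)))"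
   proof -
    have "norm (R (u0 + w t)) \<le> e * (C * \<bar>t\<bar>)"
     using elim e by (meson mult_left_mono order_trans less_imp_le)
    thus ?thesis using \<beta> by (intro mult_left_mono) auto
   qed
   finally have 1: "\<bar>inner z (c t)\<bar> \<le> e * norm z * \<beta> * C * \<bar>t\<bar>" by (simp add: ac_simps)
   have "\<bar>inner z (c t - c 0 - t *\<^sub>R d)\<bar> \<le> norm z * (e * \<bar>t\<bar>)"
    using Cauchy_Schwarz_ineq2[of z "c t - c 0 - t *\<^sub>R d"] elim
    by (meson mult_left_mono norm_ge_zero order_trans)
   moreover have "inner z (c t - c 0 - t *\<^sub>R d) = inner z (c t) - t * inner z d"
    using zc0 by (simp add: inner_diff_right)
   ultimately have "\<bar>t * inner z d\<bar> \<le> e * norm z * \<beta> * C * \<bar>t\<bar> + norm z * (e * \<bar>t\<bar>)" using 1 by linarith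
   thus ?case by (simp add: abs_mult algebra_simps)
  qed
  then obtain \<delta> where \<delta>: "\<delta> > 0" "\<And>t. dist t 0 < \<delta> ==>
    \<bar>inner z d\<bar> * \<bar>t\<bar> \<le> e * (norm z * (\<beta> * C + 1)) * \<bar>t\<bar>"
   unfolding eventually_nhds_metric by blast
  \<comment> \<open>Any admissible nonzero time serves to cancel the factor that depends on
    \<open>t\<close>.\<close>
  from \<delta>(2)[of "\<delta> / 2"] \<delta>(1) show ?thesis by simp
 qed
 have "\<bar>inner z d\<bar> \<le> 0"
 proof (rule field_le_epsilon)
  fix \<epsilon> :: real assume \<epsilon>: "\<epsilon> > 0"
  let ?M = "norm z * (\<beta> * C + 1)"
  have M: "?M \<ge> 0" using \<beta> C by simp
  \<comment> \<open>The divisor is \<open>?M + 1\<close> because \<open>?M\<close> vanishes when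
    \<open>z\<close> does.\<close>
  have "\<bar>inner z d\<bar> \<le> \<epsilon> / (?M + 1) * ?M" using bd[of "\<epsilon> / (?M + 1)"] \<epsilon> M by simp
  also have "\<dots> \<le> \<epsilon>"
  proof -
   have "\<epsilon> * ?M \<le> \<epsilon> * (?M + 1)" using \<epsilon> by (intro mult_left_mono) auto
   thus ?thesis using M by (simp add: field_simps)
  qed
  finally show "\<bar>inner z d\<bar> \<le> 0 + \<epsilon>" by simp
 qed
 hence "inner z z = 0" using zd inner_ge_zero[of z] by linarith
 hence "z = 0" by simp
 thus ?thesis using d y spanY by simp
qed

text \<open>One inclusion is \<open>velocity_in_Ych\<close>. For the other, the direction
  \<open>h\<close> of a representative is realized by the curve that \<psi> traces along the segment
  from \<open>u0\<close> in direction \<open>h\<close>, which stays in \<open>S\<close>.\<close>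

lemma tangent_space_chart:
 assumes u0: "u0 \<in> D \<inter> S"
 shows "tangent_space X (span {\<psi> u0})
  = vcarrier (vs_hom (vs_of (span {\<psi> u0})) (vs_quot (span {\<psi> u0}) (Ych u0)))"
proof -
 let ?l = "span {\<psi> u0}"
 have ops: "vadd (vs_quot ?l A) = vadd (vs_quot ?l B)" "vscale (vs_quot ?l A) = vscale (vs_quot ?l B)" for A B
  by (simp_all add: vs_quot_def)
 interpret Y: line_in_space ?l "Ych u0" "\<psi> u0" m "%i. d\<psi> u0 (base i)"
  by (rule line_in_Ych[OF u0])
 have hom: "\<phi> \<in> vcarrier (vs_hom (vs_of ?l) (vs_quot ?l B)) \<longleftrightarrow>
   \<phi> \<in> vcarrier (vs_hom (vs_of ?l) (vs_quot ?l UNIV)) \<and> (\<forall>x\<in>?l. \<phi> x \<in> vs_coset ?l ` B)" for \<phi> B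
  unfolding vs_hom_iff vlinear_def using ops[of B UNIV] by (auto simp: quot_simps)
 show ?thesis
 proof
  show "tangent_space X ?l \<subseteq> vcarrier (vs_hom (vs_of ?l) (vs_quot ?l (Ych u0)))"
  proof
   fix \<phi> assume "\<phi> \<in> tangent_space X ?l"
   then obtain c d where \<phi>: "\<phi> \<in> vcarrier (vs_hom (vs_of ?l) (vs_quot ?l UNIV))"
    and c: "(c has_vector_derivative d) (at 0)" "c 0 \<in> ?l"
     "\<forall>\<^sub>F t in nhds 0. c t \<noteq> 0 \<and> span {c t} \<in> X" "d \<in> \<phi> (c 0)"
    unfolding tangent_space_def by blast
   have d: "d \<in> Ych u0" by (rule velocity_in_Ych[OF u0 c(1-3)])
   have c0: "c 0 \<noteq> 0" using eventually_nhds_x_imp_x[OF c(3)] by blast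
   have vl: "vline (vs_of ?l) (c 0)" by (rule vline_proj[OF span_in_proj[OF nz[OF u0]] c(2) c0])
   have "\<phi> (c 0) \<in> vs_coset ?l ` UNIV" using \<phi> c(2) by (auto simp: vs_hom_iff vlinear_def quot_simps)
   hence pd: "\<phi> (c 0) = vs_coset ?l d" using c(4) coset_eqI[OF Y.sub_A] by blast
   have "\<phi> x \<in> vs_coset ?l ` Ych u0" if x: "x \<in> ?l" for x
   proof -
    have "\<phi> x = vscale (vs_quot ?l UNIV) (lcoef (vs_of ?l) (c 0) x) (\<phi> (c 0))"
     by (rule line_hom_apply[OF Y.real_vs_A vl \<phi>]) (use x in simp)
    also have "\<dots> = vs_coset ?l (lcoef (vs_of ?l) (c 0) x *\<^sub>R d)"
     unfolding pd by (rule quot_scale[OF Y.sub_A])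
    finally show ?thesis using subspace_scale[OF Y.sub_B d] by blast
   qed
   thus "\<phi> \<in> vcarrier (vs_hom (vs_of ?l) (vs_quot ?l (Ych u0)))"
    using hom[of \<phi> "Ych u0"] \<phi> by blast
  qed
  show "vcarrier (vs_hom (vs_of ?l) (vs_quot ?l (Ych u0))) \<subseteq> tangent_space X ?l"
  proof
   fix \<phi> assume \<phi>Y: "\<phi> \<in> vcarrier (vs_hom (vs_of ?l) (vs_quot ?l (Ych u0)))"
   hence \<phi>: "\<phi> \<in> vcarrier (vs_hom (vs_of ?l) (vs_quot ?l UNIV))"
    and im: "\<forall>x\<in>?l. \<phi> x \<in> vs_coset ?l ` Ych u0" using hom[of \<phi> "Ych u0"] by blast+
   then obtain y where y: "y \<in> Ych u0" "\<phi> (\<psi> u0) = vs_coset ?l y" using Y.v_mem by blast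
   then obtain a h where h: "y = a *\<^sub>R \<psi> u0 + d\<psi> u0 h" "h \<in> S" unfolding Ych_def by blast
   \<comment> \<open>The summand along \<psi> \<open>u0\<close> disappears in the quotient by the
     line, so the derivative alone represents the class.\<close>
   have dh: "d\<psi> u0 h \<in> \<phi> (\<psi> u0)"
    using h(1) y(2) subspace_scale[OF Y.sub_A Y.v_mem, of "- a"] by (simp add: mem_coset_iff)
   let ?c = "%t. \<psi> (u0 + t *\<^sub>R h)"
   have uD: "u0 \<in> D" and uS: "u0 \<in> S" using u0 by auto
   have "((%t. u0 + t *\<^sub>R h) has_derivative (%t. t *\<^sub>R h)) (at 0)"
    by (auto intro!: derivative_eq_intros)
   moreover have "(\<psi> has_derivative d\<psi> u0) (at (u0 + 0 *\<^sub>R h))" using has_derivative[OF uD] by simp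
   ultimately have "(?c has_derivative (%t. d\<psi> u0 (t *\<^sub>R h))) (at 0)"
    by (rule has_derivative_compose)
   hence vd: "(?c has_vector_derivative d\<psi> u0 h) (at 0)"
    using linear_scale[OF linear_derivative[OF uD]] by (simp add: has_vector_derivative_def)
   have "((%t. u0 + t *\<^sub>R h) \<longlongrightarrow> u0 + 0 *\<^sub>R h) (nhds 0)"
    by (intro tendsto_intros) (simp add: filterlim_ident)
   hence "\<forall>\<^sub>F t in nhds 0. u0 + t *\<^sub>R h \<in> D" using D uD by (intro topological_tendstoD) auto
   hence "\<forall>\<^sub>F t in nhds 0. ?c t \<noteq> 0 \<and> span {?c t} \<in> X"
   proof (rule eventually_mono)
    fix t assume "u0 + t *\<^sub>R h \<in> D"
    hence "u0 + t *\<^sub>R h \<in> D \<inter> S" using subspace_add[OF S(1) uS subspace_scale[OF S(1) h(2)]] by blast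
    thus "?c t \<noteq> 0 \<and> span {?c t} \<in> X" using nz chart_line by blast
   qed
   thus "\<phi> \<in> tangent_space X ?l"
    unfolding tangent_space_def using \<phi> vd dh Y.v_mem
    by (intro CollectI conjI exI[of _ ?c] exI[of _ "d\<psi> u0 h"]) auto
  qed
 qed
qed

end

text \<open>Evaluating the homomorphism that sends \<open>v\<close> to the class of \<open>b\<close>
  recovers \<open>b\<close> up to \<open>A\<close>, and \<open>A\<close> lies in \<open>C\<close>.
  Applied in both directions, this gives the uniqueness demanded by \<open>Y_fib\<close>.\<close>

lemma hom_quot_determines:
 assumes A: "subspace A" and v: "vline (vs_of A) v"
  and B: "subspace B" "A \<subseteq> B" and C: "subspace C" "A \<subseteq> C"
  and sub: "vcarrier (vs_hom (vs_of A) (vs_quot A B)) \<subseteq> vcarrier (vs_hom (vs_of A) (vs_quot A C))"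
 shows "B \<subseteq> C"
proof
 fix b assume b: "b \<in> B"
 note RA = real_vs_vs_of[OF A]
 have vA: "v \<in> A" using vline_mem[OF v] by simp
 have "tangent_vec A v b \<in> vcarrier (vs_hom (vs_of A) (vs_quot A B))"
  unfolding tangent_vec_def vs_hom_iff vlinear_def
  using b subspace_add[OF A] subspace_scale[OF A] subspace_scale[OF B(1)]
   vcoord_add[OF RA v] vcoord_scale[OF RA v]
  by (auto simp: quot_simps quot_add[OF A] quot_scale[OF A] algebra_simps)
 hence "tangent_vec A v b \<in> vcarrier (vs_hom (vs_of A) (vs_quot A C))" using sub by blast
 hence "tangent_vec A v b v \<in> vs_coset A ` C" using vA by (auto simp: vs_hom_iff vlinear_def quot_simps)
 moreover have "tangent_vec A v b v = vs_coset A b"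
  using lcoef_self[OF RA v] vA by (simp add: tangent_vec_def)
 ultimately obtain c where c: "c \<in> C" "vs_coset A b = vs_coset A c" by auto
 hence "b - c \<in> C" using coset_eq_iff[OF A] C(2) by blast
 from subspace_add[OF C(1) this c(1)] show "b \<in> C" by simp
qed

context chart
begin

lemma Y_fib_chart:
 assumes u0: "u0 \<in> D \<inter> S"
 shows "Y_fib X (span {\<psi> u0}) = Ych u0"
 unfolding Y_fib_def
proof (rule the_equality)
 interpret Y: line_in_space "span {\<psi> u0}" "Ych u0" "\<psi> u0" m "%i. d\<psi> u0 (base i)"
  by (rule line_in_Ych[OF u0])
 show "subspace (Ych u0) \<and> span {\<psi> u0} \<subseteq> Ych u0 \<and> tangent_space X (span {\<psi> u0})
  = vcarrier (vs_hom (vs_of (span {\<psi> u0})) (vs_quot (span {\<psi> u0}) (Ych u0)))"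
  using Y.sub_B Y.A_subset tangent_space_chart[OF u0] by blast
 fix Y assume Y: "subspace Y \<and> span {\<psi> u0} \<subseteq> Y \<and> tangent_space X (span {\<psi> u0})
  = vcarrier (vs_hom (vs_of (span {\<psi> u0})) (vs_quot (span {\<psi> u0}) Y))"
 show "Y = Ych u0"
 proof
  show "Y \<subseteq> Ych u0"
   by (rule hom_quot_determines[OF Y.sub_A Y.line_A])
     (use Y Y.sub_B Y.A_subset tangent_space_chart[OF u0] in auto)
  show "Ych u0 \<subseteq> Y"
   by (rule hom_quot_determines[OF Y.sub_A Y.line_A])
     (use Y Y.sub_B Y.A_subset tangent_space_chart[OF u0] in auto)
 qed
qed

end

section \<open>Local frames over a submanifold\<close>

lemma smooth_submanifold_chart:
 assumes "smooth_submanifold m X" "l \<in> X"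
 obtains U S D \<psi> where "chart m X U S D \<psi>" "l \<in> U"
proof -
 from assms(1)[unfolded smooth_submanifold_def, THEN conjunct2, THEN bspec, OF assms(2)]
 show thesis
 proof (elim exE)
  fix U S D and \<psi> :: "'a \<Rightarrow> 'a" assume *:
  "openin proj_top U \<and> l \<in> U \<and> subspace S \<and> dim S = m \<and> open D \<and>
    smooth_on D \<psi> \<and> (\<forall>u\<in>D \<inter> S. \<psi> u \<noteq> 0) \<and>
    homeomorphic_map (subtopology euclidean (D \<inter> S)) (subtopology proj_top (X \<inter> U))
     (%u. span {\<psi> u}) \<and>
    (\<forall>u\<in>D \<inter> S. \<forall>h\<in>S. frechet_derivative \<psi> (at u) h \<in> span {\<psi> u} \<longrightarrow> h = 0)"
 have "chart m X U S D \<psi>"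
 proof (rule chart.intro)
  show "X \<subseteq> proj UNIV" using assms(1) unfolding smooth_submanifold_def by (rule conjunct1)
  show "openin proj_top U" "subspace S" "dim S = m" "open D" "smooth_on D \<psi>"
   "homeomorphic_map (subtopology euclidean (D \<inter> S)) (subtopology proj_top (X \<inter> U)) (%u. span {\<psi> u})"
   using * by - (elim conjE, assumption)+
  have "\<forall>u\<in>D \<inter> S. \<psi> u \<noteq> 0" using * by - (elim conjE, assumption)
  thus "\<psi> u \<noteq> 0" if "u \<in> D \<inter> S" for u using that by (rule bspec)
  have "\<forall>u\<in>D \<inter> S. \<forall>h\<in>S. frechet_derivative \<psi> (at u) h \<in> span {\<psi> u} \<longrightarrow> h = 0"
   using * by - (elim conjE, assumption)
  thus "h = 0" if "u \<in> D \<inter> S" "h \<in> S" "frechet_derivative \<psi> (at u) h \<in> span {\<psi> u}" for u h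
   using that by metis
 qed
 moreover have "l \<in> U" using * by - (elim conjE, assumption)
 ultimately show thesis by (rule that)
 qed
qed

context chart
begin

lemma chart_inverse:
 "\<exists>g. continuous_map (subtopology proj_top (X \<inter> U)) (top_of_set (D \<inter> S)) g \<and>
  (\<forall>u\<in>D \<inter> S. g (span {\<psi> u}) = u) \<and> (\<forall>l\<in>X \<inter> U. span {\<psi> (g l)} = l) \<and> (\<forall>l\<in>X \<inter> U. g l \<in> D \<inter> S)"
proof -
 have top: "topspace (subtopology proj_top (X \<inter> U)) = X \<inter> U" using X by auto
 from homeo obtain g where g: "continuous_map (subtopology proj_top (X \<inter> U)) (top_of_set (D \<inter> S)) g"
  "\<forall>u\<in>topspace (top_of_set (D \<inter> S)). g (span {\<psi> u}) = u"
  "\<forall>l\<in>topspace (subtopology proj_top (X \<inter> U)). span {\<psi> (g l)} = l"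
  unfolding homeomorphic_map_maps homeomorphic_maps_def by blast
 have "g l \<in> D \<inter> S" if "l \<in> X \<inter> U" for l
  using g(1) that unfolding continuous_map_def top by auto
 with g show ?thesis unfolding top by (intro exI[of _ g]) simp
qed

definition chart_inv :: "'v set \<Rightarrow> 'v" where
 "chart_inv = (SOME g. continuous_map (subtopology proj_top (X \<inter> U)) (top_of_set (D \<inter> S)) g \<and>
  (\<forall>u\<in>D \<inter> S. g (span {\<psi> u}) = u) \<and> (\<forall>l\<in>X \<inter> U. span {\<psi> (g l)} = l) \<and> (\<forall>l\<in>X \<inter> U. g l \<in> D \<inter> S))"

lemma chart_inv:
 shows "continuous_map (subtopology proj_top (X \<inter> U)) (top_of_set (D \<inter> S)) chart_inv"
  and "u \<in> D \<inter> S ==> chart_inv (span {\<psi> u}) = u"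
  and "l \<in> X \<inter> U ==> span {\<psi> (chart_inv l)} = l"
  and "l \<in> X \<inter> U ==> chart_inv l \<in> D \<inter> S"
proof -
 note P = someI_ex[OF chart_inverse, folded chart_inv_def]
 show "continuous_map (subtopology proj_top (X \<inter> U)) (top_of_set (D \<inter> S)) chart_inv"
  by (rule P[THEN conjunct1])
 show "chart_inv (span {\<psi> u}) = u" if "u \<in> D \<inter> S"
  by (rule P[THEN conjunct2, THEN conjunct1, THEN bspec, OF that])
 show "span {\<psi> (chart_inv l)} = l" if "l \<in> X \<inter> U"
  by (rule P[THEN conjunct2, THEN conjunct2, THEN conjunct1, THEN bspec, OF that])
 show "chart_inv l \<in> D \<inter> S" if "l \<in> X \<inter> U"
  by (rule P[THEN conjunct2, THEN conjunct2, THEN conjunct2, THEN bspec, OF that])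
qed

lemma continuous_chart: "continuous_map (top_of_set (D \<inter> S)) (subtopology proj_top (X \<inter> U)) (%u. span {\<psi> u})"
 using homeo homeomorphic_imp_continuous_map by blast

text \<open>The frame consists of \<psi> and its derivatives along \<open>base\<close>, composed
  with the inverse of the chart; continuity of the derivatives is the only smoothness that enters
  here.\<close>

lemma chart_frame:
 "\<exists>v y. cont_on (subtopology proj_top X) (X \<inter> U) v \<and>
  (\<forall>i<m. cont_on (subtopology proj_top X) (X \<inter> U) (y i)) \<and>
  (\<forall>l\<in>X \<inter> U. line_in_space l (Y_fib X l) (v l) m (%i. y i l))"
proof -
 have "continuous_map (subtopology proj_top (X \<inter> U)) euclidean chart_inv"
  using chart_inv(1) continuous_map_into_fulltopology by blast
 hence cg: "cont_on (subtopology proj_top X) (X \<inter> U) chart_inv"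
  by (simp add: cont_on_def subtopology_subtopology)
 show ?thesis
 proof (intro exI[of _ "%l. \<psi> (chart_inv l)"] exI[of _ "%i l. d\<psi> (chart_inv l) (base i)"] conjI allI impI ballI)
  show "cont_on (subtopology proj_top X) (X \<inter> U) (%l. \<psi> (chart_inv l))"
   using continuous_\<psi> chart_inv(4) by (intro cont_on_isCont[OF cg]) (auto simp: continuous_on_eq_continuous_at[OF D])
  show "cont_on (subtopology proj_top X) (X \<inter> U) (%l. d\<psi> (chart_inv l) (base i))" for i
  proof (rule cont_on_isCont[OF cg, where h = "%u. d\<psi> u (base i)"])
   show "isCont (%u. d\<psi> u (base i)) (chart_inv l)" if "l \<in> X \<inter> U" for l
    using continuous_derivative[of "base i"] chart_inv(4)[OF that] by (simp add: continuous_on_eq_continuous_at[OF D])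
  qed
  fix l assume l: "l \<in> X \<inter> U"
  show "line_in_space l (Y_fib X l) (\<psi> (chart_inv l)) m (%i. d\<psi> (chart_inv l) (base i))"
   using line_in_Ych[OF chart_inv(4)[OF l]] Y_fib_chart[OF chart_inv(4)[OF l]] chart_inv(3)[OF l] by simp
 qed
qed

lemma tangent_space_Y_fib:
 assumes "l \<in> X \<inter> U"
 shows "tangent_space X l = vcarrier (vs_hom (vs_of l) (vs_quot l (Y_fib X l)))"
proof -
 show ?thesis
  using tangent_space_chart[OF chart_inv(4)[OF assms]] Y_fib_chart[OF chart_inv(4)[OF assms]]
   chart_inv(3)[OF assms] by simp
qed

text \<open>The paths are the images of segments in the chart.\<close>

lemma chart_paths:
 assumes W: "openin (subtopology proj_top X) W" and l0: "l0 \<in> W" "l0 \<in> U"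
 shows "\<exists>W'. openin (subtopology proj_top X) W' \<and> l0 \<in> W' \<and> W' \<subseteq> W \<and>
  (\<forall>l\<in>W'. \<exists>\<sigma>. singular_simplex 1 (subtopology proj_top X) \<sigma> \<and> \<sigma> vertex0 = l0 \<and> \<sigma> vertex1 = l \<and>
   \<sigma> ` standard_simplex 1 \<subseteq> W)"
proof -
 have WX: "W \<subseteq> X" using openin_subset[OF W] by auto
 have l0X: "l0 \<in> X \<inter> U" using l0 WX by blast
 have top: "topspace (subtopology proj_top (X \<inter> U)) = X \<inter> U" using X by auto
 have WU: "openin (subtopology proj_top (X \<inter> U)) (W \<inter> U)"
 proof -
  obtain G where "openin proj_top G" "W = G \<inter> X" using W unfolding openin_subtopology by blast
  thus ?thesis unfolding openin_subtopology by (intro exI[of _ G]) auto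
 qed
 have "openin (top_of_set (D \<inter> S)) {u \<in> topspace (top_of_set (D \<inter> S)). span {\<psi> u} \<in> W \<inter> U}"
  by (rule openin_continuous_map_preimage[OF continuous_chart WU])
 then obtain Q where Q: "open Q" "{u \<in> D \<inter> S. span {\<psi> u} \<in> W \<inter> U} = (D \<inter> S) \<inter> Q"
  unfolding openin_open by auto
 have g0: "chart_inv l0 \<in> D \<inter> S" "span {\<psi> (chart_inv l0)} = l0" using chart_inv(3,4) l0X by auto
 hence "chart_inv l0 \<in> Q \<inter> D" using Q(2) l0 by auto
 moreover have "open (Q \<inter> D)" using Q(1) D by auto
 ultimately obtain r where r: "r > 0" "ball (chart_inv l0) r \<subseteq> Q \<inter> D" by (meson openE)
 \<comment> \<open>In the chart this is a ball around the parameter of \<open>l0\<close> inside the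
   part mapped to \<open>W\<close>. A ball is convex and \<open>S\<close> is a subspace, so the
   segment from the centre to any parameter of \<open>W'\<close> stays in the domain.\<close>
 define W' where "W' = {l \<in> X \<inter> U. chart_inv l \<in> ball (chart_inv l0) r}"
 have oW': "openin (subtopology proj_top X) W'"
 proof -
  have "openin (subtopology proj_top (X \<inter> U)) {l \<in> topspace (subtopology proj_top (X \<inter> U)). chart_inv l \<in> (D \<inter> S) \<inter> ball (chart_inv l0) r}"
   by (rule openin_continuous_map_preimage[OF chart_inv(1)]) (simp add: openin_open_Int)
  also have "{l \<in> topspace (subtopology proj_top (X \<inter> U)). chart_inv l \<in> (D \<inter> S) \<inter> ball (chart_inv l0) r} = W'"
   unfolding top W'_def using chart_inv(4) by auto
  finally obtain G where "openin proj_top G" "W' = G \<inter> (X \<inter> U)" unfolding openin_subtopology by blast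
  thus ?thesis unfolding openin_subtopology using U by (intro exI[of _ "G \<inter> U"]) auto
 qed
 show ?thesis
 proof (intro exI[of _ W'] conjI ballI oW')
  show "l0 \<in> W'" using l0X r(1) by (simp add: W'_def)
  have inW: "span {\<psi> u} \<in> W" if "u \<in> ball (chart_inv l0) r" "u \<in> S" for u
  proof -
   have "u \<in> (D \<inter> S) \<inter> Q" using r(2) that by blast
   hence "u \<in> {u \<in> D \<inter> S. span {\<psi> u} \<in> W \<inter> U}" unfolding Q(2) .
   thus ?thesis by blast
  qed
  show "W' \<subseteq> W"
  proof
   fix l assume "l \<in> W'"
   hence "l \<in> X \<inter> U" "chart_inv l \<in> ball (chart_inv l0) r" by (auto simp: W'_def)
   thus "l \<in> W" using inW[of "chart_inv l"] chart_inv(3,4) by auto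
  qed
  fix l assume l: "l \<in> W'"
  hence lX: "l \<in> X \<inter> U" and lb: "chart_inv l \<in> ball (chart_inv l0) r" by (auto simp: W'_def)
  let ?u = "\<lambda>z :: nat \<Rightarrow> real. chart_inv l0 + z 1 *\<^sub>R (chart_inv l - chart_inv l0)"
  let ?I = "subtopology (powertop_real UNIV) (standard_simplex 1)"
  let ?\<sigma> = "restrict (%z. span {\<psi> (?u z)}) (standard_simplex 1)"
  have uS: "?u z \<in> S" for z
   using chart_inv(4)[OF lX] g0(1) by (intro subspace_add[OF S(1)] subspace_scale[OF S(1)] subspace_diff[OF S(1)]) auto
  have ub: "?u z \<in> ball (chart_inv l0) r" if "z \<in> standard_simplex 1" for z
  proof -
   have "0 \<le> z 1" "z 1 \<le> 1" using that by (auto simp: standard_simplex_def)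
   hence "norm (z 1 *\<^sub>R (chart_inv l - chart_inv l0)) \<le> norm (chart_inv l - chart_inv l0)" by (simp add: mult_left_le_one_le)
   thus ?thesis using lb by (simp add: dist_norm norm_minus_commute)
  qed
  have "continuous_map ?I euclideanreal (%z. z 1)"
   by (intro continuous_map_from_subtopology continuous_map_product_projection) auto
  hence "cont_on ?I (standard_simplex 1) (%z. z 1)"
   unfolding cont_on_def by (rule continuous_map_from_subtopology)
  hence "cont_on ?I (standard_simplex 1) ?u"
   by (intro cont_on_add cont_on_scaleR cont_on_const)
  hence "continuous_map ?I euclidean ?u"
   unfolding cont_on_def by (simp add: subtopology_subtopology)
  hence "continuous_map ?I (top_of_set (D \<inter> S)) ?u"
   using uS ub r(2) by (auto simp: continuous_map_in_subtopology)
  from continuous_map_compose[OF this continuous_chart]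
  have "continuous_map ?I (subtopology proj_top (X \<inter> U)) (%z. span {\<psi> (?u z)})" by (simp add: o_def)
  hence "continuous_map ?I (subtopology proj_top X) (%z. span {\<psi> (?u z)})"
   by (auto simp: continuous_map_in_subtopology)
  hence "continuous_map ?I (subtopology proj_top X) ?\<sigma>"
   by (rule continuous_map_eq) simp
  hence "singular_simplex 1 (subtopology proj_top X) ?\<sigma>"
   by (simp add: singular_simplex_def)
  moreover have "vertex0 \<in> standard_simplex 1" "vertex1 \<in> standard_simplex 1"
   using basis_in_standard_simplex[of 0 1] basis_in_standard_simplex[of 1 1]
   by (simp_all add: vertex0_def vertex1_def)
  hence "?\<sigma> vertex0 = l0" "?\<sigma> vertex1 = l"
   using g0(2) chart_inv(3)[OF lX] by (simp_all add: vertex0_def vertex1_def)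
  moreover have "span {\<psi> (?u z)} \<in> W" if "z \<in> standard_simplex 1" for z
   by (rule inW) (rule ub[OF that], rule uS)
  hence "?\<sigma> ` standard_simplex 1 \<subseteq> W" by auto
  ultimately show "\<exists>\<sigma>. singular_simplex 1 (subtopology proj_top X) \<sigma> \<and> \<sigma> vertex0 = l0 \<and> \<sigma> vertex1 = l \<and>
    \<sigma> ` standard_simplex 1 \<subseteq> W" by blast
 qed
qed

end

text \<open>Fibres are compared over the base only: the tangent bundle agrees with
  \<open>Hom(l, Y/l)\<close> at the points of \<open>X\<close>, but the fibre function also has
  values off \<open>X\<close>, so the two records cannot simply be equated.\<close>

lemma bundle_transfer:
 assumes base: "bbase E = bbase F" and fib: "\<And>x. x \<in> topspace (bbase E) ==> bfib E x = bfib F x"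
  and sec: "bsec E = bsec F"
 shows "section_sheaf F ==> section_sheaf E" "lframe F U r b ==> lframe E U r b"
proof -
 have m: "bfib E x = bfib F x" if "openin (bbase F) U" "x \<in> U" for x U
  using fib base that openin_subset by fastforce
 show "section_sheaf E" if F: "section_sheaf F"
  unfolding section_sheaf_def
 proof (intro conjI allI impI ballI)
  show "real_vs (bfib E x)" if "x \<in> topspace (bbase E)" for x
   using sheaf_real_vs[OF F] fib[OF that] that base by simp
  show "openin (bbase E) U" if "bsec E U s" for U s
   using sheaf_openin[OF F] that base sec by simp
  show "s x \<in> vcarrier (bfib E x)" if "bsec E U s" "x \<in> U" for U s x
   using sheaf_mem[OF F, of U s x] sheaf_openin[OF F, of U s] m[of U x] that sec by simp
  show "bsec E (\<Union>\<U>) s \<longleftrightarrow> (\<forall>U\<in>\<U>. bsec E U s)" if "\<forall>U\<in>\<U>. openin (bbase E) U" for \<U> s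
   using sheaf_Union[OF F, of \<U> s] that base sec by simp
 qed
 show "lframe E U r b" if b: "lframe F U r b"
  unfolding lframe_def frame_def
 proof (intro conjI allI impI ballI)
  show o: "openin (bbase E) U" using b base by (simp add: lframe_def)
  show "bsec E U (b i)" if "i < r" for i using lframe_bsec[OF b that] sec by simp
  show "vs_basis (bfib E x) r (%i. b i x)" if "x \<in> U" for x
   using b m[of U x] that by (simp add: lframe_def frame_def)
  fix V s assume V: "openin (bbase E) V \<and> V \<subseteq> U"
  hence "lincomb (bfib E y) r c d = lincomb (bfib F y) r c d" if "y \<in> V" for y c d
   using m[of V y] that base by simp
  moreover have "bsec F V s \<longleftrightarrow> (\<exists>c. (\<forall>i<r. cont_on (bbase F) V (c i)) \<and>
    (\<forall>y\<in>V. s y = lincomb (bfib F y) r (%i. c i y) (%i. b i y)))"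
   using b V base unfolding lframe_def by simp
  ultimately show "bsec E V s \<longleftrightarrow> (\<exists>c. (\<forall>i<r. cont_on (bbase E) V (c i)) \<and>
    (\<forall>y\<in>V. s y = lincomb (bfib E y) r (%i. c i y) (%i. b i y)))"
   unfolding sec base by (simp cong: ball_cong)
 qed
qed

lemma line_in_space_scale:
 assumes "line_in_space A B v m y" and a: "a \<noteq> 0"
 shows "line_in_space A B (a *\<^sub>R v) m y"
proof -
 interpret line_in_space A B v m y by fact
 show ?thesis
 proof
  show "subspace A" "subspace B" by (fact sub_A, fact sub_B)
  show "vline (vs_of A) (a *\<^sub>R v)" using vline_scale[OF real_vs_A line_A a] by simp
  show "vs_basis (vs_of B) (Suc m) (case_nat (a *\<^sub>R v) y)"
  proof (rule vs_basisI[OF real_vs_B])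
   show "case_nat (a *\<^sub>R v) y i \<in> vcarrier (vs_of B)" if "i < Suc m" for i
    using that v_mem A_subset subspace_scale[OF sub_B] y_mem by (cases i) auto
  next
   fix x assume "x \<in> vcarrier (vs_of B)"
   then obtain c d where "x = c *\<^sub>R v + (\<Sum>i<m. d i *\<^sub>R y i)" using B_expand[of x] by auto
   hence "x = (\<Sum>i<Suc m. case_nat (c / a) d i *\<^sub>R case_nat (a *\<^sub>R v) y i)"
    using a unfolding sum.lessThan_Suc_shift by simp
   thus "\<exists>c. x = lincomb (vs_of B) (Suc m) c (case_nat (a *\<^sub>R v) y)" unfolding lincomb_vs_of by blast
  next
   fix c assume "lincomb (vs_of B) (Suc m) c (case_nat (a *\<^sub>R v) y) = vzero (vs_of B)"
   hence "lincomb (vs_of B) (Suc m) (case_nat (c 0 * a) (%i. c (Suc i))) (case_nat v y) = vzero (vs_of B)"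
    unfolding lincomb_vs_of sum.lessThan_Suc_shift by simp
   from vs_basis_indep[OF real_vs_B basis_B this]
   have z: "case_nat (c 0 * a) (%i. c (Suc i)) i = 0" if "i < Suc m" for i using that by blast
   show "\<forall>i<Suc m. c i = 0"
   proof (intro allI impI)
    fix i assume "i < Suc m"
    thus "c i = 0" using z[of i] a by (cases i) auto
   qed
  qed
 qed
qed

lemma lgen_scale:
 assumes sh: "section_sheaf E" and e: "lgen E U e" and c: "cont_on (bbase E) U c"
  and nz: "\<And>x. x \<in> U ==> c x \<noteq> 0"
 shows "lgen E U (%x. vscale (bfib E x) (c x) (e x))"
proof (rule lgenI)
 note R = lframe_real_vs[OF sh e] and L = lgen_line[OF sh e]
 show "openin (bbase E) U" by (rule lframe_openin[OF sh e])
 show vl: "vline (bfib E y) (vscale (bfib E y) (c y) (e y))" if "y \<in> U" for y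
  by (rule vline_scale[OF R[OF that] L[OF that] nz[OF that]])
 fix V s assume V: "openin (bbase E) V" "V \<subseteq> U"
 have cV: "cont_on (bbase E) V c" by (rule cont_on_subset[OF c V(2)])
 have lc: "lcoef (bfib E y) (e y) x = c y * lcoef (bfib E y) (vscale (bfib E y) (c y) (e y)) x"
  if y: "y \<in> U" and x: "x \<in> vcarrier (bfib E y)" for y x
 proof -
  have "x = vscale (bfib E y) (lcoef (bfib E y) (vscale (bfib E y) (c y) (e y)) x * c y) (e y)"
   using lcoef_scale[OF R[OF y] vl[OF y] x] real_vsD(9)[OF R[OF y] vline_mem[OF L[OF y]]] by simp
  hence "lcoef (bfib E y) (e y) x = lcoef (bfib E y) (vscale (bfib E y) (c y) (e y)) x * c y"
   using lcoef_unique[OF R[OF y] L[OF y]] by metis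
  thus ?thesis by simp
 qed
 have "cont_on (bbase E) V (%y. lcoef (bfib E y) (e y) (s y)) \<longleftrightarrow>
   cont_on (bbase E) V (%y. lcoef (bfib E y) (vscale (bfib E y) (c y) (e y)) (s y))"
  if s: "\<forall>y\<in>V. s y \<in> vcarrier (bfib E y)"
 proof
  assume "cont_on (bbase E) V (%y. lcoef (bfib E y) (vscale (bfib E y) (c y) (e y)) (s y))"
  from cont_on_mult[OF cV this] show "cont_on (bbase E) V (%y. lcoef (bfib E y) (e y) (s y))"
   by (rule cont_on_cong) (rule lc[symmetric], use s V(2) in auto)
 next
  assume "cont_on (bbase E) V (%y. lcoef (bfib E y) (e y) (s y))"
  hence "cont_on (bbase E) V (%y. lcoef (bfib E y) (e y) (s y) / c y)"
   by (rule cont_on_divide[OF _ cV]) (use nz V(2) in auto)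
  thus "cont_on (bbase E) V (%y. lcoef (bfib E y) (vscale (bfib E y) (c y) (e y)) (s y))"
  proof (rule cont_on_cong)
   fix y assume "y \<in> V"
   hence y: "y \<in> U" "s y \<in> vcarrier (bfib E y)" using V(2) s by auto
   show "lcoef (bfib E y) (e y) (s y) / c y = lcoef (bfib E y) (vscale (bfib E y) (c y) (e y)) (s y)"
    using lc[OF y] nz[OF y(1)] by simp
  qed
 qed
 thus "bsec E V s \<longleftrightarrow> (\<forall>y\<in>V. s y \<in> vcarrier (bfib E y)) \<and>
   cont_on (bbase E) V (%y. lcoef (bfib E y) (vscale (bfib E y) (c y) (e y)) (s y))"
  using bsec_iff_lcoef[OF sh e V] by blast
qed (rule lframe_real_vs[OF sh e])

section \<open>The tautological, tangent and \<open>Y\<close> bundles of a submanifold\<close>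

locale submanifold =
 fixes m :: nat and X :: "'v::euclidean_space set set"
 assumes smooth: "smooth_submanifold m X"
begin

abbreviation "TX \<equiv> subtopology proj_top X"

lemma X_subset: "X \<subseteq> proj UNIV"
 using smooth by (simp add: smooth_submanifold_def)

lemma topspace_TX [simp]: "topspace TX = X"
 using X_subset by auto

lemma X_frame:
 assumes "l0 \<in> X"
 obtains U v y where "openin TX U" "l0 \<in> U" "cont_on TX U v" "\<And>i. i < m ==> cont_on TX U (y i)"
  "\<And>l. l \<in> U ==> line_in_space l (Y_fib X l) (v l) m (%i. y i l)"
proof -
 obtain U S D \<psi> where "chart m X U S D \<psi>" and l0: "l0 \<in> U" by (rule smooth_submanifold_chart[OF smooth assms])
 then interpret chart m X U S D \<psi> by simp
 obtain v y where *: "cont_on TX (X \<inter> U) v" "\<forall>i<m. cont_on TX (X \<inter> U) (y i)"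
  "\<forall>l\<in>X \<inter> U. line_in_space l (Y_fib X l) (v l) m (%i. y i l)"
  by (rule exE[OF chart_frame]) (elim exE conjE)
 have U': "openin TX (X \<inter> U)" unfolding openin_subtopology using U by (intro exI[of _ U]) auto
 have l0': "l0 \<in> X \<inter> U" using assms l0 by blast
 show ?thesis
  by (rule that[OF U' l0' *(1), of y]) (use *(2,3) in simp_all)
qed

lemma tangent_space_eq: "l \<in> X ==> tangent_space X l = vcarrier (vs_hom (vs_of l) (vs_quot l (Y_fib X l)))"
proof -
 assume l: "l \<in> X"
 obtain U S D \<psi> where c: "chart m X U S D \<psi>" and lU: "l \<in> U" by (rule smooth_submanifold_chart[OF smooth l])
 show "tangent_space X l = vcarrier (vs_hom (vs_of l) (vs_quot l (Y_fib X l)))"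
  by (rule chart.tangent_space_Y_fib[OF c]) (use l lU in blast)
qed

lemma subspace_Y: "l \<in> X ==> subspace (Y_fib X l)"
 by (rule X_frame) (auto dest: line_in_space.sub_B)

lemma subspace_l: "l \<in> X ==> subspace l"
 using X_subset projD(1) by blast

lemma l_subset_Y: "l \<in> X ==> l \<subseteq> Y_fib X l"
 by (rule X_frame) (auto dest: line_in_space.A_subset)

lemma X_paths:
 assumes "openin TX W" "l0 \<in> W"
 shows "\<exists>W'. openin TX W' \<and> l0 \<in> W' \<and> W' \<subseteq> W \<and>
  (\<forall>l\<in>W'. \<exists>\<sigma>. singular_simplex 1 TX \<sigma> \<and> \<sigma> vertex0 = l0 \<and> \<sigma> vertex1 = l \<and> \<sigma> ` standard_simplex 1 \<subseteq> W)"
proof -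
 have "l0 \<in> X" using assms openin_subset by fastforce
 then obtain U S D \<psi> where "chart m X U S D \<psi>" and l0: "l0 \<in> U" by (rule smooth_submanifold_chart[OF smooth])
 then interpret chart m X U S D \<psi> by simp
 show ?thesis by (rule chart_paths[OF assms l0])
qed

lemma tangent_bundle_base [simp]: "bbase (tangent_bundle X) = TX"
 by (simp add: tangent_bundle_def)

lemma tangent_bundle_fib:
 assumes "l \<in> X"
 shows "bfib (tangent_bundle X) l = vs_hom (vs_of l) (vs_quot l (Y_fib X l))"
 using tangent_space_eq[OF assms]
 by (simp add: tangent_bundle_def proj_tangent_bundle_def taut_bundle_def vs_hom_def fun_space_def vs_quot_def)

text \<open>The two sides ask for continuous lifts into \<open>V\<close> and into \<open>Y\<close>.
  If the value of \<phi> lies in \<open>Y/l\<close>, any lift of it differs from an element of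
  \<open>Y\<close> by an element of \<open>l\<close>, and \<open>l\<close> is contained in
  \<open>Y\<close>; hence the lifts are the same.\<close>

lemma tangent_bundle_sec: "bsec (tangent_bundle X) = bsec (hq_bundle TX (%l. l) (Y_fib X))"
proof (intro ext)
 fix W \<phi>
 have t: "bsec (tangent_bundle X) W \<phi> \<longleftrightarrow>
   bsec (hq_bundle TX (%l. l) (%_. UNIV)) W \<phi> \<and> (\<forall>l\<in>W. \<phi> l \<in> tangent_space X l)"
  by (simp add: tangent_bundle_def proj_tangent_bundle_def taut_bundle_def)
 have ops: "vadd (vs_quot l A) = vadd (vs_quot l B)" "vscale (vs_quot l A) = vscale (vs_quot l B)"
  for l A B :: "'v set"
  by (simp_all add: vs_quot_def)
 have homU: "\<psi> \<in> vcarrier (vs_hom (vs_of l) (vs_quot l UNIV))"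
  if "\<psi> \<in> vcarrier (vs_hom (vs_of l) (vs_quot l (Y_fib X l)))" for \<psi> l
  using that ops(1)[of l UNIV "Y_fib X l"] ops(2)[of l UNIV "Y_fib X l"]
  unfolding vs_hom_iff vlinear_def by (auto simp: quot_simps)
 show "bsec (tangent_bundle X) W \<phi> = bsec (hq_bundle TX (%l. l) (Y_fib X)) W \<phi>"
 proof (cases "openin TX W \<and> (\<forall>l\<in>W. \<phi> l \<in> vcarrier (vs_hom (vs_of l) (vs_quot l (Y_fib X l))))")
  case False
  have "openin TX W ==> l \<in> W ==> l \<in> X" for l using openin_subset by fastforce
  thus ?thesis using False tangent_space_eq unfolding t bsec_hq_bundle by blast
 next
  case True
  hence WX: "l \<in> X" if "l \<in> W" for l using openin_subset that by fastforce
  have q: "bsec (quot_bundle TX (%l. l) (%_. UNIV)) V (%l. \<phi> l (s l)) \<longleftrightarrow>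
    bsec (quot_bundle TX (%l. l) (Y_fib X)) V (%l. \<phi> l (s l))"
   if V: "V \<subseteq> W" and s: "bsec (sub_bundle TX (%l. l)) V s" for V s
  proof -
   have "bsec (sub_bundle TX (%_. UNIV)) V' s' \<longleftrightarrow> bsec (sub_bundle TX (Y_fib X)) V' s'"
    if V': "V' \<subseteq> V" and c: "\<forall>l\<in>V'. \<phi> l (s l) = vs_coset l (s' l)" for V' s'
   proof -
    have "s' l \<in> Y_fib X l" if l: "l \<in> V'" for l
    proof -
     have lX: "l \<in> X" and lW: "l \<in> W" and lV: "l \<in> V" using l V' V WX by auto
     have "\<phi> l (s l) \<in> vs_coset l ` Y_fib X l"
      using True lW s lV by (auto simp: vs_hom_iff vlinear_def quot_simps bsec_sub_bundle)
     then obtain y where y: "y \<in> Y_fib X l" "vs_coset l (s' l) = vs_coset l y" using c l by auto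
     hence "s' l - y \<in> Y_fib X l"
      using coset_eq_iff[OF subspace_l[OF lX]] l_subset_Y[OF lX] by blast
     from subspace_add[OF subspace_Y[OF lX] this y(1)] show ?thesis by simp
    qed
    thus ?thesis by (auto simp: bsec_sub_bundle)
   qed
   hence "(\<exists>U' s'. x \<in> U' \<and> U' \<subseteq> V \<and> bsec (sub_bundle TX (%_. UNIV)) U' s' \<and>
      (\<forall>y\<in>U'. \<phi> y (s y) = vs_coset y (s' y))) \<longleftrightarrow>
     (\<exists>U' s'. x \<in> U' \<and> U' \<subseteq> V \<and> bsec (sub_bundle TX (Y_fib X)) U' s' \<and>
      (\<forall>y\<in>U'. \<phi> y (s y) = vs_coset y (s' y)))" for x by blast
   thus ?thesis unfolding bsec_quot_bundle by simp
  qed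
  have "\<forall>l\<in>W. \<phi> l \<in> tangent_space X l" using True WX tangent_space_eq by simp
  thus ?thesis unfolding t bsec_hq_bundle using True q homU by blast
 qed
qed

lemma tangent_bundle_sheaf: "section_sheaf (tangent_bundle X)"
 by (rule bundle_transfer(1)[OF _ _ tangent_bundle_sec hq_bundle_sheaf])
   (auto simp: tangent_bundle_fib subspace_l subspace_Y)

lemma lframe_tangent:
 assumes U: "openin TX U" and v: "cont_on TX U v" and y: "\<And>i. i < m ==> cont_on TX U (y i)"
  and l: "\<And>l. l \<in> U ==> line_in_space l (Y_fib X l) (v l) m (%i. y i l)"
 shows "lframe (tangent_bundle X) U m (%i l. tangent_vec l (v l) (y i l))"
 by (rule bundle_transfer(2)[OF _ _ tangent_bundle_sec lframe_hq_bundle[OF U l v y]])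
   (auto simp: tangent_bundle_fib)

lemma taut_sheaf: "section_sheaf (taut_bundle X)"
 unfolding taut_bundle_def by (rule sub_bundle_sheaf) (simp add: subspace_l)

lemma Y_sheaf: "section_sheaf (Y_bundle X)"
 unfolding Y_bundle_def by (rule sub_bundle_sheaf) (simp add: subspace_Y)

lemma lgen_taut:
 assumes U: "openin TX U" and v: "cont_on TX U v" 
  and l: "\<And>l. l \<in> U ==> line_in_space l (Y_fib X l) (v l) m (%i. y i l)"
 shows "lgen (taut_bundle X) U v"
 unfolding taut_bundle_def
 by (rule lframe_sub_bundle[OF U]) (use l v in \<open>auto simp: line_in_space_def\<close>)

lemma lframe_Y:
 assumes U: "openin TX U" and v: "cont_on TX U v" and y: "\<And>i. i < m ==> cont_on TX U (y i)"
  and l: "\<And>l. l \<in> U ==> line_in_space l (Y_fib X l) (v l) m (%i. y i l)"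
 shows "lframe (Y_bundle X) U (Suc m) (%i l. case_nat (v l) (%i. y i l) i)"
 unfolding Y_bundle_def
proof (rule lframe_sub_bundle[OF U])
 show "cont_on TX U (%l. case_nat (v l) (%i. y i l) i)" if "i < Suc m" for i
  using v y that by (cases i) auto
qed (use l in \<open>auto simp: line_in_space_def\<close>)

end

section \<open>The projection induced by a linear map\<close>

lemma vline_nonzero: "subspace A ==> vline (vs_of A) v ==> v \<noteq> 0"
proof
 assume *: "subspace A" "vline (vs_of A) v" "v = 0"
 have "lcoef (vs_of A) v (vscale (vs_of A) a v) = a" for a
  by (rule lcoef_unique[OF real_vs_vs_of[OF *(1)] *(2)])
 from this[of 0] this[of 1] show False using *(3) by (simp add: vs_of_def)
qed

lemma lgen_cong:
 assumes sh: "section_sheaf E" and e: "lgen E U e" and eq: "\<And>x. x \<in> U ==> e x = e' x"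
 shows "lgen E U e'"
proof (rule lgenI)
 show "openin (bbase E) U" by (rule lframe_openin[OF sh e])
 show "vline (bfib E y) (e' y)" if "y \<in> U" for y using lgen_line[OF sh e that] eq[OF that] by simp
 fix V s assume V: "openin (bbase E) V" "V \<subseteq> U"
 have "cont_on (bbase E) V (%y. lcoef (bfib E y) (e y) (s y)) \<longleftrightarrow>
   cont_on (bbase E) V (%y. lcoef (bfib E y) (e' y) (s y))"
  by (rule cont_on_cong_iff) (use eq V in auto)
 thus "bsec E V s \<longleftrightarrow> (\<forall>y\<in>V. s y \<in> vcarrier (bfib E y)) \<and>
   cont_on (bbase E) V (%y. lcoef (bfib E y) (e' y) (s y))"
  using bsec_iff_lcoef[OF sh e V] by simp
qed (rule lframe_real_vs[OF sh e])

lemma vs_hom_compose: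
 assumes "h \<in> vcarrier (vs_hom A B)" "k \<in> vcarrier (vs_hom B C)" "real_vs A"
 shows "compose (vcarrier A) k h \<in> vcarrier (vs_hom A C)"
 using assms unfolding vs_hom_iff vlinear_def
 by (auto simp: compose_def real_vsD)

lemma proj_top_UNIV [simp]: "subtopology proj_top (proj UNIV) = proj_top"
 using subtopology_topspace[of proj_top] by simp

lemma proj_tangent_bundle_UNIV:
 "proj_tangent_bundle (proj UNIV) = hq_bundle proj_top (%l. l) (%_. UNIV)"
 by (simp add: proj_tangent_bundle_def taut_bundle_def)

text \<open>The composition is followed on one generator: the canonical isomorphism yields a
  decomposable tensor, the dual of \<open>f\<close> restricted to \<open>l\<close> turns the dual
  vector of \<open>f v\<close> into that of \<open>v\<close>, and \<mu> acts on the remaining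
  factor.\<close>

lemma proj_det_map_gen:
 fixes f :: "'v::euclidean_space \<Rightarrow> 'w::euclidean_space"
 assumes f: "linear f" and l: "subspace l" and v: "vline (vs_of l) v"
  and B: "line_in_space (proj_map f l) UNIV (f v) m b"
  and D: "real_vs D" and \<mu>: "\<mu> \<in> vcarrier (vs_hom (vs_det (vs_of UNIV)) D)"
 defines "T \<equiv> vs_hom (vs_of (proj_map f l)) (vs_quot (proj_map f l) UNIV)"
 shows "proj_det_map (Suc m) f l D \<mu>
   \<in> vcarrier (vs_hom (vs_det T) (vs_tensor (vs_tpow (Suc m) (vs_dual (vs_of l))) D))"
  and "proj_det_map (Suc m) f l D \<mu> (wedge T (%i. tangent_vec (proj_map f l) (f v) (b i)))
   = tens (vs_tpow (Suc m) (vs_dual (vs_of l))) D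
     (tprod (Suc m) (vs_dual (vs_of l)) (%_. dual_vec (vs_of l) v))
     (\<mu> (wedge (vs_of UNIV) (case_nat (f v) b)))"
proof -
 interpret line_in_space "proj_map f l" UNIV "f v" m b by fact
 let ?A = "vs_of l" and ?A' = "vs_of (proj_map f l)" and ?n = "Suc m"
 let ?r = "restrict f l" and ?p = "dual_vec (vs_of (proj_map f l)) (f v)"
 have RA: "real_vs ?A" by (rule real_vs_vs_of[OF l])
 have RD: "real_vs (vs_dual ?A)" by (rule real_vs_dual[OF RA])
 have r: "vlinear ?A ?A' ?r"
  unfolding vlinear_def using f l
  by (auto simp: proj_map_def vs_of_def linear_add linear_scale subspace_add subspace_scale)
 have d: "dual_map ?A ?A' ?r \<in> vcarrier (vs_hom (vs_dual ?A') (vs_dual ?A))"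
  by (rule dual_map_hom[OF RA real_vs_A r])
 hence dl: "vlinear (vs_dual ?A') (vs_dual ?A) (dual_map ?A ?A' ?r)" by (simp add: vs_hom_iff)
 have p: "?p \<in> vcarrier (vs_dual ?A')" by (rule dual_vec_mem[OF real_vs_A line_A])
 have "v \<in> l" using vline_mem[OF v] by (simp add: vs_of_def)
 \<comment> \<open>A functional on a line is fixed by its value at \<open>v\<close>; here that value
   is the dual vector of \<open>f v\<close> evaluated at \<open>f v\<close>.\<close>
 hence dp: "dual_map ?A ?A' ?r ?p = dual_vec ?A v"
  using dual_vec_self[OF real_vs_A line_A] p
  by (intro dual_vec_unique[OF RA v vlinearD(1)[OF dl p]]) (simp add: dual_map_def vs_of_def)
 let ?t = "tpow_map ?n (vs_dual ?A') (vs_dual ?A) (dual_map ?A ?A' ?r)"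
 have th: "?t \<in> vcarrier (vs_hom (vs_tpow ?n (vs_dual ?A')) (vs_tpow ?n (vs_dual ?A)))"
  by (rule tpow_map_hom[OF real_vs_L RD dl])
 hence tl: "vlinear (vs_tpow ?n (vs_dual ?A')) (vs_tpow ?n (vs_dual ?A)) ?t" by (simp add: vs_hom_iff)
 have tp: "?t (tprod ?n (vs_dual ?A') (%_. ?p)) = tprod ?n (vs_dual ?A) (%_. dual_vec ?A v)"
  using tpow_map_tprod[OF real_vs_L RD dl, of ?n "%_. ?p"] p dp by simp
 have \<mu>l: "vlinear (vs_det (vs_of UNIV)) D \<mu>" using \<mu> by (simp add: vs_hom_iff)
 have RT: "real_vs (vs_tpow ?n (vs_dual ?A))" by (rule real_vs_tpow[OF RD])
 let ?M = "tensor_map (vs_tpow ?n (vs_dual ?A')) (vs_det (vs_of UNIV)) (vs_tpow ?n (vs_dual ?A)) D ?t \<mu>"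
 have M: "?M \<in> vcarrier (vs_hom (vs_tensor (vs_tpow ?n (vs_dual ?A')) (vs_det (vs_of UNIV)))
   (vs_tensor (vs_tpow ?n (vs_dual ?A)) D))"
  by (rule tensor_map_hom[OF real_vs_tpowL real_vs_detB RT D tl \<mu>l])
 have eq: "proj_det_map ?n f l D \<mu> = compose (vcarrier (vs_det T)) ?M (det_tangent_iso (proj_map f l) UNIV)"
  by (simp add: proj_det_map_def proj_tangent_bundle_UNIV T_def Let_def)
 show "proj_det_map ?n f l D \<mu> \<in> vcarrier (vs_hom (vs_det T) (vs_tensor (vs_tpow ?n (vs_dual ?A)) D))"
  unfolding eq T_def by (rule vs_hom_compose[OF vs_isos_hom[OF det_tangent_iso_iso] M real_vs_detT])
 have g: "wedge T (%i. tangent_vec (proj_map f l) (f v) (b i)) \<in> vcarrier (vs_det T)"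
  unfolding T_def by (rule vline_mem[OF vline_source])
 have w: "wedge (vs_of UNIV) (case_nat (f v) b) \<in> vcarrier (vs_det (vs_of UNIV))"
  by (rule vline_mem[OF vline_wedge[OF real_vs_B basis_B]])
 have tm: "tprod ?n (vs_dual ?A') (%_. ?p) \<in> vcarrier (vs_tpow ?n (vs_dual ?A'))"
  by (rule tprod_mem[OF p real_vs_L])
 have "proj_det_map ?n f l D \<mu> (wedge T (%i. tangent_vec (proj_map f l) (f v) (b i)))
   = ?M (det_tangent_iso (proj_map f l) UNIV (wedge T (%i. tangent_vec (proj_map f l) (f v) (b i))))"
  unfolding eq by (simp only: compose_eq[OF g])
 also have "\<dots> = ?M gen_target" unfolding T_def by (simp only: det_tangent_iso_gen)
 also have "\<dots> = tens (vs_tpow ?n (vs_dual ?A)) D (?t (tprod ?n (vs_dual ?A') (%_. ?p)))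
   (\<mu> (wedge (vs_of UNIV) (case_nat (f v) b)))"
  by (rule tensor_map_tens[OF real_vs_tpowL real_vs_detB RT D tl \<mu>l tm w])
 finally show "proj_det_map ?n f l D \<mu> (wedge T (%i. tangent_vec (proj_map f l) (f v) (b i)))
   = tens (vs_tpow ?n (vs_dual ?A)) D (tprod ?n (vs_dual ?A) (%_. dual_vec ?A v))
     (\<mu> (wedge (vs_of UNIV) (case_nat (f v) b)))"
  unfolding tp .
qed

section \<open>The projection induced by \<open>f\<close> and generators adapted to it\<close>

locale projection = submanifold m X for m and X :: "'v::euclidean_space set set" +
 fixes f :: "'v \<Rightarrow> 'w::euclidean_space"
 assumes f: "f \<in> Hom_avoiding X" and dim_W: "DIM('w) = Suc m"
begin

abbreviation "detW \<equiv> vs_det (vs_of (UNIV :: 'w set))"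

lemma linear_f: "linear f"
 using f by (simp add: Hom_avoiding_def)

lemma f_nonzero:
 assumes l: "l \<in> X" and v: "v \<in> l" "v \<noteq> 0"
 shows "f v \<noteq> 0"
proof
 assume 0: "f v = 0"
 have lp: "l \<in> proj UNIV" using l X_subset by blast
 have "f x = 0" if "x \<in> l" for x
 proof -
  have "x \<in> span {v}" using proj_eq_span[OF lp v] that by simp
  then obtain k where "x = k *\<^sub>R v" unfolding span_singleton by blast
  thus "f x = 0" using 0 linear_f by (simp add: linear_scale)
 qed
 hence "l \<in> proj {v. f v = 0}" using projD[OF lp] by (auto simp: proj_def)
 thus False using l f by (auto simp: Hom_avoiding_def)
qed

lemma proj_map_span:
 assumes l: "l \<in> X" and v: "v \<in> l" "v \<noteq> 0"
 shows "proj_map f l = span {f v}"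
proof -
 have "l = span {v}" using proj_eq_span X_subset l v by blast
 thus ?thesis using linear_span_image[OF linear_f, of "{v}"] by (simp add: proj_map_def)
qed

lemma proj_map_proj: "l \<in> X ==> proj_map f l \<in> proj UNIV"
 using X_subset proj_obtain proj_map_span f_nonzero span_in_proj by (metis subsetD)

text \<open>The lines outside the kernel whose image lies in \<open>V\<close> form an open set of
  the whole projective space, because their cone is the preimage under \<open>f\<close> of the cone
  over \<open>V\<close>. Restricting to \<open>X\<close> gives the preimage of
  \<open>V\<close>.\<close>

lemma continuous_proj_map: "continuous_map TX proj_top (proj_map f)"
 unfolding continuous_map_def
proof (intro conjI allI impI)
 show "proj_map f \<in> topspace TX \<rightarrow> topspace proj_top" using proj_map_proj by simp
 fix V :: "'w set set" assume V: "openin proj_top V"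
 define U where "U = {l \<in> proj UNIV. \<exists>v\<in>l. f v \<noteq> 0 \<and> span {f v} \<in> V}"
 have "v \<noteq> 0 \<and> span {v} \<in> U \<longleftrightarrow> f v \<noteq> 0 \<and> span {f v} \<in> V" for v
 proof
  assume v: "v \<noteq> 0 \<and> span {v} \<in> U"
  then obtain k where k: "f (k *\<^sub>R v) \<noteq> 0" "span {f (k *\<^sub>R v)} \<in> V"
   unfolding U_def span_singleton by auto
  hence "k \<noteq> 0" "f v \<noteq> 0" by (auto simp: linear_scale[OF linear_f] linear_0[OF linear_f])
  moreover from this have "span {k *\<^sub>R f v} = span {f v}"
   by (intro proj_eq_span[symmetric] span_in_proj) (auto simp: span_base span_scale)
  ultimately show "f v \<noteq> 0 \<and> span {f v} \<in> V" using k by (simp add: linear_scale[OF linear_f])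
 next
  assume fv: "f v \<noteq> 0 \<and> span {f v} \<in> V"
  hence "v \<noteq> 0" using linear_0[OF linear_f] by auto
  thus "v \<noteq> 0 \<and> span {v} \<in> U" using fv span_in_proj[of v] span_base[of v "{v}"] unfolding U_def by auto
 qed
 hence "{v. v \<noteq> 0 \<and> span {v} \<in> U} = f -` {w. w \<noteq> 0 \<and> span {w} \<in> V}" by auto
 moreover have "open (f -` {w. w \<noteq> 0 \<and> span {w} \<in> V})"
  using V linear_f unfolding openin_proj_top
  by (intro open_vimage) (auto simp: linear_continuous_on linear_conv_bounded_linear)
 ultimately have "openin proj_top U" unfolding openin_proj_top by (auto simp: U_def)
 moreover have "l \<in> U \<longleftrightarrow> proj_map f l \<in> V" if l: "l \<in> X" for l
 proof -
  have lp: "l \<in> proj UNIV" using l X_subset by blast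
  obtain v where v: "v \<in> l" "v \<noteq> 0" by (rule proj_obtain[OF lp])
  have eq: "span {f x} = proj_map f l" if "x \<in> l" "f x \<noteq> 0" for x
   using proj_map_span[OF l that(1)] that linear_0[OF linear_f] by fastforce
  show ?thesis using eq eq[OF v(1) f_nonzero[OF l v]] f_nonzero[OF l v] v(1) lp unfolding U_def by auto
 qed
 ultimately show "openin TX {l \<in> topspace TX. proj_map f l \<in> V}"
  unfolding openin_subtopology topspace_TX by (intro exI[of _ U]) auto
qed

text \<open>A generator of a pullback should be a section over P(W) composed with the projection.
  The normalization \<open>q (f (v l)) = 1\<close> achieves this: \<open>f (v l)\<close> is then the
  value at \<open>f(l)\<close> of the section \<open>norm_sec q\<close>. The vectors
  \<open>b\<close> do not depend on \<open>l\<close>, so they serve over P(W) as well.\<close>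

definition local_data :: "'v set set \<Rightarrow> ('v set \<Rightarrow> 'v) \<Rightarrow> (nat \<Rightarrow> 'v set \<Rightarrow> 'v) \<Rightarrow> (nat \<Rightarrow> 'w) \<Rightarrow> ('w \<Rightarrow> real) \<Rightarrow> bool"
 where "local_data U v y b q \<longleftrightarrow> openin TX U \<and> cont_on TX U v \<and> (\<forall>i<m. cont_on TX U (y i)) \<and>
  (\<forall>l\<in>U. line_in_space l (Y_fib X l) (v l) m (%i. y i l)) \<and> linear q \<and>
  (\<forall>w. q w = 1 \<longrightarrow> vs_basis (vs_of UNIV) (Suc m) (case_nat w b)) \<and> (\<forall>l\<in>U. q (f (v l)) = 1)"

lemma local_data_exists:
 assumes "l0 \<in> X"
 shows "\<exists>U v y b q. l0 \<in> U \<and> local_data U v y b q"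
proof -
 obtain U0 v0 y where U0: "openin TX U0" "l0 \<in> U0" "cont_on TX U0 v0"
  and y: "\<And>i. i < m ==> cont_on TX U0 (y i)"
  and L: "\<And>l. l \<in> U0 ==> line_in_space l (Y_fib X l) (v0 l) m (%i. y i l)"
  using X_frame[OF assms] by metis
 have U0X: "l \<in> X" if "l \<in> U0" for l using openin_subset[OF U0(1)] that by auto
 have v0: "v0 l \<in> l" "v0 l \<noteq> 0" if "l \<in> U0" for l
  using line_in_space.v_mem[OF L[OF that]]
   vline_nonzero[OF line_in_space.sub_A[OF L[OF that]] line_in_space.line_A[OF L[OF that]]] by auto
 \<comment> \<open>Taking \<open>q\<close> to be the inner product with the image of
   \<open>v0 l0\<close> makes \<open>q\<close> nonzero there, so after shrinking the neighbourhood
   \<open>v0\<close> can be divided by the continuous function \<open>c\<close>.\<close>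
 define w0 where "w0 = f (v0 l0)"
 have w0: "w0 \<noteq> 0" unfolding w0_def using f_nonzero[OF assms] v0[OF U0(2)] by blast
 obtain b where b: "\<And>w. inner w0 w = 1 ==> vs_basis (vs_of UNIV) (Suc m) (case_nat w b)"
  using hyperplane_basis[OF w0] dim_W by (metis diff_Suc_1)
 define c where "c l = inner w0 (f (v0 l))" for l
 have lin: "linear (%x. inner w0 (f x))"
  by (rule linearI) (simp_all add: linear_add[OF linear_f] linear_scale[OF linear_f] inner_add_right)
 have cc: "cont_on TX U0 c"
  unfolding c_def
  by (rule cont_on_isCont[OF U0(3)]) (use lin in \<open>auto simp: linear_conv_bounded_linear intro: linear_continuous_at\<close>)
 define U where "U = {l \<in> U0. c l \<in> - {0}}"
 have U: "openin TX U" unfolding U_def using cc cont_on_openin[OF U0(1)] by blast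
 have sub: "U \<subseteq> U0" and nz: "\<And>l. l \<in> U ==> c l \<noteq> 0" by (auto simp: U_def)
 have "local_data U (%l. (1 / c l) *\<^sub>R v0 l) y b (inner w0)"
  unfolding local_data_def
 proof (intro conjI ballI allI impI)
  show "cont_on TX U (%l. (1 / c l) *\<^sub>R v0 l)"
   by (intro cont_on_scaleR cont_on_divide cont_on_const cont_on_subset[OF cc sub]
     cont_on_subset[OF U0(3) sub] nz)
  show "cont_on TX U (y i)" if "i < m" for i by (rule cont_on_subset[OF y[OF that] sub])
  show "line_in_space l (Y_fib X l) ((1 / c l) *\<^sub>R v0 l) m (%i. y i l)" if "l \<in> U" for l
   by (rule line_in_space_scale[OF L]) (use that sub nz in auto)
  show "linear (inner w0)" by (simp add: bounded_linear.linear bounded_linear_inner_right)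
  show "inner w0 (f ((1 / c l) *\<^sub>R v0 l)) = 1" if "l \<in> U" for l
   using nz[OF that] by (simp add: linear_scale[OF linear_f] c_def)
 qed (use U b in auto)
 moreover have "l0 \<in> U" using U0(2) w0 by (simp add: U_def c_def w0_def[symmetric])
 ultimately show ?thesis by blast
qed

context
 fixes U v y b q
 assumes ld: "local_data U v y b q"
begin

lemma local_dataD:
 shows "openin TX U" "cont_on TX U v" "\<And>i. i < m ==> cont_on TX U (y i)"
  "\<And>l. l \<in> U ==> line_in_space l (Y_fib X l) (v l) m (%i. y i l)" "linear q"
  "\<And>w. q w = 1 ==> vs_basis (vs_of UNIV) (Suc m) (case_nat w b)" "\<And>l. l \<in> U ==> q (f (v l)) = 1"
 using ld unfolding local_data_def by blast+

lemma local_X: "l \<in> U ==> l \<in> X"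
 using openin_subset[OF local_dataD(1)] by auto

lemma local_v: "l \<in> U ==> v l \<in> l" "l \<in> U ==> v l \<noteq> 0" "l \<in> U ==> vline (vs_of l) (v l)"
 "l \<in> U ==> subspace l"
proof -
 assume l: "l \<in> U"
 show "v l \<in> l" by (rule line_in_space.v_mem[OF local_dataD(4)[OF l]])
 show 1: "vline (vs_of l) (v l)" by (rule line_in_space.line_A[OF local_dataD(4)[OF l]])
 show 2: "subspace l" by (rule line_in_space.sub_A[OF local_dataD(4)[OF l]])
 show "v l \<noteq> 0" by (rule vline_nonzero[OF 2 1])
qed

lemma local_line_W:
 assumes "l \<in> U"
 shows "line_in_space (proj_map f l) UNIV (f (v l)) m b"
proof
 have F: "proj_map f l = span {f (v l)}"
  by (rule proj_map_span[OF local_X[OF assms] local_v(1,2)[OF assms]])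
 show "subspace (proj_map f l)" unfolding F by simp
 show "vline (vs_of (proj_map f l)) (f (v l))"
  unfolding F by (rule vline_span[OF f_nonzero[OF local_X[OF assms] local_v(1,2)[OF assms]]])
 show "vs_basis (vs_of UNIV) (Suc m) (case_nat (f (v l)) b)"
  by (rule local_dataD(6)[OF local_dataD(7)[OF assms]])
qed simp

text \<open>Over \<open>norm_dom q\<close> in P(W) the tangent bundle has the frame built from
  \<open>norm_sec q\<close> and \<open>b\<close>. Pulling back the wedge of this frame and replacing
  \<open>norm_sec q\<close> by \<open>f (v l)\<close> gives the generator.\<close>

lemma lgen_pullback_det:
 "lgen (pullback_det X f) U (%l. wedge (vs_hom (vs_of (proj_map f l)) (vs_quot (proj_map f l) UNIV))
   (%i. tangent_vec (proj_map f l) (f (v l)) (b i)))"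
proof -
 let ?PT = "hq_bundle proj_top (%l. l) (%_. UNIV :: 'w set)"
 have sh: "section_sheaf ?PT" by (rule hq_bundle_sheaf) (auto dest: projD(1))
 have "lframe ?PT (norm_dom q) m (%i l. tangent_vec l (norm_sec q l) (b i))"
 proof (rule lframe_hq_bundle[OF openin_norm_dom[OF local_dataD(5)] _ cont_on_norm_sec[OF local_dataD(5)]])
  fix l assume l: "l \<in> norm_dom q"
  note n = norm_sec_props[OF local_dataD(5) l]
  show "line_in_space l UNIV (norm_sec q l) m b"
   by unfold_locales (use n projD(1)[OF n(4)] vline_proj[OF n(4,1,3)] local_dataD(6)[OF n(2)] in auto)
 qed simp
 from lgen_det[OF sh this]
 have g: "lgen (det_bundle ?PT) (norm_dom q)
  (%l. wedge (bfib ?PT l) (%i. tangent_vec l (norm_sec q l) (b i)))" .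
 have F: "proj_map f l \<in> proj UNIV" "f (v l) \<in> proj_map f l" "norm_sec q (proj_map f l) = f (v l)"
  if l: "l \<in> U" for l
 proof -
  show p: "proj_map f l \<in> proj UNIV" by (rule proj_map_proj[OF local_X[OF l]])
  show m: "f (v l) \<in> proj_map f l" using local_v(1)[OF l] by (auto simp: proj_map_def)
  show "norm_sec q (proj_map f l) = f (v l)"
   by (rule norm_sec_eq[OF local_dataD(5) p m local_dataD(7)[OF l]])
 qed
 have "proj_map f ` U \<subseteq> norm_dom q"
 proof (rule image_subsetI)
  fix l assume l: "l \<in> U"
  have "q (f (v l)) \<noteq> 0" using local_dataD(7)[OF l] by simp
  hence "\<exists>x\<in>proj_map f l. q x \<noteq> 0" using F(2)[OF l] by (rule bexI)
  thus "proj_map f l \<in> norm_dom q" using F(1)[OF l] by (simp add: norm_dom_def)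
 qed
 moreover have "continuous_map (subtopology TX U) (bbase (det_bundle ?PT)) (proj_map f)"
  using continuous_map_from_subtopology[OF continuous_proj_map] by simp
 ultimately have "lgen (pullback_bundle TX (proj_map f) (det_bundle ?PT)) U
  (%l. wedge (bfib ?PT (proj_map f l)) (%i. tangent_vec (proj_map f l) (norm_sec q (proj_map f l)) (b i)))"
  by (intro lframe_pullback[OF det_bundle_sheaf[OF sh] g local_dataD(1)])
 moreover have "section_sheaf (pullback_bundle TX (proj_map f) (det_bundle ?PT))"
  by (rule pullback_sheaf[OF det_bundle_sheaf[OF sh]]) (use proj_map_proj in auto)
 ultimately show ?thesis
  unfolding pullback_det_def proj_tangent_bundle_UNIV
  by (elim lgen_cong[rotated]) (simp_all add: F(3))
qed

text \<open>Although the bundle is constant, the generator has to move with \<open>l\<close> to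
  match the one on the other side. It is the wedge at a reference point \<open>l0\<close> times a
  continuous determinant without zeros; only the choice of \<open>l0\<close> forces the empty set to
  be treated apart.\<close>

lemma lgen_trivial_det:
 "lgen (trivial_bundle TX detW) U (%l. wedge (vs_of UNIV) (case_nat (f (v l)) b))"
proof (cases "U = {}")
 case True
 have d: "\<exists>e. vline detW e"
  using vs_basis_exists[OF subspace_UNIV] vline_wedge[OF real_vs_vs_of[OF subspace_UNIV]] by metis
 then obtain e where "vline detW e" by blast
 from lgen_trivial[OF real_vs_det[OF real_vs_vs_of[OF subspace_UNIV]] this local_dataD(1)]
 show ?thesis
  by (rule lgen_cong[rotated]) (use True in \<open>auto simp: trivial_bundle_sheaf real_vs_det real_vs_vs_of\<close>)
next
 case False
 then obtain l0 where l0: "l0 \<in> U" by blast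
 let ?\<beta> = "case_nat (f (v l0)) b" and ?W = "vs_of (UNIV :: 'w set)"
 have RW: "real_vs ?W" by (rule real_vs_vs_of[OF subspace_UNIV])
 have bas: "vs_basis ?W (Suc m) (case_nat (f (v l)) b)" if "l \<in> U" for l
  by (rule local_dataD(6)[OF local_dataD(7)[OF that]])
 have triv: "section_sheaf (trivial_bundle TX detW)" by (rule trivial_bundle_sheaf[OF real_vs_det[OF RW]])
 let ?c = "%l. dform ?W (Suc m) ?\<beta> (case_nat (f (v l)) b)"
 have g: "lgen (trivial_bundle TX detW) U (%_. wedge ?W ?\<beta>)"
  by (rule lgen_trivial[OF real_vs_det[OF RW] vline_wedge[OF RW bas[OF l0]] local_dataD(1)])
 let ?E = "sub_bundle TX (%_. UNIV :: 'w set)"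
 have fr: "lframe ?E U (Suc m) (%i _. ?\<beta> i)"
  by (rule lframe_sub_bundle[OF local_dataD(1)]) (use bas[OF l0] in auto)
 have fv: "cont_on TX U (%l. f (v l))"
  by (rule cont_on_isCont[OF local_dataD(2)])
    (use linear_f in \<open>auto simp: linear_conv_bounded_linear intro: linear_continuous_at\<close>)
 have "cont_on (bbase ?E) U (%x. dform (bfib ?E x) (Suc m) (%i. ?\<beta> i) (%i. case_nat (f (v x)) b i))"
 proof (rule cont_on_dform[OF _ fr])
  show "section_sheaf ?E" by (rule sub_bundle_sheaf) simp
  show "bsec ?E U (%x. case_nat (f (v x)) b i)" if "i < Suc m" for i
   unfolding bsec_sub_bundle using local_dataD(1) fv by (cases i) auto
 qed (use local_dataD(1) in auto)
 hence c: "cont_on TX U ?c" by simp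
 have "lgen (trivial_bundle TX detW) U (%l. vscale (bfib (trivial_bundle TX detW) l) (?c l) (wedge ?W ?\<beta>))"
 proof (rule lgen_scale[OF triv g])
  show "cont_on (bbase (trivial_bundle TX detW)) U ?c" using c by simp
  show "?c l \<noteq> 0" if "l \<in> U" for l by (rule dform_nonzero[OF RW bas[OF l0] bas[OF that]])
 qed
 thus ?thesis
 proof (rule lgen_cong[OF triv])
  fix l assume l: "l \<in> U"
  have "wedge ?W (case_nat (f (v l)) b) = vscale detW (?c l) (wedge ?W ?\<beta>)"
   by (rule wedge_eq[OF RW bas[OF l0]]) (simp add: vs_of_def)
  thus "vscale (bfib (trivial_bundle TX detW) l) (?c l) (wedge ?W ?\<beta>) = wedge ?W (case_nat (f (v l)) b)"
   by simp
 qed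
qed

lemma lgen_tpow_taut:
 "lgen (tpow_bundle n (dual_bundle (taut_bundle X))) U
   (%l. tprod n (vs_dual (vs_of l)) (%_. dual_vec (vs_of l) (v l)))"
proof -
 have "lgen (taut_bundle X) U v" by (rule lgen_taut[OF local_dataD(1,2,4)])
 from lgen_tpow[OF dual_bundle_sheaf[OF taut_sheaf] lgen_dual_vec[OF taut_sheaf this]]
 show ?thesis by (simp add: taut_bundle_def)
qed

lemma lgen_det_Y: "lgen (det_bundle (Y_bundle X)) U (%l. wedge (vs_of (Y_fib X l)) (case_nat (v l) (%i. y i l)))"
 using lgen_det[OF Y_sheaf lframe_Y[OF local_dataD(1-4)]] by (simp add: Y_bundle_def)

lemma lgen_det_tangent:
 "lgen (det_bundle (tangent_bundle X)) U
   (%l. wedge (vs_hom (vs_of l) (vs_quot l (Y_fib X l))) (%i. tangent_vec l (v l) (y i l)))"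
proof (rule lgen_cong[OF det_bundle_sheaf[OF tangent_bundle_sheaf]
    lgen_det[OF tangent_bundle_sheaf lframe_tangent[OF local_dataD(1-4)]]])
 fix l assume l: "l \<in> U"
 have t: "bfib (tangent_bundle X) l = vs_hom (vs_of l) (vs_quot l (Y_fib X l))"
  by (rule tangent_bundle_fib[OF local_X[OF l]])
 show "wedge (bfib (tangent_bundle X) l) (%i. tangent_vec l (v l) (y i l))
   = wedge (vs_hom (vs_of l) (vs_quot l (Y_fib X l))) (%i. tangent_vec l (v l) (y i l))"
  by (rule arg_cong[OF t])
qed

end

end

section \<open>The canonical identification and the correspondence of \<mu> and \<nu> on
  generators\<close>

context projection
begin

abbreviation "TF l \<equiv> vs_hom (vs_of (proj_map f l)) (vs_quot (proj_map f l) UNIV)"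
abbreviation "\<Lambda> l \<equiv> vs_tpow (Suc m) (vs_dual (vs_of l))"

lemma pullback_det_simps [simp]:
 "bbase (pullback_det X f) = TX" "bfib (pullback_det X f) l = vs_det (TF l)"
 by (simp_all add: pullback_det_def proj_tangent_bundle_UNIV)

lemma pullback_det_sheaf: "section_sheaf (pullback_det X f)"
 unfolding pullback_det_def proj_tangent_bundle_UNIV
proof (rule pullback_sheaf[OF det_bundle_sheaf])
 show "section_sheaf (hq_bundle proj_top (%l. l) (%_. UNIV :: 'w set))"
  by (rule hq_bundle_sheaf) (auto dest: projD(1))
qed (use proj_map_proj in auto)

lemma real_vs_detW: "real_vs detW"
 by (rule real_vs_det[OF real_vs_vs_of[OF subspace_UNIV]])

lemma line_bundle_pullback_det: "line_bundle (pullback_det X f)"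
proof (rule line_bundleI[OF pullback_det_sheaf])
 fix x assume "x \<in> topspace (bbase (pullback_det X f))"
 hence "x \<in> X" by simp
 then obtain U v y b q where "x \<in> U" "local_data U v y b q" using local_data_exists by blast
 thus "\<exists>U e. x \<in> U \<and> lgen (pullback_det X f) U e" using lgen_pullback_det by blast
qed

lemma line_bundle_trivial_det: "line_bundle (trivial_bundle TX detW)"
proof (rule line_bundleI[OF trivial_bundle_sheaf[OF real_vs_detW]])
 fix x assume "x \<in> topspace (bbase (trivial_bundle TX detW))"
 hence "x \<in> X" by simp
 then obtain U v y b q where "x \<in> U" "local_data U v y b q" using local_data_exists by blast
 thus "\<exists>U e. x \<in> U \<and> lgen (trivial_bundle TX detW) U e" using lgen_trivial_det by blast
qed

lemma line_bundle_det_Y: "line_bundle (det_bundle (Y_bundle X))"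
proof (rule line_bundleI[OF det_bundle_sheaf[OF Y_sheaf]])
 fix x assume "x \<in> topspace (bbase (det_bundle (Y_bundle X)))"
 hence "x \<in> X" by (simp add: Y_bundle_def)
 then obtain U v y b q where "x \<in> U" "local_data U v y b q" using local_data_exists by blast
 thus "\<exists>U e. x \<in> U \<and> lgen (det_bundle (Y_bundle X)) U e" using lgen_det_Y by blast
qed

lemma line_bundle_det_tangent: "line_bundle (det_bundle (tangent_bundle X))"
proof (rule line_bundleI[OF det_bundle_sheaf[OF tangent_bundle_sheaf]])
 fix x assume "x \<in> topspace (bbase (det_bundle (tangent_bundle X)))"
 hence "x \<in> X" by simp
 then obtain U v y b q where "x \<in> U" "local_data U v y b q" using local_data_exists by blast
 thus "\<exists>U e. x \<in> U \<and> lgen (det_bundle (tangent_bundle X)) U e" using lgen_det_tangent by blast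
qed

abbreviation "target_bundle \<equiv>
 tensor_bundle (tpow_bundle (Suc m) (dual_bundle (taut_bundle X))) (trivial_bundle TX detW)"

lemma taut_bundle_simps [simp]: "bbase (taut_bundle X) = TX" "bfib (taut_bundle X) l = vs_of l"
 by (simp_all add: taut_bundle_def)

lemma lgen_target:
 assumes "local_data U v y b q"
 shows "lgen target_bundle U (%l. tens (\<Lambda> l) detW (tprod (Suc m) (vs_dual (vs_of l)) (%_. dual_vec (vs_of l) (v l)))
   (wedge (vs_of UNIV) (case_nat (f (v l)) b)))"
 using lgen_tensor[OF tpow_bundle_sheaf[OF dual_bundle_sheaf[OF taut_sheaf]] lgen_tpow_taut[OF assms]
   trivial_bundle_sheaf[OF real_vs_detW] lgen_trivial_det[OF assms]] by simp

lemma line_bundle_target: "line_bundle target_bundle"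
proof (rule line_bundleI)
 show "section_sheaf target_bundle"
  by (intro tensor_bundle_sheaf tpow_bundle_sheaf dual_bundle_sheaf taut_sheaf trivial_bundle_sheaf
    real_vs_detW) simp
 fix x assume "x \<in> topspace (bbase target_bundle)"
 hence "x \<in> X" by simp
 then obtain U v y b q where "x \<in> U" "local_data U v y b q" using local_data_exists by blast
 thus "\<exists>U e. x \<in> U \<and> lgen target_bundle U e" using lgen_target by blast
qed

lemma proj_det_map_local:
 assumes ld: "local_data U v y b q" and l: "l \<in> U" and D: "real_vs D" 
  and \<mu>: "\<mu> \<in> vs_isos detW D"
 shows "proj_det_map (Suc m) f l D \<mu> \<in> vs_isos (vs_det (TF l)) (vs_tensor (\<Lambda> l) D)"
  and "proj_det_map (Suc m) f l D \<mu> (wedge (TF l) (%i. tangent_vec (proj_map f l) (f (v l)) (b i)))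
   = tens (\<Lambda> l) D (tprod (Suc m) (vs_dual (vs_of l)) (%_. dual_vec (vs_of l) (v l)))
     (\<mu> (wedge (vs_of UNIV) (case_nat (f (v l)) b)))"
proof -
 interpret W: line_in_space "proj_map f l" UNIV "f (v l)" m b by (rule local_line_W[OF ld l])
 note g = proj_det_map_gen[OF linear_f local_v(4,3)[OF ld l] W.line_in_space_axioms D vs_isos_hom[OF \<mu>]]
 show 2: "proj_det_map (Suc m) f l D \<mu> (wedge (TF l) (%i. tangent_vec (proj_map f l) (f (v l)) (b i)))
   = tens (\<Lambda> l) D (tprod (Suc m) (vs_dual (vs_of l)) (%_. dual_vec (vs_of l) (v l)))
     (\<mu> (wedge (vs_of UNIV) (case_nat (f (v l)) b)))"
  by (rule g(2))
 have RA: "real_vs (vs_of l)" by (rule real_vs_vs_of[OF local_v(4)[OF ld l]])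
 have RL: "real_vs (\<Lambda> l)" by (rule real_vs_tpow[OF real_vs_dual[OF RA]])
 show "proj_det_map (Suc m) f l D \<mu> \<in> vs_isos (vs_det (TF l)) (vs_tensor (\<Lambda> l) D)"
 proof (rule line_hom_iso[OF W.real_vs_detT real_vs_tensor[OF RL D] W.vline_source g(1)], unfold 2)
  show "vline (vs_tensor (\<Lambda> l) D) (tens (\<Lambda> l) D (tprod (Suc m) (vs_dual (vs_of l)) (%_. dual_vec (vs_of l) (v l)))
     (\<mu> (wedge (vs_of UNIV) (case_nat (f (v l)) b))))"
   by (rule vline_tensor[OF RL D vline_tpow[OF real_vs_dual[OF RA] vline_dual_vec[OF RA local_v(3)[OF ld l]]]
      vs_iso_line[OF real_vs_detW D vline_wedge[OF W.real_vs_B W.basis_B] \<mu>]])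
 qed
qed

lemma id_iso: "restrict id (vcarrier detW) \<in> vs_isos detW detW"
 using real_vsD[OF real_vs_detW] unfolding vs_isos_def vs_hom_iff vlinear_def
 by (auto simp: bij_betw_def inj_on_def)

theorem canonical_iso:
 "(\<lambda>l\<in>X. proj_det_map (Suc m) f l detW (restrict id (vcarrier detW)))
   \<in> line_bundle_isos (pullback_det X f) target_bundle"
proof (rule line_bundle_isosI[OF line_bundle_pullback_det line_bundle_target])
 fix x assume "x \<in> topspace (bbase (pullback_det X f))"
 hence x: "x \<in> X" by simp
 then obtain U v y b q where xU: "x \<in> U" and ld: "local_data U v y b q" using local_data_exists by blast
 show "(\<lambda>l\<in>X. proj_det_map (Suc m) f l detW (restrict id (vcarrier detW))) x
   \<in> vs_isos (bfib (pullback_det X f) x) (bfib target_bundle x)"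
  using proj_det_map_local(1)[OF ld xU real_vs_detW id_iso] x by simp
 show "\<exists>U e g c. x \<in> U \<and> lgen (pullback_det X f) U e \<and> lgen target_bundle U g \<and>
   cont_on (bbase (pullback_det X f)) U c \<and>
   (\<forall>l\<in>U. (\<lambda>l\<in>X. proj_det_map (Suc m) f l detW (restrict id (vcarrier detW))) l (e l)
    = vscale (bfib target_bundle l) (c l) (g l))"
 proof (intro exI conjI ballI)
  show "lgen (pullback_det X f) U (%l. wedge (TF l) (%i. tangent_vec (proj_map f l) (f (v l)) (b i)))"
   by (rule lgen_pullback_det[OF ld])
  note G = lgen_target[OF ld]
  show "lgen target_bundle U (%l. tens (\<Lambda> l) detW (tprod (Suc m) (vs_dual (vs_of l)) (%_. dual_vec (vs_of l) (v l)))
   (wedge (vs_of UNIV) (case_nat (f (v l)) b)))" by (rule G)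
  show "cont_on (bbase (pullback_det X f)) U (%_. 1 :: real)" by simp
  fix l assume l: "l \<in> U"
  have sh: "section_sheaf target_bundle" by (rule line_bundle_sheaf[OF line_bundle_target])
  have w: "wedge (vs_of UNIV) (case_nat (f (v l)) b) \<in> vcarrier detW"
   by (rule vline_mem[OF lgen_line[OF trivial_bundle_sheaf[OF real_vs_detW] lgen_trivial_det[OF ld] l, simplified]])
  note one = real_vsD(10)[OF lframe_real_vs[OF sh G l] vline_mem[OF lgen_line[OF sh G l]]]
  have "(\<lambda>l\<in>X. proj_det_map (Suc m) f l detW (restrict id (vcarrier detW))) l
    = proj_det_map (Suc m) f l detW (restrict id (vcarrier detW))"
   using local_X[OF ld l] by simp
  thus "(\<lambda>l\<in>X. proj_det_map (Suc m) f l detW (restrict id (vcarrier detW))) l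
     (wedge (TF l) (%i. tangent_vec (proj_map f l) (f (v l)) (b i)))
    = vscale (bfib target_bundle l) 1 (tens (\<Lambda> l) detW
     (tprod (Suc m) (vs_dual (vs_of l)) (%_. dual_vec (vs_of l) (v l)))
     (wedge (vs_of UNIV) (case_nat (f (v l)) b)))"
   using proj_det_map_local(2)[OF ld l real_vs_detW id_iso] w one by simp
 qed (use xU in auto)
qed (simp_all add: Int_absorb1[OF X_subset])

text \<open>The correspondence at one point, as an operation on the value of \<mu> there; this is
  the fibrewise form required by \<open>line_bundle_isos_transfer\<close>.\<close>

definition nu_map :: "'v set \<Rightarrow> ((((nat \<Rightarrow> 'w) \<Rightarrow> real) \<Rightarrow> real) \<Rightarrow> ((nat \<Rightarrow> 'v) \<Rightarrow> real) \<Rightarrow> real) \<Rightarrow>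
  (((nat \<Rightarrow> 'w \<Rightarrow> 'w set) \<Rightarrow> real) \<Rightarrow> real) \<Rightarrow> (((nat \<Rightarrow> 'v \<Rightarrow> 'v set) \<Rightarrow> real) \<Rightarrow> real)" where
 "nu_map l h = compose (vcarrier (bfib (pullback_det X f) l))
    (inv_into (vcarrier (bfib (det_bundle (tangent_bundle X)) l)) (det_tangent_iso l (Y_fib X l)))
    (proj_det_map (Suc m) f l (vs_det (vs_of (Y_fib X l))) h)"

text \<open>Both canonical identifications send generators to generators with the same first tensor
  factor. Thus the scalar by which \<open>h\<close> acts on the determinants passes through the
  tensor product and the inverse unchanged.\<close>

lemma nu_map_local:
 assumes ld: "local_data U v y b q" and l: "l \<in> U"
  and h: "h \<in> vs_isos detW (vs_det (vs_of (Y_fib X l)))"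
 defines "T \<equiv> vs_hom (vs_of l) (vs_quot l (Y_fib X l))"
 shows "nu_map l h \<in> vs_isos (vs_det (TF l)) (vs_det T)"
  and "lcoef (vs_det T) (wedge T (%i. tangent_vec l (v l) (y i l)))
    (nu_map l h (wedge (TF l) (%i. tangent_vec (proj_map f l) (f (v l)) (b i))))
   = lcoef (vs_det (vs_of (Y_fib X l))) (wedge (vs_of (Y_fib X l)) (case_nat (v l) (%i. y i l)))
    (h (wedge (vs_of UNIV) (case_nat (f (v l)) b)))"
proof -
 interpret Y: line_in_space l "Y_fib X l" "v l" m "%i. y i l" by (rule local_dataD(4)[OF ld l])
 interpret W: line_in_space "proj_map f l" UNIV "f (v l)" m b by (rule local_line_W[OF ld l])
 let ?D = "vs_det (vs_of (Y_fib X l))" and ?k = "det_tangent_iso l (Y_fib X l)"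
 let ?P = "proj_det_map (Suc m) f l ?D h"
 let ?e = "wedge (TF l) (%i. tangent_vec (proj_map f l) (f (v l)) (b i))"
 let ?w = "wedge (vs_of UNIV) (case_nat (f (v l)) b)"
 let ?g = "wedge (vs_of (Y_fib X l)) (case_nat (v l) (%i. y i l))"
 let ?s = "wedge T (%i. tangent_vec l (v l) (y i l))"
 note pd = proj_det_map_local[OF ld l Y.real_vs_detB h]
 have fibT: "bfib (det_bundle (tangent_bundle X)) l = vs_det T"
  by (simp add: tangent_bundle_fib[OF local_X[OF ld l]] T_def)
 have k: "?k \<in> vs_isos (vs_det T) (vs_tensor (\<Lambda> l) ?D)" unfolding T_def by (rule Y.det_tangent_iso_iso)
 \<comment> \<open>Restricted to the carrier the inverse is an element of \<open>vs_isos\<close>;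
   the composition evaluates it only there.\<close>
 let ?i = "restrict (inv_into (vcarrier (vs_det T)) ?k) (vcarrier (vs_tensor (\<Lambda> l) ?D))"
 have i: "?i \<in> vs_isos (vs_tensor (\<Lambda> l) ?D) (vs_det T)"
  using k unfolding T_def by (rule vs_isos_inverse[OF Y.real_vs_detT Y.real_vs_target])
 have eq: "nu_map l h = compose (vcarrier (vs_det (TF l))) ?i ?P"
  unfolding nu_map_def fibT pullback_det_simps
  by (rule ext) (auto simp: compose_def vs_isos_mem[OF pd(1)])
 show "nu_map l h \<in> vs_isos (vs_det (TF l)) (vs_det T)"
  unfolding eq by (rule vs_isos_compose[OF W.real_vs_detT pd(1) i])
 have e: "?e \<in> vcarrier (vs_det (TF l))" by (rule vline_mem[OF W.vline_source])
 have w: "?w \<in> vcarrier detW" by (rule vline_mem[OF vline_wedge[OF W.real_vs_B W.basis_B]])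
 have gl: "vline ?D ?g" by (rule vline_wedge[OF Y.real_vs_B Y.basis_B])
 define c where "c = lcoef ?D ?g (h ?w)"
 have hw: "h ?w = vscale ?D c ?g"
  unfolding c_def by (rule lcoef_scale[OF Y.real_vs_detB gl vs_isos_mem[OF h w]])
 let ?p = "tprod (Suc m) (vs_dual (vs_of l)) (%_. dual_vec (vs_of l) (v l))"
 have pm: "?p \<in> vcarrier (\<Lambda> l)" by (rule vline_mem[OF vline_tpow[OF Y.real_vs_L Y.vline_L]])
 have sm: "?s \<in> vcarrier (vs_det T)" unfolding T_def by (rule vline_mem[OF Y.vline_source])
 have kl: "vlinear (vs_det T) (vs_tensor (\<Lambda> l) ?D) ?k" using vs_isos_hom[OF k] by (simp add: vs_hom_iff)
 have "?P ?e = tens (\<Lambda> l) ?D ?p (vscale ?D c ?g)" using pd(2) hw by simp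
 also have "\<dots> = tens (\<Lambda> l) ?D (vscale (\<Lambda> l) 1 ?p) (vscale ?D c ?g)"
  by (simp only: real_vsD(10)[OF Y.real_vs_tpowL pm])
 also have "\<dots> = vscale (vs_tensor (\<Lambda> l) ?D) (1 * c) (tens (\<Lambda> l) ?D ?p ?g)"
  by (rule tens_scale[OF Y.real_vs_tpowL Y.real_vs_detB pm vline_mem[OF gl]])
 also have "\<dots> = vscale (vs_tensor (\<Lambda> l) ?D) c (?k ?s)"
  unfolding T_def by (simp only: Y.det_tangent_iso_gen mult_1)
 also have "\<dots> = ?k (vscale (vs_det T) c ?s)" by (rule vlinearD(3)[OF kl sm, symmetric])
 finally have Pe: "?P ?e = ?k (vscale (vs_det T) c ?s)" .
 have RT: "real_vs (vs_det T)" unfolding T_def by (rule Y.real_vs_detT)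
 have sc: "vscale (vs_det T) c ?s \<in> vcarrier (vs_det T)" by (rule real_vsD(6)[OF RT sm])
 have "inj_on ?k (vcarrier (vs_det T))" using k by (simp add: vs_isos_def bij_betw_def)
 hence "inv_into (vcarrier (vs_det T)) ?k (?P ?e) = vscale (vs_det T) c ?s"
  unfolding Pe using sc by (rule inv_into_f_f)
 hence "nu_map l h ?e = vscale (vs_det T) c ?s"
  unfolding eq compose_eq[OF e] using vs_isos_mem[OF pd(1) e] by simp
 moreover have "vline (vs_det T) ?s" unfolding T_def by (rule Y.vline_source)
 ultimately show "lcoef (vs_det T) ?s (nu_map l h ?e) = lcoef ?D ?g (h ?w)"
  using lcoef_unique[OF RT] c_def by metis
qed

theorem nu_of_mu_bij:
 "bij_betw (nu_of_mu (Suc m) X f)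
   (line_bundle_isos (trivial_bundle TX detW) (det_bundle (Y_bundle X)))
   (line_bundle_isos (pullback_det X f) (det_bundle (tangent_bundle X)))"
proof -
 have eq: "nu_of_mu (Suc m) X f = (%\<mu>. \<lambda>l\<in>topspace TX. nu_map l (\<mu> l))"
  unfolding topspace_TX by (intro ext) (simp add: nu_of_mu_def nu_map_def)
 show ?thesis
  unfolding eq
 proof (rule line_bundle_isos_transfer[OF line_bundle_trivial_det line_bundle_det_Y
    line_bundle_pullback_det line_bundle_det_tangent])
  fix x assume "x \<in> topspace TX"
  hence x: "x \<in> X" by simp
  then obtain U v y b q where xU: "x \<in> U" and ld: "local_data U v y b q" using local_data_exists by blast
  show "\<exists>U e1 f1 e2 f2. x \<in> U \<and> lgen (trivial_bundle TX detW) U e1 \<and>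
    lgen (det_bundle (Y_bundle X)) U f1 \<and> lgen (pullback_det X f) U e2 \<and>
    lgen (det_bundle (tangent_bundle X)) U f2 \<and>
    (\<forall>l\<in>U. \<forall>h\<in>vs_isos (bfib (trivial_bundle TX detW) l) (bfib (det_bundle (Y_bundle X)) l).
     nu_map l h \<in> vs_isos (bfib (pullback_det X f) l) (bfib (det_bundle (tangent_bundle X)) l) \<and>
     lcoef (bfib (det_bundle (tangent_bundle X)) l) (f2 l) (nu_map l h (e2 l))
      = lcoef (bfib (det_bundle (Y_bundle X)) l) (f1 l) (h (e1 l)))"
  proof (intro exI conjI, rule xU, rule lgen_trivial_det[OF ld], rule lgen_det_Y[OF ld],
    rule lgen_pullback_det[OF ld], rule lgen_det_tangent[OF ld], intro ballI)
   fix l h assume l: "l \<in> U"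
    and "h \<in> vs_isos (bfib (trivial_bundle TX detW) l) (bfib (det_bundle (Y_bundle X)) l)"
   hence h: "h \<in> vs_isos detW (vs_det (vs_of (Y_fib X l)))" by (simp add: Y_bundle_def)
   have t: "bfib (det_bundle (tangent_bundle X)) l = vs_det (vs_hom (vs_of l) (vs_quot l (Y_fib X l)))"
    by (simp add: tangent_bundle_fib[OF local_X[OF ld l]])
   have y: "bfib (det_bundle (Y_bundle X)) l = vs_det (vs_of (Y_fib X l))" by (simp add: Y_bundle_def)
   show "nu_map l h \<in> vs_isos (bfib (pullback_det X f) l) (bfib (det_bundle (tangent_bundle X)) l) \<and>
     lcoef (bfib (det_bundle (tangent_bundle X)) l)
      (wedge (vs_hom (vs_of l) (vs_quot l (Y_fib X l))) (%i. tangent_vec l (v l) (y i l)))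
      (nu_map l h (wedge (TF l) (%i. tangent_vec (proj_map f l) (f (v l)) (b i))))
     = lcoef (bfib (det_bundle (Y_bundle X)) l) (wedge (vs_of (Y_fib X l)) (case_nat (v l) (%i. y i l)))
      (h (wedge (vs_of UNIV) (case_nat (f (v l)) b)))"
    unfolding t y pullback_det_simps using nu_map_local[OF ld l h] by (rule conjI)
  qed
 qed (simp_all add: Y_bundle_def)
qed

theorem trivializations_bij:
 "bij_betw (%\<mu>. \<lambda>l\<in>X. restrict (inv_into (vcarrier detW) (\<mu> l)) (vcarrier (vs_det (vs_of (Y_fib X l)))))
   (line_bundle_isos (trivial_bundle TX detW) (det_bundle (Y_bundle X)))
   (global_trivializations (det_bundle (Y_bundle X)) detW)"
 using line_bundle_isos_inverse_bij[of "trivial_bundle TX detW" "det_bundle (Y_bundle X)"]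
 unfolding global_trivializations_def by (simp add: Y_bundle_def Int_absorb1[OF X_subset])

end

text \<open>Both bundles are isomorphic to \<open>?E\<close>, which is built from \<open>X\<close>
  and \<open>W\<close> alone.\<close>

lemma pullback_det_isomorphic:
 fixes f g :: "'v::euclidean_space \<Rightarrow> 'w::euclidean_space"
 assumes "projection m X f" "projection m X g"
 shows "line_bundle_isomorphic (pullback_det X f) (pullback_det X g)"
proof -
 let ?E = "tensor_bundle (tpow_bundle (Suc m) (dual_bundle (taut_bundle X)))
   (trivial_bundle (subtopology proj_top X) (vs_det (vs_of (UNIV :: 'w set))))"
 have "line_bundle_isomorphic (pullback_det X h) ?E" if "projection m X h" for h :: "'v \<Rightarrow> 'w"
  unfolding line_bundle_isomorphic_def
  using projection.canonical_iso[OF that] by (rule ex_in_conv[THEN iffD1, OF exI])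
 from this[OF assms(1)] line_bundle_isomorphic_sym[OF this[OF assms(2)]]
 show ?thesis by (rule line_bundle_isomorphic_trans)
qed

section \<open>Degree one cohomology classes\<close>

text \<open>Sums of bits are to remain sums, so that the cochain identities below are rearrangements
  in an abelian group.\<close>

declare add_bit_eq_xor [simp del] mult_bit_eq_and [simp del]

lemma standard_simplex_0: "standard_simplex 0 = {vertex0}"
proof -
 have "(%i. if i = (0::nat) then 1 else 0) = (vertex0 :: nat \<Rightarrow> real)" by (simp add: vertex0_def)
 thus ?thesis using standard_simplex_0 by (metis (no_types))
qed

text \<open>Face number \<open>k\<close> omits vertex number \<open>k\<close>, so face 0 of an edge
  is its end point and face 1 its starting point.\<close>

lemma singular_face_vertex:
 "singular_face (Suc 0) 0 u = (\<lambda>z\<in>standard_simplex 0. u vertex1)"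
 "singular_face (Suc 0) (Suc 0) u = (\<lambda>z\<in>standard_simplex 0. u vertex0)"
proof -
 have "simplical_face 0 vertex0 = vertex1" "simplical_face (Suc 0) vertex0 = vertex0"
  by (auto simp: simplical_face_def vertex0_def vertex1_def fun_eq_iff)
 thus "singular_face (Suc 0) 0 u = (\<lambda>z\<in>standard_simplex 0. u vertex1)"
  "singular_face (Suc 0) (Suc 0) u = (\<lambda>z\<in>standard_simplex 0. u vertex0)"
  by (simp_all add: singular_face_def standard_simplex_0 restrict_def cong: if_cong)
qed

definition edge_coboundary :: "'a topology \<Rightarrow> ('a \<Rightarrow> bit) \<Rightarrow> ((nat \<Rightarrow> real) \<Rightarrow> 'a) \<Rightarrow> bit" where
 "edge_coboundary T a u = (if singular_simplex 1 T u then a (u vertex0) + a (u vertex1) else 0)"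

lemma vertices_mem:
 assumes "singular_simplex 1 T u"
 shows "u vertex0 \<in> topspace T" "u vertex1 \<in> topspace T"
proof -
 have "vertex0 \<in> standard_simplex 1" "vertex1 \<in> standard_simplex 1"
  using basis_in_standard_simplex[of 0 1] basis_in_standard_simplex[of 1 1]
  by (simp_all add: vertex0_def vertex1_def)
 moreover have "continuous_map (subtopology (powertop_real UNIV) (standard_simplex 1)) T u"
  using assms by (simp add: singular_simplex_def)
 hence "u ` standard_simplex 1 \<subseteq> topspace T"
  using continuous_map_image_subset_topspace by fastforce
 ultimately show "u vertex0 \<in> topspace T" "u vertex1 \<in> topspace T" by auto
qed

text \<open>A 0-simplex is a point, so a 0-cochain is an arbitrary function on points. Values of
  \<open>a\<close> outside the space are harmless, since the ends of a singular edge lie in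
  it.\<close>

lemma coboundaries_1: "coboundaries 1 T = range (edge_coboundary T)"
proof
 have eq: "coboundary 0 T c = edge_coboundary T (%x. c (\<lambda>z\<in>standard_simplex 0. x))" for c
  by (rule ext) (simp add: coboundary_def edge_coboundary_def singular_face_vertex add.commute One_nat_def)
 thus "coboundaries 1 T \<subseteq> range (edge_coboundary T)" by (auto simp: coboundaries_def One_nat_def)
 show "range (edge_coboundary T) \<subseteq> coboundaries 1 T"
 proof (rule image_subsetI)
  fix a :: "'a \<Rightarrow> bit"
  let ?c = "%u. if singular_simplex 0 T u then a (u vertex0) else 0"
  have "edge_coboundary T a = coboundary 0 T ?c"
  proof
   fix u
   have "singular_simplex 0 T (\<lambda>z\<in>standard_simplex 0. x)" if "x \<in> topspace T" for x
    using that by (auto simp: singular_simplex_def intro: continuous_map_eq[of _ _ "%_. x"])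
   thus "edge_coboundary T a u = coboundary 0 T ?c u"
    using vertices_mem[of T u] unfolding eq edge_coboundary_def by (simp add: standard_simplex_0)
  qed
  moreover have "?c \<in> carrier (cochain_group 0 T)" by (simp add: cochain_group_def)
  ultimately show "edge_coboundary T a \<in> coboundaries 1 T" by (auto simp: coboundaries_def One_nat_def)
 qed
qed

lemma coh_class_iff: "d \<in> coh_class 1 T c \<longleftrightarrow> (\<exists>a. d = (%u. edge_coboundary T a u + c u))"
 by (auto simp: coh_class_def r_coset_def coboundaries_1 cocycle_group_def cochain_group_def)

lemma edge_coboundary_add:
 "edge_coboundary T a u + edge_coboundary T b u = edge_coboundary T (%x. a x + b x) u"
 by (cases "singular_simplex 1 T u") (simp_all only: edge_coboundary_def ac_simps if_True if_False add_0)

lemma edge_coboundary_zero [simp]: "edge_coboundary T (%_. 0) u = 0"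
 by (cases "singular_simplex 1 T u") (simp_all add: edge_coboundary_def)

lemma bit_add_self [simp]: "(x::bit) + x = 0" "(x::bit) + (x + y) = y"
 by (cases x; cases y; simp)+

text \<open>Two cosets agree iff the representatives differ by a coboundary, and in characteristic
  two the difference is the sum.\<close>

lemma coh_class_eq_iff:
 "coh_class 1 T c = coh_class 1 T d \<longleftrightarrow> (\<exists>a. \<forall>u. c u + d u = edge_coboundary T a u)"
proof
 assume eq: "coh_class 1 T c = coh_class 1 T d"
 have "c \<in> coh_class 1 T c"
  unfolding coh_class_iff by (intro exI[of _ "%_. 0"]) simp
 then obtain a where "c = (%u. edge_coboundary T a u + d u)" unfolding eq coh_class_iff by blast
 thus "\<exists>a. \<forall>u. c u + d u = edge_coboundary T a u" by (intro exI[of _ a]) (simp add: ac_simps)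
next
 assume "\<exists>a. \<forall>u. c u + d u = edge_coboundary T a u"
 then obtain a where a: "\<And>u. edge_coboundary T a u = c u + d u" by metis
 have sub: "e \<in> coh_class 1 T c'" if e: "e \<in> coh_class 1 T d'" and a: "\<And>u. edge_coboundary T a u = c' u + d' u"
  for e c' d'
 proof -
  from e obtain b where "e = (%u. edge_coboundary T b u + d' u)" unfolding coh_class_iff by blast
  hence "e = (%u. edge_coboundary T (%x. b x + a x) u + c' u)"
   unfolding edge_coboundary_add[symmetric] by (simp add: a ac_simps)
  thus ?thesis unfolding coh_class_iff by blast
 qed
 show "coh_class 1 T c = coh_class 1 T d"
 proof (intro Set.set_eqI iffI)
  show "e \<in> coh_class 1 T d" if "e \<in> coh_class 1 T c" for e
   by (rule sub[OF that]) (simp add: a add.commute)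
  show "e \<in> coh_class 1 T c" if "e \<in> coh_class 1 T d" for e by (rule sub[OF that a])
 qed
qed

lemma coh_class_mult:
 "coh_class 1 T c \<otimes>\<^bsub>cohomology 1 T\<^esub> coh_class 1 T d = coh_class 1 T (%u. c u + d u)"
proof -
 have "coh_class 1 T c \<otimes>\<^bsub>cohomology 1 T\<^esub> coh_class 1 T d
   = {%u. x u + y u | x y. x \<in> coh_class 1 T c \<and> y \<in> coh_class 1 T d}"
  by (auto simp: cohomology_def FactGroup_def set_mult_def cocycle_group_def cochain_group_def)
 also have "\<dots> = coh_class 1 T (%u. c u + d u)"
 proof (intro Set.set_eqI iffI)
  fix e assume "e \<in> {%u. x u + y u | x y. x \<in> coh_class 1 T c \<and> y \<in> coh_class 1 T d}"
  then obtain a b where "e = (%u. (edge_coboundary T a u + c u) + (edge_coboundary T b u + d u))"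
   unfolding coh_class_iff by blast
  hence "e = (%u. edge_coboundary T (%x. a x + b x) u + (c u + d u))"
   unfolding edge_coboundary_add[symmetric] by (simp add: ac_simps)
  thus "e \<in> coh_class 1 T (%u. c u + d u)" unfolding coh_class_iff by blast
 next
  fix e assume "e \<in> coh_class 1 T (%u. c u + d u)"
  then obtain a where "e = (%u. edge_coboundary T a u + (c u + d u))" unfolding coh_class_iff by blast
  hence "e = (%u. (edge_coboundary T a u + c u) + (edge_coboundary T (%_. 0) u + d u))"
   by (simp add: ac_simps)
  thus "e \<in> {%u. x u + y u | x y. x \<in> coh_class 1 T c \<and> y \<in> coh_class 1 T d}"
   unfolding mem_Collect_eq coh_class_iff by (intro exI conjI) (assumption | rule refl)+
 qed
 finally show ?thesis .
qed

text \<open>The quotient group is written multiplicatively, so the multiple \<open>n w_1\<close> of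
  the theorem appears as a power.\<close>

lemma coh_class_pow:
 "coh_class 1 T c [^]\<^bsub>cohomology 1 T\<^esub> (n::nat) = coh_class 1 T (%u. of_nat n * c u)"
proof (induction n)
 case 0
 have "\<one>\<^bsub>cohomology 1 T\<^esub> = coh_class 1 T (%_. 0)"
  by (rule Set.set_eqI) (auto simp: coh_class_iff cohomology_def FactGroup_def coboundaries_1)
 thus ?case by (simp add: nat_pow_def)
next
 case (Suc n)
 have "coh_class 1 T c [^]\<^bsub>cohomology 1 T\<^esub> (Suc n)
   = coh_class 1 T c [^]\<^bsub>cohomology 1 T\<^esub> n \<otimes>\<^bsub>cohomology 1 T\<^esub> coh_class 1 T c"
  by (simp add: nat_pow_def)
 also have "\<dots> = coh_class 1 T (%u. of_nat (Suc n) * c u)"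
  unfolding Suc.IH coh_class_mult by (simp add: algebra_simps)
 finally show ?case .
qed

lemma singular_simplex_subtopology_mono:
 "singular_simplex p (subtopology S X) u ==> singular_simplex p S u"
 by (simp add: singular_simplex_subtopology)

lemma restrict_singular_simplex: "singular_simplex p T u ==> restrict u (standard_simplex p) = u"
 by (simp add: singular_simplex_def extensional_restrict)

text \<open>The pullback is a union over all representatives. Two of them differ by the coboundary
  of a function on the larger space, whose restriction has the restricted coboundary, so every term
  of the union is the same class.\<close>

lemma coh_pullback_id:
 "coh_pullback 1 (subtopology S X) id (coh_class 1 S c)
  = coh_class 1 (subtopology S X) (cochain_pullback 1 (subtopology S X) id c)"
proof -
 let ?T = "subtopology S X"
 have eq: "coh_class 1 ?T (cochain_pullback 1 ?T id d) = coh_class 1 ?T (cochain_pullback 1 ?T id c)"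
  if dc: "d \<in> coh_class 1 S c" for d
 proof -
  obtain a where d: "d = (%u. edge_coboundary S a u + c u)" using dc unfolding coh_class_iff by blast
  have "cochain_pullback 1 ?T id d u + cochain_pullback 1 ?T id c u = edge_coboundary ?T a u" for u
   by (auto simp: cochain_pullback_def d edge_coboundary_def restrict_singular_simplex ac_simps
     dest: singular_simplex_subtopology_mono)
  thus ?thesis unfolding coh_class_eq_iff by blast
 qed
 have "c \<in> coh_class 1 S c"
  unfolding coh_class_iff by (intro exI[of _ "%_. 0"]) simp
 thus ?thesis unfolding coh_pullback_def using eq by blast
qed

text \<open>The equation of cohomology classes becomes a statement about the endpoints of paths in
  \<open>X\<close>, the only form in which cohomology enters the comparison with sections.\<close>

lemma coh_class_eq_pullback_pow:
 assumes c: "\<And>u. \<not> singular_simplex 1 (subtopology S X) u ==> c u = 0"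
 shows "coh_class 1 (subtopology S X) c
   = coh_pullback 1 (subtopology S X) id (coh_class 1 S d) [^]\<^bsub>cohomology 1 (subtopology S X)\<^esub> n
  \<longleftrightarrow> (\<exists>a. \<forall>u. singular_simplex 1 (subtopology S X) u \<longrightarrow>
     c u + of_nat n * d u = a (u vertex0) + a (u vertex1))"
proof -
 let ?T = "subtopology S X"
 have "c u + of_nat n * cochain_pullback 1 ?T id d u = edge_coboundary ?T a u \<longleftrightarrow>
   (singular_simplex 1 ?T u \<longrightarrow> c u + of_nat n * d u = a (u vertex0) + a (u vertex1))" for a u
  using c[of u] by (auto simp: cochain_pullback_def edge_coboundary_def restrict_singular_simplex)
 thus ?thesis unfolding coh_pullback_id coh_class_pow coh_class_eq_iff by simp
qed

section \<open>Bundles over an interval\<close>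

abbreviation simplex_interval :: "(nat \<Rightarrow> real) topology" where
 "simplex_interval \<equiv> subtopology (powertop_real UNIV) (standard_simplex 1)"

text \<open>The inverse of coordinate 1 on the standard 1-simplex: the parameter runs from
  \<open>vertex0\<close> at 0 to \<open>vertex1\<close> at 1.\<close>

definition interval_point :: "real \<Rightarrow> nat \<Rightarrow> real" where
 "interval_point t = (%i. if i = 0 then 1 - t else if i = 1 then t else 0)"

lemma topspace_simplex_interval [simp]: "topspace simplex_interval = standard_simplex 1"
 by simp

lemma interval_point_mem: "interval_point t \<in> standard_simplex 1 \<longleftrightarrow> 0 \<le> t \<and> t \<le> 1"
 by (auto simp: standard_simplex_def interval_point_def One_nat_def dest: spec[of _ "Suc 0"])

lemma interval_point_coord [simp]: "interval_point t 1 = t"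
 by (simp add: interval_point_def)

lemma interval_point_vertex: "interval_point 0 = vertex0" "interval_point 1 = vertex1"
 by (auto simp: interval_point_def vertex0_def vertex1_def)

lemma interval_point_inverse:
 assumes "z \<in> standard_simplex 1"
 shows "interval_point (z 1) = z" "0 \<le> z 1" "z 1 \<le> 1"
 using assms by (auto simp: standard_simplex_def interval_point_def fun_eq_iff One_nat_def)

lemma continuous_interval_point:
 assumes "continuous_map T euclideanreal t" "\<And>x. x \<in> topspace T ==> 0 \<le> t x \<and> t x \<le> 1"
 shows "continuous_map T simplex_interval (%x. interval_point (t x))"
proof -
 have "continuous_map T (powertop_real UNIV) (%x. interval_point (t x))"
  unfolding continuous_map_componentwise_UNIV interval_point_def
  using assms(1) by (auto intro!: continuous_map_diff)
 thus ?thesis using assms(2) by (auto simp: continuous_map_in_subtopology interval_point_mem)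
qed

lemma cont_on_coord: "cont_on simplex_interval U (%z. z i)"
 unfolding cont_on_def
 by (intro continuous_map_from_subtopology continuous_map_product_projection) simp

lemma nonzero_sign_interval:
 assumes g: "cont_on simplex_interval (standard_simplex 1) (g :: _ \<Rightarrow> real)"
  and nz: "\<And>z. z \<in> standard_simplex 1 ==> g z \<noteq> 0"
 shows "g vertex0 > 0 \<longleftrightarrow> g vertex1 > 0"
proof -
 have g': "continuous_map simplex_interval euclidean g"
  using g by (simp add: cont_on_def subtopology_subtopology)
 have "continuous_map (top_of_set {0..1}) simplex_interval (%t. interval_point t)"
  by (rule continuous_interval_point) auto
 from continuous_map_compose[OF this g']
 have c: "continuous_on {0..1} (%t. g (interval_point t))" by (simp add: o_def)
 have nz': "g (interval_point t) \<noteq> 0" if "0 \<le> t" "t \<le> 1" for t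
  using that by (intro nz) (simp add: interval_point_mem)
 show ?thesis
 proof (rule ccontr)
  assume "\<not> ?thesis"
  then consider "g (interval_point 0) \<le> 0" "0 \<le> g (interval_point 1)"
   | "g (interval_point 1) \<le> 0" "0 \<le> g (interval_point 0)"
   unfolding interval_point_vertex by linarith
  thus False
  proof cases
   case 1
   thus False using IVT'[of "%t. g (interval_point t)" 0 0 1] c nz' by force
  next
   case 2
   thus False using IVT2'[of "%t. g (interval_point t)" 1 0 0] c nz' by force
  qed
 qed
qed


text \<open>Locally the bundle has a trivializing frame \<open>b\<close>. The coordinates in
  \<open>t\<close> are quotients of determinants taken with respect to \<open>b\<close>, so they are
  continuous; conversely coordinates in \<open>b\<close> are combinations of those in
  \<open>t\<close>.\<close>

lemma frame_lframe:
 assumes E: "vector_bundle r E" and U: "openin (bbase E) U" and t: "frame E U r t"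
 shows "lframe E U r t"
proof (rule lframeI)
 note sh = line_bundle_sheaf[OF E]
 have UT: "x \<in> topspace (bbase E)" if "x \<in> U" for x using openin_subset[OF U] that by blast
 have R: "real_vs (bfib E y)" if "y \<in> U" for y by (rule sheaf_real_vs[OF sh UT[OF that]])
 have bt: "vs_basis (bfib E y) r (%i. t i y)" if "y \<in> U" for y using t that by (simp add: frame_def)
 have st: "bsec E U (t i)" if "i < r" for i using t that by (simp add: frame_def)
 show "openin (bbase E) U" "\<And>y. y \<in> U ==> real_vs (bfib E y)"
  "\<And>y. y \<in> U ==> vs_basis (bfib E y) r (%i. t i y)" by (fact U, fact R, fact bt)
 fix V s assume V: "openin (bbase E) V" "V \<subseteq> U"
 have loc: "\<exists>W b. x \<in> W \<and> W \<subseteq> V \<and> openin (bbase E) W \<and> lframe E W r b" if x: "x \<in> V" for x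
 proof -
  obtain W b where W: "x \<in> W" "lframe E W r b" using E UT x V(2) unfolding vector_bundle_iff by blast
  have "openin (bbase E) (W \<inter> V)" using lframe_openin[OF sh W(2)] V(1) by blast
  moreover from this have "lframe E (W \<inter> V) r b" by (rule lframe_subset[OF sh W(2)]) simp
  ultimately show ?thesis using W(1) x by (intro exI[of _ "W \<inter> V"] exI[of _ b]) simp
 qed
 show "bsec E V s \<longleftrightarrow> (\<forall>y\<in>V. s y \<in> vcarrier (bfib E y)) \<and>
   (\<forall>i<r. cont_on (bbase E) V (%y. vcoord (bfib E y) r (%i. t i y) (s y) i))"
 proof (intro iffI conjI ballI allI impI)
  assume s: "bsec E V s"
  show sm: "s y \<in> vcarrier (bfib E y)" if "y \<in> V" for y by (rule sheaf_mem[OF sh s that])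
  fix i assume i: "i < r"
  show "cont_on (bbase E) V (%y. vcoord (bfib E y) r (%i. t i y) (s y) i)"
  proof (rule cont_on_local)
   fix x assume "x \<in> V"
   from loc[OF this] obtain W b where W: "x \<in> W" "W \<subseteq> V" "openin (bbase E) W" and b: "lframe E W r b" by blast
   have tW: "bsec E W (t j)" if "j < r" for j
    by (rule sheaf_restrict[OF sh st[OF that] W(3)]) (use W(2) V(2) in blast)
   have sW: "bsec E W s" by (rule sheaf_restrict[OF sh s W(3,2)])
   \<comment> \<open>Numerator and denominator of Cramer's rule for coordinate \<open>i\<close>:
     column \<open>i\<close> of the frame is replaced by \<open>s\<close>.\<close>
   let ?n = "%y. dform (bfib E y) r (%i. b i y) (%j. (if j = i then s else t j) y)"
   let ?d = "%y. dform (bfib E y) r (%i. b i y) (%j. t j y)"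
   have by': "vs_basis (bfib E y) r (%i. b i y)" if "y \<in> W" for y by (rule lframe_basis[OF sh b that])
   have WU: "y \<in> U" "y \<in> V" if "y \<in> W" for y using that W(2) V(2) by auto
   have d0: "?d y \<noteq> 0" if "y \<in> W" for y by (rule dform_nonzero[OF R[OF WU(1)[OF that]] by'[OF that] bt[OF WU(1)[OF that]]])
   have "cont_on (bbase E) W (%y. ?n y / ?d y)"
   proof (rule cont_on_divide[OF _ _ d0])
    show "cont_on (bbase E) W ?n"
     by (rule cont_on_dform[OF sh b W(3) subset_refl]) (simp add: sW tW)
    show "cont_on (bbase E) W ?d" by (rule cont_on_dform[OF sh b W(3) subset_refl tW])
   qed
   hence "cont_on (bbase E) W (%y. vcoord (bfib E y) r (%i. t i y) (s y) i)"
   proof (rule cont_on_cong)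
    fix y assume y: "y \<in> W"
    note F = R[OF WU(1)[OF y]] and T = bt[OF WU(1)[OF y]]
    have eq: "(%j. (if j = i then s else t j) y) = (%j. t j y)(i := s y)" by auto
    have "?n y = ?d y * dform (bfib E y) r (%j. t j y) ((%j. t j y)(i := s y))"
     unfolding eq by (rule dform_chain[OF F by'[OF y] T])
      (use vs_basis_mem[OF T] sm[OF WU(2)[OF y]] in auto)
    also have "dform (bfib E y) r (%j. t j y) ((%j. t j y)(i := s y)) = vcoord (bfib E y) r (%i. t i y) (s y) i"
     by (rule dform_replace[OF F T i sm[OF WU(2)[OF y]]])
    finally show "?n y / ?d y = vcoord (bfib E y) r (%i. t i y) (s y) i" using d0[OF y] by simp
   qed
   thus "\<exists>W. openin (bbase E) W \<and> x \<in> W \<and> W \<subseteq> V \<and>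
     cont_on (bbase E) W (%y. vcoord (bfib E y) r (%i. t i y) (s y) i)" using W by blast
  qed
 next
  assume s: "(\<forall>y\<in>V. s y \<in> vcarrier (bfib E y)) \<and>
   (\<forall>i<r. cont_on (bbase E) V (%y. vcoord (bfib E y) r (%i. t i y) (s y) i))"
  show "bsec E V s"
  proof (rule sheaf_local[OF sh])
   fix x assume "x \<in> V"
   from loc[OF this] obtain W b where W: "x \<in> W" "W \<subseteq> V" "openin (bbase E) W" and b: "lframe E W r b" by blast
   have tW: "bsec E W (t j)" if "j < r" for j
    by (rule sheaf_restrict[OF sh st[OF that] W(3)]) (use W(2) V(2) in blast)
   have "cont_on (bbase E) W (%y. vcoord (bfib E y) r (%i. b i y) (s y) j)" if j: "j < r" for j
   proof -
    have "cont_on (bbase E) W (%y. \<Sum>i<r. vcoord (bfib E y) r (%i. t i y) (s y) i *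
      vcoord (bfib E y) r (%i. b i y) (t i y) j)"
    proof (intro cont_on_sum cont_on_mult)
     fix i assume "i \<in> {..<r}"
     hence i: "i < r" by simp
     show "cont_on (bbase E) W (%y. vcoord (bfib E y) r (%i. t i y) (s y) i)"
      using s i by (intro cont_on_subset[OF _ W(2)]) blast
     show "cont_on (bbase E) W (%y. vcoord (bfib E y) r (%i. b i y) (t i y) j)"
      using tW[OF i] bsec_iff_coords[OF sh b W(3) subset_refl] j by blast
    qed
    thus ?thesis
    proof (rule cont_on_cong)
     fix y assume y: "y \<in> W"
     hence yU: "y \<in> U" and sy: "s y \<in> vcarrier (bfib E y)" using W(2) V(2) s by auto
     have "s y = lincomb (bfib E y) r (vcoord (bfib E y) r (%i. t i y) (s y)) (%i. t i y)"
      by (rule vcoord_lincomb[OF bt[OF yU] sy])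
     hence "vcoord (bfib E y) r (%i. b i y) (s y) j = vcoord (bfib E y) r (%i. b i y)
      (lincomb (bfib E y) r (vcoord (bfib E y) r (%i. t i y) (s y)) (%i. t i y)) j" by (rule arg_cong)
     also have "\<dots> = (\<Sum>i<r. vcoord (bfib E y) r (%i. t i y) (s y) i *
       vcoord (bfib E y) r (%i. b i y) (t i y) j)"
      by (rule vcoord_lincomb_lincomb[OF R[OF yU] lframe_basis[OF sh b y] vs_basis_mem[OF bt[OF yU]] j])
     finally show "(\<Sum>i<r. vcoord (bfib E y) r (%i. t i y) (s y) i *
       vcoord (bfib E y) r (%i. b i y) (t i y) j) = vcoord (bfib E y) r (%i. b i y) (s y) j" ..
    qed
   qed
   hence "bsec E W s" using bsec_iff_coords[OF sh b W(3) subset_refl] s W(2) by blast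
   thus "\<exists>W. x \<in> W \<and> W \<subseteq> V \<and> bsec E W s" using W(1,2) by blast
  qed
 qed
qed

lemma vs_basis_rescale:
 assumes F: "real_vs F" and b: "vs_basis F k b" and e: "\<And>i. i < k ==> e i \<noteq> 0"
 shows "vs_basis F k (%i. vscale F (e i) (b i))"
proof (rule vs_basisI[OF F])
 have mem: "b i \<in> vcarrier F" if "i < k" for i by (rule vs_basis_mem[OF b that])
 have eq: "lincomb F k c (%i. vscale F (e i) (b i)) = lincomb F k (%i. c i * e i) b" for c
  using mem by (induction k) (simp_all add: real_vsD(9)[OF F])
 show "vscale F (e i) (b i) \<in> vcarrier F" if "i < k" for i by (rule real_vsD(6)[OF F mem[OF that]])
 show "\<exists>c. x = lincomb F k c (%i. vscale F (e i) (b i))" if x: "x \<in> vcarrier F" for x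
 proof
  have "lincomb F k (vcoord F k b x) b = lincomb F k (%i. (vcoord F k b x i / e i) * e i) b"
   by (rule lincomb_cong) (simp_all add: e)
  thus "x = lincomb F k (%i. vcoord F k b x i / e i) (%i. vscale F (e i) (b i))"
   unfolding eq using vcoord_lincomb[OF b x] by simp
 qed
 show "\<forall>i<k. c i = 0" if "lincomb F k c (%i. vscale F (e i) (b i)) = vzero F" for c
  using vs_basis_indep[OF F b that[unfolded eq]] e by simp
qed

lemma openin_coord_interval:
 "openin simplex_interval {z \<in> standard_simplex 1. a < z 1 \<and> z 1 < b}"
proof -
 have "cont_on simplex_interval (standard_simplex 1) (%z. z 1)" by (rule cont_on_coord)
 moreover have "openin simplex_interval (standard_simplex 1)"
  using openin_topspace[of simplex_interval] by (simp only: topspace_simplex_interval)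
 ultimately have "openin simplex_interval {z \<in> standard_simplex 1. z 1 \<in> {a<..<b}}"
  by (rule cont_on_openin[THEN iffD1, rotated, THEN spec, THEN mp]) (rule open_greaterThanLessThan)
 thus ?thesis by simp
qed

text \<open>Frames over the two halves of an interval are glued by continuing the first one with
 constant coefficients with respect to the second one.\<close>

lemma interval_frame:
 assumes E: "vector_bundle r E" and base: "bbase E = simplex_interval"
 shows "\<exists>s. lframe E (standard_simplex 1) r s"
proof -
 note sh = line_bundle_sheaf[OF E]
 define W where "W a b = {z \<in> standard_simplex 1. a < z 1 \<and> z 1 < b}" for a b :: real
 have oW: "openin (bbase E) (W a b)" for a b unfolding base W_def by (rule openin_coord_interval)
 have R: "real_vs (bfib E z)" if "z \<in> standard_simplex 1" for z
  by (rule sheaf_real_vs[OF sh]) (simp only: base topspace_simplex_interval that)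
 \<comment> \<open>Subdivision by \<open>Bolzano\<close> yields intervals that meet in a point. The
   margin around \<open>[a, b]\<close> makes the frames of neighbouring pieces overlap, and the
   guards confine the claim to subintervals of \<open>[0, 1]\<close>.\<close>
 define P where "P a b \<longleftrightarrow> (0 \<le> a \<longrightarrow> b \<le> 1 \<longrightarrow> (\<exists>\<epsilon>>0. \<exists>s. lframe E (W (a - \<epsilon>) (b + \<epsilon>)) r s))" for a b
 have "P 0 1"
 proof (rule Bolzano)
  show "(0::real) \<le> 1" by simp
  fix x :: real assume x: "0 \<le> x" "x \<le> 1"
  have "interval_point x \<in> topspace (bbase E)"
   unfolding base topspace_simplex_interval using x by (simp only: interval_point_mem simp_thms)
  then obtain U b where U: "interval_point x \<in> U" "lframe E U r b" using E unfolding vector_bundle_iff by blast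
  have "continuous_map (top_of_set {0..1}) simplex_interval (%t. interval_point t)"
   by (rule continuous_interval_point) auto
  hence "openin (top_of_set {0..1}) {t \<in> topspace (top_of_set {0..1}). interval_point t \<in> U}"
   using lframe_openin[OF sh U(2)] unfolding base by (rule openin_continuous_map_preimage)
  hence "openin (top_of_set {0..1}) {t \<in> {0..1}. interval_point t \<in> U}" by simp
  then obtain d where d: "d > 0" "\<And>t. t \<in> {0..1} ==> dist t x < d ==> interval_point t \<in> U"
   using x U(1) unfolding openin_euclidean_subtopology_iff by force
  show "\<exists>d>0. \<forall>a b. a \<le> x \<and> x \<le> b \<and> b - a < d \<longrightarrow> P a b"
  proof (intro exI[of _ "d / 2"] conjI allI impI)
   show "d / 2 > 0" using d(1) by simp
   fix a c assume ac: "a \<le> x \<and> x \<le> c \<and> c - a < d / 2"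
   have "z \<in> U" if z: "z \<in> W (a - d / 2) (c + d / 2)" for z
   proof -
    have zs: "z \<in> standard_simplex 1" and z1: "a - d / 2 < z 1" "z 1 < c + d / 2" using z by (auto simp: W_def)
    have "dist (z 1) x < d" using ac z1 unfolding dist_real_def abs_less_iff by linarith
    hence "interval_point (z 1) \<in> U" using interval_point_inverse(2,3)[OF zs] by (intro d(2)) simp_all
    thus ?thesis by (simp only: interval_point_inverse(1)[OF zs])
   qed
   hence "lframe E (W (a - d / 2) (c + d / 2)) r b"
    by (intro lframe_subset[OF sh U(2) oW]) blast
   thus "P a c" unfolding P_def using \<open>d / 2 > 0\<close> by blast
  qed
 next
  fix a b c assume Pab: "P a b" and Pbc: "P b c" and abc: "a \<le> b" "b \<le> c"
  show "P a c"
   unfolding P_def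
  proof (intro impI)
   assume ac: "0 \<le> a" "c \<le> 1"
   obtain \<epsilon>1 s where s1: "\<epsilon>1 > 0" "lframe E (W (a - \<epsilon>1) (b + \<epsilon>1)) r s"
    using Pab ac abc unfolding P_def by (meson order_trans)
   obtain \<epsilon>2 s' where s2: "\<epsilon>2 > 0" "lframe E (W (b - \<epsilon>2) (c + \<epsilon>2)) r s'"
    using Pbc ac abc unfolding P_def by (meson order_trans)
   define \<epsilon> where "\<epsilon> = min \<epsilon>1 \<epsilon>2"
   have \<epsilon>: "\<epsilon> > 0" using s1(1) s2(1) by (simp add: \<epsilon>_def)
   let ?W1 = "W (a - \<epsilon>) (b + \<epsilon>)" and ?W2 = "W (b - \<epsilon>) (c + \<epsilon>)"
   have f1: "lframe E ?W1 r s"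
    by (rule lframe_subset[OF sh s1(2) oW]) (auto simp: W_def \<epsilon>_def)
   have f2: "lframe E ?W2 r s'"
    by (rule lframe_subset[OF sh s2(2) oW]) (auto simp: W_def \<epsilon>_def)
   \<comment> \<open>Retraction of the second piece onto its part up to parameter \<open>b\<close>,
     which lies in the overlap. Reading the coefficients of \<open>s\<close> in \<open>s'\<close> at
     \<open>g z\<close> keeps them constant beyond \<open>b\<close>.\<close>
   define g where "g z = interval_point (min (z 1) b)" for z :: "nat \<Rightarrow> real"
   have gW: "g z \<in> ?W1" "g z \<in> ?W2" "g z \<in> standard_simplex 1" if "z \<in> ?W2" for z
   proof -
    have "z \<in> standard_simplex 1" using that by (simp add: W_def)
    note zz = interval_point_inverse(2,3)[OF this]
    show gs: "g z \<in> standard_simplex 1" unfolding g_def interval_point_mem using zz ac abc by linarith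
    show "g z \<in> ?W1" "g z \<in> ?W2"
     using gs that abc \<epsilon> unfolding W_def by (auto simp: g_def)
   qed
   define A where "A z i = vcoord (bfib E (g z)) r (%j. s' j (g z)) (s i (g z))" for z i
   define t where "t i z = (if z 1 < b then s i z else lincomb (bfib E z) r (A z i) (%j. s' j z))" for i z
   \<comment> \<open>Up to \<open>b\<close> the retraction is the identity and the expansion merely
     reproduces \<open>s\<close>; hence one formula with continuous coefficients describes
     \<open>t\<close> on the whole second piece.\<close>
   have t2: "t i z = lincomb (bfib E z) r (A z i) (%j. s' j z)" if z: "z \<in> ?W2" and i: "i < r" for i z
   proof (cases "z 1 < b")
    case True
    have "z \<in> standard_simplex 1" using z by (simp add: W_def)
    hence gz: "g z = z" using True interval_point_inverse(1) by (simp add: g_def)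
    have "s i z \<in> vcarrier (bfib E z)"
     using vs_basis_mem[OF lframe_basis[OF sh f1 gW(1)[OF z]] i] unfolding gz .
    thus ?thesis
     using True vcoord_lincomb[OF lframe_basis[OF sh f2 z]] by (simp add: t_def A_def gz)
   qed (simp add: t_def)
   have sec1: "bsec E (W (a - \<epsilon>) b) (t i)" if i: "i < r" for i
   proof -
    have "bsec E (W (a - \<epsilon>) b) (s i)"
     by (rule sheaf_restrict[OF sh lframe_bsec[OF f1 i] oW]) (use \<epsilon> in \<open>auto simp: W_def\<close>)
    thus ?thesis by (rule bsec_cong[OF sh E]) (simp add: t_def W_def)
   qed
   have gc: "continuous_map (subtopology (bbase E) ?W2) (bbase E) g"
   proof -
    have "continuous_map (subtopology simplex_interval ?W2) euclideanreal (%z. min (z 1) b)"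
     by (intro continuous_map_real_min continuous_map_canonical_const continuous_map_from_subtopology
       continuous_map_product_projection) simp
    moreover have "0 \<le> min (z 1) b \<and> min (z 1) b \<le> 1" if "z \<in> topspace (subtopology simplex_interval ?W2)" for z
    proof -
     have "z \<in> standard_simplex 1" using that by (simp add: W_def)
     from interval_point_inverse(2,3)[OF this] show ?thesis using ac abc by linarith
    qed
    ultimately show ?thesis unfolding g_def[abs_def] base by (rule continuous_interval_point)
   qed
   have sec2: "bsec E ?W2 (t i)" if i: "i < r" for i
   proof -
    have o: "openin (bbase E) (?W1 \<inter> ?W2)" by (rule openin_Int[OF oW oW])
    have "bsec E (?W1 \<inter> ?W2) (s i)" by (rule sheaf_restrict[OF sh lframe_bsec[OF f1 i] o]) simp
    hence "cont_on (bbase E) (?W1 \<inter> ?W2) (%z. vcoord (bfib E z) r (%j. s' j z) (s i z) j)" if "j < r" for j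
     using bsec_iff_coords[OF sh f2 o Int_lower2] that by simp
    note cs = this
    have cA: "cont_on (bbase E) ?W2 (%z. A z i j)" if j: "j < r" for j
     unfolding A_def by (rule cont_on_compose[OF gc _ cs[OF j]]) (use gW in blast)
    have tA: "\<forall>z\<in>?W2. t i z = lincomb (bfib E z) r (%j. A z i j) (%j. s' j z)" using t2 i by blast
    have iff: "bsec E ?W2 (t i) \<longleftrightarrow> (\<exists>c. (\<forall>j<r. cont_on (bbase E) ?W2 (c j)) \<and>
      (\<forall>z\<in>?W2. t i z = lincomb (bfib E z) r (%j. c j z) (%j. s' j z)))"
     using f2 oW unfolding lframe_def by simp
    show ?thesis
     by (rule iffD2[OF iff], rule exI[of _ "%j z. A z i j"], intro conjI allI impI, rule cA, assumption, rule tA)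
   qed
   have cover: "z \<in> W (a - \<epsilon>) b \<or> z \<in> ?W2" if "z \<in> W (a - \<epsilon>) (c + \<epsilon>)" for z
    using that \<epsilon> by (auto simp: W_def)
   have "frame E (W (a - \<epsilon>) (c + \<epsilon>)) r t"
    unfolding frame_def
   proof (intro conjI allI impI ballI)
    fix i assume i: "i < r"
    show "bsec E (W (a - \<epsilon>) (c + \<epsilon>)) (t i)"
    proof (rule sheaf_local[OF sh])
     fix z assume "z \<in> W (a - \<epsilon>) (c + \<epsilon>)"
     moreover have "W (a - \<epsilon>) b \<subseteq> W (a - \<epsilon>) (c + \<epsilon>)" "?W2 \<subseteq> W (a - \<epsilon>) (c + \<epsilon>)"
      using abc \<epsilon> by (auto simp: W_def)
     ultimately show "\<exists>V. z \<in> V \<and> V \<subseteq> W (a - \<epsilon>) (c + \<epsilon>) \<and> bsec E V (t i)"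
      using cover sec1[OF i] sec2[OF i] by blast
    qed
   next
    fix z assume z: "z \<in> W (a - \<epsilon>) (c + \<epsilon>)"
    show "vs_basis (bfib E z) r (%i. t i z)"
    proof (cases "z 1 < b")
     case True
     hence "z \<in> ?W1" using z \<epsilon> by (simp add: W_def)
     from lframe_basis[OF sh f1 this] show ?thesis using True by (simp add: t_def)
    next
     case False
     hence z2: "z \<in> ?W2" using z \<epsilon> by (simp add: W_def)
     have zs: "z \<in> standard_simplex 1" using z by (simp add: W_def)
     have "vs_basis (bfib E z) r (%i. lincomb (bfib E z) r (vcoord (bfib E (g z)) r (%j. s' j (g z)) (s i (g z))) (%j. s' j z))"
      by (rule vs_basis_change[OF R[OF gW(3)[OF z2]] R[OF zs] lframe_basis[OF sh f2 gW(2)[OF z2]]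
         lframe_basis[OF sh f1 gW(1)[OF z2]] lframe_basis[OF sh f2 z2]])
     thus ?thesis using False by (simp add: t_def A_def)
    qed
   qed
   from frame_lframe[OF E oW this] show "\<exists>\<epsilon>>0. \<exists>s. lframe E (W (a - \<epsilon>) (c + \<epsilon>)) r s" using \<epsilon> by blast
  qed
 qed
 then obtain \<epsilon> s where \<epsilon>: "\<epsilon> > 0" and s: "lframe E (W (0 - \<epsilon>) (1 + \<epsilon>)) r s" unfolding P_def by auto
 have "W (0 - \<epsilon>) (1 + \<epsilon>) = standard_simplex 1"
  unfolding W_def using interval_point_inverse(2,3) \<epsilon> by force
 thus ?thesis using s by metis
qed

text \<open>The determinant of one frame with respect to the other is continuous and never zero on a
  connected space. Transport of orientations along a path is therefore independent of the
  frame.\<close>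

lemma frame_sign_interval:
 assumes E: "vector_bundle r E" and base: "bbase E = simplex_interval"
  and s: "frame E (standard_simplex 1) r s" and t: "frame E (standard_simplex 1) r t"
 shows "dform (bfib E vertex0) r (%i. s i vertex0) (%i. t i vertex0) > 0 \<longleftrightarrow>
  dform (bfib E vertex1) r (%i. s i vertex1) (%i. t i vertex1) > 0"
proof -
 note sh = line_bundle_sheaf[OF E]
 have o: "openin (bbase E) (standard_simplex 1)"
  using openin_topspace[of simplex_interval] by (simp only: topspace_simplex_interval base)
 show ?thesis
 proof (rule nonzero_sign_interval)
  have "cont_on (bbase E) (standard_simplex 1) (%z. dform (bfib E z) r (%i. s i z) (%i. t i z))"
   by (rule cont_on_dform[OF sh frame_lframe[OF E o s] o subset_refl]) (use t in \<open>simp add: frame_def\<close>)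
  thus "cont_on simplex_interval (standard_simplex 1) (%z. dform (bfib E z) r (%i. s i z) (%i. t i z))"
   unfolding base .
  fix z assume z: "z \<in> standard_simplex 1"
  have "real_vs (bfib E z)" by (rule sheaf_real_vs[OF sh]) (simp only: base topspace_simplex_interval z)
  thus "dform (bfib E z) r (%i. s i z) (%i. t i z) \<noteq> 0"
   by (rule dform_nonzero) (use s t z in \<open>simp_all add: frame_def\<close>)
 qed
qed

section \<open>The Stiefel-Whitney cochain computed from one frame along the path\<close>

lemma vector_bundle_pullback:
 assumes E: "vector_bundle r E" and g: "continuous_map T (bbase E) g"
 shows "vector_bundle r (pullback_bundle T g E)"
 unfolding vector_bundle_iff
proof (intro conjI ballI)
 note sh = line_bundle_sheaf[OF E]
 have gT: "g x \<in> topspace (bbase E)" if "x \<in> topspace T" for x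
  using g that by (auto simp: continuous_map_def)
 show "section_sheaf (pullback_bundle T g E)" by (rule pullback_sheaf[OF sh]) (use gT in auto)
 fix x assume "x \<in> topspace (bbase (pullback_bundle T g E))"
 hence x: "x \<in> topspace T" by simp
 then obtain V b where V: "g x \<in> V" "lframe E V r b" using E gT unfolding vector_bundle_iff by blast
 have "openin T {y \<in> topspace T. g y \<in> V}"
  by (rule openin_continuous_map_preimage[OF g lframe_openin[OF sh V(2)]])
 hence "lframe (pullback_bundle T g E) {y \<in> topspace T. g y \<in> V} r (%i y. b i (g y))"
  by (rule lframe_pullback[OF sh V(2)]) (auto simp: continuous_map_from_subtopology g)
 moreover have "x \<in> {y \<in> topspace T. g y \<in> V}" using x V(1) by simp
 ultimately show "\<exists>U b. x \<in> U \<and> lframe (pullback_bundle T g E) U r b" by (intro exI conjI)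
qed

text \<open>Negating the first member reverses the orientation; this needs a first member, hence
  positive rank.\<close>

lemma dform_flip:
 assumes F: "real_vs F" and b: "vs_basis F r b" and s: "vs_basis F r s" and r: "r > 0"
 shows "dform F r b (%i. vscale F (if i = 0 then - 1 else 1) (s i)) = - dform F r b s"
proof -
 have mem: "s i \<in> vcarrier F" if "i < r" for i by (rule vs_basis_mem[OF s that])
 have "dform F r b (%i. vscale F (if i = 0 then - 1 else 1) (s i))
   = dform F r b s * dform F r s (%i. vscale F (if i = 0 then - 1 else 1) (s i))"
  by (rule dform_chain[OF F b s real_vsD(6)[OF F mem]])
 also have "dform F r s (%i. vscale F (if i = 0 then - 1 else 1) (s i)) = dform F r s (s(0 := vscale F (- 1) (s 0)))"
  by (rule dform_cong) (simp add: real_vsD(10)[OF F mem])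
 also have "\<dots> = vcoord F r s (vscale F (- 1) (s 0)) 0"
  by (rule dform_replace[OF F s r real_vsD(6)[OF F mem[OF r]]])
 also have "\<dots> = - 1"
  using vcoord_scale[OF F s mem[OF r] r] vcoord_basis[OF F s r r] by simp
 finally show ?thesis by simp
qed

lemma frame_flip:
 assumes E: "vector_bundle r E" and U: "openin (bbase E) U" and s: "frame E U r s"
 shows "frame E U r (%i z. vscale (bfib E z) (if i = 0 then - 1 else 1) (s i z))"
 unfolding frame_def
proof (intro conjI allI impI ballI)
 note sh = line_bundle_sheaf[OF E]
 note L = frame_lframe[OF E U s]
 fix i assume i: "i < r"
 let ?e = "if i = 0 then - 1 else (1::real)"
 show "bsec E U (%z. vscale (bfib E z) ?e (s i z))"
  unfolding bsec_iff_coords[OF sh L U subset_refl]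
 proof (intro conjI ballI allI impI)
  have mem: "s i z \<in> vcarrier (bfib E z)" if "z \<in> U" for z
   by (rule vs_basis_mem[OF lframe_basis[OF sh L that] i])
  show "vscale (bfib E z) ?e (s i z) \<in> vcarrier (bfib E z)" if "z \<in> U" for z
   by (rule real_vsD(6)[OF lframe_real_vs[OF sh L that] mem[OF that]])
  fix j assume j: "j < r"
  show "cont_on (bbase E) U (%z. vcoord (bfib E z) r (%i. s i z) (vscale (bfib E z) ?e (s i z)) j)"
  proof (rule cont_on_cong[OF cont_on_const])
   fix z assume z: "z \<in> U"
   note R = lframe_real_vs[OF sh L z] and B = lframe_basis[OF sh L z]
   show "?e * (if j = i then 1 else 0)
     = vcoord (bfib E z) r (%i. s i z) (vscale (bfib E z) ?e (s i z)) j"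
    by (simp only: vcoord_scale[OF R B mem[OF z] j] vcoord_basis[OF R B i j])
  qed
 qed
next
 note sh = line_bundle_sheaf[OF E]
 note L = frame_lframe[OF E U s]
 fix z assume z: "z \<in> U"
 show "vs_basis (bfib E z) r (%i. vscale (bfib E z) (if i = 0 then - 1 else 1) (s i z))"
  by (rule vs_basis_rescale[OF lframe_real_vs[OF sh L z] lframe_basis[OF sh L z]]) simp
qed

lemma vertex_mem: "vertex0 \<in> standard_simplex 1" "vertex1 \<in> standard_simplex 1"
 using basis_in_standard_simplex[of 0 1] basis_in_standard_simplex[of 1 1]
 by (simp_all add: vertex0_def vertex1_def)

lemma singular_simplex_1: "singular_simplex 1 T u ==> continuous_map simplex_interval T u"
 by (simp add: singular_simplex_def)

text \<open>The cochain asks for some frame that is positive at both ends. Two frames differ in sign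
  at both ends or at neither, so a given frame \<open>s\<close> decides: it must have equal signs at
  the ends, and if both are negative, a flip makes them positive.\<close>

lemma w1_cochain_frame:
 assumes E: "vector_bundle r E" and u: "singular_simplex 1 (bbase E) u"
  and b: "\<And>x. x \<in> topspace (bbase E) ==> vs_basis (bfib E x) r (b x)"
  and s: "frame (pullback_bundle simplex_interval u E) (standard_simplex 1) r s"
 shows "w1_cochain E b u = 0 \<longleftrightarrow>
  (dform (bfib E (u vertex0)) r (b (u vertex0)) (%i. s i vertex0) > 0 \<longleftrightarrow>
   dform (bfib E (u vertex1)) r (b (u vertex1)) (%i. s i vertex1) > 0)"
proof -
 let ?E = "pullback_bundle simplex_interval u E" and ?S = "standard_simplex 1"
 let ?F0 = "bfib E (u vertex0)" and ?F1 = "bfib E (u vertex1)"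
 let ?b0 = "b (u vertex0)" and ?b1 = "b (u vertex1)"
 have PE: "vector_bundle r ?E" by (rule vector_bundle_pullback[OF E singular_simplex_1[OF u]])
 note sh = line_bundle_sheaf[OF E]
 note R0 = sheaf_real_vs[OF sh vertices_mem(1)[OF u]] and R1 = sheaf_real_vs[OF sh vertices_mem(2)[OF u]]
 note b0 = b[OF vertices_mem(1)[OF u]] and b1 = b[OF vertices_mem(2)[OF u]]
 have bas0: "vs_basis ?F0 k (%i. t i vertex0)" and bas1: "vs_basis ?F1 k (%i. t i vertex1)"
  if "frame ?E ?S k t" for t k
  using that vertex_mem unfolding frame_def by simp_all
 have rank: "k = r" if "frame ?E ?S k t" for t k
  using vs_dim_eq[OF R0 bas0[OF that]] vs_dim_eq[OF R0 b0] by simp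
 have iff: "w1_cochain E b u = 0 \<longleftrightarrow> (\<exists>t. frame ?E ?S r t \<and>
   dform ?F0 r ?b0 (%i. t i vertex0) > 0 \<and> dform ?F1 r ?b1 (%i. t i vertex1) > 0)"
 proof -
  have "w1_cochain E b u = 0 \<longleftrightarrow> (\<exists>k t. frame ?E ?S k t \<and>
    same_orientation ?F0 (%i. t i vertex0) ?b0 \<and> same_orientation ?F1 (%i. t i vertex1) ?b1)"
  proof -
   have if_zero: "((if P \<and> \<not> Q then (1::bit) else 0) = 0) = Q" if "P" for P Q using that by simp
   show ?thesis unfolding w1_cochain_def Let_def topspace_simplex_interval by (rule if_zero[OF u])
  qed
  moreover have "frame ?E ?S k t \<and> same_orientation ?F0 (%i. t i vertex0) ?b0 \<and>
     same_orientation ?F1 (%i. t i vertex1) ?b1 \<longleftrightarrow>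
    k = r \<and> frame ?E ?S r t \<and> dform ?F0 r ?b0 (%i. t i vertex0) > 0 \<and> dform ?F1 r ?b1 (%i. t i vertex1) > 0"
   for k t
  proof (cases "frame ?E ?S k t")
   case True
   hence t: "frame ?E ?S r t" using rank[OF True] by simp
   show ?thesis
    using True rank[OF True] same_orientation_iff[OF R0 bas0[OF t] b0] same_orientation_iff[OF R1 bas1[OF t] b1]
    by simp
  next
   case False
   thus ?thesis by metis
  qed
  ultimately show ?thesis by simp
 qed
 have ch0: "dform ?F0 r ?b0 (%i. t i vertex0)
   = dform ?F0 r ?b0 (%i. s i vertex0) * dform ?F0 r (%i. s i vertex0) (%i. t i vertex0)"
  if "frame ?E ?S r t" for t
  by (rule dform_chain[OF R0 b0 bas0[OF s] vs_basis_mem[OF bas0[OF that]]])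
 have ch1: "dform ?F1 r ?b1 (%i. t i vertex1)
   = dform ?F1 r ?b1 (%i. s i vertex1) * dform ?F1 r (%i. s i vertex1) (%i. t i vertex1)"
  if "frame ?E ?S r t" for t
  by (rule dform_chain[OF R1 b1 bas1[OF s] vs_basis_mem[OF bas1[OF that]]])
 have nz: "dform ?F0 r ?b0 (%i. s i vertex0) \<noteq> 0" "dform ?F1 r ?b1 (%i. s i vertex1) \<noteq> 0"
  by (rule dform_nonzero[OF R0 b0 bas0[OF s]], rule dform_nonzero[OF R1 b1 bas1[OF s]])
 show ?thesis
  unfolding iff
 proof
  assume "\<exists>t. frame ?E ?S r t \<and>
   dform ?F0 r ?b0 (%i. t i vertex0) > 0 \<and> dform ?F1 r ?b1 (%i. t i vertex1) > 0"
  then obtain t where t: "frame ?E ?S r t"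
   "dform ?F0 r ?b0 (%i. t i vertex0) > 0" "dform ?F1 r ?b1 (%i. t i vertex1) > 0" by blast
  have "dform ?F0 r (%i. s i vertex0) (%i. t i vertex0) > 0 \<longleftrightarrow>
    dform ?F1 r (%i. s i vertex1) (%i. t i vertex1) > 0"
   using frame_sign_interval[OF PE _ s t(1)] by simp
  thus "(dform ?F0 r ?b0 (%i. s i vertex0) > 0) = (dform ?F1 r ?b1 (%i. s i vertex1) > 0)"
   using t(2,3) unfolding ch0[OF t(1)] ch1[OF t(1)] zero_less_mult_iff by linarith
 next
  assume eq: "(dform ?F0 r ?b0 (%i. s i vertex0) > 0) = (dform ?F1 r ?b1 (%i. s i vertex1) > 0)"
  show "\<exists>t. frame ?E ?S r t \<and>
   dform ?F0 r ?b0 (%i. t i vertex0) > 0 \<and> dform ?F1 r ?b1 (%i. t i vertex1) > 0"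
  proof (cases "dform ?F0 r ?b0 (%i. s i vertex0) > 0")
   case True
   thus ?thesis using eq s by blast
  next
   case False
   \<comment> \<open>In rank 0 the determinant is that of the empty matrix, which is 1, so a sign
     can be wrong only in positive rank, where a flip is possible.\<close>
   have r: "r > 0"
   proof (rule ccontr)
    assume "\<not> r > 0"
    hence "dform ?F0 r ?b0 (%i. s i vertex0) = dform ?F0 r ?b0 ?b0" by (intro dform_cong) simp
    thus False using False dform_basis[OF R0 b0] by simp
   qed
   let ?t = "%i z. vscale (bfib ?E z) (if i = 0 then - 1 else 1) (s i z)"
   have oS: "openin (bbase ?E) ?S"
    using openin_topspace[of simplex_interval] by (simp only: topspace_simplex_interval pullback_bundle_simps)
   have "frame ?E ?S r ?t" by (rule frame_flip[OF PE oS s])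
   moreover have "dform ?F0 r ?b0 (%i. ?t i vertex0) > 0"
    using dform_flip[OF R0 b0 bas0[OF s] r] False nz(1) by simp
   moreover have "dform ?F1 r ?b1 (%i. ?t i vertex1) > 0"
    using dform_flip[OF R1 b1 bas1[OF s] r] False eq nz(2) by simp
   ultimately show ?thesis by blast
  qed
 qed
qed

lemma w1_basis:
 assumes E: "vector_bundle r E"
 defines "b \<equiv> SOME b. \<forall>x\<in>topspace (bbase E). vs_basis (bfib E x) (vs_dim (bfib E x)) (b x)"
 assumes x: "x \<in> topspace (bbase E)"
 shows "vs_basis (bfib E x) r (b x)"
proof -
 note sh = line_bundle_sheaf[OF E]
 have ex: "\<exists>c. vs_basis (bfib E x) r c" if x: "x \<in> topspace (bbase E)" for x
 proof -
  obtain U c where "x \<in> U" "lframe E U r c" using E x unfolding vector_bundle_iff by blast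
  from lframe_basis[OF sh this(2,1)] show ?thesis by blast
 qed
 have dim: "vs_dim (bfib E x) = r" if "x \<in> topspace (bbase E)" for x
  using ex[OF that] vs_dim_eq[OF sheaf_real_vs[OF sh that]] by blast
 have "\<forall>x\<in>topspace (bbase E). \<exists>c. vs_basis (bfib E x) (vs_dim (bfib E x)) c" using ex dim by simp
 hence "\<exists>b. \<forall>x\<in>topspace (bbase E). vs_basis (bfib E x) (vs_dim (bfib E x)) (b x)" by (rule bchoice)
 hence "\<forall>x\<in>topspace (bbase E). vs_basis (bfib E x) (vs_dim (bfib E x)) (b x)"
  unfolding b_def by (rule someI_ex)
 thus ?thesis using x dim by fastforce
qed

section \<open>The tautological bundle of the whole projective space and its pullbacks\<close>

lemma taut_bundle_UNIV_simps [simp]: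
 "bbase (taut_bundle (proj UNIV)) = proj_top" "bfib (taut_bundle (proj UNIV)) l = vs_of l"
 by (simp_all add: taut_bundle_def)

lemma taut_UNIV_sheaf: "section_sheaf (taut_bundle (proj UNIV))"
 unfolding taut_bundle_def by (rule sub_bundle_sheaf) (auto dest: projD(1))

lemma vector_bundle_taut_UNIV: "line_bundle (taut_bundle (proj (UNIV :: 'v::euclidean_space set)))"
proof (rule line_bundleI[OF taut_UNIV_sheaf])
 fix l assume "l \<in> topspace (bbase (taut_bundle (proj (UNIV :: 'v set))))"
 hence l: "l \<in> proj UNIV" by simp
 obtain v where v: "v \<in> l" "v \<noteq> 0" by (rule proj_obtain[OF l])
 let ?q = "inner v"
 note q = norm_dom_exists[OF l v]
 have "lgen (taut_bundle (proj UNIV)) (norm_dom ?q) (norm_sec ?q)"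
  unfolding taut_bundle_def proj_top_UNIV
 proof (rule lframe_sub_bundle[OF openin_norm_dom[OF q(1)]])
  fix x assume x: "x \<in> norm_dom ?q"
  note n = norm_sec_props[OF q(1) x]
  show "subspace x" by (rule projD(1)[OF n(4)])
  show "vline (vs_of x) (norm_sec ?q x)" by (rule vline_proj[OF n(4,1,3)])
 qed (rule cont_on_norm_sec[OF q(1)])
 thus "\<exists>U e. l \<in> U \<and> lgen (taut_bundle (proj UNIV)) U e" using q(2) by blast
qed

text \<open>Near a point the pullback is generated by \<open>norm_sec q\<close> composed with
  \<open>g\<close>, and a vector \<open>s y\<close> in the line \<open>g y\<close> is
  \<open>q (s y)\<close> times this generator. Sections of the pullback thus become continuous
  vector-valued maps.\<close>

lemma bsec_pullback_taut:
 fixes g :: "'x \<Rightarrow> 'v::euclidean_space set"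
 assumes g: "continuous_map T proj_top g"
 shows "bsec (pullback_bundle T g (taut_bundle (proj UNIV))) W s \<longleftrightarrow> bsec (sub_bundle T g) W s"
proof
 have gT: "g x \<in> proj UNIV" if "x \<in> topspace T" for x using g that by (auto simp: continuous_map_def)
 {
  assume s: "bsec (pullback_bundle T g (taut_bundle (proj UNIV))) W s"
  have sh: "section_sheaf (pullback_bundle T g (taut_bundle (proj UNIV)))"
   by (rule pullback_sheaf[OF taut_UNIV_sheaf]) (use gT in auto)
  show "bsec (sub_bundle T g) W s"
   unfolding bsec_sub_bundle
  proof (intro conjI ballI)
   show "openin T W" using sheaf_openin[OF sh s] by simp
   show "s x \<in> g x" if "x \<in> W" for x using sheaf_mem[OF sh s that] by (simp add: vs_of_def)
   show "cont_on T W s"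
   proof (rule cont_on_local)
    fix x assume "x \<in> W"
    from bsec_pullbackE[OF s this] obtain U' U'' k c e where U: "openin T U'" "x \<in> U'" "U' \<subseteq> W" "g ` U' \<subseteq> U''"
     and ce: "\<forall>i<k. cont_on T U' (c i) \<and> bsec (taut_bundle (proj UNIV)) U'' (e i)"
     and se: "\<forall>y\<in>U'. s y = lincomb (bfib (taut_bundle (proj UNIV)) (g y)) k (%i. c i y) (%i. e i (g y))"
     by metis
    have "cont_on T U' (%y. \<Sum>i<k. c i y *\<^sub>R e i (g y))"
    proof (intro cont_on_sum cont_on_scaleR)
     fix i assume i: "i \<in> {..<k}"
     thus "cont_on T U' (c i)" using ce by simp
     have "cont_on proj_top U'' (e i)" using ce i by (simp add: taut_bundle_def bsec_sub_bundle)
     thus "cont_on T U' (%y. e i (g y))"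
      using U(4) by (intro cont_on_compose[OF continuous_map_from_subtopology[OF g]]) auto
    qed
    hence "cont_on T U' s"
     by (rule cont_on_cong) (use se in \<open>simp add: lincomb_vs_of\<close>)
    thus "\<exists>U'. openin T U' \<and> x \<in> U' \<and> U' \<subseteq> W \<and> cont_on T U' s" using U by blast
   qed
  qed
 next
  assume "bsec (sub_bundle T g) W s"
  hence W: "openin T W" and mem: "\<And>x. x \<in> W ==> s x \<in> g x" and c: "cont_on T W s"
   by (simp_all add: bsec_sub_bundle)
  show "bsec (pullback_bundle T g (taut_bundle (proj UNIV))) W s"
   unfolding bsec_pullback
  proof (intro conjI ballI W)
   fix x assume x: "x \<in> W"
   have gx: "g x \<in> proj UNIV" using gT openin_subset[OF W] x by blast
   obtain v where v: "v \<in> g x" "v \<noteq> 0" by (rule proj_obtain[OF gx])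
   let ?q = "inner v"
   note q = norm_dom_exists[OF gx v]
   let ?U = "W \<inter> {y \<in> topspace T. g y \<in> norm_dom ?q}"
   have oU: "openin T ?U"
    using W openin_continuous_map_preimage[OF g openin_norm_dom[OF q(1)]] by (rule openin_Int)
   have xU: "x \<in> ?U" using x q(2) openin_subset[OF W] by blast
   have cq: "cont_on T ?U (%y. ?q (s y))"
    by (intro cont_on_inner cont_on_const cont_on_subset[OF c]) simp
   have sec: "bsec (taut_bundle (proj UNIV)) (norm_dom ?q) (norm_sec ?q)"
    unfolding taut_bundle_def proj_top_UNIV bsec_sub_bundle
    using openin_norm_dom[OF q(1)] cont_on_norm_sec[OF q(1)] norm_sec_props(1)[OF q(1)] by blast
   have se: "s y = lincomb (bfib (taut_bundle (proj UNIV)) (g y)) 1 (%i. ?q (s y)) (%i. norm_sec ?q (g y))"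
    if y: "y \<in> ?U" for y
   proof -
    have yd: "g y \<in> norm_dom ?q" and yW: "y \<in> W" using y by auto
    note n = norm_sec_props[OF q(1) yd]
    have "s y \<in> span {norm_sec ?q (g y)}" using mem[OF yW] proj_eq_span[OF n(4,1,3)] by simp
    then obtain a where a: "s y = a *\<^sub>R norm_sec ?q (g y)" unfolding span_singleton by blast
    hence "?q (s y) = a" using n(2) by simp
    thus ?thesis using a by (simp add: lincomb_vs_of One_nat_def)
   qed
   show "\<exists>U' U'' k c e. openin T U' \<and> x \<in> U' \<and> U' \<subseteq> W \<and> g ` U' \<subseteq> U'' \<and>
      (\<forall>i<k. cont_on T U' (c i) \<and> bsec (taut_bundle (proj UNIV)) U'' (e i)) \<and>
      (\<forall>y\<in>U'. s y = lincomb (bfib (taut_bundle (proj UNIV)) (g y)) k (%i. c i y) (%i. e i (g y)))"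
    by (rule exI[of _ ?U], rule exI[of _ "norm_dom ?q"], rule exI[of _ 1],
      rule exI[of _ "%i y. ?q (s y)"], rule exI[of _ "%i. norm_sec ?q"])
      (intro conjI ballI allI impI, rule oU, rule xU, blast, blast, rule cq, rule sec, rule se)
  qed
 }
qed

section \<open>Relative orientability and Stiefel-Whitney classes\<close>

text \<open>Modulo two only the parity of \<open>n\<close> matters: for even \<open>n\<close> the
  power is positive and \<open>y\<close> drops out, for odd \<open>n\<close> the power has the sign
  of its base.\<close>

lemma sign_parity:
 fixes x y :: bit and A B A' B' :: real
 assumes "x = 0 \<longleftrightarrow> (B > 0 \<longleftrightarrow> B' > 0)" "y = 0 \<longleftrightarrow> (A > 0 \<longleftrightarrow> A' > 0)"
  and nz: "A \<noteq> 0" "B \<noteq> 0" "A' \<noteq> 0" "B' \<noteq> 0"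
 shows "x + of_nat n * y = 0 \<longleftrightarrow> (A ^ n * B > 0 \<longleftrightarrow> A' ^ n * B' > 0)"
proof (cases "even n")
 case True
 then obtain k where n: "n = 2 * k" by blast
 have "of_nat n = (0::bit)" by (simp add: n)
 moreover have "A ^ n > 0" "A' ^ n > 0" using nz True by (simp_all add: zero_less_power_eq)
 ultimately show ?thesis using assms True by (simp add: zero_less_mult_iff)
next
 case False
 then obtain k where n: "n = 2 * k + 1" by (rule oddE)
 have "of_nat n = (1::bit)" by (simp add: n)
 moreover have "A ^ n > 0 \<longleftrightarrow> A > 0" "A' ^ n > 0 \<longleftrightarrow> A' > 0" "A ^ n < 0 \<longleftrightarrow> A < 0" "A' ^ n < 0 \<longleftrightarrow> A' < 0"
  using False odd_pos[OF False] by (simp_all add: zero_less_power_eq power_less_zero_eq)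
 moreover have "x + y = 0 \<longleftrightarrow> (x = 0 \<longleftrightarrow> y = 0)" by (cases x; cases y) simp_all
 moreover have "C ^ n * D > 0 \<longleftrightarrow> (C > 0 \<longleftrightarrow> D > 0)"
  if "C ^ n > 0 \<longleftrightarrow> C > 0" "C ^ n < 0 \<longleftrightarrow> C < 0" "C \<noteq> 0" "D \<noteq> 0" for C D :: real
  using that unfolding zero_less_mult_iff by linarith
 ultimately show ?thesis using assms by (simp only: mult_1) blast
qed

context submanifold
begin

abbreviation "Tan l \<equiv> vs_hom (vs_of l) (vs_quot l (Y_fib X l))"
abbreviation "DetY l \<equiv> vs_det (vs_of (Y_fib X l))"
abbreviation "wY l v y \<equiv> wedge (vs_of (Y_fib X l)) (case_nat v y)"

abbreviation "PV \<equiv> taut_bundle (proj (UNIV :: 'v set))"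

text \<open>Literally the choice made inside \<open>w1\<close>, so that \<open>w1\<close> unfolds to
  the cochain of this basis. It lives on the whole projective space, because the theorem restricts
  the class of the bundle over P(V).\<close>

definition bL :: "'v set \<Rightarrow> nat \<Rightarrow> 'v" where
 "bL = (SOME b. \<forall>x\<in>topspace (bbase PV). vs_basis (bfib PV x) (vs_dim (bfib PV x)) (b x))"

definition bT :: "'v set \<Rightarrow> nat \<Rightarrow> 'v \<Rightarrow> 'v set" where
 "bT = (SOME b. \<forall>x\<in>topspace (bbase (tangent_bundle X)).
   vs_basis (bfib (tangent_bundle X) x) (vs_dim (bfib (tangent_bundle X) x)) (b x))"

text \<open>\<open>local_data\<close> without \<open>f\<close> and \<open>W\<close>: the comparison
  of det Y with the Stiefel-Whitney classes concerns \<open>X\<close> alone.\<close>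

definition local_frame :: "'v set set \<Rightarrow> ('v set \<Rightarrow> 'v) \<Rightarrow> (nat \<Rightarrow> 'v set \<Rightarrow> 'v) \<Rightarrow> bool" where
 "local_frame U v y \<longleftrightarrow> openin TX U \<and> cont_on TX U v \<and> (\<forall>i<m. cont_on TX U (y i)) \<and>
  (\<forall>l\<in>U. line_in_space l (Y_fib X l) (v l) m (%i. y i l))"

lemma local_frameD:
 assumes "local_frame U v y"
 shows "openin TX U" "cont_on TX U v" "\<And>i. i < m ==> cont_on TX U (y i)"
  "\<And>l. l \<in> U ==> line_in_space l (Y_fib X l) (v l) m (%i. y i l)" "\<And>l. l \<in> U ==> l \<in> X"
proof -
 show "openin TX U" "cont_on TX U v" "\<And>i. i < m ==> cont_on TX U (y i)"
  "\<And>l. l \<in> U ==> line_in_space l (Y_fib X l) (v l) m (%i. y i l)"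
  using assms unfolding local_frame_def by blast+
 show "l \<in> X" if "l \<in> U" for l using openin_subset[of TX U] assms that unfolding local_frame_def by auto
qed

lemma local_frame_exists:
 assumes "l \<in> X"
 shows "\<exists>U v y. l \<in> U \<and> local_frame U v y"
proof -
 obtain U v y where "openin TX U" "l \<in> U" "cont_on TX U v" "\<And>i. i < m ==> cont_on TX U (y i)"
  "\<And>l. l \<in> U ==> line_in_space l (Y_fib X l) (v l) m (%i. y i l)"
  using X_frame[OF assms] by metis
 hence "local_frame U v y" unfolding local_frame_def by simp
 thus ?thesis using \<open>l \<in> U\<close> by blast
qed

lemma vector_bundle_tangent: "vector_bundle m (tangent_bundle X)"
 unfolding vector_bundle_iff
proof (intro conjI ballI tangent_bundle_sheaf)
 fix x assume "x \<in> topspace (bbase (tangent_bundle X))"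
 hence "x \<in> X" by simp
 then obtain U v y where "x \<in> U" and f: "local_frame U v y" using local_frame_exists by blast
 with lframe_tangent[OF local_frameD(1-4)[OF f]]
 show "\<exists>U b. x \<in> U \<and> lframe (tangent_bundle X) U m b" by blast
qed

lemma bL: "l \<in> X ==> vs_basis (vs_of l) 1 (bL l)"
 using w1_basis[OF vector_bundle_taut_UNIV, of l] X_subset unfolding bL_def by auto

lemma bT: "l \<in> X ==> vs_basis (Tan l) m (bT l)"
proof -
 assume l: "l \<in> X"
 have "vs_basis (bfib (tangent_bundle X) l) m (bT l)"
  unfolding bT_def by (rule w1_basis[OF vector_bundle_tangent]) (use l X_subset in auto)
 thus "vs_basis (Tan l) m (bT l)" by (simp only: tangent_bundle_fib[OF l])
qed

text \<open>As det Y is the \<open>n\<close>-th power of the tautological line tensored with det TX,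
  a vector \<open>v\<close> and a frame \<phi> of TX orient det Y. This number is their coefficient
  against the bases chosen in the two Stiefel-Whitney cochains, with exponent
  \<open>n = m + 1\<close>.\<close>

definition orient :: "'v set \<Rightarrow> 'v \<Rightarrow> (nat \<Rightarrow> 'v \<Rightarrow> 'v set) \<Rightarrow> real" where
 "orient l v \<phi> = dform (vs_of l) 1 (bL l) (%_. v) ^ Suc m * dform (Tan l) m (bT l) \<phi>"

lemma dform_line:
 assumes F: "real_vs F" and e: "vline F e" and x: "x \<in> vcarrier F"
 shows "dform F 1 (%_. e) (%_. x) = lcoef F e x"
proof -
 have "dform F 1 (%_. e) (%_. x) = dform F 1 (%_. e) ((%_. e)(0 := x))" by (rule dform_cong) simp
 also have "\<dots> = lcoef F e x" by (rule dform_replace[OF F e _ x]) simp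
 finally show ?thesis .
qed

context
 fixes l :: "'v set" and v :: 'v and y :: "nat \<Rightarrow> 'v"
 assumes l: "l \<in> X" and L: "line_in_space l (Y_fib X l) v m y"
begin

interpretation line_in_space l "Y_fib X l" v m y by (rule L)

lemma orient_chain:
 assumes x: "x \<in> l" and \<phi>: "\<And>i. i < m ==> \<phi> i \<in> vcarrier (Tan l)"
 shows "orient l x \<phi> = orient l v (%i. tangent_vec l v (y i)) *
  (lcoef (vs_of l) v x ^ Suc m * dform (Tan l) m (%i. tangent_vec l v (y i)) \<phi>)"
proof -
 have xc: "x \<in> vcarrier (vs_of l)" using x by (simp add: vs_of_def)
 have "dform (vs_of l) 1 (bL l) (%_. x) = dform (vs_of l) 1 (bL l) (%_. v) * dform (vs_of l) 1 (%_. v) (%_. x)"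
  by (rule dform_chain[OF real_vs_A bL[OF l] line_A xc])
 moreover have "dform (Tan l) m (bT l) \<phi> = dform (Tan l) m (bT l) (%i. tangent_vec l v (y i)) *
   dform (Tan l) m (%i. tangent_vec l v (y i)) \<phi>"
  by (rule dform_chain[OF real_vs_T bT[OF l] basis_T \<phi>])
 ultimately show ?thesis
  unfolding orient_def dform_line[OF real_vs_A line_A xc] by (simp only: power_mult_distrib ac_simps)
qed

lemma orient_nonzero: "orient l v (%i. tangent_vec l v (y i)) \<noteq> 0"
 unfolding orient_def
 using dform_nonzero[OF real_vs_A bL[OF l] line_A] dform_nonzero[OF real_vs_T bT[OF l] basis_T] by simp

text \<open>\<open>dform_rep\<close> identifies the change of basis determinant of \<open>Y\<close>
  with \<open>a^n\<close> times that of the tangent frames, where \<open>v' = a v\<close>. So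
  \<open>orient\<close> transforms like an orientation of det Y.\<close>

lemma orient_change:
 assumes L': "line_in_space l (Y_fib X l) v' m y'"
 shows "orient l v' (%i. tangent_vec l v' (y' i)) = orient l v (%i. tangent_vec l v (y i)) *
  dform (vs_of (Y_fib X l)) (Suc m) (case_nat v y) (case_nat v' y')"
proof -
 interpret L': line_in_space l "Y_fib X l" v' m y' by (rule L')
 define a where "a = lcoef (vs_of l) v v'"
 have v'l: "v' \<in> vcarrier (vs_of l)" using L'.v_mem by (simp add: vs_of_def)
 have v': "v' = a *\<^sub>R v" using lcoef_scale[OF real_vs_A line_A v'l] by (simp add: a_def vs_of_def)
 have a: "a \<noteq> 0" using vline_nonzero_coef[OF real_vs_A line_A L'.line_A] by (simp add: a_def)
 have "dform (vs_of (Y_fib X l)) (Suc m) (case_nat v y) (case_nat v' y')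
   = a ^ Suc m * dform (Tan l) m (%i. tangent_vec l v (y i)) (%i. tangent_vec l v' (y' i))"
  unfolding v'
 proof (rule dform_rep[OF _ _ a])
  show "tangent_vec l (a *\<^sub>R v) (y' i) \<in> vcarrier (Tan l)" if "i < m" for i
   using L'.tangent_vec_mem[OF L'.y_mem[OF that]] unfolding v' .
  show "y' i \<in> tangent_vec l (a *\<^sub>R v) (y' i) (a *\<^sub>R v)" for i
   using L'.tangent_vec_self[of "y' i"] coset_self[OF sub_A, of "y' i"] unfolding v' by simp
 qed
 thus ?thesis
  using orient_chain[OF L'.v_mem, of "%i. tangent_vec l v' (y' i)"] L'.tangent_vec_mem[OF L'.y_mem]
  by (simp add: a_def)
qed

text \<open>The coefficient of \<rho> transforms inversely to \<open>orient\<close>, so that the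
  product of the two does not depend on the basis.\<close>

lemma lcoef_wedge_change:
 assumes L': "line_in_space l (Y_fib X l) v' m y'" and \<rho>: "\<rho> \<in> vcarrier (DetY l)"
 shows "lcoef (DetY l) (wY l v y) \<rho>
  = lcoef (DetY l) (wY l v' y') \<rho> * dform (vs_of (Y_fib X l)) (Suc m) (case_nat v y) (case_nat v' y')"
proof -
 interpret L': line_in_space l "Y_fib X l" v' m y' by (rule L')
 have g: "vline (DetY l) (wY l v y)" and g': "vline (DetY l) (wY l v' y')"
  by (rule vline_wedge[OF real_vs_B basis_B], rule vline_wedge[OF real_vs_B L'.basis_B])
 let ?d = "dform (vs_of (Y_fib X l)) (Suc m) (case_nat v y) (case_nat v' y')"
 let ?c = "lcoef (DetY l) (wY l v' y') \<rho>"
 have "wY l v' y' = vscale (DetY l) ?d (wY l v y)"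
  by (rule wedge_eq[OF real_vs_B basis_B vs_basis_mem[OF L'.basis_B]])
 hence "\<rho> = vscale (DetY l) (?c * ?d) (wY l v y)"
  using lcoef_scale[OF real_vs_detB g' \<rho>] real_vsD(9)[OF real_vs_detB vline_mem[OF g]] by simp
 thus ?thesis using lcoef_unique[OF real_vs_detB g] by metis
qed

end

text \<open>Each cochain is read off one frame along \<open>u\<close>: the tautological bundle
  contributes \<open>v\<close>, the tangent bundle \<open>s\<close>. By parity, adding the first one
  \<open>n\<close> times corresponds to multiplying the determinants as in
  \<open>orient\<close>.\<close>

lemma bit_w1_cochain:
 assumes u: "singular_simplex 1 TX u"
  and v: "cont_on simplex_interval (standard_simplex 1) v" "\<And>z. z \<in> standard_simplex 1 ==> vline (vs_of (u z)) (v z)"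
  and s: "frame (pullback_bundle simplex_interval u (tangent_bundle X)) (standard_simplex 1) m s"
 shows "w1_cochain (tangent_bundle X) bT u + of_nat (Suc m) * w1_cochain PV bL u = 0 \<longleftrightarrow>
  (orient (u vertex0) (v vertex0) (%i. s i vertex0) > 0 \<longleftrightarrow>
   orient (u vertex1) (v vertex1) (%i. s i vertex1) > 0)"
proof -
 have uP: "singular_simplex 1 (bbase PV) u" using singular_simplex_subtopology_mono[OF u] by simp
 have uT: "singular_simplex 1 (bbase (tangent_bundle X)) u" using u by simp
 have oS: "openin simplex_interval (standard_simplex 1)"
  using openin_topspace[of simplex_interval] by (simp only: topspace_simplex_interval)
 have vfr: "frame (pullback_bundle simplex_interval u PV) (standard_simplex 1) 1 (%_. v)"
  unfolding frame_def
 proof (intro conjI allI impI ballI)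
  show "bsec (pullback_bundle simplex_interval u PV) (standard_simplex 1) v"
   unfolding bsec_pullback_taut[OF singular_simplex_1[OF uP, simplified]] bsec_sub_bundle
   using oS v(1) vline_mem[OF v(2)] by (simp add: vs_of_def)
 qed (use v(2) in simp)
 have x: "u vertex0 \<in> X" "u vertex1 \<in> X" using vertices_mem[OF u] by simp_all
 have T: "w1_cochain (tangent_bundle X) bT u = 0 \<longleftrightarrow>
   (dform (Tan (u vertex0)) m (bT (u vertex0)) (%i. s i vertex0) > 0 \<longleftrightarrow>
    dform (Tan (u vertex1)) m (bT (u vertex1)) (%i. s i vertex1) > 0)"
  using w1_cochain_frame[OF vector_bundle_tangent uT _ s, of bT] bT x by (simp add: tangent_bundle_fib)
 have P: "w1_cochain PV bL u = 0 \<longleftrightarrow>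
   (dform (vs_of (u vertex0)) 1 (bL (u vertex0)) (%_. v vertex0) > 0 \<longleftrightarrow>
    dform (vs_of (u vertex1)) 1 (bL (u vertex1)) (%_. v vertex1) > 0)"
 proof -
  have "vs_basis (bfib PV l) 1 (bL l)" if "l \<in> topspace (bbase PV)" for l
   unfolding bL_def by (rule w1_basis[OF vector_bundle_taut_UNIV that])
  from w1_cochain_frame[OF vector_bundle_taut_UNIV uP this vfr] show ?thesis by simp
 qed
 have RL: "real_vs (vs_of l)" and RT: "real_vs (Tan l)" if l: "l \<in> X" for l
  by (rule real_vs_vs_of[OF subspace_l[OF l]],
    rule real_vs_hom[OF real_vs_vs_of[OF subspace_l[OF l]] real_vs_quot[OF subspace_l[OF l] subspace_Y[OF l]]])
 have sb: "vs_basis (Tan (u z)) m (%i. s i z)" if "z \<in> standard_simplex 1" "u z \<in> X" for z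
 proof -
  have "vs_basis (bfib (tangent_bundle X) (u z)) m (%i. s i z)"
   using s that(1) by (simp add: frame_def)
  thus ?thesis by (simp only: tangent_bundle_fib[OF that(2)])
 qed
 show ?thesis
  unfolding orient_def
  by (rule sign_parity[OF T P])
    (rule dform_nonzero[OF RL[OF x(1)] bL[OF x(1)] v(2)[OF vertex_mem(1)]],
    rule dform_nonzero[OF RT[OF x(1)] bT[OF x(1)] sb[OF vertex_mem(1) x(1)]],
    rule dform_nonzero[OF RL[OF x(2)] bL[OF x(2)] v(2)[OF vertex_mem(2)]],
    rule dform_nonzero[OF RT[OF x(2)] bT[OF x(2)] sb[OF vertex_mem(2) x(2)]])
qed

end

section \<open>Nowhere vanishing sections of det Y and the equation of Stiefel-Whitney
  classes\<close>

context submanifold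
begin

text \<open>A global generator of det Y, with continuity tested on coefficients in local frames:
  exactly the form in which signs can be compared along paths.\<close>

definition nonvanishing :: "('v set \<Rightarrow> ((nat \<Rightarrow> 'v) \<Rightarrow> real) \<Rightarrow> real) \<Rightarrow> bool" where
 "nonvanishing \<rho> \<longleftrightarrow> (\<forall>l\<in>X. vline (DetY l) (\<rho> l)) \<and>
  (\<forall>U v y. local_frame U v y \<longrightarrow> cont_on TX U (%l. lcoef (DetY l) (wY l (v l) (%i. y i l)) (\<rho> l)))"

text \<open>A choice at each point with no continuity. It serves only to define quantities that
  afterwards prove independent of the basis.\<close>

lemma adapted_basis_exists:
 "\<exists>V Y. \<forall>l\<in>X. line_in_space l (Y_fib X l) (V l) m (Y l)"
proof -
 have "\<forall>l\<in>X. \<exists>p. line_in_space l (Y_fib X l) (fst p) m (snd p)"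
 proof
  fix l assume "l \<in> X"
  then obtain U v y where "l \<in> U" "local_frame U v y" using local_frame_exists by blast
  from local_frameD(4)[OF this(2,1)] show "\<exists>p. line_in_space l (Y_fib X l) (fst p) m (snd p)"
   by (intro exI[of _ "(v l, %i. y i l)"]) simp
 qed
 from bchoice[OF this] obtain p where "\<forall>l\<in>X. line_in_space l (Y_fib X l) (fst (p l)) m (snd (p l))" ..
 thus ?thesis by (intro exI)
qed

text \<open>The chosen bases enter \<open>h\<close> and the denominator through the same factor and
  cancel. In a local frame what remains is the coefficient of \<rho>, divided by the
  \<open>n\<close>-th power of the coefficient of \<open>v\<close> and the determinant of
  \<open>s\<close>, all of them continuous along \<open>u\<close>.\<close>

lemma orientation_quotient_continuous:
 assumes h: "\<And>l v y. l \<in> X ==> line_in_space l (Y_fib X l) v m y ==>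
   h l = lcoef (DetY l) (wY l v y) (\<rho> l) * orient l v (%i. tangent_vec l v (y i))"
  and \<rho>: "\<And>U v y. local_frame U v y ==> cont_on TX U (%l. lcoef (DetY l) (wY l (v l) (%i. y i l)) (\<rho> l))"
  and u: "singular_simplex 1 TX u"
  and v: "cont_on simplex_interval (standard_simplex 1) v" "\<And>z. z \<in> standard_simplex 1 ==> vline (vs_of (u z)) (v z)"
  and s: "frame (pullback_bundle simplex_interval u (tangent_bundle X)) (standard_simplex 1) m s"
 shows "cont_on simplex_interval (standard_simplex 1) (%z. h (u z) / orient (u z) (v z) (%i. s i z))"
proof (rule cont_on_local)
 let ?S = "standard_simplex 1" and ?PT = "pullback_bundle simplex_interval u (tangent_bundle X)"
 note uc = singular_simplex_1[OF u]
 have uX: "u z \<in> X" if "z \<in> ?S" for z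
  using continuous_map_image_subset_topspace[OF uc] that unfolding topspace_simplex_interval topspace_TX by blast
 have psh: "section_sheaf ?PT"
  by (rule line_bundle_sheaf[OF vector_bundle_pullback[OF vector_bundle_tangent]]) (simp add: uc)
 have ssh: "section_sheaf (sub_bundle simplex_interval u)"
  by (rule sub_bundle_sheaf) (simp only: topspace_simplex_interval subspace_l uX)
 fix z0 :: "nat \<Rightarrow> real" assume z0: "z0 \<in> ?S"
 obtain U v' y' where U: "u z0 \<in> U" and f: "local_frame U v' y'" using local_frame_exists[OF uX[OF z0]] by blast
 define V where "V = {z \<in> ?S. u z \<in> U}"
 have oV: "openin simplex_interval V"
  using openin_continuous_map_preimage[OF uc local_frameD(1)[OF f]] unfolding topspace_simplex_interval V_def .
 have VS: "V \<subseteq> ?S" and VU: "u z \<in> U" if "z \<in> V" for z using that by (auto simp: V_def)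
 have VS: "V \<subseteq> ?S" by (auto simp: V_def)
 note uV = continuous_map_from_subtopology[OF uc, of V]
 have L: "line_in_space (u z) (Y_fib X (u z)) (v' (u z)) m (%i. y' i (u z))" if "z \<in> V" for z
  by (rule local_frameD(4)[OF f VU[OF that]])
 have image: "u ` V \<subseteq> U" using VU by blast
 let ?e = "%z. lcoef (DetY (u z)) (wY (u z) (v' (u z)) (%i. y' i (u z))) (\<rho> (u z))"
 let ?a = "%z. lcoef (vs_of (u z)) (v' (u z)) (v z)"
 let ?\<phi> = "%i z. tangent_vec (u z) (v' (u z)) (y' i (u z))"
 let ?d = "%z. dform (Tan (u z)) m (%i. ?\<phi> i z) (%i. s i z)"
 have ce: "cont_on simplex_interval V ?e"
  by (rule cont_on_compose[OF uV _ \<rho>[OF f]]) (use image in blast)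
 have cv': "cont_on simplex_interval V (%z. v' (u z))"
  by (rule cont_on_compose[OF uV _ local_frameD(2)[OF f]]) (use image in blast)
 have gen: "lgen (sub_bundle simplex_interval u) V (%z. v' (u z))"
  by (rule lframe_sub_bundle[OF oV line_in_space.sub_A[OF L] line_in_space.line_A[OF L] cv'])
 have "bsec (sub_bundle simplex_interval u) V v"
  unfolding bsec_sub_bundle
 proof (intro conjI ballI oV)
  show "cont_on simplex_interval V v" by (rule cont_on_subset[OF v(1) VS])
  show "v z \<in> u z" if "z \<in> V" for z using vline_mem[OF v(2)] that VS by (auto simp: vs_of_def)
 qed
 hence ca: "cont_on simplex_interval V ?a"
  using bsec_iff_lcoef[OF ssh gen, of V v] oV by simp
 have lf: "lframe ?PT V m ?\<phi>"
  by (rule lframe_pullback[OF tangent_bundle_sheaf lframe_tangent[OF local_frameD(1-4)[OF f]] oV _ image])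
    (simp_all only: tangent_bundle_base uV)
 have sV: "bsec ?PT V (s i)" if "i < m" for i
  by (rule sheaf_restrict[OF psh _ _ VS]) (use s that oV in \<open>auto simp: frame_def\<close>)
 have fib: "bfib ?PT z = Tan (u z)" if "z \<in> ?S" for z
  by (simp add: tangent_bundle_fib[OF uX[OF that]])
 have "cont_on (bbase ?PT) V (%z. dform (bfib ?PT z) m (%i. ?\<phi> i z) (%i. s i z))"
  by (rule cont_on_dform[OF psh lf _ subset_refl sV]) (simp_all add: oV)
 hence cd: "cont_on simplex_interval V ?d"
  unfolding pullback_bundle_simps(1)
  by (rule cont_on_cong) (use fib VS in \<open>simp only: subsetD\<close>)
 have sb: "vs_basis (Tan (u z)) m (%i. s i z)" if "z \<in> ?S" for z
  using s that unfolding frame_def fib[OF that, symmetric] by blast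
 have nz: "?a z ^ Suc m * ?d z \<noteq> 0" if z: "z \<in> V" for z
 proof -
  interpret line_in_space "u z" "Y_fib X (u z)" "v' (u z)" m "%i. y' i (u z)" by (rule L[OF z])
  have zS: "z \<in> ?S" using z VS by blast
  show ?thesis
   using vline_nonzero_coef[OF real_vs_A line_A v(2)[OF zS]] dform_nonzero[OF real_vs_T basis_T sb[OF zS]] by simp
 qed
 have "cont_on simplex_interval V (%z. ?e z / (?a z ^ Suc m * ?d z))"
  by (rule cont_on_divide[OF ce cont_on_mult[OF cont_on_power[OF ca] cd] nz])
 hence "cont_on simplex_interval V (%z. h (u z) / orient (u z) (v z) (%i. s i z))"
 proof (rule cont_on_cong)
  fix z assume z: "z \<in> V"
  hence zS: "z \<in> ?S" using VS by blast
  have vm: "v z \<in> u z" using vline_mem[OF v(2)[OF zS]] by (simp add: vs_of_def)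
  have "orient (u z) (v z) (%i. s i z) = orient (u z) (v' (u z)) (%i. ?\<phi> i z) * (?a z ^ Suc m * ?d z)"
   by (rule orient_chain[OF uX[OF zS] L[OF z] vm vs_basis_mem[OF sb[OF zS]]])
  thus "?e z / (?a z ^ Suc m * ?d z) = h (u z) / orient (u z) (v z) (%i. s i z)"
   using h[OF uX[OF zS] L[OF z]] orient_nonzero[OF uX[OF zS] L[OF z]] by simp
 qed
 thus "\<exists>V. openin simplex_interval V \<and> z0 \<in> V \<and> V \<subseteq> ?S \<and>
   cont_on simplex_interval V (%z. h (u z) / orient (u z) (v z) (%i. s i z))"
  using oV VS z0 U by (intro exI[of _ V]) (simp add: V_def)
qed

abbreviation "w_cochain u \<equiv> w1_cochain (tangent_bundle X) bT u + of_nat (Suc m) * w1_cochain PV bL u"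

text \<open>The sign of \<open>h l\<close> compares the orientation by \<rho> with the chosen one
  and defines \<open>a\<close>. Along a path the quotient of \<open>h\<close> by the orientation of
  a transported frame has constant sign, so the transported orientation changes sides exactly when
  \<open>a\<close> does.\<close>

lemma nonvanishing_cochain:
 assumes \<rho>: "nonvanishing \<rho>"
 shows "\<exists>a. \<forall>u. singular_simplex 1 TX u \<longrightarrow> w_cochain u = a (u vertex0) + a (u vertex1)"
proof -
 obtain V Y where VY: "\<And>l. l \<in> X ==> line_in_space l (Y_fib X l) (V l) m (Y l)"
  using adapted_basis_exists by metis
 have \<rho>l: "vline (DetY l) (\<rho> l)" if "l \<in> X" for l using \<rho> that by (simp add: nonvanishing_def)
 define h where "h l = lcoef (DetY l) (wY l (V l) (Y l)) (\<rho> l) * orient l (V l) (%i. tangent_vec l (V l) (Y l i))" for l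
 have h_eq: "h l = lcoef (DetY l) (wY l v y) (\<rho> l) * orient l v (%i. tangent_vec l v (y i))"
  if l: "l \<in> X" and L: "line_in_space l (Y_fib X l) v m y" for l v y
  unfolding h_def lcoef_wedge_change[OF l VY[OF l] L vline_mem[OF \<rho>l[OF l]]] orient_change[OF l VY[OF l] L] by simp
 have h_nz: "h l \<noteq> 0" if l: "l \<in> X" for l
 proof -
  interpret line_in_space l "Y_fib X l" "V l" m "Y l" by (rule VY[OF l])
  show ?thesis
   unfolding h_def
   using vline_nonzero_coef[OF real_vs_detB vline_wedge[OF real_vs_B basis_B] \<rho>l[OF l]] orient_nonzero[OF l VY[OF l]] by simp
 qed
 define a :: "'v set \<Rightarrow> bit" where "a l = (if h l > 0 then 0 else 1)" for l
 have "w_cochain u = a (u vertex0) + a (u vertex1)" if u: "singular_simplex 1 TX u" for u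
 proof -
  let ?S = "standard_simplex 1"
  note uc = singular_simplex_1[OF u]
  have uP: "continuous_map simplex_interval proj_top u"
   by (rule singular_simplex_1[OF singular_simplex_subtopology_mono[OF u]])
  have uX: "u z \<in> X" if "z \<in> ?S" for z
   using continuous_map_image_subset_topspace[OF uc] that unfolding topspace_simplex_interval topspace_TX by blast
  let ?PV = "pullback_bundle simplex_interval u PV" and ?PT = "pullback_bundle simplex_interval u (tangent_bundle X)"
  have EV: "vector_bundle 1 ?PV" by (rule vector_bundle_pullback[OF vector_bundle_taut_UNIV]) (simp add: uP)
  have ET: "vector_bundle m ?PT" by (rule vector_bundle_pullback[OF vector_bundle_tangent]) (simp add: uc)
  obtain vs where vs: "lframe ?PV ?S 1 vs" using interval_frame[OF EV] by auto
  obtain s where s: "lframe ?PT ?S m s" using interval_frame[OF ET] by auto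
  have sf: "frame ?PT ?S m s" using s by (simp add: lframe_def)
  have v: "cont_on simplex_interval ?S (vs 0)"
  proof -
   have "bsec ?PV ?S (vs 0)" by (rule lframe_bsec[OF vs]) simp
   thus ?thesis unfolding bsec_pullback_taut[OF uP] bsec_sub_bundle by blast
  qed
  have vl: "vline (vs_of (u z)) (vs 0 z)" if z: "z \<in> ?S" for z
  proof -
   have "vs_basis (vs_of (u z)) 1 (%i. vs i z)"
    using lframe_basis[OF line_bundle_sheaf[OF EV] vs z] by simp
   moreover have "vs i z = vs 0 z" if "i < 1" for i using that by simp
   ultimately show ?thesis using vs_basis_cong[of 1 "%i. vs i z" "%_. vs 0 z"] by blast
  qed
  let ?o = "%z. orient (u z) (vs 0 z) (%i. s i z)"
  have o_nz: "?o z \<noteq> 0" if z: "z \<in> ?S" for z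
  proof -
   note x = uX[OF z]
   interpret line_in_space "u z" "Y_fib X (u z)" "V (u z)" m "Y (u z)" by (rule VY[OF x])
   have "vs_basis (bfib ?PT z) m (%i. s i z)" by (rule lframe_basis[OF line_bundle_sheaf[OF ET] s z])
   hence "vs_basis (Tan (u z)) m (%i. s i z)" by (simp add: tangent_bundle_fib[OF x])
   thus ?thesis
    unfolding orient_def using dform_nonzero[OF real_vs_A bL[OF x] vl[OF z]] dform_nonzero[OF real_vs_T bT[OF x]] by simp
  qed
  have "(h (u vertex0) / ?o vertex0 > 0) = (h (u vertex1) / ?o vertex1 > 0)"
  proof (rule nonzero_sign_interval)
   show "cont_on simplex_interval ?S (%z. h (u z) / ?o z)"
    by (rule orientation_quotient_continuous[OF h_eq _ u v vl sf]) (use \<rho> in \<open>simp_all add: nonvanishing_def\<close>)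
   show "h (u z) / ?o z \<noteq> 0" if "z \<in> ?S" for z using h_nz[OF uX[OF that]] o_nz[OF that] by simp
  qed
  hence "(?o vertex0 > 0 \<longleftrightarrow> ?o vertex1 > 0) \<longleftrightarrow> (h (u vertex0) > 0 \<longleftrightarrow> h (u vertex1) > 0)"
   using o_nz[OF vertex_mem(1)] o_nz[OF vertex_mem(2)] h_nz[OF uX[OF vertex_mem(1)]] h_nz[OF uX[OF vertex_mem(2)]]
   unfolding zero_less_divide_iff by linarith
  moreover have "a (u vertex0) + a (u vertex1) = 0 \<longleftrightarrow> (h (u vertex0) > 0 \<longleftrightarrow> h (u vertex1) > 0)"
   by (simp add: a_def)
  ultimately have "w_cochain u = 0 \<longleftrightarrow> a (u vertex0) + a (u vertex1) = 0"
   using bit_w1_cochain[OF u v vl sf] by blast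
  thus ?thesis by (cases "w_cochain u"; cases "a (u vertex0) + a (u vertex1)") (simp_all only: bit_not_zero_iff simp_thms one_neq_zero zero_neq_one)
 qed
 thus ?thesis by blast
qed

text \<open>The function \<open>a\<close> corrects the chosen orientation at each point, and the
  cochain equation says that the corrected orientation is preserved along paths. With a length fixed
  by the metric it becomes a section of det Y.\<close>

lemma cochain_nonvanishing:
 assumes a: "\<And>u. singular_simplex 1 TX u ==> w_cochain u = a (u vertex0) + a (u vertex1)"
 shows "\<exists>\<rho>. nonvanishing \<rho>"
proof -
 obtain V Y where VY: "\<And>l. l \<in> X ==> line_in_space l (Y_fib X l) (V l) m (Y l)"
  using adapted_basis_exists by metis
 define \<epsilon> :: "'v set \<Rightarrow> real" where "\<epsilon> l = (if a l = 0 then 1 else - 1)" for l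
 \<comment> \<open>The intended coefficient of \<rho> in the basis \<open>v, y\<close>. The sign of
   \<open>orient\<close> and the square root of the Gram determinant change with the basis by the
   sign and the absolute value of the same determinant, so all bases define the same
   element.\<close>
 define c where "c l v y = \<epsilon> l * sgn (orient l v (%i. tangent_vec l v (y i))) /
   sqrt \<bar>gram (Suc m) (case_nat v y) (case_nat v y)\<bar>" for l v y
 define \<rho> where "\<rho> l = vscale (DetY l) (c l (V l) (Y l)) (wY l (V l) (Y l))" for l
 have coef: "lcoef (DetY l) (wY l v y) (\<rho> l) = c l v y"
  if l: "l \<in> X" and L: "line_in_space l (Y_fib X l) v m y" for l v y
 proof -
  interpret line_in_space l "Y_fib X l" v m y by (rule L)
  interpret V: line_in_space l "Y_fib X l" "V l" m "Y l" by (rule VY[OF l])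
  let ?d = "dform (vs_of (Y_fib X l)) (Suc m) (case_nat v y) (case_nat (V l) (Y l))"
  have d: "?d \<noteq> 0" by (rule dform_nonzero[OF real_vs_B basis_B V.basis_B])
  have g: "vline (DetY l) (wY l v y)" by (rule vline_wedge[OF real_vs_B basis_B])
  have "wY l (V l) (Y l) = vscale (DetY l) ?d (wY l v y)"
   by (rule wedge_eq[OF real_vs_B basis_B vs_basis_mem[OF V.basis_B]])
  hence "\<rho> l = vscale (DetY l) (c l (V l) (Y l) * ?d) (wY l v y)"
   unfolding \<rho>_def using real_vsD(9)[OF real_vs_detB vline_mem[OF g]] by simp
  hence "lcoef (DetY l) (wY l v y) (\<rho> l) = c l (V l) (Y l) * ?d"
   using lcoef_unique[OF real_vs_detB g] by simp
  also have "\<dots> = c l v y"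
  proof -
   have mem: "case_nat (V l) (Y l) i \<in> Y_fib X l" if "i < Suc m" for i
    using vs_basis_mem[OF V.basis_B that] by (simp add: vs_of_def)
   have "gram (Suc m) (case_nat (V l) (Y l)) (case_nat (V l) (Y l))
     = ?d\<^sup>2 * gram (Suc m) (case_nat v y) (case_nat v y)"
    by (rule gram_square[OF sub_B basis_B mem])
   hence "sqrt \<bar>gram (Suc m) (case_nat (V l) (Y l)) (case_nat (V l) (Y l))\<bar>
     = \<bar>?d\<bar> * sqrt \<bar>gram (Suc m) (case_nat v y) (case_nat v y)\<bar>"
    by (simp add: abs_mult real_sqrt_mult)
   moreover have "sgn (orient l (V l) (%i. tangent_vec l (V l) (Y l i)))
     = sgn (orient l v (%i. tangent_vec l v (y i))) * sgn ?d"
    unfolding orient_change[OF l L VY[OF l]] by (rule sgn_mult)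
   moreover have "sgn ?d * ?d / \<bar>?d\<bar> = 1" using d by (simp add: sgn_if)
   ultimately show ?thesis
    unfolding c_def using d by (simp add: field_simps sgn_eq_0_iff)
  qed
  finally show ?thesis .
 qed
 have c_nz: "c l v y \<noteq> 0" if l: "l \<in> X" and L: "line_in_space l (Y_fib X l) v m y" for l v y
  using gram_nonzero[OF line_in_space.sub_B[OF L] line_in_space.basis_B[OF L]] orient_nonzero[OF l L]
  by (simp add: c_def \<epsilon>_def sgn_if)
 have "nonvanishing \<rho>"
  unfolding nonvanishing_def
 proof (intro conjI ballI allI impI)
  fix l assume l: "l \<in> X"
  interpret line_in_space l "Y_fib X l" "V l" m "Y l" by (rule VY[OF l])
  show "vline (DetY l) (\<rho> l)"
   unfolding \<rho>_def by (rule vline_scale[OF real_vs_detB vline_wedge[OF real_vs_B basis_B] c_nz[OF l VY[OF l]]])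
 next
  fix U v y assume f: "local_frame U v y"
  let ?S = "standard_simplex 1"
  note D = local_frameD[OF f]
  let ?g = "%l. gram (Suc m) (case_nat (v l) (%i. y i l)) (case_nat (v l) (%i. y i l))"
  let ?o = "%l. \<epsilon> l * sgn (orient l (v l) (%i. tangent_vec l (v l) (y i l)))"
  \<comment> \<open>Along a path inside \<open>U\<close> the local frame itself can be used in
    \<open>bit_w1_cochain\<close>: \<open>orient\<close> changes sign between the ends exactly when
    \<open>a\<close> changes, and the product of the two signs stays constant.\<close>
  have path: "?o (u vertex1) = ?o (u vertex0)"
   if u: "singular_simplex 1 TX u" and U: "u ` ?S \<subseteq> U" for u
  proof -
   note uc = singular_simplex_1[OF u]
   have zU: "u z \<in> U" if "z \<in> ?S" for z using U that by blast
   have oS: "openin simplex_interval ?S"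
    using openin_topspace[of simplex_interval] by (simp only: topspace_simplex_interval)
   have cv: "cont_on simplex_interval ?S (%z. v (u z))"
    by (rule cont_on_compose[OF continuous_map_from_subtopology[OF uc] _ D(2)]) (use U in blast)
   have lf: "lframe (pullback_bundle simplex_interval u (tangent_bundle X)) ?S m
     (%i z. tangent_vec (u z) (v (u z)) (y i (u z)))"
    by (rule lframe_pullback[OF tangent_bundle_sheaf lframe_tangent[OF D(1-4)] oS _ U])
      (simp_all only: tangent_bundle_base continuous_map_from_subtopology[OF uc])
   hence fr: "frame (pullback_bundle simplex_interval u (tangent_bundle X)) ?S m
     (%i z. tangent_vec (u z) (v (u z)) (y i (u z)))" by (simp add: lframe_def)
   have "w_cochain u = 0 \<longleftrightarrow>
     (orient (u vertex0) (v (u vertex0)) (%i. tangent_vec (u vertex0) (v (u vertex0)) (y i (u vertex0))) > 0 \<longleftrightarrow>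
      orient (u vertex1) (v (u vertex1)) (%i. tangent_vec (u vertex1) (v (u vertex1)) (y i (u vertex1))) > 0)"
    by (rule bit_w1_cochain[OF u cv line_in_space.line_A[OF D(4)[OF zU]] fr])
   moreover have "orient (u z) (v (u z)) (%i. tangent_vec (u z) (v (u z)) (y i (u z))) \<noteq> 0" if "z \<in> ?S" for z
    by (rule orient_nonzero[OF D(5)[OF zU[OF that]] D(4)[OF zU[OF that]]])
   note this[OF vertex_mem(1)] this[OF vertex_mem(2)]
   moreover have "w_cochain u = 0 \<longleftrightarrow> (a (u vertex0) = 0 \<longleftrightarrow> a (u vertex1) = 0)"
    unfolding a[OF u] by (cases "a (u vertex0)"; cases "a (u vertex1)") simp_all
   moreover have "(if q = 0 then 1 else - 1) * sgn t = (if p = 0 then 1 else - 1) * sgn s"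
    if "(s > 0 \<longleftrightarrow> t > 0) \<longleftrightarrow> (p = 0 \<longleftrightarrow> q = 0)" "s \<noteq> 0" "t \<noteq> 0" for s t :: real and p q :: bit
    using that by (cases p; cases q; cases "s > 0"; cases "t > 0") (simp_all add: sgn_if)
   ultimately show ?thesis unfolding \<epsilon>_def by metis
  qed
  have "cont_on TX U (%l. c l (v l) (%i. y i l))"
  proof (rule cont_on_local)
   fix l0 assume l0: "l0 \<in> U"
   \<comment> \<open>Every point of \<open>W\<close> is joined to \<open>l0\<close> by a path in
     \<open>U\<close>, so the sign in \<open>c\<close> is constant on \<open>W\<close>. Continuity
     then reduces to that of the Gram determinant.\<close>
   obtain W where W: "openin TX W" "l0 \<in> W" "W \<subseteq> U" and
    P: "\<forall>l\<in>W. \<exists>u. singular_simplex 1 TX u \<and> u vertex0 = l0 \<and> u vertex1 = l \<and> u ` ?S \<subseteq> U"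
    using X_paths[OF D(1) l0] by (elim exE conjE)
   have const: "?o l = ?o l0" if "l \<in> W" for l using P that path by metis
   have g_nz: "?g l \<noteq> 0" if "l \<in> W" for l
   proof -
    have "l \<in> U" using that W(3) by blast
    from line_in_space.sub_B[OF D(4)[OF this]] line_in_space.basis_B[OF D(4)[OF this]]
    show ?thesis by (rule gram_nonzero)
   qed
   have cy: "cont_on TX W (%l. case_nat (v l) (%i. y i l) i)" if "i < Suc m" for i
    using that cont_on_subset[OF D(2) W(3)] cont_on_subset[OF D(3) W(3)] by (cases i) auto
   have cg: "cont_on TX W ?g" by (rule cont_on_gram[OF cy cy])
   have "cont_on TX W (%l. ?o l0 / sqrt \<bar>?g l\<bar>)"
   proof (rule cont_on_divide[OF cont_on_const])
    show "cont_on TX W (%l. sqrt \<bar>?g l\<bar>)"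
     by (rule cont_on_isCont[OF cg, of "%t. sqrt \<bar>t\<bar>"]) (intro continuous_intros)
    show "sqrt \<bar>?g l\<bar> \<noteq> 0" if "l \<in> W" for l using g_nz[OF that] by simp
   qed
   hence "cont_on TX W (%l. c l (v l) (%i. y i l))"
    by (rule cont_on_cong) (simp only: c_def const)
   thus "\<exists>W. openin TX W \<and> l0 \<in> W \<and> W \<subseteq> U \<and> cont_on TX W (%l. c l (v l) (%i. y i l))"
    using W by blast
  qed
  thus "cont_on TX U (%l. lcoef (DetY l) (wY l (v l) (%i. y i l)) (\<rho> l))"
   by (rule cont_on_cong) (simp only: coef[OF D(5) D(4)])
 qed
 thus ?thesis by blast
qed

lemma w1_eq_iff_nonvanishing:
 "w1 (tangent_bundle X) = coh_pullback 1 TX id (w1 PV) [^]\<^bsub>cohomology 1 TX\<^esub> Suc m \<longleftrightarrow> (\<exists>\<rho>. nonvanishing \<rho>)"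
proof -
 have "w1 (tangent_bundle X) = coh_class 1 TX (w1_cochain (tangent_bundle X) bT)"
  unfolding w1_def bT_def by simp
 moreover have "w1 PV = coh_class 1 proj_top (w1_cochain PV bL)" unfolding w1_def bL_def by simp
 moreover have "w1_cochain (tangent_bundle X) bT u = 0" if "\<not> singular_simplex 1 TX u" for u
  using that by (simp add: w1_cochain_def)
 ultimately show ?thesis
  using coh_class_eq_pullback_pow[of proj_top X "w1_cochain (tangent_bundle X) bT" "w1_cochain PV bL" "Suc m"]
   nonvanishing_cochain cochain_nonvanishing by metis
qed

lemma lgen_det_Y_frame:
 assumes "local_frame U v y"
 shows "lgen (det_bundle (Y_bundle X)) U (%l. wY l (v l) (%i. y i l))"
 using lgen_det[OF Y_sheaf lframe_Y[OF local_frameD(1-4)[OF assms]]] by (simp add: Y_bundle_def)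

end

section \<open>Relative orientability of the projection\<close>

context projection
begin

text \<open>With a fixed generator \<delta> of det W, evaluating an isomorphism at \<delta> gives a
  section without zeros; conversely such a section prescribes the image of \<delta>.\<close>

lemma trivial_iff_nonvanishing:
 "line_bundle_isos (trivial_bundle TX detW) (det_bundle (Y_bundle X)) \<noteq> {} \<longleftrightarrow> (\<exists>\<rho>. nonvanishing \<rho>)"
proof -
 obtain \<delta> where \<delta>: "vline detW \<delta>"
  using vs_basis_exists[OF subspace_UNIV] vline_wedge[OF real_vs_vs_of[OF subspace_UNIV]] by metis
 have RY: "real_vs (DetY l)" if "l \<in> X" for l by (rule real_vs_det[OF real_vs_vs_of[OF subspace_Y[OF that]]])
 have fib: "bfib (det_bundle (Y_bundle X)) l = DetY l" for l by (simp add: Y_bundle_def)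
 show ?thesis
 proof
  assume "line_bundle_isos (trivial_bundle TX detW) (det_bundle (Y_bundle X)) \<noteq> {}"
  then obtain \<mu> where \<mu>: "\<mu> \<in> line_bundle_isos (trivial_bundle TX detW) (det_bundle (Y_bundle X))" by blast
  have "nonvanishing (%l. \<mu> l \<delta>)"
   unfolding nonvanishing_def
  proof (intro conjI ballI allI impI)
   fix l assume l: "l \<in> X"
   have "\<mu> l \<in> vs_isos detW (DetY l)"
    using line_bundle_isosD(5)[OF \<mu>, of l] l X_subset by (auto simp: Y_bundle_def)
   thus "vline (DetY l) (\<mu> l \<delta>)" by (rule vs_iso_line[OF real_vs_detW RY[OF l] \<delta>])
  next
   fix U v y assume f: "local_frame U v y"
   from line_bundle_iso_coef[OF \<mu> lgen_trivial[OF real_vs_detW \<delta> local_frameD(1)[OF f]] lgen_det_Y_frame[OF f]]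
   show "cont_on TX U (%l. lcoef (DetY l) (wY l (v l) (%i. y i l)) (\<mu> l \<delta>))"
    by (simp add: Y_bundle_def)
  qed
  thus "\<exists>\<rho>. nonvanishing \<rho>" by blast
 next
  assume "\<exists>\<rho>. nonvanishing \<rho>"
  then obtain \<rho> where \<rho>: "nonvanishing \<rho>" by blast
  have \<rho>l: "vline (DetY l) (\<rho> l)" if "l \<in> X" for l using \<rho> that by (simp add: nonvanishing_def)
  let ?\<mu> = "\<lambda>l\<in>X. lmap detW (DetY l) \<delta> (\<rho> l)"
  have "?\<mu> \<in> line_bundle_isos (trivial_bundle TX detW) (det_bundle (Y_bundle X))"
  proof (rule line_bundle_isosI[OF line_bundle_trivial_det line_bundle_det_Y])
   fix l assume "l \<in> topspace (bbase (trivial_bundle TX detW))"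
   hence l: "l \<in> X" by simp
   show "?\<mu> l \<in> vs_isos (bfib (trivial_bundle TX detW) l) (bfib (det_bundle (Y_bundle X)) l)"
    using lmap_iso[OF real_vs_detW RY[OF l] \<delta> \<rho>l[OF l]] l by (simp add: Y_bundle_def)
   obtain U v y where lU: "l \<in> U" and f: "local_frame U v y" using local_frame_exists[OF l] by blast
   let ?c = "%l. lcoef (DetY l) (wY l (v l) (%i. y i l)) (\<rho> l)"
   have c: "cont_on TX U ?c" using \<rho> f by (simp add: nonvanishing_def)
   show "\<exists>U e g c. l \<in> U \<and> lgen (trivial_bundle TX detW) U e \<and> lgen (det_bundle (Y_bundle X)) U g \<and>
     cont_on (bbase (trivial_bundle TX detW)) U c \<and>
     (\<forall>x\<in>U. ?\<mu> x (e x) = vscale (bfib (det_bundle (Y_bundle X)) x) (c x) (g x))"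
   proof (intro exI conjI ballI)
    show "lgen (trivial_bundle TX detW) U (%_. \<delta>)" by (rule lgen_trivial[OF real_vs_detW \<delta> local_frameD(1)[OF f]])
    show "lgen (det_bundle (Y_bundle X)) U (%l. wY l (v l) (%i. y i l))" by (rule lgen_det_Y_frame[OF f])
    show "cont_on (bbase (trivial_bundle TX detW)) U ?c" using c by simp
    fix x assume x: "x \<in> U"
    note xX = local_frameD(5)[OF f x]
    interpret line_in_space x "Y_fib X x" "v x" m "%i. y i x" by (rule local_frameD(4)[OF f x])
    have "\<rho> x = vscale (DetY x) (?c x) (wY x (v x) (%i. y i x))"
     by (rule lcoef_scale[OF real_vs_detB vline_wedge[OF real_vs_B basis_B] vline_mem[OF \<rho>l[OF xX]]])
    thus "?\<mu> x \<delta> = vscale (bfib (det_bundle (Y_bundle X)) x) (?c x) (wY x (v x) (%i. y i x))"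
     using lmap_apply[OF real_vs_detW RY[OF xX] \<delta> vline_mem[OF \<rho>l[OF xX]]] xX by (simp only: fib restrict_apply' )
   qed (rule lU)
  qed (simp_all add: Y_bundle_def Int_absorb1[OF X_subset])
  thus "line_bundle_isos (trivial_bundle TX detW) (det_bundle (Y_bundle X)) \<noteq> {}" by blast
 qed
qed

theorem relatively_orientable_iff:
 "relatively_orientable (tangent_bundle X) (proj_tangent_bundle (proj (UNIV :: 'w set))) (proj_map f) \<longleftrightarrow>
  w1 (tangent_bundle X) = coh_pullback 1 TX id (w1 PV) [^]\<^bsub>cohomology 1 TX\<^esub> Suc m"
proof -
 have base: "bbase (proj_tangent_bundle (proj (UNIV :: 'w set))) = proj_top"
  by (simp add: proj_tangent_bundle_UNIV)
 have "relatively_orientable (tangent_bundle X) (proj_tangent_bundle (proj (UNIV :: 'w set))) (proj_map f) \<longleftrightarrow>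
   line_bundle_isos (pullback_det X f) (det_bundle (tangent_bundle X)) \<noteq> {}"
  using continuous_proj_map
  unfolding relatively_orientable_def line_bundle_isomorphic_def pullback_det_def base tangent_bundle_base by blast
 \<comment> \<open>The correspondence of \<mu> and \<nu> is a bijection, so isomorphisms of one kind
   exist iff those of the other kind do.\<close>
 also have "\<dots> \<longleftrightarrow> line_bundle_isos (trivial_bundle TX detW) (det_bundle (Y_bundle X)) \<noteq> {}"
  using bij_betw_imp_surj_on[OF nu_of_mu_bij] by blast
 finally show ?thesis unfolding trivial_iff_nonvanishing w1_eq_iff_nonvanishing .
qed

end

theorem lemma2p6:
  fixes X :: "'v::euclidean_space set set"
    and f :: "'v \<Rightarrow> 'w::euclidean_space"
    and m n :: nat
  assumes "smooth_submanifold m X"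
    and "compactin proj_top X"
    and "m < DIM('v) - 1"
    and "n = m + 1"
    and "DIM('w) = n"
    and "f \<in> Hom_avoiding X"
  defines "TX \<equiv> subtopology proj_top X"
    and "detW \<equiv> vs_det (vs_of (UNIV :: 'w set))"
  shows
    "(\<lambda>l\<in>X. proj_det_map n f l detW (restrict id (vcarrier detW)))
       \<in> line_bundle_isos (pullback_det X f)
           (tensor_bundle (tpow_bundle n (dual_bundle (taut_bundle X))) (trivial_bundle TX detW))
     \<and>
     (\<forall>g \<in> (Hom_avoiding X :: ('v \<Rightarrow> 'w) set).
        line_bundle_isomorphic (pullback_det X f) (pullback_det X g))
     \<and>
     (relatively_orientable (tangent_bundle X) (proj_tangent_bundle (proj (UNIV :: 'w set)))
          (proj_map f)
        \<longleftrightarrow> w1 (tangent_bundle X) =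
              coh_pullback 1 TX id (w1 (taut_bundle (proj (UNIV :: 'v set))))
                [^]\<^bsub>cohomology 1 TX\<^esub> n)
     \<and>
     (bij_betw (nu_of_mu n X f)
        (line_bundle_isos (trivial_bundle TX detW) (det_bundle (Y_bundle X)))
        (line_bundle_isos (pullback_det X f) (det_bundle (tangent_bundle X)))
      \<and>
      bij_betw
        (\<lambda>\<mu>. \<lambda>l\<in>X. restrict (inv_into (vcarrier detW) (\<mu> l))
                       (vcarrier (vs_det (vs_of (Y_fib X l)))))
        (line_bundle_isos (trivial_bundle TX detW) (det_bundle (Y_bundle X)))
        (global_trivializations (det_bundle (Y_bundle X)) detW))"
proof -
  have n: "n = Suc m" using assms(4) by simp
  have proj: "projection m X g" if "g \<in> Hom_avoiding X" for g :: "'v \<Rightarrow> 'w"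
    using assms(1,5) that n by unfold_locales simp_all
  note pf = proj[OF assms(6)]
  show ?thesis
    unfolding TX_def detW_def n
    by (intro conjI ballI projection.canonical_iso[OF pf] pullback_det_isomorphic[OF pf proj]
        projection.relatively_orientable_iff[OF pf] projection.nu_of_mu_bij[OF pf]
        projection.trivializations_bij[OF pf])
qed

end
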